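(* Let $\mathbb{K}$ be a field of characteristic equal to zero or greater than $5$. Suppose $\phi \colon \mathrm{Out}(F_n) \to \mathrm{GL}(V)$ is an $m$-dimensional $\mathbb{K}$-linear representation of $\mathrm{Out}(F_n)$, where $n \in \{4,5\}$ and $m < 2n+1$. Then $\phi$ factors through the natural projection $p \colon \mathrm{Out}(F_n) \to \mathrm{GL}_n(\mathbb{Z})$.
   Context: $F_n$ is the free group of rank $n$ and $\mathrm{Out}(F_n)$ its outer automorphism group. The natural projection $p \colon \mathrm{Out}(F_n) \to \mathrm{GL}_n(\mathbb{Z})$ is the homomorphism induced by the action of $\mathrm{Out}(F_n)$ on the abelianisation $\mathbb{Z}^n$ of $F_n$. "$\phi$ factors through $p$" means that there is a homomorphism $\psi \colon \mathrm{GL}_n(\mathbb{Z}) \to \mathrm{GL}(V)$ with $\phi = \psi \circ p$. *)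

theory Defs
  imports
    "HOL-Algebra.Algebra"
    "Jordan_Normal_Form.Matrix"
begin

section \<open>The free group of rank n\<close>

text \<open>
  The letter \<open>(i, True)\<close> is the \<open>i\<close>-th free generator and \<open>(i, False)\<close> its inverse.
  The elements of the free group are the freely reduced words over these letters.
\<close>

type_synonym letter = "nat \<times> bool"

definition inv_letter :: "letter \<Rightarrow> letter" where
  "inv_letter a = (fst a, \<not> snd a)"

definition reduced :: "letter list \<Rightarrow> bool" where
  "reduced w \<longleftrightarrow> successively (\<lambda>a b. b \<noteq> inv_letter a) w"

fun cons_red :: "letter \<Rightarrow> letter list \<Rightarrow> letter list" where
  "cons_red a [] = [a]"
| "cons_red a (b # w) = (if b = inv_letter a then w else a # b # w)"

definition free_reduction :: "letter list \<Rightarrow> letter list" where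
  "free_reduction w = foldr cons_red w []"

definition free_group :: "nat \<Rightarrow> letter list monoid" where
  "free_group n =
    \<lparr>carrier = {w. fst ` set w \<subseteq> {..<n} \<and> reduced w},
     monoid.mult = (\<lambda>u v. free_reduction (u @ v)),
     one = []\<rparr>"

definition gen :: "nat \<Rightarrow> letter list" where
  "gen i = [(i, True)]"

section \<open>Outer automorphism groups\<close>

definition inner_auts :: "('a, 'b) monoid_scheme \<Rightarrow> ('a \<Rightarrow> 'a) set" where
  "inner_auts G = (\<lambda>g. \<lambda>x\<in>carrier G. g \<otimes>\<^bsub>G\<^esub> x \<otimes>\<^bsub>G\<^esub> inv\<^bsub>G\<^esub> g) ` carrier G"

definition OutGroup :: "('a, 'b) monoid_scheme \<Rightarrow> ('a \<Rightarrow> 'a) set monoid" where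
  "OutGroup G = AutoGroup G Mod inner_auts G"

section \<open>The natural projection from \<open>Out(F\<^sub>n)\<close> to \<open>GL\<^sub>n(\<int>)\<close>\<close>

definition GL_int :: "nat \<Rightarrow> int mat monoid" where
  "GL_int n = units_of (ring_mat TYPE(int) n ())"

fun letter_exp :: "nat \<Rightarrow> letter \<Rightarrow> int" where
  "letter_exp i (j, b) = (if j = i then (if b then 1 else - 1) else 0)"

definition exp_sum :: "nat \<Rightarrow> letter list \<Rightarrow> int" where
  "exp_sum i w = (\<Sum>a\<leftarrow>w. letter_exp i a)"

text \<open>
  The abelianisation map from the free group onto \<open>\<int>\<^sup>n\<close>, taking the generators to the standard
  basis. Lemmas \<open>abel_mult\<close>, \<open>abel_surj\<close> and \<open>abel_kernel\<close> below: it is an epimorphism whose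
  kernel is the commutator subgroup.
\<close>

definition abel :: "nat \<Rightarrow> letter list \<Rightarrow> int vec" where
  "abel n w = vec n (\<lambda>i. exp_sum i w)"

text \<open>
  The matrix (acting on column vectors) of the automorphism of \<open>\<int>\<^sup>n\<close> that an automorphism of the
  free group induces; see \<open>abel_action\<close>.
\<close>

definition aut_matrix :: "nat \<Rightarrow> (letter list \<Rightarrow> letter list) \<Rightarrow> int mat" where
  "aut_matrix n f = mat n n (\<lambda>(i, j). abel n (f (gen j)) $ i)"

text \<open>
  An outer automorphism is a coset of automorphisms; all its members induce the same matrix
  (\<open>nat_proj_coset\<close>), which is its image.
\<close>

definition nat_proj :: "nat \<Rightarrow> (letter list \<Rightarrow> letter list) set \<Rightarrow> int mat" where
  "nat_proj n C = the_elem (aut_matrix n ` C)"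

section \<open>The general linear group of a vector space\<close>

definition GL :: "('k::field \<Rightarrow> 'v::ab_group_add \<Rightarrow> 'v) \<Rightarrow> ('v \<Rightarrow> 'v) monoid" where
  "GL scale = \<lparr>carrier = {f. Vector_Spaces.linear scale scale f \<and> bij f}, monoid.mult = (\<circ>), one = id\<rparr>"

section \<open>Basic properties\<close>

subsection \<open>Linear groups\<close>

lemma group_GL:
  assumes "vector_space scale"
  shows "group (GL scale)"
proof (rule groupI)
  interpret vector_space scale by fact
  interpret vector_space_pair scale scale ..
  show "\<And>x y. x \<in> carrier (GL scale) \<Longrightarrow> y \<in> carrier (GL scale) \<Longrightarrow> x \<otimes>\<^bsub>GL scale\<^esub> y \<in> carrier (GL scale)"
    by (auto simp: GL_def intro: Vector_Spaces.linear_compose bij_comp)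
  show "\<one>\<^bsub>GL scale\<^esub> \<in> carrier (GL scale)"
    by (simp add: GL_def linear_id)
  fix f assume f: "f \<in> carrier (GL scale)"
  then have l: "Vector_Spaces.linear scale scale f" and b: "bij f" by (auto simp: GL_def)
  interpret f: Vector_Spaces.linear scale scale f by fact
  have "Vector_Spaces.linear scale scale (inv_into UNIV f)"
    unfolding Vector_Spaces.linear_iff
  proof (intro conjI allI)
    fix x y r
    show "inv_into UNIV f (x + y) = inv_into UNIV f x + inv_into UNIV f y"
      using b by (intro inv_f_eq) (auto simp: f.add bij_is_inj bij_is_surj surj_f_inv_f)
    show "inv_into UNIV f (scale r x) = scale r (inv_into UNIV f x)"
      using b by (intro inv_f_eq) (auto simp: f.scale bij_is_inj bij_is_surj surj_f_inv_f)
  qed fact+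
  then show "\<exists>y\<in>carrier (GL scale). y \<otimes>\<^bsub>GL scale\<^esub> f = \<one>\<^bsub>GL scale\<^esub>"
    using b by (intro bexI[of _ "inv_into UNIV f"]) (auto simp: GL_def bij_imp_bij_inv bij_is_inj)
qed (auto simp: GL_def)

lemma group_GL_int: "group (GL_int n)"
proof -
  interpret ring "ring_mat TYPE(int) n ()" by (rule ring_mat)
  show ?thesis unfolding GL_int_def by (rule units_group)
qed

subsection \<open>The free group\<close>

lemma inv_letter_inv [simp]: "inv_letter (inv_letter a) = a"
  by (simp add: inv_letter_def)

lemma inv_letter_neq [simp]: "inv_letter a \<noteq> a" "a \<noteq> inv_letter a"
  by (auto simp: inv_letter_def prod_eq_iff)

lemma fst_inv_letter [simp]: "fst (inv_letter a) = fst a"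
  by (simp add: inv_letter_def)

lemma reduced_Nil [simp]: "reduced []"
  and reduced_single [simp]: "reduced [a]"
  and reduced_Cons2 [simp]: "reduced (a # b # w) \<longleftrightarrow> b \<noteq> inv_letter a \<and> reduced (b # w)"
  by (simp_all add: reduced_def)

lemma reduced_ConsD: "reduced (a # w) \<Longrightarrow> reduced w"
  by (cases w) auto

lemma reduced_cons_red: "reduced w \<Longrightarrow> reduced (cons_red a w)"
  by (cases w) (auto dest: reduced_ConsD)

lemma cons_red_reduced: "reduced (a # w) \<Longrightarrow> cons_red a w = a # w"
  by (cases w) auto

lemma cons_red_cancel: "reduced w \<Longrightarrow> cons_red a (cons_red (inv_letter a) w) = w"
  by (cases w) (auto simp: cons_red_reduced)

lemma reduced_foldr: "reduced w \<Longrightarrow> reduced (foldr cons_red u w)"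
  by (induction u) (auto intro: reduced_cons_red)

lemma reduced_free_reduction [simp]: "reduced (free_reduction w)"
  unfolding free_reduction_def by (rule reduced_foldr) simp

lemma free_reduction_reduced: "reduced w \<Longrightarrow> free_reduction w = w"
  unfolding free_reduction_def
  by (induction w) (metis foldr.simps(1) id_apply, metis cons_red_reduced foldr_Cons o_apply reduced_ConsD)

lemma foldr_cons_red_left:
  assumes "reduced v"
  shows "foldr cons_red (cons_red a u) v = cons_red a (foldr cons_red u v)"
  using cons_red_cancel[OF reduced_foldr[OF assms]] by (cases u) auto

lemma foldr_free_reduction:
  assumes "reduced v"
  shows "foldr cons_red (free_reduction u) v = foldr cons_red u v"
  unfolding free_reduction_def
  by (induction u) (auto simp: foldr_cons_red_left[OF assms])

lemma free_reduction_append: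
  "free_reduction (u @ v) = foldr cons_red u (free_reduction v)"
  by (simp add: free_reduction_def)

lemma free_reduction_append_left:
  "free_reduction (free_reduction u @ v) = free_reduction (u @ v)"
  by (simp add: free_reduction_append foldr_free_reduction)

lemma free_reduction_append_right:
  "free_reduction (u @ free_reduction v) = free_reduction (u @ v)"
  by (simp add: free_reduction_append free_reduction_reduced)

lemma set_cons_red: "set (cons_red a w) \<subseteq> insert a (set w)"
  by (cases w) auto

lemma set_free_reduction: "set (free_reduction w) \<subseteq> set w"
proof (induction w)
  case (Cons a w)
  then show ?case
    using set_cons_red[of a "free_reduction w"] by (auto simp: free_reduction_def)
qed (simp add: free_reduction_def)

lemma mem_free_group: "w \<in> carrier (free_group n) \<longleftrightarrow> fst ` set w \<subseteq> {..<n} \<and> reduced w"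
  by (simp add: free_group_def)

lemma mult_free_group: "u \<otimes>\<^bsub>free_group n\<^esub> v = free_reduction (u @ v)"
  by (simp add: free_group_def)

lemma one_free_group: "\<one>\<^bsub>free_group n\<^esub> = []"
  by (simp add: free_group_def)

lemma foldr_inverse_word:
  "reduced v \<Longrightarrow> foldr cons_red (rev (map inv_letter w)) (foldr cons_red w v) = v"
  by (induction w) (use cons_red_cancel[of _ "inv_letter _"] in \<open>auto simp: reduced_foldr\<close>)

lemma group_free_group: "group (free_group n)"
proof (rule groupI)
  fix u v w
  assume "u \<in> carrier (free_group n)" "v \<in> carrier (free_group n)" "w \<in> carrier (free_group n)"
  show "u \<otimes>\<^bsub>free_group n\<^esub> v \<otimes>\<^bsub>free_group n\<^esub> w = u \<otimes>\<^bsub>free_group n\<^esub> (v \<otimes>\<^bsub>free_group n\<^esub> w)"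
    by (simp add: mult_free_group free_reduction_append_left free_reduction_append_right)
next
  fix u v
  assume "u \<in> carrier (free_group n)" "v \<in> carrier (free_group n)"
  then show "u \<otimes>\<^bsub>free_group n\<^esub> v \<in> carrier (free_group n)"
    using set_free_reduction[of "u @ v"] by (fastforce simp: mult_free_group mem_free_group)
next
  show "\<one>\<^bsub>free_group n\<^esub> \<in> carrier (free_group n)"
    by (simp add: one_free_group mem_free_group)
next
  fix u assume u: "u \<in> carrier (free_group n)"
  then show "\<one>\<^bsub>free_group n\<^esub> \<otimes>\<^bsub>free_group n\<^esub> u = u"
    by (simp add: one_free_group mult_free_group mem_free_group free_reduction_reduced)
  define v where "v = free_reduction (rev (map inv_letter u))"
  have "fst ` set v \<subseteq> fst ` set (rev (map inv_letter u))"
    unfolding v_def by (intro image_mono set_free_reduction)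
  also have "\<dots> = fst ` set u" by (simp add: image_image)
  also have "\<dots> \<subseteq> {..<n}" using u by (simp add: mem_free_group)
  finally have "fst ` set v \<subseteq> {..<n}" .
  moreover have "v \<otimes>\<^bsub>free_group n\<^esub> u = \<one>\<^bsub>free_group n\<^esub>"
    using foldr_inverse_word[of "[]" u]
    by (simp add: v_def mult_free_group one_free_group free_reduction_append_left)
       (simp add: free_reduction_def)
  ultimately show "\<exists>y\<in>carrier (free_group n). y \<otimes>\<^bsub>free_group n\<^esub> u = \<one>\<^bsub>free_group n\<^esub>"
    by (intro bexI[of _ v]) (auto simp: mem_free_group v_def)
qed

lemma gen_closed: "i < n \<Longrightarrow> gen i \<in> carrier (free_group n)"
  by (simp add: gen_def mem_free_group)


lemma reduced_word_split:
  assumes "a # w \<in> carrier (free_group n)"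
  shows "[a] \<in> carrier (free_group n)" "w \<in> carrier (free_group n)"
    "a # w = [a] \<otimes>\<^bsub>free_group n\<^esub> w"
  using assms
  by (auto simp: mem_free_group mult_free_group free_reduction_reduced dest: reduced_ConsD)

lemma inv_single:
  assumes "i < n"
  shows "inv\<^bsub>free_group n\<^esub> (gen i) = [(i, False)]"
proof -
  interpret group "free_group n" by (rule group_free_group)
  show ?thesis
    using assms
    by (intro inv_equality)
       (auto simp: gen_def mem_free_group mult_free_group one_free_group free_reduction_def inv_letter_def)
qed

subsection \<open>The abelianisation\<close>

lemma exp_sum_simps [simp]:
  "exp_sum i [] = 0"
  "exp_sum i (a # w) = letter_exp i a + exp_sum i w"
  "exp_sum i (u @ v) = exp_sum i u + exp_sum i v"
  by (simp_all add: exp_sum_def)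

lemma letter_exp_inv: "letter_exp i (inv_letter a) = - letter_exp i a"
  by (cases a) (auto simp: inv_letter_def)

lemma exp_sum_cons_red: "exp_sum i (cons_red a w) = letter_exp i a + exp_sum i w"
  by (cases w) (auto simp: letter_exp_inv)

lemma exp_sum_free_reduction [simp]: "exp_sum i (free_reduction w) = exp_sum i w"
  unfolding free_reduction_def by (induction w) (auto simp: exp_sum_cons_red)

lemma exp_sum_mult: "exp_sum i (u \<otimes>\<^bsub>free_group n\<^esub> v) = exp_sum i u + exp_sum i v"
  by (simp add: mult_free_group)

lemma exp_sum_inv:
  assumes "u \<in> carrier (free_group n)"
  shows "exp_sum i (inv\<^bsub>free_group n\<^esub> u) = - exp_sum i u"
proof -
  interpret group "free_group n" by (rule group_free_group)
  have "exp_sum i (inv\<^bsub>free_group n\<^esub> u \<otimes>\<^bsub>free_group n\<^esub> u) = 0"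
    using assms by (simp add: one_free_group)
  then show ?thesis by (simp add: exp_sum_mult)
qed

lemma abel_carrier [simp]: "abel n w \<in> carrier_vec n"
  by (simp add: abel_def)

lemma abel_mult: "abel n (u \<otimes>\<^bsub>free_group n\<^esub> v) = abel n u + abel n v"
  by (rule eq_vecI) (auto simp: abel_def exp_sum_mult)

lemma abel_gen: "i < n \<Longrightarrow> abel n (gen i) = unit_vec n i"
  by (rule eq_vecI) (auto simp: abel_def gen_def)

lemma hom_to_abelian:
  assumes "comm_group H" "h \<in> hom (free_group n) H" "w \<in> carrier (free_group n)"
  shows "h w = (\<Otimes>\<^bsub>H\<^esub>i\<in>{..<n}. h (gen i) [^]\<^bsub>H\<^esub> exp_sum i w)"
proof -
  interpret H: comm_group H by fact
  interpret F: group "free_group n" by (rule group_free_group)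
  interpret h: group_hom "free_group n" H h
    using assms by (simp add: group_hom_def group_hom_axioms_def group_free_group H.group_axioms)
  have gens: "h (gen i) \<in> carrier H" if "i < n" for i
    using that by (simp add: gen_closed)
  have single: "h [a] = (\<Otimes>\<^bsub>H\<^esub>i\<in>{..<n}. h (gen i) [^]\<^bsub>H\<^esub> letter_exp i a)" if "fst a < n" for a
  proof -
    obtain j b where a: "a = (j, b)" by (cases a)
    with that have j: "j < n" by simp
    have "(\<Otimes>\<^bsub>H\<^esub>i\<in>{..<n}. h (gen i) [^]\<^bsub>H\<^esub> letter_exp i a) =
          (\<Otimes>\<^bsub>H\<^esub>i\<in>{..<n}. if j = i then h (gen i) [^]\<^bsub>H\<^esub> (if b then 1 else - 1 :: int) else \<one>\<^bsub>H\<^esub>)"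
      using gens by (intro H.finprod_cong') (auto simp: a)
    also have "\<dots> = h (gen j) [^]\<^bsub>H\<^esub> (if b then 1 else - 1 :: int)"
      using gens j by (intro H.finprod_singleton) auto
    also have "\<dots> = h [a]"
      using gens[OF j] j by (auto simp: a gen_closed H.int_pow_neg inv_single simp flip: h.hom_inv)
        (simp_all add: gen_def)
    finally show ?thesis by simp
  qed
  show ?thesis
    using assms(3)
  proof (induction w)
    case Nil
    have "h [] = \<one>\<^bsub>H\<^esub>" using h.hom_one by (simp add: one_free_group)
    then show ?case by simp
  next
    case (Cons a w)
    note sp = reduced_word_split[OF Cons.prems]
    have "h (a # w) = h [a] \<otimes>\<^bsub>H\<^esub> h w"
      using sp by (metis h.hom_mult)
    also have "\<dots> = (\<Otimes>\<^bsub>H\<^esub>i\<in>{..<n}. h (gen i) [^]\<^bsub>H\<^esub> letter_exp i a) \<otimes>\<^bsub>H\<^esub>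
                    (\<Otimes>\<^bsub>H\<^esub>i\<in>{..<n}. h (gen i) [^]\<^bsub>H\<^esub> exp_sum i w)"
      using Cons.IH[OF sp(2)] single[of a] sp(1) by (simp add: mem_free_group)
    also have "\<dots> = (\<Otimes>\<^bsub>H\<^esub>i\<in>{..<n}. (h (gen i) [^]\<^bsub>H\<^esub> letter_exp i a) \<otimes>\<^bsub>H\<^esub> (h (gen i) [^]\<^bsub>H\<^esub> exp_sum i w))"
      using gens by (intro H.finprod_multf[symmetric]) auto
    also have "\<dots> = (\<Otimes>\<^bsub>H\<^esub>i\<in>{..<n}. h (gen i) [^]\<^bsub>H\<^esub> exp_sum i (a # w))"
      using gens by (intro H.finprod_cong') (auto simp: H.int_pow_mult)
    finally show ?case .
  qed
qed

lemma abel_kernel: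
  "{w \<in> carrier (free_group n). abel n w = 0\<^sub>v n} = derived (free_group n) (carrier (free_group n))"
    (is "?K = ?D")
proof
  interpret F: group "free_group n" by (rule group_free_group)
  interpret D: normal ?D "free_group n"
    by (rule F.derived_is_normal) (rule F.normal_self)
  let ?H = "free_group n Mod ?D" and ?h = "\<lambda>x. ?D #>\<^bsub>free_group n\<^esub> x"
  have cg: "comm_group ?H" by (rule F.derived_quot_is_comm_group)
  have hom: "?h \<in> hom (free_group n) ?H" by (rule D.r_coset_hom_Mod)
  interpret H: comm_group ?H by (rule cg)
  show "?K \<subseteq> ?D"
  proof safe
    fix w assume w: "w \<in> carrier (free_group n)" "abel n w = 0\<^sub>v n"
    then have "exp_sum i w = 0" if "i < n" for i
      using that by (auto simp: abel_def vec_eq_iff)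
    then have "?h w = \<one>\<^bsub>?H\<^esub>"
      unfolding hom_to_abelian[OF cg hom w(1)] by (intro H.finprod_one_eqI) simp
    then have "?h w = ?D" by (simp add: FactGroup_def)
    then show "w \<in> ?D"
      using w(1) D.subgroup_axioms F.rcos_self by blast
  qed
  show "?D \<subseteq> ?K"
  proof
    fix w assume w: "w \<in> ?D"
    then have "w \<in> generate (free_group n) (derived_set (free_group n) (carrier (free_group n)))"
      by (simp add: derived_def)
    then have "\<forall>i. exp_sum i w = 0"
    proof induction
      case one
      then show ?case by (simp add: one_free_group)
    next
      case (incl h)
      then show ?case by (auto simp: exp_sum_mult exp_sum_inv)
    next
      case (inv h)
      then show ?case by (auto simp: exp_sum_mult exp_sum_inv)
    qed (auto simp: exp_sum_mult)
    then show "w \<in> ?K"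
      using w D.subset by (auto simp: abel_def vec_eq_iff)
  qed
qed

lemma exp_sum_pow:
  assumes "u \<in> carrier (free_group n)"
  shows "exp_sum i (u [^]\<^bsub>free_group n\<^esub> (k :: int)) = k * exp_sum i u"
proof -
  interpret F: group "free_group n" by (rule group_free_group)
  have "exp_sum i (u [^]\<^bsub>free_group n\<^esub> (k :: nat)) = k * exp_sum i u" for k
    by (induction k) (auto simp: one_free_group exp_sum_mult algebra_simps)
  then show ?thesis
    using assms
    by (cases k rule: int_cases2) (auto simp: int_pow_int F.int_pow_neg_int exp_sum_inv)
qed

lemma abel_surj: "abel n ` carrier (free_group n) = carrier_vec n"
proof safe
  interpret F: group "free_group n" by (rule group_free_group)
  fix v :: "int vec" assume v: "v \<in> carrier_vec n"
  have "\<exists>w\<in>carrier (free_group n). \<forall>i. exp_sum i w = (if i < k then v $ i else 0)" if "k \<le> n" for k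
    using that
  proof (induction k)
    case 0
    then show ?case by (intro bexI[of _ "\<one>\<^bsub>free_group n\<^esub>"]) (auto simp: one_free_group mem_free_group)
  next
    case (Suc k)
    then obtain w where w: "w \<in> carrier (free_group n)"
      "\<And>i. exp_sum i w = (if i < k then v $ i else 0)" by auto
    have g: "gen k \<in> carrier (free_group n)" using Suc.prems by (simp add: gen_closed)
    have e: "exp_sum i (gen k) = (if i = k then 1 else 0)" for i by (simp add: gen_def)
    have "exp_sum i (w \<otimes>\<^bsub>free_group n\<^esub> gen k [^]\<^bsub>free_group n\<^esub> (v $ k)) = (if i < Suc k then v $ i else 0)" for i
      using w(2)[of i] e by (auto simp: exp_sum_mult exp_sum_pow[OF g] less_Suc_eq)
    then show ?case
      using w g by (intro bexI[of _ "w \<otimes>\<^bsub>free_group n\<^esub> gen k [^]\<^bsub>free_group n\<^esub> (v $ k)"]) auto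
  qed
  from this[of n] obtain w where "w \<in> carrier (free_group n)"
    "\<And>i. exp_sum i w = (if i < n then v $ i else 0)" by auto
  then show "v \<in> abel n ` carrier (free_group n)"
    using v by (intro image_eqI[of _ _ w]) (auto simp: abel_def vec_eq_iff)
qed simp

subsection \<open>The induced action and the natural projection\<close>

lemma autoD:
  assumes "f \<in> auto G"
  shows "f \<in> hom G G" "\<And>x. x \<in> carrier G \<Longrightarrow> f x \<in> carrier G"
    "\<And>x y. x \<in> carrier G \<Longrightarrow> y \<in> carrier G \<Longrightarrow> f (x \<otimes>\<^bsub>G\<^esub> y) = f x \<otimes>\<^bsub>G\<^esub> f y"
    "f \<in> Bij (carrier G)"
  using assms by (auto simp: auto_def hom_def)

lemma AutoGroup_simps:
  "carrier (AutoGroup G) = auto G"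
  "f \<in> auto G \<Longrightarrow> g \<in> auto G \<Longrightarrow> f \<otimes>\<^bsub>AutoGroup G\<^esub> g = compose (carrier G) f g"
  "\<one>\<^bsub>AutoGroup G\<^esub> = (\<lambda>x\<in>carrier G. x)"
  by (auto simp: AutoGroup_def BijGroup_def auto_def)

lemma aut_matrix_carrier [simp]: "aut_matrix n f \<in> carrier_mat n n"
  by (simp add: aut_matrix_def)

lemma aut_matrix_index [simp]:
  "i < n \<Longrightarrow> j < n \<Longrightarrow> aut_matrix n f $$ (i, j) = exp_sum i (f (gen j))"
  by (simp add: aut_matrix_def abel_def)

lemma abel_action:
  assumes f: "f \<in> hom (free_group n) (free_group n)" and w: "w \<in> carrier (free_group n)"
  shows "abel n (f w) = aut_matrix n f *\<^sub>v abel n w"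
proof (rule eq_vecI)
  interpret F: group "free_group n" by (rule group_free_group)
  interpret f: group_hom "free_group n" "free_group n" f
    using f by (simp add: group_hom_def group_hom_axioms_def group_free_group)
  fix i assume "i < dim_vec (aut_matrix n f *\<^sub>v abel n w)"
  then have i: "i < n" by (simp add: aut_matrix_def)
  have single: "exp_sum i (f [a]) = (\<Sum>j<n. exp_sum i (f (gen j)) * letter_exp j a)"
    if a: "[a] \<in> carrier (free_group n)" for a
  proof -
    obtain j b where ab: "a = (j, b)" by (cases a)
    with a have j: "j < n" by (simp add: mem_free_group)
    have "(\<Sum>k<n. exp_sum i (f (gen k)) * letter_exp k a) =
          (\<Sum>k<n. if j = k then exp_sum i (f (gen k)) * (if b then 1 else - 1) else 0)"
      by (intro sum.cong) (auto simp: ab)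
    also have "\<dots> = exp_sum i (f (gen j)) * (if b then 1 else - 1)"
      using j by simp
    also have "\<dots> = exp_sum i (f [a])"
    proof (cases b)
      case False
      have "f [a] = inv\<^bsub>free_group n\<^esub> f (gen j)"
        using False j by (simp add: ab gen_closed flip: inv_single f.hom_inv)
      then show ?thesis using False j by (simp add: exp_sum_inv gen_closed)
    qed (simp add: ab gen_def)
    finally show ?thesis by simp
  qed
  have "exp_sum i (f w) = (\<Sum>j<n. exp_sum i (f (gen j)) * exp_sum j w)"
    using w
  proof (induction w)
    case Nil
    have "f [] = []" using f.hom_one by (simp add: one_free_group)
    then show ?case by simp
  next
    case (Cons a w)
    note sp = reduced_word_split[OF Cons.prems]
    have "f (a # w) = f [a] \<otimes>\<^bsub>free_group n\<^esub> f w"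
      using sp by (metis f.hom_mult)
    then have "exp_sum i (f (a # w)) = exp_sum i (f [a]) + exp_sum i (f w)"
      by (simp add: exp_sum_mult)
    then show ?case
      using Cons.IH[OF sp(2)] single[OF sp(1)] by (simp add: sum.distrib algebra_simps)
  qed
  then show "abel n (f w) $ i = (aut_matrix n f *\<^sub>v abel n w) $ i"
    using i by (simp add: abel_def scalar_prod_def atLeast0LessThan aut_matrix_def)
qed (simp add: abel_def aut_matrix_def)

lemma aut_matrix_compose:
  assumes f: "f \<in> auto (free_group n)" and g: "g \<in> auto (free_group n)"
  shows "aut_matrix n (compose (carrier (free_group n)) f g) = aut_matrix n f * aut_matrix n g"
proof (rule eq_matI)
  fix i j assume "i < dim_row (aut_matrix n f * aut_matrix n g)" "j < dim_col (aut_matrix n f * aut_matrix n g)"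
  then have ij: "i < n" "j < n" by (simp_all add: aut_matrix_def)
  have "abel n (f (g (gen j))) = aut_matrix n f *\<^sub>v abel n (g (gen j))"
    using ij autoD[OF f] autoD[OF g] by (intro abel_action) (auto simp: gen_closed)
  also have "abel n (g (gen j)) = col (aut_matrix n g) j"
    using ij by (intro eq_vecI) (auto simp: abel_def aut_matrix_def)
  finally have "abel n (f (g (gen j))) $ i = (aut_matrix n f * aut_matrix n g) $$ (i, j)"
    using ij by (simp add: aut_matrix_def)
  then show "aut_matrix n (compose (carrier (free_group n)) f g) $$ (i, j) =
      (aut_matrix n f * aut_matrix n g) $$ (i, j)"
    using ij by (simp add: abel_def compose_eq gen_closed)
qed (simp_all add: aut_matrix_def)

lemma aut_matrix_one: "aut_matrix n (\<lambda>x\<in>carrier (free_group n). x) = 1\<^sub>m n"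
  by (rule eq_matI) (auto simp: aut_matrix_def abel_def gen_closed, auto simp: gen_def)

lemma aut_matrix_hom: "aut_matrix n \<in> hom (AutoGroup (free_group n)) (GL_int n)"
proof -
  interpret F: group "free_group n" by (rule group_free_group)
  interpret A: group "AutoGroup (free_group n)" by (rule F.AutoGroup)
  have units: "aut_matrix n f \<in> carrier (GL_int n)" if f: "f \<in> auto (free_group n)" for f
  proof -
    define g where "g = inv\<^bsub>AutoGroup (free_group n)\<^esub> f"
    have g: "g \<in> auto (free_group n)"
      using A.inv_closed[of f] f by (simp add: g_def AutoGroup_simps)
    have "compose (carrier (free_group n)) f g = (\<lambda>x\<in>carrier (free_group n). x)"
      "compose (carrier (free_group n)) g f = (\<lambda>x\<in>carrier (free_group n). x)"
      using f g A.r_inv[of f] A.l_inv[of f] by (simp_all add: g_def AutoGroup_simps)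
    then have "aut_matrix n f * aut_matrix n g = 1\<^sub>m n" "aut_matrix n g * aut_matrix n f = 1\<^sub>m n"
      using f g by (simp_all add: aut_matrix_one flip: aut_matrix_compose)
    then show ?thesis
      by (auto simp: GL_int_def units_of_def Units_def ring_mat_def intro!: bexI[of _ "aut_matrix n g"])
  qed
  show ?thesis
    by (rule homI)
       (use units in \<open>auto simp: AutoGroup_simps aut_matrix_compose GL_int_def units_of_mult ring_mat_simps\<close>)
qed

lemma (in group) inner_in_auto:
  assumes g: "g \<in> carrier G"
  shows "(\<lambda>x\<in>carrier G. g \<otimes> x \<otimes> inv g) \<in> auto G"
proof -
  have c: "inv g \<otimes> (g \<otimes> x) = x" "g \<otimes> (inv g \<otimes> x) = x" if "x \<in> carrier G" for x
    using g that by (simp_all flip: m_assoc)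
  have "bij_betw (\<lambda>x\<in>carrier G. g \<otimes> x \<otimes> inv g) (carrier G) (carrier G)"
    using g by (intro bij_betwI[where g = "\<lambda>x. inv g \<otimes> x \<otimes> g"]) (auto simp: m_assoc c)
  then show ?thesis
    using g by (auto simp: auto_def Bij_def hom_def m_assoc c)
qed

lemma (in group) inner_auts_normal: "inner_auts G \<lhd> AutoGroup G"
proof -
  interpret A: group "AutoGroup G" by (rule AutoGroup)
  let ?c = "\<lambda>g. \<lambda>x\<in>carrier G. g \<otimes> x \<otimes> inv g"
  have hom: "?c \<in> hom G (AutoGroup G)"
  proof (rule homI)
    fix g h assume gh: "g \<in> carrier G" "h \<in> carrier G"
    then show "?c (g \<otimes> h) = ?c g \<otimes>\<^bsub>AutoGroup G\<^esub> ?c h"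
      by (auto simp: AutoGroup_simps inner_in_auto compose_def inv_mult_group m_assoc fun_eq_iff)
  qed (simp add: AutoGroup_simps inner_in_auto)
  interpret c: group_hom G "AutoGroup G" ?c
    using hom by (simp add: group_hom_def group_hom_axioms_def A.group_axioms group_axioms)
  have sub: "subgroup (inner_auts G) (AutoGroup G)"
    unfolding inner_auts_def by (rule c.img_is_subgroup)
  have "f \<otimes>\<^bsub>AutoGroup G\<^esub> k \<otimes>\<^bsub>AutoGroup G\<^esub> inv\<^bsub>AutoGroup G\<^esub> f \<in> inner_auts G"
    if f: "f \<in> carrier (AutoGroup G)" and k: "k \<in> inner_auts G" for f k
  proof -
    obtain g where g: "g \<in> carrier G" "k = ?c g" using k by (auto simp: inner_auts_def)
    have f': "f \<in> auto G" using f by (simp add: AutoGroup_simps)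
    interpret f: group_hom G G f
      using autoD[OF f'] by (simp add: group_hom_def group_hom_axioms_def group_axioms)
    have "f \<otimes>\<^bsub>AutoGroup G\<^esub> k = ?c (f g) \<otimes>\<^bsub>AutoGroup G\<^esub> f"
      using f' inner_in_auto[OF g(1)] inner_in_auto[of "f g"] g(1)
      unfolding g(2) by (auto simp: AutoGroup_simps compose_def fun_eq_iff)
    moreover have "?c (f g) \<in> carrier (AutoGroup G)"
      using g by (simp add: AutoGroup_simps inner_in_auto)
    ultimately have "f \<otimes>\<^bsub>AutoGroup G\<^esub> k \<otimes>\<^bsub>AutoGroup G\<^esub> inv\<^bsub>AutoGroup G\<^esub> f = ?c (f g)"
      using f by (simp add: A.m_assoc)
    then show ?thesis using g by (auto simp: inner_auts_def)
  qed
  with sub show ?thesis by (simp add: A.normal_inv_iff)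
qed

lemma (in group) group_OutGroup: "group (OutGroup G)"
  unfolding OutGroup_def by (intro normal.factorgroup_is_group inner_auts_normal)

lemma aut_matrix_inner:
  assumes "k \<in> inner_auts (free_group n)"
  shows "aut_matrix n k = 1\<^sub>m n"
proof -
  obtain g where g: "g \<in> carrier (free_group n)"
    "k = (\<lambda>x\<in>carrier (free_group n). g \<otimes>\<^bsub>free_group n\<^esub> x \<otimes>\<^bsub>free_group n\<^esub> inv\<^bsub>free_group n\<^esub> g)"
    using assms by (auto simp: inner_auts_def)
  have "aut_matrix n k = aut_matrix n (\<lambda>x\<in>carrier (free_group n). x)"
    by (rule eq_matI)
       (use g in \<open>auto simp: aut_matrix_def abel_def gen_closed exp_sum_mult exp_sum_inv\<close>)
  then show ?thesis by (simp add: aut_matrix_one)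
qed

lemma nat_proj_coset:
  assumes C: "C \<in> carrier (OutGroup (free_group n))" and f: "f \<in> C"
  shows "nat_proj n C = aut_matrix n f"
proof -
  interpret F: group "free_group n" by (rule group_free_group)
  interpret N: normal "inner_auts (free_group n)" "AutoGroup (free_group n)"
    by (rule F.inner_auts_normal)
  obtain f0 where f0: "f0 \<in> carrier (AutoGroup (free_group n))"
    "C = inner_auts (free_group n) #>\<^bsub>AutoGroup (free_group n)\<^esub> f0"
    using C by (auto simp: OutGroup_def FactGroup_def RCOSETS_def)
  have "aut_matrix n x = aut_matrix n f0" if "x \<in> C" for x
  proof -
    obtain k where k: "k \<in> inner_auts (free_group n)" "x = k \<otimes>\<^bsub>AutoGroup (free_group n)\<^esub> f0"
      using \<open>x \<in> C\<close> f0(2) by (auto simp: r_coset_def)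
    have "k \<in> auto (free_group n)" using k(1) N.subset by (auto simp: AutoGroup_simps)
    then show ?thesis
      using k f0(1) left_mult_one_mat[OF aut_matrix_carrier]
      by (simp add: AutoGroup_simps aut_matrix_compose aut_matrix_inner)
  qed
  then have "aut_matrix n ` C = {aut_matrix n f}" using f by fastforce
  then show ?thesis by (simp add: nat_proj_def)
qed

lemma nat_proj_hom: "nat_proj n \<in> hom (OutGroup (free_group n)) (GL_int n)"
proof -
  interpret F: group "free_group n" by (rule group_free_group)
  interpret N: normal "inner_auts (free_group n)" "AutoGroup (free_group n)"
    by (rule F.inner_auts_normal)
  interpret m: group_hom "AutoGroup (free_group n)" "GL_int n" "aut_matrix n"
    by (simp add: group_hom_def group_hom_axioms_def F.AutoGroup group_GL_int aut_matrix_hom)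
  let ?q = "\<lambda>f. inner_auts (free_group n) #>\<^bsub>AutoGroup (free_group n)\<^esub> f"
  have q: "nat_proj n (?q f) = aut_matrix n f" "?q f \<in> carrier (OutGroup (free_group n))"
    if "f \<in> carrier (AutoGroup (free_group n))" for f
  proof -
    show *: "?q f \<in> carrier (OutGroup (free_group n))"
      using that by (auto simp: OutGroup_def FactGroup_def RCOSETS_def)
    show "nat_proj n (?q f) = aut_matrix n f"
      using that N.subgroup_axioms by (intro nat_proj_coset[OF *] N.rcos_self)
  qed
  have ex: "\<exists>f\<in>carrier (AutoGroup (free_group n)). C = ?q f"
    if "C \<in> carrier (OutGroup (free_group n))" for C
    using that by (auto simp: OutGroup_def FactGroup_def RCOSETS_def)
  have mult: "C \<otimes>\<^bsub>OutGroup (free_group n)\<^esub> D = C <#>\<^bsub>AutoGroup (free_group n)\<^esub> D" for C D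
    by (simp add: OutGroup_def FactGroup_def)
  show ?thesis
  proof (rule homI)
    fix C D assume "C \<in> carrier (OutGroup (free_group n))" "D \<in> carrier (OutGroup (free_group n))"
    then obtain f g where "f \<in> carrier (AutoGroup (free_group n))" "C = ?q f"
      "g \<in> carrier (AutoGroup (free_group n))" "D = ?q g" using ex by metis
    then show "nat_proj n (C \<otimes>\<^bsub>OutGroup (free_group n)\<^esub> D) = nat_proj n C \<otimes>\<^bsub>GL_int n\<^esub> nat_proj n D"
      by (auto simp: q N.rcos_sum mult)
  next
    fix C assume "C \<in> carrier (OutGroup (free_group n))"
    then show "nat_proj n C \<in> carrier (GL_int n)" using ex q(1) m.hom_closed by metis
  qed
qed

end

theory Submission
  imports Defs "HOL-Combinatorics.Permutations"
begin

text \<open>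
  Let \<open>\<Phi>\<close> be the composition of \<open>\<phi>\<close> with the quotient map from the automorphism group of the free group.
  Decompose \<open>V\<close> into the joint eigenspaces of the involutions inverting one generator each. They are permuted by
  the symmetric group, so the dimension bound \<open>2n\<close> leaves few possibilities, and in each of them
  explicit relations between Nielsen automorphisms force \<open>a\<^sub>i \<mapsto> a\<^sub>i a\<^sub>j\<close> and \<open>a\<^sub>i \<mapsto> a\<^sub>j a\<^sub>i\<close> to have the same image
  under \<open>\<Phi>\<close>. Once these are identified, the Nielsen relations become a presentation of \<open>GL\<^sub>n(\<int>)\<close>: by Euclid's algorithm
  on the first column, uniquely up to the relations, an element acting trivially on \<open>\<int>\<^sup>n\<close> is a consequence of them.
  As the Nielsen automorphisms generate by Nielsen's cancellation argument, \<open>\<Phi>\<close> depends only on the induced matrix.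
\<close>

section \<open>Joint eigenvectors of commuting operators\<close>

text \<open>\<open>R i j\<close> can change a sign pattern only at i and j, and its difference from
  the left multiplication \<open>L i j\<close> changes exactly one of these two signs. So
  \<open>R\<close> and \<open>L\<close> differ only if two consecutive numbers of minus signs occur,
  and binomial orbit sizes then leave the patterns {} and singletons, or their complements. With U
  the common fixed space and e_i spanning the line of {i}, equality of \<open>R i j\<close> and
  \<open>L i j\<close> on these layers means that two entries vanish: \<beta>, from U to e_j, and b,
  from e_j to U. If both were nonzero, U would contain six independent vectors. If only one were,
  seven characters would have to occur in U unless the diagonal action on U is trivial; the relation
  coming from inner automorphisms then gives n-1 times the entry equal to zero. The characteristic
  thus enters through 2 and n-1, which is 3 or 4.

  For the second half no abstractly presented group is built: the relations are the axioms of a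
  locale in which elements act on integer vectors, and faithfulness of that action is proved there.
  Pairs of a value of \<Phi> and its integral matrix then form an instance.\<close>

context vector_space begin

text \<open>Applying \<open>T j\<close> minus the scalar \<open>c s j\<close> to the relation
  removes the term of s and multiplies each other term by \<open>c t j - c s j\<close>. The shorter
  relation falls to the induction hypothesis, and a separating j makes the factor nonzero.\<close>

lemma joint_eigen_sum_zero:
  assumes "finite S"
    and lin: "\<And>j. j \<in> J \<Longrightarrow> Vector_Spaces.linear scale scale (T j)"
    and eigen: "\<And>s j. s \<in> S \<Longrightarrow> j \<in> J \<Longrightarrow> T j (v s) = scale (c s j) (v s)"
    and sep: "\<And>s t. s \<in> S \<Longrightarrow> t \<in> S \<Longrightarrow> s \<noteq> t \<Longrightarrow> \<exists>j\<in>J. c s j \<noteq> c t j"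
    and sum: "(\<Sum>s\<in>S. v s) = 0"
  shows "\<forall>s\<in>S. v s = 0"
proof -
  interpret p: vector_space_pair scale scale ..
  show ?thesis
    using assms(1) eigen sep sum
  proof (induction S arbitrary: v)
    case (insert s S)
    have zero: "scale (c t j - c s j) (v t) = 0" if j: "j \<in> J" and t: "t \<in> S" for t j
    proof -
      have "(\<Sum>t\<in>insert s S. scale (c t j) (v t)) = T j (\<Sum>t\<in>insert s S. v t)"
        unfolding p.linear_sum[OF lin[OF j]] using insert.prems(1) j by (intro sum.cong) auto
      also have "\<dots> = 0" using insert.prems(3) by (simp add: p.linear_0[OF lin[OF j]])
      finally have 1: "(\<Sum>t\<in>insert s S. scale (c t j) (v t)) = 0" .
      have 2: "(\<Sum>t\<in>insert s S. scale (c s j) (v t)) = 0"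
        using insert.prems(3) by (simp flip: scale_sum_right)
      have "(\<Sum>t\<in>insert s S. scale (c t j - c s j) (v t)) = 0"
        unfolding scale_left_diff_distrib sum_subtractf 1 2 by simp
      then have "(\<Sum>t\<in>S. scale (c t j - c s j) (v t)) = 0" using insert.hyps by simp
      moreover have "T i (scale (c t j - c s j) (v t)) = scale (c t i) (scale (c t j - c s j) (v t))"
        if "t \<in> S" "i \<in> J" for t i
        using insert.prems(1)[of t i] that by (simp add: p.linear_scale[OF lin] scale_left_commute)
      ultimately have "\<forall>t\<in>S. scale (c t j - c s j) (v t) = 0"
        using insert.prems(2) by (intro insert.IH) auto
      then show ?thesis using t by blast
    qed
    have "v t = 0" if t: "t \<in> S" for t
    proof -
      have "t \<noteq> s" using t insert.hyps by blast
      then obtain j where "j \<in> J" "c t j \<noteq> c s j" using insert.prems(2)[of t s] t by auto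
      then show ?thesis using zero[of j t] t by simp
    qed
    moreover from this have "v s = 0" using insert.prems(3) insert.hyps by simp
    ultimately show ?case by simp
  qed simp
qed

text \<open>Independence is required of the indexed family, so that injectivity of \<open>v\<close>
  need not be supplied: equal values at s and t would give the relation with coefficients 1 and
  -1.\<close>

lemma card_le_dimI:
  assumes "finite_dimensional_vector_space scale B" "finite S" "v ` S \<subseteq> U"
    and ind: "\<And>a. (\<Sum>s\<in>S. scale (a s) (v s)) = 0 \<Longrightarrow> \<forall>s\<in>S. a s = 0"
  shows "card S \<le> dim U"
proof -
  interpret f: finite_dimensional_vector_space scale B by fact
  have inj: "inj_on v S"
  proof (rule inj_onI, rule ccontr)
    fix s t assume st: "s \<in> S" "t \<in> S" "v s = v t" "s \<noteq> t"
    have "(\<Sum>r\<in>S. scale (if r = s then 1 else if r = t then - 1 else 0) (v r)) =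
      (\<Sum>r\<in>S. (if s = r then v s else 0) + (if t = r then - v t else 0))"
      using st by (intro sum.cong) auto
    also have "\<dots> = 0" using st assms(2) by (simp add: sum.distrib)
    finally show False using ind[of "\<lambda>r. if r = s then 1 else if r = t then - 1 else 0"] st by fastforce
  qed
  have "independent (v ` S)"
  proof (rule independent_if_scalars_zero)
    fix f x assume f: "(\<Sum>x\<in>v ` S. scale (f x) x) = 0" "x \<in> v ` S"
    then have "\<forall>s\<in>S. f (v s) = 0" by (intro ind) (simp add: sum.reindex[OF inj])
    then show "f x = 0" using f by auto
  qed (use assms in simp)
  then have "card (v ` S) \<le> dim U" using assms by (intro f.independent_card_le_dim)
  then show ?thesis using card_image[OF inj] by simp
qed

lemma card_le_dim_joint_eigen:
  assumes "finite_dimensional_vector_space scale B" "finite S" "v ` S \<subseteq> U"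
    and lin: "\<And>j. j \<in> J \<Longrightarrow> Vector_Spaces.linear scale scale (T j)"
    and eigen: "\<And>s j. s \<in> S \<Longrightarrow> j \<in> J \<Longrightarrow> T j (v s) = scale (c s j) (v s)"
    and sep: "\<And>s t. s \<in> S \<Longrightarrow> t \<in> S \<Longrightarrow> s \<noteq> t \<Longrightarrow> \<exists>j\<in>J. c s j \<noteq> c t j"
    and nz: "\<And>s. s \<in> S \<Longrightarrow> v s \<noteq> 0"
  shows "card S \<le> dim U"
proof (rule card_le_dimI[OF assms(1-3)])
  interpret p: vector_space_pair scale scale ..
  fix a assume sum: "(\<Sum>s\<in>S. scale (a s) (v s)) = 0"
  have "\<forall>s\<in>S. scale (a s) (v s) = 0"
  proof (rule joint_eigen_sum_zero[OF assms(2) lin _ sep sum])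
    fix s j assume "s \<in> S" "j \<in> J"
    then show "T j (scale (a s) (v s)) = scale (c s j) (scale (a s) (v s))"
      using eigen by (simp add: p.linear_scale[OF lin] scale_left_commute)
  qed
  then show "\<forall>s\<in>S. a s = 0" using nz by auto
qed

text \<open>Applying \<open>g s\<close> to a linear relation isolates the coefficient at s, up to a
  nonzero factor. This serves for the pairing of the functionals \<beta> with the vectors b.\<close>

lemma card_le_dim_dual:
  assumes "finite_dimensional_vector_space scale B" "finite S" "v ` S \<subseteq> U"
    and lin: "\<And>s. s \<in> S \<Longrightarrow> Vector_Spaces.linear scale (*) (g s)"
    and nz: "\<And>s. s \<in> S \<Longrightarrow> g s (v s) \<noteq> 0"
    and orth: "\<And>s t. s \<in> S \<Longrightarrow> t \<in> S \<Longrightarrow> s \<noteq> t \<Longrightarrow> g s (v t) = 0"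
  shows "card S \<le> dim U"
proof (rule card_le_dimI[OF assms(1-3)])
  interpret p: vector_space_pair scale "(*)"
    by unfold_locales (auto simp: algebra_simps)
  fix a assume sum: "(\<Sum>s\<in>S. scale (a s) (v s)) = 0"
  show "\<forall>s\<in>S. a s = 0"
  proof
    fix s assume s: "s \<in> S"
    have "0 = g s (\<Sum>t\<in>S. scale (a t) (v t))" using sum by (simp add: p.linear_0[OF lin[OF s]])
    also have "\<dots> = (\<Sum>t\<in>S. a t * g s (v t))"
      by (simp add: p.linear_sum[OF lin[OF s]] p.linear_scale[OF lin[OF s]])
    also have "\<dots> = (\<Sum>t\<in>S. if s = t then a s * g s (v s) else 0)"
      using orth s by (intro sum.cong) auto
    also have "\<dots> = a s * g s (v s)" using s assms(2) by simp
    finally show "a s = 0" using nz[OF s] by simp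
  qed
qed

text \<open>The commuting involutions \<open>a\<^sub>1\<close>, \<open>a\<^sub>2\<close>, \<open>a\<^sub>3\<close> are permuted by the operators \<open>m\<close> like a basis of
  \<open>\<F>\<^sub>2\<^sup>3\<close> by transvections, so all seven nontrivial characters occur as soon as one does.\<close>

lemma seven_characters:
  assumes "finite_dimensional_vector_space scale B" and U: "subspace U"
    and lin: "\<And>j. j \<in> {1,2,3::nat} \<Longrightarrow> Vector_Spaces.linear scale scale (a j)"
    and lin_m: "\<And>k j. k \<in> {1,2,3} \<Longrightarrow> j \<in> {1,2,3::nat} \<Longrightarrow> k \<noteq> j \<Longrightarrow> Vector_Spaces.linear scale scale (m k j)"
    and aU: "\<And>j u. j \<in> {1,2,3} \<Longrightarrow> u \<in> U \<Longrightarrow> a j u \<in> U"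
    and mU: "\<And>k j u. k \<in> {1,2,3} \<Longrightarrow> j \<in> {1,2,3} \<Longrightarrow> k \<noteq> j \<Longrightarrow> u \<in> U \<Longrightarrow> m k j u \<in> U"
    and a2: "\<And>j u. j \<in> {1,2,3} \<Longrightarrow> u \<in> U \<Longrightarrow> a j (a j u) = u"
    and m2: "\<And>k j u. k \<in> {1,2,3} \<Longrightarrow> j \<in> {1,2,3} \<Longrightarrow> k \<noteq> j \<Longrightarrow> u \<in> U \<Longrightarrow> m k j (m k j u) = u"
    and aa: "\<And>k j u. k \<in> {1,2,3} \<Longrightarrow> j \<in> {1,2,3} \<Longrightarrow> u \<in> U \<Longrightarrow> a k (a j u) = a j (a k u)"
    and am: "\<And>k j l u. k \<in> {1,2,3} \<Longrightarrow> j \<in> {1,2,3} \<Longrightarrow> l \<in> {1,2,3} \<Longrightarrow> k \<noteq> j \<Longrightarrow> l \<noteq> k \<Longrightarrow> u \<in> U \<Longrightarrow>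
      a l (m k j u) = m k j (a l u)"
    and chain: "\<And>k j u. k \<in> {1,2,3} \<Longrightarrow> j \<in> {1,2,3} \<Longrightarrow> k \<noteq> j \<Longrightarrow> u \<in> U \<Longrightarrow> m k j (a k u) = a k (m k j (a j u))"
    and u: "u \<in> U" "a 1 u \<noteq> u" and two: "(2::'a) \<noteq> 0"
  shows "7 \<le> dim U"
proof -
  interpret p: vector_space_pair scale scale ..
  have ne: "(1::'a) \<noteq> - 1" using two by (metis add.right_inverse one_add_one)
  define att where "att \<chi> \<longleftrightarrow> (\<exists>v\<in>U. v \<noteq> 0 \<and> (\<forall>j\<in>{1,2,3}. a j v = scale (if \<chi> j then - 1 else 1) v))" for \<chi> :: "nat \<Rightarrow> bool"
  \<comment> \<open>By \<open>chain\<close>, the sign of \<open>a k\<close> on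
    \<open>m k j v\<close> is the product of the signs of \<open>a k\<close> and \<open>a j\<close>
    on \<open>v\<close>, while the other signs stay: the transvection that adds coordinate j to
    coordinate k.\<close>
  have move: "att (\<chi>(k := (\<chi> k \<noteq> \<chi> j)))" if \<chi>: "att \<chi>" and kj: "k \<in> {1,2,3}" "j \<in> {1,2,3}" "k \<noteq> j" for \<chi> k j
  proof -
    obtain v where v: "v \<in> U" "v \<noteq> 0" "\<And>j. j \<in> {1,2,3} \<Longrightarrow> a j v = scale (if \<chi> j then - 1 else 1) v"
      using \<chi> unfolding att_def by blast
    let ?w = "m k j v"
    have "?w \<noteq> 0" using m2[OF kj v(1)] v(2) p.linear_0[OF lin_m[OF kj]] by auto
    moreover have "a l ?w = scale (if (\<chi>(k := (\<chi> k \<noteq> \<chi> j))) l then - 1 else 1) ?w" if l: "l \<in> {1,2,3}" for l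
    proof (cases "l = k")
      case True
      have "m k j (a k v) = a k (m k j (a j v))" by (rule chain[OF kj v(1)])
      then have "scale (if \<chi> k then - 1 else 1) ?w = scale (if \<chi> j then - 1 else 1) (a k ?w)"
        using kj by (simp add: v(3) p.linear_scale[OF lin_m[OF kj]] p.linear_scale[OF lin[OF kj(1)]] del: scale_minus_left)
      then have "scale (if \<chi> j then - 1 else 1) (scale (if \<chi> k then - 1 else 1) ?w) = a k ?w"
        by (simp split: if_splits)
      then show ?thesis using True by (auto split: if_splits)
    next
      case False
      then show ?thesis
        using am[OF kj(1,2) l kj(3) False v(1)] v(3)[OF l] by (simp add: p.linear_scale[OF lin_m[OF kj]] del: scale_minus_left)
    qed
    ultimately show ?thesis unfolding att_def using mU[OF kj v(1)] by blast
  qed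
  \<comment> \<open>Either w already has eigenvalue -1 under \<open>a j\<close>, or
    \<open>w + a j w\<close> is a nonzero fixed vector. Commutation keeps the eigenvalues that w
    already has.\<close>
  have split: "\<exists>v\<in>U. v \<noteq> 0 \<and> (\<exists>s. a j v = scale (if s then - 1 else 1) v) \<and>
      (\<forall>l\<in>{1,2,3}. \<forall>c. a l w = scale c w \<longrightarrow> a l v = scale c v)"
    if j: "j \<in> {1,2,3}" and w: "w \<in> U" "w \<noteq> 0" for j w
  proof (cases "a j w = - w")
    case True
    then show ?thesis using w by (intro bexI[of _ w]) (auto intro: exI[of _ True])
  next
    case False
    let ?v = "w + a j w"
    have "?v \<noteq> 0" using False by (simp add: eq_neg_iff_add_eq_0 add.commute)
    moreover have "a j ?v = ?v" using w j by (simp add: p.linear_add[OF lin] a2 add.commute)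
    moreover have "a l ?v = scale c ?v" if l: "l \<in> {1,2,3}" "a l w = scale c w" for l c
    proof -
      have "a l (a j w) = a j (a l w)" using aa l j w by blast
      then show ?thesis
        using l j by (simp add: p.linear_add[OF lin] p.linear_scale[OF lin] scale_right_distrib)
    qed
    moreover have "?v \<in> U" using w j aU U by (simp add: subspace_add)
    ultimately show ?thesis by (intro bexI[of _ ?v] conjI exI[of _ False]) auto
  qed
  obtain \<chi> where \<chi>: "att \<chi>" "\<chi> 1"
  proof -
    \<comment> \<open>This vector has eigenvalue -1 under \<open>a 1\<close>; splitting it for 2 and
      3 yields a nontrivial character.\<close>
    let ?u1 = "u - a 1 u"
    have u1: "?u1 \<in> U" "?u1 \<noteq> 0" "a 1 ?u1 = scale (- 1) ?u1"
      using u aU[of 1 u] U a2[of 1 u] by (auto simp: subspace_diff p.linear_diff[OF lin])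
    have in3: "1 \<in> {1,2,3::nat}" "2 \<in> {1,2,3::nat}" "3 \<in> {1,2,3::nat}" by simp_all
    obtain u2 s2 where u2: "u2 \<in> U" "u2 \<noteq> 0" "a 2 u2 = scale (if s2 then - 1 else 1) u2"
      "\<forall>l\<in>{1,2,3}. \<forall>c. a l ?u1 = scale c ?u1 \<longrightarrow> a l u2 = scale c u2"
      using split[OF in3(2) u1(1,2)] by blast
    obtain u3 s3 where u3: "u3 \<in> U" "u3 \<noteq> 0" "a 3 u3 = scale (if s3 then - 1 else 1) u3"
      "\<forall>l\<in>{1,2,3}. \<forall>c. a l u2 = scale c u2 \<longrightarrow> a l u3 = scale c u3"
      using split[OF in3(3) u2(1,2)] by blast
    have "a 1 u2 = scale (- 1) u2" using u2(4) u1(3) in3(1) by blast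
    then have "a 1 u3 = scale (- 1) u3" using u3(4) in3(1) by blast
    moreover have "a 2 u3 = scale (if s2 then - 1 else 1) u3" using u3(4) u2(3) in3(2) by blast
    ultimately have "att (\<lambda>j. if j = 1 then True else if j = 2 then s2 else s3)"
      unfolding att_def using u3(1-3) by (intro bexI[of _ u3]) auto
    then show ?thesis using that by simp
  qed
  define att3 where "att3 p q r = att (\<lambda>j. if j = 1 then p else if j = 2 then q else r)" for p q r
  have att_cong: "att \<chi> \<longleftrightarrow> att3 (\<chi> 1) (\<chi> 2) (\<chi> 3)" for \<chi>
    unfolding att3_def att_def by simp
  have m3: "att3 (p \<noteq> q) q r" "att3 (p \<noteq> r) q r" "att3 p (q \<noteq> p) r" "att3 p (q \<noteq> r) r" "att3 p q (r \<noteq> p)" "att3 p q (r \<noteq> q)"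
    if "att3 p q r" for p q r
    using move[of "\<lambda>j. if j = 1 then p else if j = 2 then q else r" 1 2]
      move[of "\<lambda>j. if j = 1 then p else if j = 2 then q else r" 1 3]
      move[of "\<lambda>j. if j = 1 then p else if j = 2 then q else r" 2 1]
      move[of "\<lambda>j. if j = 1 then p else if j = 2 then q else r" 2 3]
      move[of "\<lambda>j. if j = 1 then p else if j = 2 then q else r" 3 1]
      move[of "\<lambda>j. if j = 1 then p else if j = 2 then q else r" 3 2] that
    by (simp_all add: att_cong)
  \<comment> \<open>The two unknown signs are cleared by adding the first coordinate where
    necessary; from (1,0,0) the transvections reach the other six nonzero triples.\<close>
  have 1: "att3 True (\<chi> 2) (\<chi> 3)" using \<chi> att_cong by simp
  have 2: "att3 True False (\<chi> 3)" using 1 m3(3)[OF 1] by (cases "\<chi> 2") simp_all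
  have a100: "att3 True False False" using 2 m3(5)[OF 2] by (cases "\<chi> 3") simp_all
  have a110: "att3 True True False" using m3(3)[OF a100] by simp
  have a101: "att3 True False True" using m3(5)[OF a100] by simp
  have a111: "att3 True True True" using m3(5)[OF a110] by simp
  have a010: "att3 False True False" using m3(1)[OF a110] by simp
  have a001: "att3 False False True" using m3(2)[OF a101] by simp
  have a011: "att3 False True True" using m3(6)[OF a010] by simp
  let ?S = "{(p, q, r). p \<or> q \<or> (r::bool)}"
  let ?c = "\<lambda>s (j::nat). if (if j = 1 then fst s else if j = 2 then fst (snd s) else snd (snd s)) then - 1 else (1::'a)"
  let ?Q = "\<lambda>s v. v \<in> U \<and> v \<noteq> 0 \<and> (\<forall>j\<in>{1,2,3::nat}. a j v = scale (?c s j) v)"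
  have Q: "\<exists>v. ?Q (p, q, r) v" if "att3 p q r" for p q r
    using that unfolding att3_def att_def fst_conv snd_conv by blast
  have "\<forall>s\<in>?S. \<exists>v. ?Q s v"
  proof
    fix s assume s: "s \<in> ?S"
    obtain p q r where pqr: "s = (p, q, r)" by (cases s)
    then have "att3 p q r"
      using s a100 a110 a101 a111 a010 a001 a011 by (cases p; cases q; cases r) simp_all
    then show "\<exists>v. ?Q s v" unfolding pqr by (rule Q)
  qed
  from bchoice[OF this] obtain v where v: "\<forall>s\<in>?S. ?Q s (v s)" by (elim exE)
  have "card ?S \<le> dim U"
  proof (rule card_le_dim_joint_eigen[OF assms(1), of ?S v U "{1,2,3}" a])
    show "finite ?S" by simp
    show "v ` ?S \<subseteq> U" using v by blast
    show "a j (v s) = scale (?c s j) (v s)" if "s \<in> ?S" "j \<in> {1,2,3}" for s j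
      using v that by blast
    show "\<exists>j\<in>{1,2,3}. ?c s j \<noteq> ?c t j" if "s \<in> ?S" "t \<in> ?S" "s \<noteq> t" for s t
    proof -
      have "fst s \<noteq> fst t \<or> fst (snd s) \<noteq> fst (snd t) \<or> snd (snd s) \<noteq> snd (snd t)"
        using that(3) by (simp add: prod_eq_iff)
      moreover have "fst s \<noteq> fst t \<Longrightarrow> ?c s 1 \<noteq> ?c t 1" "fst (snd s) \<noteq> fst (snd t) \<Longrightarrow> ?c s 2 \<noteq> ?c t 2"
        "snd (snd s) \<noteq> snd (snd t) \<Longrightarrow> ?c s 3 \<noteq> ?c t 3"
        using ne ne[symmetric] by simp_all
      ultimately show ?thesis by blast
    qed
    show "v s \<noteq> 0" if "s \<in> ?S" for s using v that by blast
    show "Vector_Spaces.linear scale scale (a j)" if "j \<in> {1,2,3}" for j by (rule lin[OF that])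
  qed
  moreover have "?S = {(True,True,True), (True,True,False), (True,False,True), (True,False,False),
      (False,True,True), (False,True,False), (False,False,True)}" by auto
  then have "card ?S = 7" by simp
  ultimately show ?thesis by simp
qed

end

section \<open>Representations of dimension at most 2n\<close>

text \<open>\<open>R i j\<close>, \<open>\<epsilon> i\<close> and \<open>\<sigma> \<pi>\<close> stand for the images of the automorphisms \<open>a\<^sub>i \<mapsto> a\<^sub>i a\<^sub>j\<close>, \<open>a\<^sub>i \<mapsto> a\<^sub>i\<^sup>-\<^sup>1\<close> and
  \<open>a\<^sub>i \<mapsto> a\<^bsub>\<pi> i\<^esub>\<close>; then \<open>L i j\<close> below is the image of \<open>a\<^sub>i \<mapsto> a\<^sub>j a\<^sub>i\<close>. Only \<open>\<Delta>_\<tau>\<close> uses that inner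
  automorphisms act trivially: inverting all generators commutes with \<open>a\<^sub>i \<mapsto> a\<^sub>i a\<^sub>j\<close> (all \<open>i \<noteq> j\<close>) up to
  conjugation by \<open>a\<^sub>j\<close>.\<close>

locale out_rep = finite_dimensional_vector_space scale Basis
  for scale :: "'k::field \<Rightarrow> 'v::ab_group_add \<Rightarrow> 'v" (infixr "*s" 75) and Basis +
  fixes n :: nat and R :: "nat \<Rightarrow> nat \<Rightarrow> 'v \<Rightarrow> 'v" and \<epsilon> :: "nat \<Rightarrow> 'v \<Rightarrow> 'v"
    and \<sigma> :: "(nat \<Rightarrow> nat) \<Rightarrow> 'v \<Rightarrow> 'v"
  assumes n4: "4 \<le> n"
    and two: "(2::'k) \<noteq> 0"
    and linear_R: "i < n \<Longrightarrow> j < n \<Longrightarrow> i \<noteq> j \<Longrightarrow> Vector_Spaces.linear (*s) (*s) (R i j)"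
    and linear_\<epsilon>: "i < n \<Longrightarrow> Vector_Spaces.linear (*s) (*s) (\<epsilon> i)"
    and linear_\<sigma>: "\<pi> permutes {..<n} \<Longrightarrow> Vector_Spaces.linear (*s) (*s) (\<sigma> \<pi>)"
    and \<epsilon>_\<epsilon> [simp]: "i < n \<Longrightarrow> \<epsilon> i (\<epsilon> i v) = v"
    and \<epsilon>_comm: "i < n \<Longrightarrow> j < n \<Longrightarrow> \<epsilon> i (\<epsilon> j v) = \<epsilon> j (\<epsilon> i v)"
    and \<epsilon>_R: "i < n \<Longrightarrow> j < n \<Longrightarrow> i \<noteq> j \<Longrightarrow> k < n \<Longrightarrow> k \<noteq> i \<Longrightarrow> k \<noteq> j \<Longrightarrow> \<epsilon> k (R i j v) = R i j (\<epsilon> k v)"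
    and R_\<epsilon>_R: "i < n \<Longrightarrow> j < n \<Longrightarrow> i \<noteq> j \<Longrightarrow> R i j (\<epsilon> j (R i j v)) = \<epsilon> j v"
    and R_comm: "i < n \<Longrightarrow> j < n \<Longrightarrow> i \<noteq> j \<Longrightarrow> k < n \<Longrightarrow> l < n \<Longrightarrow> k \<noteq> l \<Longrightarrow> i \<noteq> k \<Longrightarrow> i \<noteq> l \<Longrightarrow> j \<noteq> k \<Longrightarrow>
      R i j (R k l v) = R k l (R i j v)"
    and R_L: "i < n \<Longrightarrow> j < n \<Longrightarrow> i \<noteq> j \<Longrightarrow> k < n \<Longrightarrow> i \<noteq> k \<Longrightarrow>
      R i j (\<epsilon> i (\<epsilon> k (R i k (\<epsilon> i (\<epsilon> k v))))) = \<epsilon> i (\<epsilon> k (R i k (\<epsilon> i (\<epsilon> k (R i j v)))))"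
    and R_chain: "i < n \<Longrightarrow> j < n \<Longrightarrow> k < n \<Longrightarrow> i \<noteq> j \<Longrightarrow> i \<noteq> k \<Longrightarrow> j \<noteq> k \<Longrightarrow>
      R k j (R i k v) = R i k (R k j (R i j v))"
    and \<sigma>_comp: "\<pi> permutes {..<n} \<Longrightarrow> \<rho> permutes {..<n} \<Longrightarrow> \<sigma> \<pi> (\<sigma> \<rho> v) = \<sigma> (\<pi> \<circ> \<rho>) v"
    and \<sigma>_id: "\<sigma> id v = v"
    and \<sigma>_R: "\<pi> permutes {..<n} \<Longrightarrow> i < n \<Longrightarrow> j < n \<Longrightarrow> i \<noteq> j \<Longrightarrow> \<sigma> \<pi> (R i j v) = R (\<pi> i) (\<pi> j) (\<sigma> \<pi> v)"
    and \<sigma>_\<epsilon>: "\<pi> permutes {..<n} \<Longrightarrow> i < n \<Longrightarrow> \<sigma> \<pi> (\<epsilon> i v) = \<epsilon> (\<pi> i) (\<sigma> \<pi> v)"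
    and R_three: "i < n \<Longrightarrow> j < n \<Longrightarrow> i \<noteq> j \<Longrightarrow>
      R i j v = \<epsilon> j (\<epsilon> i (R j i (\<epsilon> j (\<epsilon> i (\<sigma> (transpose i j) (\<epsilon> j (R j i v)))))))"
    and \<Delta>_\<tau>: "j < n \<Longrightarrow> fold \<epsilon> [0..<n] (fold (\<lambda>i. R i j) (filter (\<lambda>i. i \<noteq> j) [0..<n]) v) =
      fold (\<lambda>i. R i j) (filter (\<lambda>i. i \<noteq> j) [0..<n]) (fold \<epsilon> [0..<n] v)"
begin

sublocale vp: vector_space_pair scale scale ..

abbreviation "lin \<equiv> Vector_Spaces.linear (*s) (*s)"

lemmas lin_simps = vp.linear_add vp.linear_scale vp.linear_diff vp.linear_neg vp.linear_0 vp.linear_sum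

lemmas R_lin = lin_simps[OF linear_R]
lemmas \<epsilon>_lin = lin_simps[OF linear_\<epsilon>]
lemmas \<sigma>_lin = lin_simps[OF linear_\<sigma>]

lemma swap_perm [simp]: "i < n \<Longrightarrow> j < n \<Longrightarrow> transpose i j permutes {..<n}"
  by (rule permutes_swap_id) auto

lemma perm_less: "\<pi> permutes {..<n} \<Longrightarrow> i < n \<Longrightarrow> \<pi> i < n"
  using permutes_in_image[of \<pi> "{..<n}" i] by simp

lemma perm_eq: "\<pi> permutes {..<n} \<Longrightarrow> \<pi> i = \<pi> j \<longleftrightarrow> i = j"
  by (metis permutes_inverses(2))

definition L :: "nat \<Rightarrow> nat \<Rightarrow> 'v \<Rightarrow> 'v" where
  "L i j v = \<epsilon> i (\<epsilon> j (R i j (\<epsilon> i (\<epsilon> j v))))"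

section \<open>Joint eigenspaces of the sign changes\<close>

definition eig :: "nat set \<Rightarrow> 'v set" where
  "eig I = {v. \<forall>i<n. \<epsilon> i v = (if i \<in> I then - v else v)}"

lemma eigD: "v \<in> eig I \<Longrightarrow> i < n \<Longrightarrow> \<epsilon> i v = (if i \<in> I then - v else v)"
  by (simp add: eig_def)

lemma subspace_eig: "subspace (eig I)"
  by (auto simp: subspace_def eig_def \<epsilon>_lin)

lemma double: "v + v = (2::'k) *s v"
  by (metis one_add_one scale_left_distrib scale_one)

lemma half_double [simp]: "(1/2) *s (v + v) = v"
  using two by (simp add: double)

lemma neg_eq_self: "- v = v \<longleftrightarrow> v = (0::'v)"
proof
  assume "- v = v"
  then have "v + v = 0" by (metis add.right_inverse)
  then have "(1/2) *s (v + v) = 0" by simp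
  then show "v = 0" by simp
qed simp

lemma split_half: "v = (1/2) *s (v + \<epsilon> i v) + (1/2) *s (v - \<epsilon> i v)"
proof -
  have "(1/2) *s (v + \<epsilon> i v) + (1/2) *s (v - \<epsilon> i v) = (1/2) *s (v + v)"
    unfolding scale_right_distrib[symmetric] by simp
  then show ?thesis by simp
qed

abbreviation "sg I k \<equiv> (if k \<in> I then - 1 else (1::'k))"

lemma eig_sg: "v \<in> eig I \<longleftrightarrow> (\<forall>k<n. \<epsilon> k v = sg I k *s v)"
  by (simp add: eig_def if_distrib[of "\<lambda>c. c *s v"])

text \<open>The halves of \<open>v + \<epsilon> i v\<close> and \<open>v - \<epsilon> i v\<close> do
  it, which is where 2 must be invertible. As the \<epsilon> commute, every eigenvalue already known
  for \<open>v\<close> passes to both parts.\<close>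

lemma \<epsilon>_split:
  assumes "i < n"
  obtains v1 v2 where "v = v1 + v2" "\<epsilon> i v1 = v1" "\<epsilon> i v2 = - 1 *s v2"
    "\<And>k c. k < n \<Longrightarrow> \<epsilon> k v = c *s v \<Longrightarrow> \<epsilon> k v1 = c *s v1 \<and> \<epsilon> k v2 = c *s v2"
proof
  let ?v1 = "(1/2) *s (v + \<epsilon> i v)" and ?v2 = "(1/2) *s (v - \<epsilon> i v)"
  show "v = ?v1 + ?v2" by (rule split_half)
  show "\<epsilon> i ?v1 = ?v1" using assms by (simp add: \<epsilon>_lin add.commute)
  show "\<epsilon> i ?v2 = - 1 *s ?v2" using assms by (simp add: \<epsilon>_lin flip: scale_minus_right)
  fix k c assume k: "k < n" "\<epsilon> k v = c *s v"
  have "\<epsilon> k (\<epsilon> i v) = c *s \<epsilon> i v" using k assms by (simp add: \<epsilon>_comm[of k i] \<epsilon>_lin)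
  then show "\<epsilon> k ?v1 = c *s ?v1 \<and> \<epsilon> k ?v2 = c *s ?v2"
    using k by (simp add: \<epsilon>_lin scale_left_commute flip: scale_right_distrib scale_right_diff_distrib)
qed

text \<open>Shaped for images under \<open>R i j\<close>: that operator commutes with
  \<open>\<epsilon> k\<close> for the other k, so only the signs at i and j become unknown and four
  eigenspaces remain.\<close>

lemma block_decomp:
  assumes ij: "i < n" "j < n" "i \<noteq> j" "i \<notin> J" "j \<notin> J"
    and w: "\<And>k. k < n \<Longrightarrow> k \<noteq> i \<Longrightarrow> k \<noteq> j \<Longrightarrow> \<epsilon> k w = (if k \<in> J then - w else w)"
  shows "\<exists>w1\<in>eig J. \<exists>w2\<in>eig (insert i J). \<exists>w3\<in>eig (insert j J). \<exists>w4\<in>eig (insert i (insert j J)).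
    w = w1 + w2 + w3 + w4"
proof -
  have w': "\<epsilon> k w = sg J k *s w" if "k < n" "k \<noteq> i" "k \<noteq> j" for k
    using w[OF that] by simp
  obtain a b where ab: "w = a + b" "\<epsilon> j a = a" "\<epsilon> j b = - 1 *s b"
    "\<And>k c. k < n \<Longrightarrow> \<epsilon> k w = c *s w \<Longrightarrow> \<epsilon> k a = c *s a \<and> \<epsilon> k b = c *s b"
    by (rule \<epsilon>_split[OF ij(2), of w], (rule that; assumption))
  obtain a1 a2 where a: "a = a1 + a2" "\<epsilon> i a1 = a1" "\<epsilon> i a2 = - 1 *s a2"
    "\<And>k c. k < n \<Longrightarrow> \<epsilon> k a = c *s a \<Longrightarrow> \<epsilon> k a1 = c *s a1 \<and> \<epsilon> k a2 = c *s a2"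
    by (rule \<epsilon>_split[OF ij(1), of a], (rule that; assumption))
  obtain b1 b2 where b: "b = b1 + b2" "\<epsilon> i b1 = b1" "\<epsilon> i b2 = - 1 *s b2"
    "\<And>k c. k < n \<Longrightarrow> \<epsilon> k b = c *s b \<Longrightarrow> \<epsilon> k b1 = c *s b1 \<and> \<epsilon> k b2 = c *s b2"
    by (rule \<epsilon>_split[OF ij(1), of b], (rule that; assumption))
  have other: "\<epsilon> k a1 = sg J k *s a1" "\<epsilon> k a2 = sg J k *s a2" "\<epsilon> k b1 = sg J k *s b1" "\<epsilon> k b2 = sg J k *s b2"
    if "k < n" "k \<noteq> i" "k \<noteq> j" for k
    using ab(4)[OF that(1) w'[OF that]] a(4)[OF that(1)] b(4)[OF that(1)] by blast+
  have j: "\<epsilon> j a1 = a1" "\<epsilon> j a2 = a2" "\<epsilon> j b1 = - 1 *s b1" "\<epsilon> j b2 = - 1 *s b2"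
    using a(4)[OF ij(2), of 1] b(4)[OF ij(2) ab(3)] ab(2) by simp_all
  have eigI: "v \<in> eig I"
    if "\<And>k. k < n \<Longrightarrow> k \<noteq> i \<Longrightarrow> k \<noteq> j \<Longrightarrow> \<epsilon> k v = sg J k *s v" "\<epsilon> i v = sg I i *s v" "\<epsilon> j v = sg I j *s v"
      "\<And>k. k \<noteq> i \<Longrightarrow> k \<noteq> j \<Longrightarrow> k \<in> I \<longleftrightarrow> k \<in> J" for v I
    unfolding eig_sg
  proof (intro allI impI)
    fix k assume k: "k < n"
    show "\<epsilon> k v = sg I k *s v"
    proof (cases "k = i \<or> k = j")
      case True
      then show ?thesis using that(2,3) by blast
    next
      case False
      then show ?thesis using that(1)[of k] that(4)[of k] k by simp
    qed
  qed
  have "a1 \<in> eig J" using ij other(1) j(1) a(2) by (intro eigI) simp_all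
  moreover have "a2 \<in> eig (insert i J)" using ij other(2) j(2) a(3) by (intro eigI) simp_all
  moreover have "b1 \<in> eig (insert j J)" using ij other(3) j(3) b(2) by (intro eigI) simp_all
  moreover have "b2 \<in> eig (insert i (insert j J))" using ij other(4) j(4) b(3) by (intro eigI) simp_all
  moreover have "w = a1 + a2 + b1 + b2" by (simp only: ab a b add.assoc)
  ultimately show ?thesis by blast
qed

lemma \<sigma>_eig:
  assumes "\<pi> permutes {..<n}" "v \<in> eig I"
  shows "\<sigma> \<pi> v \<in> eig (\<pi> ` I)"
  unfolding eig_def
proof (intro CollectI allI impI)
  fix i assume i: "i < n"
  define k where "k = inv_into UNIV \<pi> i"
  have k: "\<pi> k = i" using assms(1) by (simp add: k_def permutes_inverses(1))
  then have "k < n" using assms(1) i permutes_in_image[of \<pi> "{..<n}" k] by simp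
  then have "\<epsilon> i (\<sigma> \<pi> v) = \<sigma> \<pi> (\<epsilon> k v)" using assms(1) k by (simp add: \<sigma>_\<epsilon>)
  moreover have "i \<in> \<pi> ` I \<longleftrightarrow> k \<in> I" using k perm_eq[OF assms(1)] by (metis image_iff)
  ultimately show "\<epsilon> i (\<sigma> \<pi> v) = (if i \<in> \<pi> ` I then - \<sigma> \<pi> v else \<sigma> \<pi> v)"
    using eigD[OF assms(2) \<open>k < n\<close>] assms(1) by (simp add: \<sigma>_lin)
qed

text \<open>No inverse of \<open>R\<close> is among the data; the relation
  \<open>R_\<epsilon>_R\<close> supplies one, up to sign changes.\<close>

lemma R_inj:
  assumes "i < n" "j < n" "i \<noteq> j"
  shows "R i j v = R i j w \<longleftrightarrow> v = w"
proof
  assume "R i j v = R i j w"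
  then have "\<epsilon> j v = \<epsilon> j w" using R_\<epsilon>_R[OF assms] by metis
  then show "v = w" using \<epsilon>_\<epsilon>[OF assms(2)] by metis
qed simp

lemma R_zero: "i < n \<Longrightarrow> j < n \<Longrightarrow> i \<noteq> j \<Longrightarrow> R i j v = 0 \<longleftrightarrow> v = 0"
  using R_inj[of i j v 0] by (simp add: R_lin)

lemma L_lin:
  assumes "i < n" "j < n" "i \<noteq> j"
  shows "L i j (v + w) = L i j v + L i j w" "L i j (c *s v) = c *s L i j v"
    "L i j (v - w) = L i j v - L i j w" "L i j (- v) = - L i j v" "L i j 0 = 0"
  using assms by (simp_all add: L_def R_lin \<epsilon>_lin)

lemma \<sigma>_zero:
  assumes "\<pi> permutes {..<n}" shows "\<sigma> \<pi> v = 0 \<longleftrightarrow> v = 0"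
proof
  assume "\<sigma> \<pi> v = 0"
  then have "\<sigma> (inv_into UNIV \<pi> \<circ> \<pi>) v = 0"
    using assms \<sigma>_comp[OF permutes_inv[OF assms] assms, of v] \<sigma>_lin(5)[OF permutes_inv[OF assms]] by simp
  then show "v = 0" by (simp add: permutes_inv_o[OF assms] \<sigma>_id)
qed (use assms in \<open>simp add: \<sigma>_lin\<close>)

end

text \<open>The essential case: apart from the two constant sign patterns only those with a single minus sign
  occur, each with multiplicity one.\<close>

locale out_rep_core = out_rep scale Basis n R \<epsilon> \<sigma>
  for scale :: "'k::field \<Rightarrow> 'v::ab_group_add \<Rightarrow> 'v" (infixr "*s" 75) and Basis n R \<epsilon> \<sigma> +
  fixes e0 :: 'v
  assumes e0: "e0 \<noteq> 0" "e0 \<in> eig {0}"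
    and eig_0: "v \<in> eig {0} \<Longrightarrow> \<exists>c. v = c *s e0"
    and eig_mid: "I \<subseteq> {..<n} \<Longrightarrow> 2 \<le> card I \<Longrightarrow> card I < n \<Longrightarrow> v \<in> eig I \<Longrightarrow> v = 0"
    and dim_U: "dim (eig {}) \<le> n" "n \<le> 5"
begin

text \<open>Another permutation taking 0 to i could a priori give a multiple of this vector;
  \<open>swap_e'\<close> excludes this for products of transpositions.\<close>

definition e :: "nat \<Rightarrow> 'v" where "e i = \<sigma> (transpose 0 i) e0"

section \<open>The fixed space U and the lines spanned by the e_i\<close>

abbreviation "U \<equiv> eig {}"

lemma n0 [simp]: "0 < n" "Suc 0 < n" "2 < n" "3 < n" using n4 by auto

lemma e_eig: "i < n \<Longrightarrow> e i \<in> eig {i}"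
  using \<sigma>_eig[of "transpose 0 i" e0 "{0}"] e0 by (simp add: e_def)

lemma e_neq0: "i < n \<Longrightarrow> e i \<noteq> 0"
  using e0 by (simp add: e_def \<sigma>_zero)

lemma eig_single:
  assumes "i < n" "v \<in> eig {i}"
  shows "\<exists>c. v = c *s e i"
proof -
  have t: "transpose 0 i permutes {..<n}" using assms by simp
  have "\<sigma> (transpose 0 i) v \<in> eig {0}" using \<sigma>_eig[OF t assms(2)] by simp
  then obtain c where "\<sigma> (transpose 0 i) v = c *s e0" using eig_0 by auto
  then have "\<sigma> (transpose 0 i) (\<sigma> (transpose 0 i) v) = c *s e i" using t by (simp add: \<sigma>_lin e_def)
  moreover have "\<sigma> (transpose 0 i) (\<sigma> (transpose 0 i) v) = v" using t by (simp add: \<sigma>_comp \<sigma>_id)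
  ultimately show ?thesis by auto
qed

lemma \<epsilon>_e: "i < n \<Longrightarrow> k < n \<Longrightarrow> \<epsilon> k (e i) = (if k = i then - e i else e i)"
  using eigD[OF e_eig] by simp

lemma \<epsilon>_U: "u \<in> U \<Longrightarrow> k < n \<Longrightarrow> \<epsilon> k u = u"
  using eigD[of u "{}"] by simp

lemma block_empty:
  assumes "i < n" "j < n" "i \<noteq> j" "\<And>k. k < n \<Longrightarrow> k \<noteq> i \<Longrightarrow> k \<noteq> j \<Longrightarrow> \<epsilon> k w = w"
  shows "\<exists>u\<in>U. \<exists>a b. w = u + a *s e i + b *s e j"
proof -
  obtain w1 w2 w3 w4 where w: "w1 \<in> U" "w2 \<in> eig {i}" "w3 \<in> eig {j}" "w4 \<in> eig {i, j}" "w = w1 + w2 + w3 + w4"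
    using block_decomp[of i j "{}" w] assms by auto
  have "w4 = 0" using eig_mid[OF _ _ _ w(4)] assms n4 by simp
  moreover obtain a b where "w2 = a *s e i" "w3 = b *s e j" using eig_single w assms by metis
  ultimately show ?thesis using w by auto
qed

text \<open>The other three components of the image have two or three minus signs, and these
  patterns do not occur, since 3 < n.\<close>

lemma R_e_other_ex:
  assumes "i < n" "j < n" "i \<noteq> j" "k < n" "k \<noteq> i" "k \<noteq> j"
  shows "\<exists>c. c \<noteq> 0 \<and> R i j (e k) = c *s e k"
proof -
  let ?w = "R i j (e k)"
  have "\<epsilon> l ?w = (if l \<in> {k} then - ?w else ?w)" if "l < n" "l \<noteq> i" "l \<noteq> j" for l
    using assms that by (auto simp: \<epsilon>_R \<epsilon>_e R_lin)
  then obtain w1 w2 w3 w4 where w: "w1 \<in> eig {k}" "w2 \<in> eig {i, k}" "w3 \<in> eig {j, k}" "w4 \<in> eig {i, j, k}"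
    "?w = w1 + w2 + w3 + w4"
    using block_decomp[of i j "{k}" ?w] assms by auto
  have "w2 = 0" "w3 = 0" "w4 = 0"
    using eig_mid[OF _ _ _ w(2)] eig_mid[OF _ _ _ w(3)] eig_mid[OF _ _ _ w(4)] assms n4 by simp_all
  moreover obtain c where "w1 = c *s e k" using eig_single w assms by metis
  ultimately have "?w = c *s e k" using w by simp
  moreover have "?w \<noteq> 0" using assms e_neq0 by (simp add: R_zero)
  ultimately show ?thesis by (intro exI[of _ c]) auto
qed

text \<open>With an index l different from i, j and k, the relation \<open>R_chain\<close> makes
  \<open>R i j\<close> a commutator of operators that act on \<open>e k\<close> by scalars, so its
  own scalar is 1. Four indices are needed.\<close>

lemma R_e_other:
  assumes "i < n" "j < n" "i \<noteq> j" "k < n" "k \<noteq> i" "k \<noteq> j"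
  shows "R i j (e k) = e k"
proof -
  have "\<exists>l<4. l \<noteq> i \<and> l \<noteq> j \<and> l \<noteq> k"
  proof (rule ccontr)
    assume "\<not> ?thesis"
    then have "{..<4} \<subseteq> {i, j, k}" by auto
    then have "card {..<4::nat} \<le> card {i, j, k}" by (intro card_mono) auto
    also have "\<dots> \<le> 3" by (simp add: card_insert_if)
    finally show False by simp
  qed
  then obtain l where "l < 4" and l: "l \<noteq> i" "l \<noteq> j" "l \<noteq> k" by auto
  then have "l < n" using n4 by simp
  obtain a where a: "a \<noteq> 0" "R l j (e k) = a *s e k" using R_e_other_ex assms l \<open>l < n\<close> by metis
  obtain b where b: "b \<noteq> 0" "R i l (e k) = b *s e k" using R_e_other_ex assms l \<open>l < n\<close> by metis
  obtain c where c: "c \<noteq> 0" "R i j (e k) = c *s e k" using R_e_other_ex assms by metis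
  have "R l j (R i l (e k)) = R i l (R l j (R i j (e k)))" using assms l \<open>l < n\<close> by (intro R_chain) auto
  then have "(b * a) *s e k = (c * a * b) *s e k" using assms l \<open>l < n\<close> a b c by (simp add: R_lin)
  then have "b * a = c * a * b" using e_neq0[OF assms(4)] by simp
  then have "c = 1" using a b by simp
  then show ?thesis using c by simp
qed

lemma L_e_other:
  assumes "i < n" "j < n" "i \<noteq> j" "k < n" "k \<noteq> i" "k \<noteq> j"
  shows "L i j (e k) = e k"
  using assms by (simp add: L_def \<epsilon>_e R_e_other)

lemma R_three': "i < n \<Longrightarrow> j < n \<Longrightarrow> i \<noteq> j \<Longrightarrow> R i j v = L j i (\<sigma> (transpose i j) (\<epsilon> j (R j i v)))"
  using R_three[of i j v] by (simp add: L_def)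

text \<open>\<open>R_three\<close> writes the transposition in terms of \<open>R\<close>,
  \<open>L\<close> and a sign change at j, each of which fixes \<open>e k\<close>; this forces the
  scalar to be 1.\<close>

lemma swap_e_other:
  assumes "i < n" "j < n" "k < n" "k \<noteq> i" "k \<noteq> j"
  shows "\<sigma> (transpose i j) (e k) = e k"
proof (cases "i = j")
  case True
  then show ?thesis by (simp add: \<sigma>_id)
next
  case False
  have t: "transpose i j permutes {..<n}" using assms by simp
  have "\<sigma> (transpose i j) (e k) \<in> eig {k}" using \<sigma>_eig[OF t e_eig[OF assms(3)]] assms by simp
  then obtain c where c: "\<sigma> (transpose i j) (e k) = c *s e k" using eig_single assms by metis
  have "e k = L j i (\<sigma> (transpose i j) (\<epsilon> j (R j i (e k))))"
    using R_three'[of i j "e k"] assms False by (simp add: R_e_other)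
  then have "e k = c *s e k" using assms False c by (simp add: R_e_other \<epsilon>_e L_lin L_e_other)
  then show ?thesis using c by simp
qed

lemma swap_e:
  assumes "i < n" "j < n"
  shows "\<sigma> (transpose i j) (e i) = e j"
proof -
  consider "i = j" | "i = 0" | "j = 0" | "i \<noteq> j" "i \<noteq> 0" "j \<noteq> 0" by auto
  then show ?thesis
  proof cases
    case 1
    then show ?thesis by (simp add: \<sigma>_id)
  next
    case 2
    then show ?thesis by (simp add: e_def \<sigma>_id)
  next
    case 3
    then have "\<sigma> (transpose i j) (e i) = e0" using assms
      by (simp add: e_def \<sigma>_comp transpose_commute[of i 0] \<sigma>_id)
    then show ?thesis using 3 by (simp add: e_def \<sigma>_id)
  next
    case 4
    \<comment> \<open>Commuting the two transpositions leaves one that moves neither 0 nor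
      \<open>e 0\<close>, by \<open>swap_e_other\<close>.\<close>
    have "transpose i j \<circ> transpose 0 i = transpose 0 j \<circ> transpose i j"
      using 4 by (auto simp: fun_eq_iff transpose_def)
    then have "\<sigma> (transpose i j) (e i) = \<sigma> (transpose 0 j) (\<sigma> (transpose i j) e0)"
      using assms by (simp add: e_def \<sigma>_comp)
    also have "e0 = e 0" by (simp add: e_def \<sigma>_id)
    also have "\<sigma> (transpose i j) (e 0) = e 0" using 4 assms by (intro swap_e_other) auto
    finally show ?thesis by (simp add: e_def \<sigma>_id)
  qed
qed

lemma swap_e': "i < n \<Longrightarrow> j < n \<Longrightarrow> k < n \<Longrightarrow> \<sigma> (transpose i j) (e k) = e (transpose i j k)"
  using swap_e[of i j] swap_e[of j i] swap_e_other[of i j k]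
  by (auto simp: transpose_def transpose_commute[of j i])

text \<open>Any ordered pair is the image of (0, 1) under a permutation that permutes the chosen
  vectors without scalars. Matrix entries of \<open>R i j\<close> therefore need to be named only
  once.\<close>

lemma pair_perm:
  assumes "i < n" "j < n" "i \<noteq> j"
  obtains \<pi> where "\<pi> permutes {..<n}" "\<pi> 0 = i" "\<pi> (Suc 0) = j" "\<And>k. k < n \<Longrightarrow> \<sigma> \<pi> (e k) = e (\<pi> k)"
proof -
  let ?t = "transpose 0 i"
  let ?s = "transpose (Suc 0) (?t j)"
  have t: "?t permutes {..<n}" using assms by simp
  then have s: "?s permutes {..<n}" using assms perm_less[OF t] by simp
  have "?t j \<noteq> 0" using assms by (metis transpose_apply_first transpose_involutory)
  then have "?s 0 = 0" by (intro transpose_apply_other) auto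
  then have p: "(?t \<circ> ?s) 0 = i" "(?t \<circ> ?s) (Suc 0) = j" by simp_all
  have "\<sigma> (?t \<circ> ?s) (e k) = e ((?t \<circ> ?s) k)" if k: "k < n" for k
  proof -
    have "\<sigma> ?s (e k) = e (?s k)" using k assms perm_less[OF t] by (intro swap_e') auto
    moreover have "\<sigma> ?t (e (?s k)) = e (?t (?s k))" using k assms perm_less[OF s k] by (intro swap_e') auto
    ultimately show ?thesis by (simp add: \<sigma>_comp[OF t s, symmetric])
  qed
  with permutes_compose[OF s t] p show ?thesis by (rule that)
qed

section \<open>Inverting all generators, and the subspace W\<close>

definition Delta :: "'v \<Rightarrow> 'v" where "Delta = fold \<epsilon> [0..<n]"

lemma fold_lin:
  assumes "\<And>x. x \<in> set xs \<Longrightarrow> lin (f x)"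
  shows "lin (fold f xs)"
  using assms
proof (induction xs)
  case Nil
  then show ?case using linear_id by (simp add: id_def)
next
  case (Cons x xs)
  have "lin (fold f xs \<circ> f x)" using Cons by (intro Vector_Spaces.linear_compose) auto
  then show ?case by (simp only: fold.simps)
qed

lemma linear_Delta: "lin Delta"
  unfolding Delta_def by (rule fold_lin) (auto intro: linear_\<epsilon>)

lemmas Delta_lin = lin_simps[OF linear_Delta]

lemma fold_fixed: "(\<And>x. x \<in> set xs \<Longrightarrow> f x v = v) \<Longrightarrow> fold f xs v = v"
  by (induction xs) auto

lemma Delta_U: "u \<in> U \<Longrightarrow> Delta u = u"
  unfolding Delta_def by (rule fold_fixed) (simp add: \<epsilon>_U)

lemma Delta_e:
  assumes "i < n"
  shows "Delta (e i) = - e i"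
proof -
  have "fold \<epsilon> xs (e i) = (if i \<in> set xs then - e i else e i)"
    if "distinct xs" "set xs \<subseteq> {..<n}" for xs
    using that
  proof (induction xs rule: rev_induct)
    case (snoc x xs)
    then show ?case using assms by (auto simp: \<epsilon>_e \<epsilon>_lin)
  qed simp
  from this[of "[0..<n]"] show ?thesis using assms by (simp add: Delta_def atLeast0LessThan)
qed

text \<open>The projection to the fixed space of \<open>Delta\<close>. On the subspace
  \<open>W\<close> below it is the projection onto \<open>U\<close> along the
  \<open>e i\<close>.\<close>

definition P :: "'v \<Rightarrow> 'v" where "P v = (1/2) *s (v + Delta v)"

lemma P_lin: "P (v + w) = P v + P w" "P (c *s v) = c *s P v" "P (v - w) = P v - P w" "P (- v) = - P v" "P 0 = 0"
  by (simp_all add: P_def Delta_lin scale_right_distrib scale_right_diff_distrib scale_left_commute)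

lemma P_U: "u \<in> U \<Longrightarrow> P u = u"
  by (simp add: P_def Delta_U)

lemma P_e: "i < n \<Longrightarrow> P (e i) = 0"
  by (simp add: P_def Delta_e)

text \<open>The space \<open>eig {..<n}\<close> may be nonzero and \<open>Delta\<close> acts on it
  by a sign depending on n. It is left out, so that on \<open>W\<close> the sign of
  \<open>Delta\<close> tells \<open>U\<close> from the lines of the \<open>e i\<close>.\<close>

definition W :: "'v set" where "W = span (U \<union> e ` {..<n})"

lemma W_U: "u \<in> U \<Longrightarrow> u \<in> W"
  by (auto simp: W_def intro: span_base)

lemma W_e: "i < n \<Longrightarrow> e i \<in> W"
  by (auto simp: W_def intro: span_base)

lemma W_add: "v \<in> W \<Longrightarrow> w \<in> W \<Longrightarrow> v + w \<in> W"
  and W_scale: "v \<in> W \<Longrightarrow> c *s v \<in> W"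
  and W_0: "0 \<in> W"
  by (auto simp: W_def intro: span_add span_scale span_zero)

lemma W_induct [consumes 1, case_names zero add U e]:
  assumes "v \<in> W" "Q 0" "\<And>v w c. v \<in> W \<Longrightarrow> Q v \<Longrightarrow> w \<in> W \<Longrightarrow> Q w \<Longrightarrow> Q (c *s v + w)"
    "\<And>u. u \<in> U \<Longrightarrow> Q u" "\<And>i. i < n \<Longrightarrow> Q (e i)"
  shows "Q v"
proof -
  have "v \<in> W \<and> Q v"
    using assms(1) unfolding W_def
  proof (induction rule: span_induct_alt)
    case base
    then show ?case using assms(2) W_0 by (simp add: W_def)
  next
    case (step c x y)
    then have "x \<in> W" "Q x" using assms(4,5) W_U W_e by auto
    then show ?case using step assms(3) W_add W_scale by (simp add: W_def)
  qed
  then show ?thesis by simp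
qed

lemma R_U_block:
  assumes "i < n" "j < n" "i \<noteq> j" "u \<in> U"
  shows "\<exists>u'\<in>U. \<exists>a b. R i j u = u' + a *s e i + b *s e j"
  using assms by (intro block_empty) (auto simp: \<epsilon>_R \<epsilon>_U)

lemma R_e_block:
  assumes "i < n" "j < n" "i \<noteq> j" "k = i \<or> k = j"
  shows "\<exists>u'\<in>U. \<exists>a b. R i j (e k) = u' + a *s e i + b *s e j"
  using assms by (intro block_empty) (auto simp: \<epsilon>_R \<epsilon>_e)

lemma R_W:
  assumes "i < n" "j < n" "i \<noteq> j" "v \<in> W"
  shows "R i j v \<in> W"
  using assms(4)
proof (induction rule: W_induct)
  case zero
  then show ?case using assms W_0 by (simp add: R_lin)
next
  case (add v w c)
  then show ?case using assms by (simp add: R_lin W_add W_scale)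
next
  case (U u)
  then show ?case using R_U_block[OF assms(1-3) U] assms W_add W_scale W_U W_e by auto
next
  case (e k)
  show ?case
  proof (cases "k = i \<or> k = j")
    case True
    then show ?thesis using R_e_block[OF assms(1-3) True] assms W_add W_scale W_U W_e by auto
  next
    case False
    then show ?thesis using assms e W_e by (simp add: R_e_other)
  qed
qed

lemma P_W: "v \<in> W \<Longrightarrow> P v \<in> U"
proof (induction rule: W_induct)
  case (add v w c)
  then show ?case using subspace_eig[of "{}"] by (simp add: P_lin subspace_def)
qed (use subspace_eig[of "{}"] in \<open>auto simp: P_lin P_U P_e subspace_def\<close>)

lemma Delta_fix: "v \<in> W \<Longrightarrow> Delta v = v \<Longrightarrow> v \<in> U"
  using P_W[of v] by (simp add: P_def)

definition f0 :: "'v \<Rightarrow> 'k" where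
  "f0 = (SOME f. Vector_Spaces.linear (*s) (*) f \<and> f e0 = 1)"

lemma f0: "Vector_Spaces.linear (*s) (*) f0" "f0 e0 = 1"
proof -
  interpret p: vector_space_pair "(*s)" "(*) :: 'k \<Rightarrow> _"
    by unfold_locales (auto simp: algebra_simps)
  have "independent {e0}" using e0 by (simp add: dependent_single)
  from p.linear_independent_extend[OF this, of "\<lambda>_. 1"]
  have "\<exists>f. Vector_Spaces.linear (*s) (*) f \<and> f e0 = 1" by auto
  from someI_ex[OF this] show "Vector_Spaces.linear (*s) (*) f0" "f0 e0 = 1"
    by (auto simp: f0_def)
qed

text \<open>The coefficient at \<open>e i\<close>: project to the part inverted by
  \<open>\<epsilon> i\<close>, carry it to the line of \<open>e0\<close>, and apply a functional. It
  is linear on the whole space but is a coordinate only on \<open>W\<close>; see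
  \<open>W_odd\<close>.\<close>

definition cf :: "nat \<Rightarrow> 'v \<Rightarrow> 'k" where
  "cf i v = f0 (\<sigma> (transpose 0 i) ((1/2) *s (v - \<epsilon> i v)))"

lemma cf_lin:
  assumes "i < n"
  shows "cf i (v + w) = cf i v + cf i w" "cf i (c *s v) = c * cf i v" "cf i (v - w) = cf i v - cf i w"
    "cf i (- v) = - cf i v" "cf i 0 = 0"
proof -
  interpret p: vector_space_pair "(*s)" "(*) :: 'k \<Rightarrow> _"
    by unfold_locales (auto simp: algebra_simps)
  note l = p.linear_add[OF f0(1)] p.linear_scale[OF f0(1)] p.linear_diff[OF f0(1)] p.linear_neg[OF f0(1)] p.linear_0[OF f0(1)]
  have t: "transpose 0 i permutes {..<n}" using assms by simp
  show "cf i (v + w) = cf i v + cf i w" "cf i (c *s v) = c * cf i v" "cf i (v - w) = cf i v - cf i w"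
    "cf i (- v) = - cf i v" "cf i 0 = 0"
    using assms t by (simp_all add: cf_def \<sigma>_lin \<epsilon>_lin l algebra_simps)
qed

lemma cf_e:
  assumes "i < n" "k < n"
  shows "cf i (e k) = (if i = k then 1 else 0)"
proof -
  interpret p: vector_space_pair "(*s)" "(*) :: 'k \<Rightarrow> _"
    by unfold_locales (auto simp: algebra_simps)
  have t: "transpose 0 i permutes {..<n}" using assms by simp
  have "\<sigma> (transpose 0 i) (e i) = e0" using t by (simp add: e_def \<sigma>_comp \<sigma>_id)
  then show ?thesis
    using assms t by (auto simp: cf_def \<epsilon>_e \<sigma>_lin p.linear_0[OF f0(1)] f0)
qed

lemma cf_U:
  assumes "i < n" "u \<in> U"
  shows "cf i u = 0"
proof -
  interpret p: vector_space_pair "(*s)" "(*) :: 'k \<Rightarrow> _"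
    by unfold_locales (auto simp: algebra_simps)
  show ?thesis
    using assms by (simp add: cf_def \<epsilon>_U \<sigma>_lin p.linear_0[OF f0(1)])
qed

text \<open>Within \<open>W\<close> only the line of \<open>e i\<close> is inverted by
  \<open>\<epsilon> i\<close>, so the odd part of a vector is its \<open>e i\<close>
  component.\<close>

lemma W_odd: "v \<in> W \<Longrightarrow> i < n \<Longrightarrow> (1/2) *s (v - \<epsilon> i v) = cf i v *s e i"
proof (induction rule: W_induct)
  case (add v w c)
  have "c *s v + w - \<epsilon> i (c *s v + w) = c *s (v - \<epsilon> i v) + (w - \<epsilon> i w)"
    using add.prems by (simp add: \<epsilon>_lin scale_right_diff_distrib)
  then have "(1/2) *s (c *s v + w - \<epsilon> i (c *s v + w)) = c *s ((1/2) *s (v - \<epsilon> i v)) + (1/2) *s (w - \<epsilon> i w)"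
    by (simp only: scale_right_distrib scale_left_commute[of "1/2" c])
  also have "\<dots> = c *s (cf i v *s e i) + cf i w *s e i"
    by (simp only: add.IH[OF add.prems])
  also have "\<dots> = cf i (c *s v + w) *s e i" using add.prems by (simp add: cf_lin scale_left_distrib)
  finally show ?case .
qed (auto simp: \<epsilon>_lin cf_lin \<epsilon>_U cf_U \<epsilon>_e cf_e)

text \<open>The image of the automorphism multiplying every other generator by the j-th one from the
  right; \<open>tau'\<close> omits one factor, which is possible at any place since the factors
  commute.\<close>

definition tau :: "nat \<Rightarrow> 'v \<Rightarrow> 'v" where
  "tau j = fold (\<lambda>i. R i j) (filter (\<lambda>i. i \<noteq> j) [0..<n])"

definition tau' :: "nat \<Rightarrow> nat \<Rightarrow> 'v \<Rightarrow> 'v" where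
  "tau' i j = fold (\<lambda>i. R i j) (remove1 i (filter (\<lambda>i. i \<noteq> j) [0..<n]))"

lemma set_tau': "set (remove1 i (filter (\<lambda>i. i \<noteq> j) [0..<n])) = {..<n} - {i, j}"
  by (simp add: set_remove1_eq) auto

lemma tau'_set: "x \<in> set (remove1 i (filter (\<lambda>i. i \<noteq> j) [0..<n])) \<Longrightarrow> x < n \<and> x \<noteq> i \<and> x \<noteq> j"
  by (simp only: set_tau') auto

lemma tau_split:
  assumes "i < n" "j < n" "i \<noteq> j"
  shows "tau j v = tau' i j (R i j v)"
proof -
  have "fold (\<lambda>i. R i j) (filter (\<lambda>i. i \<noteq> j) [0..<n]) =
    fold (\<lambda>i. R i j) (remove1 i (filter (\<lambda>i. i \<noteq> j) [0..<n])) \<circ> R i j"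
  proof (rule fold_remove1_split)
    show "R x j \<circ> R y j = R y j \<circ> R x j"
      if "x \<in> set (filter (\<lambda>i. i \<noteq> j) [0..<n])" "y \<in> set (filter (\<lambda>i. i \<noteq> j) [0..<n])" for x y
      using that assms by (cases "x = y") (auto simp: fun_eq_iff intro!: R_comm)
  qed (use assms in auto)
  then show ?thesis by (simp add: tau_def tau'_def)
qed

lemma fold_commute_pt: "(\<And>x v. x \<in> set xs \<Longrightarrow> g (f x v) = f x (g v)) \<Longrightarrow> g (fold f xs v) = fold f xs (g v)"
  by (induction xs arbitrary: v) auto

lemma tau'_props:
  assumes "i < n" "j < n" "i \<noteq> j"
  shows "\<epsilon> i (tau' i j v) = tau' i j (\<epsilon> i v)" "R i j (tau' i j v) = tau' i j (R i j v)"
    "v \<in> W \<Longrightarrow> tau' i j v \<in> W" "tau' i j v = tau' i j w \<longleftrightarrow> v = w"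
proof -
  have s: "x < n \<and> x \<noteq> i \<and> x \<noteq> j" if "x \<in> set (remove1 i (filter (\<lambda>i. i \<noteq> j) [0..<n]))" for x
    using that by (rule tau'_set)
  show "\<epsilon> i (tau' i j v) = tau' i j (\<epsilon> i v)"
    unfolding tau'_def using s assms by (intro fold_commute_pt \<epsilon>_R) auto
  show "R i j (tau' i j v) = tau' i j (R i j v)"
    unfolding tau'_def using s assms by (intro fold_commute_pt R_comm) auto
  have "v \<in> W \<longrightarrow> fold (\<lambda>i. R i j) xs v \<in> W" if "\<forall>x\<in>set xs. x < n \<and> x \<noteq> j" for xs v
    using that assms by (induction xs arbitrary: v) (auto simp: R_W)
  then show "v \<in> W \<Longrightarrow> tau' i j v \<in> W" unfolding tau'_def using s by blast
  have "fold (\<lambda>i. R i j) xs v = fold (\<lambda>i. R i j) xs w \<longleftrightarrow> v = w" if "\<forall>x\<in>set xs. x < n \<and> x \<noteq> j" for xs v w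
    using that assms by (induction xs arbitrary: v w) (auto simp: R_inj)
  then show "tau' i j v = tau' i j w \<longleftrightarrow> v = w" unfolding tau'_def using s by blast
qed

lemma Delta_tau: "j < n \<Longrightarrow> Delta (tau j v) = tau j (Delta v)"
  unfolding Delta_def tau_def by (rule \<Delta>_\<tau>)

text \<open>\<open>Delta\<close> commutes with \<open>tau j\<close>, so the image of a vector of
  \<open>U\<close> is fixed by \<open>Delta\<close>; it lies in \<open>W\<close>, where this means
  lying in \<open>U\<close>. The relation behind \<open>Delta_tau\<close> is the one that comes from
  inner automorphisms.\<close>

lemma tau_U:
  assumes "j < n" "u \<in> U"
  shows "tau j u \<in> U"
proof -
  obtain i where i: "i < n" "i \<noteq> j" using n4 by (metis n0(1) n0(2) n_not_Suc_n)
  have "tau j u \<in> W"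
    using assms i by (simp add: tau_split[of i] tau'_props R_W W_U)
  moreover have "Delta (tau j u) = tau j u" using assms by (simp add: Delta_tau Delta_U)
  ultimately show ?thesis by (rule Delta_fix)
qed

text \<open>\<open>tau j u\<close> lies in \<open>U\<close> and is thus fixed by
  \<open>\<epsilon> i\<close>. Stripping the injective \<open>tau' i j\<close>, which commutes with
  \<open>\<epsilon> i\<close>, shows that \<open>R i j u\<close> is fixed too.\<close>

lemma cf_R_U:
  assumes "i < n" "j < n" "i \<noteq> j" "u \<in> U"
  shows "cf i (R i j u) = 0"
proof -
  have "tau' i j (\<epsilon> i (R i j u)) = tau' i j (R i j u)"
    using tau_U[OF assms(2,4)] assms by (simp add: tau_split[of i] \<epsilon>_U flip: tau'_props(1))
  then have "\<epsilon> i (R i j u) = R i j u" using tau'_props(4)[OF assms(1-3)] by simp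
  then have "cf i (R i j u) *s e i = 0"
    using W_odd[OF R_W[OF assms(1-3) W_U[OF assms(4)]] assms(1)] by simp
  then show ?thesis using e_neq0[OF assms(1)] by simp
qed

text \<open>\<open>tau' i j\<close> commutes with \<open>\<epsilon> i\<close>, hence maps
  \<open>e i\<close> to a nonzero multiple of itself. So \<open>R i j (e i)\<close> is proportional
  to \<open>tau j (e i)\<close>, on which \<open>Delta\<close> acts as -1.\<close>

lemma P_R_e:
  assumes "i < n" "j < n" "i \<noteq> j"
  shows "P (R i j (e i)) = 0"
proof -
  let ?v = "tau' i j (e i)"
  have "?v \<in> W" using assms by (simp add: tau'_props W_e)
  moreover have "\<epsilon> i ?v = - ?v"
  proof -
    have "\<epsilon> i ?v = tau' i j (- e i)" using assms by (simp add: tau'_props \<epsilon>_e)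
    also have "\<dots> = - ?v"
    proof -
      have "lin (tau' i j)" unfolding tau'_def
        using tau'_set assms by (intro fold_lin linear_R) blast+
      then show ?thesis by (rule vp.linear_neg)
    qed
    finally show ?thesis .
  qed
  ultimately have c: "?v = cf i ?v *s e i" using W_odd[of ?v i] assms by simp
  have "?v \<noteq> tau' i j 0" using tau'_props(4)[OF assms] e_neq0[OF assms(1)] by simp
  moreover have "tau' i j 0 = 0"
    unfolding tau'_def
  proof (rule fold_fixed)
    show "R x j 0 = 0" if "x \<in> set (remove1 i (filter (\<lambda>i. i \<noteq> j) [0..<n]))" for x
      using tau'_set[OF that] assms by (simp add: R_lin)
  qed
  ultimately have c0: "cf i ?v \<noteq> 0" using c by auto
  have "tau j (e i) = R i j ?v" using assms by (simp add: tau_split[of i] tau'_props)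
  also have "\<dots> = cf i ?v *s R i j (e i)" using assms by (subst c) (simp add: R_lin)
  finally have t: "tau j (e i) = cf i ?v *s R i j (e i)" .
  have "Delta (tau j (e i)) = tau j (- e i)" using assms by (simp add: Delta_tau Delta_e)
  also have "\<dots> = - tau j (e i)"
  proof -
    have "lin (tau j)" unfolding tau_def by (rule fold_lin, rule linear_R) (use assms in auto)
    then show ?thesis by (rule vp.linear_neg)
  qed
  finally have "cf i ?v *s P (R i j (e i)) = 0" by (simp add: t P_lin(2)[symmetric]) (simp add: P_def Delta_lin t)
  then show ?thesis using c0 by simp
qed

section \<open>Entries of R i j on W\<close>

lemma Delta_\<sigma>_W:
  assumes \<pi>: "\<pi> permutes {..<n}" "\<And>k. k < n \<Longrightarrow> \<sigma> \<pi> (e k) = e (\<pi> k)" and v: "v \<in> W"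
  shows "\<sigma> \<pi> v \<in> W" "P (\<sigma> \<pi> v) = \<sigma> \<pi> (P v)"
proof -
  have "\<sigma> \<pi> v \<in> W \<and> P (\<sigma> \<pi> v) = \<sigma> \<pi> (P v)"
    using v
  proof (induction rule: W_induct)
    case zero
    then show ?case using \<pi>(1) W_0 by (simp add: \<sigma>_lin P_lin)
  next
    case (add v w c)
    then show ?case using \<pi>(1) by (simp add: \<sigma>_lin P_lin W_add W_scale)
  next
    case (U u)
    then have "\<sigma> \<pi> u \<in> U" using \<sigma>_eig[OF \<pi>(1) U] by simp
    then show ?case using U by (simp add: P_U W_U)
  next
    case (e i)
    then show ?case using \<pi> perm_less[OF \<pi>(1) e] by (simp add: P_e W_e \<sigma>_lin)
  qed
  then show "\<sigma> \<pi> v \<in> W" "P (\<sigma> \<pi> v) = \<sigma> \<pi> (P v)" by simp_all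
qed

lemma cf_\<sigma>:
  assumes \<pi>: "\<pi> permutes {..<n}" "\<And>k. k < n \<Longrightarrow> \<sigma> \<pi> (e k) = e (\<pi> k)" and v: "v \<in> W" and k: "k < n"
  shows "cf (\<pi> k) (\<sigma> \<pi> v) = cf k v"
proof -
  have k': "\<pi> k < n" by (rule perm_less[OF \<pi>(1) k])
  have "cf (\<pi> k) (\<sigma> \<pi> v) *s e (\<pi> k) = (1/2) *s (\<sigma> \<pi> v - \<sigma> \<pi> (\<epsilon> k v))"
    using W_odd[OF Delta_\<sigma>_W(1)[OF \<pi> v] k'] \<sigma>_\<epsilon>[OF \<pi>(1) k, of v] by simp
  also have "\<dots> = \<sigma> \<pi> ((1/2) *s (v - \<epsilon> k v))" using \<pi>(1) by (simp only: \<sigma>_lin)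
  also have "\<dots> = \<sigma> \<pi> (cf k v *s e k)" using W_odd[OF v k] by simp
  also have "\<dots> = cf k v *s e (\<pi> k)" using \<pi> k by (simp add: \<sigma>_lin)
  finally show ?thesis using e_neq0[OF k'] by simp
qed

text \<open>The block matrix of \<open>R i j\<close> on \<open>U\<close> and the lines of
  \<open>e i\<close> and \<open>e j\<close>: \<open>U\<close> goes to \<open>A\<close> plus \<beta>
  times \<open>e j\<close>, \<open>e i\<close> goes to x times \<open>e i\<close> plus y times
  \<open>e j\<close>, and \<open>e j\<close> goes to z times \<open>e i\<close> plus w times
  \<open>e j\<close> plus b. The other entries vanish by \<open>cf_R_U\<close> and
  \<open>P_R_e\<close>, and the four scalars do not depend on the pair.\<close>

definition A where "A i j u = P (R i j u)"
definition \<beta> where "\<beta> i j u = cf j (R i j u)"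
definition b where "b i j = P (R i j (e j))"
definition x where "x = cf 0 (R 0 (Suc 0) (e 0))"
definition y where "y = cf (Suc 0) (R 0 (Suc 0) (e 0))"
definition z where "z = cf 0 (R 0 (Suc 0) (e (Suc 0)))"
definition w where "w = cf (Suc 0) (R 0 (Suc 0) (e (Suc 0)))"

lemma block_coeff:
  assumes "i < n" "j < n" "i \<noteq> j" "\<exists>u'\<in>U. \<exists>a b. v = u' + a *s e i + b *s e j"
  shows "v = P v + cf i v *s e i + cf j v *s e j" "P v \<in> U"
proof -
  obtain u' a b where u': "u' \<in> U" "v = u' + a *s e i + b *s e j" using assms by blast
  then have "P v = u'" "cf i v = a" "cf j v = b"
    using assms(1-3) by (simp_all add: P_lin P_U P_e cf_lin cf_U cf_e)
  then show "v = P v + cf i v *s e i + cf j v *s e j" "P v \<in> U" using u' by simp_all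
qed

lemma A_U: "i < n \<Longrightarrow> j < n \<Longrightarrow> i \<noteq> j \<Longrightarrow> u \<in> U \<Longrightarrow> A i j u \<in> U"
  unfolding A_def using block_coeff(2)[OF _ _ _ R_U_block] by simp

lemma R_U: "i < n \<Longrightarrow> j < n \<Longrightarrow> i \<noteq> j \<Longrightarrow> u \<in> U \<Longrightarrow> R i j u = A i j u + \<beta> i j u *s e j"
  using block_coeff(1)[OF _ _ _ R_U_block, of i j u] cf_R_U[of i j u] by (simp add: A_def \<beta>_def)

lemma R_e1:
  assumes "i < n" "j < n" "i \<noteq> j"
  shows "R i j (e i) = x *s e i + y *s e j"
proof -
  obtain \<pi> where p: "\<pi> permutes {..<n}" "\<pi> 0 = i" "\<pi> (Suc 0) = j" "\<And>k. k < n \<Longrightarrow> \<sigma> \<pi> (e k) = e (\<pi> k)"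
    using pair_perm[OF assms] by blast
  have W: "R 0 (Suc 0) (e 0) \<in> W" by (intro R_W W_e) auto
  have eq: "\<sigma> \<pi> (R 0 (Suc 0) (e 0)) = R i j (e i)"
    using p by (simp add: \<sigma>_R)
  have "cf i (R i j (e i)) = x"
    using cf_\<sigma>[OF p(1,4) W, of 0] p(2) by (simp add: x_def eq)
  moreover have "cf j (R i j (e i)) = y"
    using cf_\<sigma>[OF p(1,4) W, of "Suc 0"] p(3) by (simp add: y_def eq)
  moreover have "R i j (e i) = P (R i j (e i)) + cf i (R i j (e i)) *s e i + cf j (R i j (e i)) *s e j"
    using assms by (intro block_coeff R_e_block) auto
  ultimately show ?thesis using P_R_e[OF assms] by simp
qed

lemma R_e2:
  assumes "i < n" "j < n" "i \<noteq> j"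
  shows "R i j (e j) = z *s e i + w *s e j + b i j" "b i j \<in> U"
proof -
  obtain \<pi> where p: "\<pi> permutes {..<n}" "\<pi> 0 = i" "\<pi> (Suc 0) = j" "\<And>k. k < n \<Longrightarrow> \<sigma> \<pi> (e k) = e (\<pi> k)"
    using pair_perm[OF assms] by blast
  have W: "R 0 (Suc 0) (e (Suc 0)) \<in> W" by (intro R_W W_e) auto
  have eq: "\<sigma> \<pi> (R 0 (Suc 0) (e (Suc 0))) = R i j (e j)"
    using p by (simp add: \<sigma>_R)
  have "cf i (R i j (e j)) = z"
    using cf_\<sigma>[OF p(1,4) W, of 0] p(2) by (simp add: z_def eq)
  moreover have "cf j (R i j (e j)) = w"
    using cf_\<sigma>[OF p(1,4) W, of "Suc 0"] p(3) by (simp add: w_def eq)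
  moreover have "R i j (e j) = P (R i j (e j)) + cf i (R i j (e j)) *s e i + cf j (R i j (e j)) *s e j"
    "P (R i j (e j)) \<in> U"
    using assms block_coeff[OF assms R_e_block[OF assms, of j]] by auto
  ultimately show "R i j (e j) = z *s e i + w *s e j + b i j" "b i j \<in> U"
    by (simp_all add: b_def add_ac)
qed

lemma b_\<sigma>:
  assumes "i < n" "j < n" "i \<noteq> j"
  shows "\<exists>\<pi>. \<pi> permutes {..<n} \<and> \<sigma> \<pi> (b 0 (Suc 0)) = b i j \<and>
    (\<forall>u\<in>U. \<sigma> \<pi> u \<in> U) \<and> (\<forall>u\<in>U. \<beta> i j (\<sigma> \<pi> u) = \<beta> 0 (Suc 0) u)"
proof -
  obtain \<pi> where p: "\<pi> permutes {..<n}" "\<pi> 0 = i" "\<pi> (Suc 0) = j" "\<And>k. k < n \<Longrightarrow> \<sigma> \<pi> (e k) = e (\<pi> k)"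
    using pair_perm[OF assms] by blast
  have W: "R 0 (Suc 0) (e (Suc 0)) \<in> W" by (intro R_W W_e) auto
  have eq: "\<sigma> \<pi> (R 0 (Suc 0) v) = R i j (\<sigma> \<pi> v)" for v
    using p by (simp add: \<sigma>_R)
  have 1: "\<sigma> \<pi> (b 0 (Suc 0)) = b i j"
    using Delta_\<sigma>_W(2)[OF p(1,4) W] p by (simp add: b_def eq)
  have 2: "\<sigma> \<pi> u \<in> U" if "u \<in> U" for u using \<sigma>_eig[OF p(1) that] by simp
  have 3: "\<beta> i j (\<sigma> \<pi> u) = \<beta> 0 (Suc 0) u" if "u \<in> U" for u
  proof -
    have "R 0 (Suc 0) u \<in> W" using that by (intro R_W W_U) auto
    then show ?thesis
      using cf_\<sigma>[OF p(1,4), of "R 0 (Suc 0) u" "Suc 0"] p(3) by (simp add: \<beta>_def eq)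
  qed
  show ?thesis using p(1) 1 2 3 by blast
qed

text \<open>By \<open>pair_perm\<close> all the vectors \<open>b i j\<close> are images of one of
  them under invertible operators.\<close>

lemma b_zero:
  assumes "i < n" "j < n" "i \<noteq> j" "k < n" "l < n" "k \<noteq> l" "b i j = 0"
  shows "b k l = 0"
proof -
  obtain \<pi> where p: "\<pi> permutes {..<n}" "\<sigma> \<pi> (b 0 (Suc 0)) = b i j" using b_\<sigma>[OF assms(1-3)] by blast
  obtain \<rho> where r: "\<rho> permutes {..<n}" "\<sigma> \<rho> (b 0 (Suc 0)) = b k l" using b_\<sigma>[OF assms(4-6)] by blast
  have "b 0 (Suc 0) = 0" using p(2) assms(7) \<sigma>_zero[OF p(1), of "b 0 (Suc 0)"] by simp
  then show ?thesis using r \<sigma>_lin(5)[OF r(1)] by simp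
qed

text \<open>Conjugation by the sign changes at i and j negates exactly the entries \<beta> and b.
  Equality of \<open>R\<close> and \<open>L\<close> on \<open>W\<close> thus amounts to their
  vanishing.\<close>

lemma L_U:
  assumes "i < n" "j < n" "i \<noteq> j" "u \<in> U"
  shows "L i j u = A i j u - \<beta> i j u *s e j"
  using assms A_U[OF assms] by (simp add: L_def R_U \<epsilon>_U \<epsilon>_e \<epsilon>_lin)

lemma L_e1: "i < n \<Longrightarrow> j < n \<Longrightarrow> i \<noteq> j \<Longrightarrow> L i j (e i) = x *s e i + y *s e j"
  by (simp add: L_def R_e1 \<epsilon>_e \<epsilon>_lin R_lin)

lemma L_e2:
  assumes "i < n" "j < n" "i \<noteq> j"
  shows "L i j (e j) = z *s e i + w *s e j - b i j"
  using assms R_e2[OF assms] by (simp add: L_def \<epsilon>_e \<epsilon>_lin R_lin \<epsilon>_U add_ac)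

lemma R_L': "i < n \<Longrightarrow> j < n \<Longrightarrow> i \<noteq> j \<Longrightarrow> k < n \<Longrightarrow> i \<noteq> k \<Longrightarrow> R i j (L i k v) = L i k (R i j v)"
  using R_L[of i j k v] by (simp add: L_def)

lemma A_lin:
  assumes "i < n" "j < n" "i \<noteq> j"
  shows "A i j (v + v') = A i j v + A i j v'" "A i j (c *s v) = c *s A i j v"
    "A i j (v - v') = A i j v - A i j v'" "A i j (- v) = - A i j v" "A i j 0 = 0"
  using assms by (simp_all add: A_def R_lin P_lin)

lemma A_linear:
  assumes "i < n" "j < n" "i \<noteq> j"
  shows "lin (A i j)"
  unfolding Vector_Spaces.linear_iff using assms vector_space_axioms by (simp add: A_lin)

lemma \<beta>_lin:
  assumes "i < n" "j < n" "i \<noteq> j"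
  shows "\<beta> i j (v + v') = \<beta> i j v + \<beta> i j v'" "\<beta> i j (c *s v) = c * \<beta> i j v"
    "\<beta> i j (v - v') = \<beta> i j v - \<beta> i j v'" "\<beta> i j (- v) = - \<beta> i j v" "\<beta> i j 0 = 0"
  using assms by (simp_all add: \<beta>_def R_lin cf_lin)

text \<open>These rules evaluate any word in \<open>R\<close> and \<open>L\<close> on
  \<open>U\<close> and the \<open>e i\<close>. Below, each relation is turned into equations by
  applying \<open>P\<close> or a \<open>cf\<close> to both sides.\<close>

lemmas eval = R_U R_e1 R_e2(1) R_e_other L_U L_e1 L_e2 L_e_other R_lin(1-5) L_lin(1-5)
  \<epsilon>_U \<epsilon>_e \<epsilon>_lin(1-5) A_U R_e2(2) P_lin P_U P_e cf_lin cf_U cf_e A_lin \<beta>_lin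

text \<open>\<open>R i j\<close> and \<open>L i j\<close> commute; since \<open>L\<close> differs by
  the sign of \<beta> and b, the products yb and z\<beta> equal their negatives.\<close>

lemma yb_z\<beta>:
  assumes "i < n" "j < n" "i \<noteq> j"
  shows "y *s b i j = 0" "u \<in> U \<Longrightarrow> z * \<beta> i j u = 0"
proof -
  have "P (R i j (L i j (e i))) = P (L i j (R i j (e i)))" using assms by (simp add: R_L')
  then have "y *s b i j = - (y *s b i j)" using assms by (simp add: eval)
  then show "y *s b i j = 0" using neg_eq_self[of "y *s b i j"] by metis
  assume u: "u \<in> U"
  have "cf i (R i j (L i j u)) = cf i (L i j (R i j u))" using assms by (simp add: R_L')
  then have "- (\<beta> i j u * z) = \<beta> i j u * z" using assms u by (simp add: eval)
  then have "2 * (z * \<beta> i j u) = 0" by (simp add: mult.commute)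
  then show "z * \<beta> i j u = 0" using two by simp
qed

lemma R\<epsilon>R_eqs:
  assumes "i < n" "j < n" "i \<noteq> j"
  shows "x * x - y * z = 1" "w * w - z * y - \<beta> i j (b i j) = 1"
    "u \<in> U \<Longrightarrow> A i j (A i j u) = u + \<beta> i j u *s b i j"
proof -
  have "cf i (R i j (\<epsilon> j (R i j (e i)))) = cf i (\<epsilon> j (e i))" using assms by (simp add: R_\<epsilon>_R)
  then show "x * x - y * z = 1" using assms by (simp add: eval)
  have "cf j (R i j (\<epsilon> j (R i j (e j)))) = cf j (\<epsilon> j (e j))" using assms by (simp add: R_\<epsilon>_R)
  then have "z * y - w * w + \<beta> i j (b i j) = - 1" using assms by (simp add: eval)
  then show "w * w - z * y - \<beta> i j (b i j) = 1" by (simp add: algebra_simps)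
  assume u: "u \<in> U"
  have "P (R i j (\<epsilon> j (R i j u))) = P (\<epsilon> j u)" using assms by (simp add: R_\<epsilon>_R)
  then show "A i j (A i j u) = u + \<beta> i j u *s b i j" using assms u by (simp add: eval algebra_simps)
qed

lemma third_index:
  assumes "i < n" "j < n"
  obtains k where "k < n" "k \<noteq> i" "k \<noteq> j"
proof -
  have "\<exists>k<3. k \<noteq> i \<and> k \<noteq> j"
  proof (rule ccontr)
    assume "\<not> ?thesis"
    then have "{..<3} \<subseteq> {i, j}" by auto
    then have "card {..<3::nat} \<le> card {i, j}" by (intro card_mono) auto
    also have "\<dots> \<le> 2" by (simp add: card_insert_if)
    finally show False by simp
  qed
  then show ?thesis using that n4 by (meson less_trans n0(4) less_le_trans numeral_less_iff semiring_norm)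
qed

section \<open>Triviality of the diagonal action on U\<close>

lemma A_comm1:
  assumes "i < n" "j < n" "i \<noteq> j" "k < n" "i \<noteq> k" "u \<in> U"
  shows "A i j (A i k u) = A i k (A i j u)"
proof (cases "j = k")
  case False
  have "P (R i j (L i k u)) = P (L i k (R i j u))" using assms by (simp add: R_L')
  then show ?thesis using assms False by (simp add: eval)
qed simp

text \<open>The \<open>U\<close> component of the relation for \<open>R\<close> is the same relation
  for \<open>A\<close> up to terms with a factor \<beta> times b, and \<open>H\<close> kills
  these.\<close>

lemma A_comm2:
  assumes "i < n" "j < n" "i \<noteq> j" "k < n" "l < n" "k \<noteq> l" "i \<noteq> k" "i \<noteq> l" "j \<noteq> k" "u \<in> U"
    and H: "\<And>i j k l u. i < n \<Longrightarrow> j < n \<Longrightarrow> i \<noteq> j \<Longrightarrow> k < n \<Longrightarrow> l < n \<Longrightarrow> k \<noteq> l \<Longrightarrow> u \<in> U \<Longrightarrow> \<beta> i j u = 0 \<or> b k l = 0"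
  shows "A i j (A k l u) = A k l (A i j u)"
proof -
  have eq: "P (R i j (R k l u)) = P (R k l (R i j u))" using assms by (simp add: R_comm)
  show ?thesis
  proof (cases "j = l")
    case True
    have "\<beta> k l u = 0 \<or> b i l = 0" "\<beta> i l u = 0 \<or> b k l = 0" using assms(1-10) True H[of k l i l u] H[of i l k l u] by simp_all
    then show ?thesis using eq assms(1-10) True by (auto simp: eval)
  next
    case False
    then show ?thesis using eq assms(1-10) by (simp add: eval)
  qed
qed

lemma A_chain:
  assumes "i < n" "j < n" "k < n" "i \<noteq> j" "i \<noteq> k" "j \<noteq> k" "u \<in> U"
    and H: "\<And>i j k l u. i < n \<Longrightarrow> j < n \<Longrightarrow> i \<noteq> j \<Longrightarrow> k < n \<Longrightarrow> l < n \<Longrightarrow> k \<noteq> l \<Longrightarrow> u \<in> U \<Longrightarrow> \<beta> i j u = 0 \<or> b k l = 0"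
  shows "A k j (A i k u) = A i k (A k j (A i j u))"
proof -
  have eq: "P (R k j (R i k u)) = P (R i k (R k j (R i j u)))" using assms(1-7) by (simp add: R_chain)
  have "\<beta> i j u = 0 \<or> b k j = 0 \<and> b i k = 0"
    using H[of i j k j u] H[of i j i k u] assms(1-7) by auto
  then show ?thesis using eq assms(1-7) by (elim disjE) (simp_all add: eval)
qed

text \<open>Under \<open>H\<close> the \<open>A p q\<close> are involutions. For a fixed i and three
  targets t, the \<open>A i t\<close> commute and the \<open>A\<close> between the targets act on
  their characters as transvections. A nontrivial character would produce seven of them, against a
  dimension of at most 5.\<close>

lemma A_trivial:
  assumes H: "\<And>i j k l u. i < n \<Longrightarrow> j < n \<Longrightarrow> i \<noteq> j \<Longrightarrow> k < n \<Longrightarrow> l < n \<Longrightarrow> k \<noteq> l \<Longrightarrow> u \<in> U \<Longrightarrow> \<beta> i j u = 0 \<or> b k l = 0"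
    and ij: "i < n" "j < n" "i \<noteq> j" and u: "u \<in> U"
  shows "A i j u = u"
proof (rule ccontr)
  assume neq: "A i j u \<noteq> u"
  obtain k where k: "k < n" "k \<noteq> i" "k \<noteq> j" using third_index ij by blast
  have "\<exists>l<4. l \<noteq> i \<and> l \<noteq> j \<and> l \<noteq> k"
  proof (rule ccontr)
    assume "\<not> ?thesis"
    then have "{..<4} \<subseteq> {i, j, k}" by auto
    then have "card {..<4::nat} \<le> card {i, j, k}" by (intro card_mono) auto
    also have "\<dots> \<le> 3" by (simp add: card_insert_if)
    finally show False by simp
  qed
  then obtain l where l0: "l < 4" "l \<noteq> i" "l \<noteq> j" "l \<noteq> k" by blast
  then have l: "l < n" using n4 by simp
  \<comment> \<open>An enumeration by 1, 2, 3 of the three targets, as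
    \<open>seven_characters\<close> expects; together with i they are four distinct indices.\<close>
  define t where "t = (\<lambda>a::nat. if a = 1 then j else if a = 2 then k else l)"
  have t: "t a < n" "t a \<noteq> i" "i \<noteq> t a" for a
    using ij k l l0 by (auto simp: t_def)
  have t_inj: "t a = t c \<longleftrightarrow> a = c" if "a \<in> {1,2,3}" "c \<in> {1,2,3}" for a c
    using that k l0 by (auto simp: t_def)
  have A2: "A p q (A p q v) = v" if "p < n" "q < n" "p \<noteq> q" "v \<in> U" for p q v
    using R\<epsilon>R_eqs(3)[OF that] H[of p q p q v] that by auto
  have "7 \<le> dim U"
  proof (rule seven_characters[of Basis U "\<lambda>a. A i (t a)" "\<lambda>a c. A (t a) (t c)" u])
    show "finite_dimensional_vector_space (*s) Basis" by (rule finite_dimensional_vector_space_axioms)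
    show "subspace U" by (rule subspace_eig)
    show "lin (A i (t a))" for a using ij t by (intro A_linear)
    show "lin (A (t a) (t c))" if "a \<in> {1,2,3}" "c \<in> {1,2,3}" "a \<noteq> c" for a c
      using t t_inj[OF that(1,2)] that(3) by (intro A_linear) auto
    show "A i (t a) v \<in> U" if "v \<in> U" for a v using ij t that by (intro A_U)
    show "A (t a) (t c) v \<in> U" if "a \<in> {1,2,3}" "c \<in> {1,2,3}" "a \<noteq> c" "v \<in> U" for a c v
      using t t_inj[OF that(1,2)] that(3,4) by (intro A_U) auto
    show "A i (t a) (A i (t a) v) = v" if "v \<in> U" for a v using ij t that by (intro A2)
    show "A (t a) (t c) (A (t a) (t c) v) = v" if "a \<in> {1,2,3}" "c \<in> {1,2,3}" "a \<noteq> c" "v \<in> U" for a c v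
      using t t_inj[OF that(1,2)] that(3,4) by (intro A2) auto
    show "A i (t a) (A i (t c) v) = A i (t c) (A i (t a) v)" if "v \<in> U" for a c v
      using ij t that by (intro A_comm1)
    show "A i (t d) (A (t a) (t c) v) = A (t a) (t c) (A i (t d) v)"
      if "a \<in> {1,2,3}" "c \<in> {1,2,3}" "d \<in> {1,2,3}" "a \<noteq> c" "d \<noteq> a" "v \<in> U" for a c d v
      using ij t t_inj[OF that(1,2)] t_inj[OF that(3,1)] that(4-6) by (intro A_comm2 H) auto
    show "A (t a) (t c) (A i (t a) v) = A i (t a) (A (t a) (t c) (A i (t c) v))"
      if "a \<in> {1,2,3}" "c \<in> {1,2,3}" "a \<noteq> c" "v \<in> U" for a c v
      using ij t t_inj[OF that(1,2)] that(3,4) by (intro A_chain H) auto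
    show "u \<in> U" by (rule u)
    show "A i (t 1) u \<noteq> u" using neq by (simp add: t_def)
    show "(2::'k) \<noteq> 0" by (rule two)
  qed
  then show False using dim_U by simp
qed

text \<open>Each \<open>g j\<close> equals the total sum, so the total equals n times
  itself.\<close>

lemma sum_trick:
  fixes g :: "nat \<Rightarrow> 'v"
  assumes "of_nat (n - 1) \<noteq> (0::'k)" "\<And>j. j < n \<Longrightarrow> (\<Sum>i\<in>{..<n} - {j}. g i) = 0" "j < n"
  shows "g j = 0"
proof -
  have *: "g j = (\<Sum>i<n. g i)" if "j < n" for j
    using assms(2)[OF that] that by (simp add: sum.remove[of "{..<n}" j])
  have "(\<Sum>i<n. g i) = (\<Sum>i<n. (\<Sum>i<n. g i))" using * by (intro sum.cong) auto
  also have "\<dots> = of_nat n *s (\<Sum>i<n. g i)" by (simp add: sum_constant_scale)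
  finally have "(of_nat n - 1) *s (\<Sum>i<n. g i) = 0" by (simp add: scale_left_diff_distrib)
  then have "of_nat (n - 1) *s (\<Sum>i<n. g i) = 0" using n4 by (simp add: of_nat_diff)
  then show ?thesis using assms(1) *[OF assms(3)] by simp
qed

text \<open>A nonzero \<beta> forces z = 0, and comparing coefficients in \<open>R_chain\<close>
  gives w = x = y = 1. Then \<beta> does not depend on the second index, and \<open>tau_U\<close>
  makes the sums over the first index vanish.\<close>

lemma core_beta:
  assumes char: "of_nat (n - 1) \<noteq> (0::'k)"
    and b0: "\<And>i j. i < n \<Longrightarrow> j < n \<Longrightarrow> i \<noteq> j \<Longrightarrow> b i j = 0"
    and ij: "i < n" "j < n" "i \<noteq> j" and u: "u \<in> U"
  shows "\<beta> i j u = 0"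
proof (rule ccontr)
  assume neq: "\<beta> i j u \<noteq> 0"
  have z: "z = 0" using yb_z\<beta>(2)[OF ij u] neq by simp
  have ww: "w * w = 1" and xx: "x * x = 1"
    using R\<epsilon>R_eqs(1,2)[OF ij] ij by (simp_all add: z b0 \<beta>_lin)
  obtain k where k: "k < n" "k \<noteq> i" "k \<noteq> j" using third_index ij by blast
  have chain: "R k j (R i k v) = R i k (R k j (R i j v))" if "i < n" "j < n" "k < n" "i \<noteq> j" "i \<noteq> k" "j \<noteq> k" for i j k v
    using that by (rule R_chain)
  have "cf j (R k j (R i k (e j))) = cf j (R i k (R k j (R i j (e j))))"
    using ij k by (simp add: chain)
  then have "w = w * w" using ij k by (simp add: eval z b0)
  then have w: "w = 1" using ww by simp
  have "cf i (R k j (R i k (e i))) = cf i (R i k (R k j (R i j (e i))))"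
    using ij k by (simp add: chain)
  then have "x = x * x" using ij k by (simp add: eval z b0)
  then have x: "x = 1" using xx by simp
  have A1: "A i j u = u" if "i < n" "j < n" "i \<noteq> j" "u \<in> U" for i j u
    by (rule A_trivial[OF _ that]) (simp add: b0)
  \<comment> \<open>The coefficient of \<open>e j\<close> in \<open>R_chain\<close>, applied to a
    vector of \<open>U\<close>; it also shows that y is not zero.\<close>
  have \<beta>\<beta>: "\<beta> i j u = y * \<beta> i k u" if "i < n" "j < n" "k < n" "i \<noteq> j" "i \<noteq> k" "j \<noteq> k" "u \<in> U" for i j k u
  proof -
    have "cf j (R k j (R i k u)) = cf j (R i k (R k j (R i j u)))"
      using that by (simp add: chain)
    then show ?thesis using that by (simp add: eval z b0 A1 w x algebra_simps)
  qed
  have "\<beta> i j u = y * (y * \<beta> i j u)" using \<beta>\<beta>[of i j k u] \<beta>\<beta>[of i k j u] ij k u by simp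
  have "cf j (R k j (R i k (e i))) = cf j (R i k (R k j (R i j (e i))))"
    using ij k by (simp add: chain)
  then have "y * y = y" using ij k by (simp add: eval z b0 w x)
  moreover have "y \<noteq> 0" using \<beta>\<beta>[of i j k u] neq ij k u by auto
  ultimately have y: "y = 1" by simp
  have \<beta>_eq: "\<beta> i j u = \<beta> i k u" if "i < n" "j < n" "k < n" "i \<noteq> j" "i \<noteq> k" for i j k
    using \<beta>\<beta>[of i j k u] that u y by (cases "j = k") auto
  \<comment> \<open>Every factor of \<open>tau j\<close> fixes \<open>u\<close> and
    \<open>e j\<close> up to adding its own multiple of \<open>e j\<close>, so the \<beta> simply
    accumulate.\<close>
  have tau: "fold (\<lambda>i. R i j) xs (u + c *s e j) = u + (c + (\<Sum>i\<leftarrow>xs. \<beta> i j u)) *s e j"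
    if "j < n" "\<forall>i\<in>set xs. i < n \<and> i \<noteq> j" for j xs c
    using that
  proof (induction xs arbitrary: c)
    case (Cons i xs)
    have "R i j (u + c *s e j) = u + (c + \<beta> i j u) *s e j"
      using Cons.prems u by (simp add: eval z b0 A1 w scale_left_distrib add_ac)
    then show ?case using Cons by (simp add: add_ac)
  qed simp
  have sum0: "(\<Sum>i\<in>{..<n} - {j}. \<beta> i j u) = 0" if j: "j < n" for j
  proof -
    let ?xs = "filter (\<lambda>i. i \<noteq> j) [0..<n]"
    have "tau j u = u + (\<Sum>i\<leftarrow>?xs. \<beta> i j u) *s e j"
      using tau[OF j, of ?xs 0] by (simp add: tau_def)
    moreover have "cf j (tau j u) = 0" using tau_U[OF j u] j by (simp add: cf_U)
    ultimately have "(\<Sum>i\<leftarrow>?xs. \<beta> i j u) = 0" using j u by (simp add: cf_lin cf_U cf_e)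
    moreover have "(\<Sum>i\<leftarrow>?xs. \<beta> i j u) = (\<Sum>i\<in>set ?xs. \<beta> i j u)"
      by (rule sum_list_distinct_conv_sum_set) simp
    moreover have "set ?xs = {..<n} - {j}" by auto
    ultimately show ?thesis by simp
  qed
  define g where "g i = \<beta> i (if i = 0 then 1 else 0) u" for i
  have g: "\<beta> i j u = g i" if "i < n" "j < n" "i \<noteq> j" for i j
    unfolding g_def using that by (intro \<beta>_eq) auto
  have "g i *s e 0 = 0"
  proof (rule sum_trick[OF char, of "\<lambda>i. g i *s e 0" i])
    fix j assume j: "j < n"
    have "(\<Sum>i\<in>{..<n} - {j}. g i) = (\<Sum>i\<in>{..<n} - {j}. \<beta> i j u)"
      using j g by (intro sum.cong) auto
    then show "(\<Sum>i\<in>{..<n} - {j}. g i *s e 0) = 0" using sum0[OF j] by (simp flip: scale_sum_left)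
  qed (rule ij)
  then show False using neq g[OF ij] e_neq0[OF n0(1)] by simp
qed

text \<open>Dual to \<open>core_beta\<close>: a nonzero b forces y = 0, x = w = 1 and z = -1, so
  that b depends only on the first index. That \<open>Delta\<close> negates
  \<open>tau j (e j)\<close> makes the sums of b vanish.\<close>

lemma core_b:
  assumes char: "of_nat (n - 1) \<noteq> (0::'k)"
    and \<beta>0: "\<And>i j u. i < n \<Longrightarrow> j < n \<Longrightarrow> i \<noteq> j \<Longrightarrow> u \<in> U \<Longrightarrow> \<beta> i j u = 0"
    and ij: "i < n" "j < n" "i \<noteq> j"
  shows "b i j = 0"
proof (rule ccontr)
  assume neq: "b i j \<noteq> 0"
  have y: "y = 0" using yb_z\<beta>(1)[OF ij] neq by simp
  have ww: "w * w = 1" and xx: "x * x = 1"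
    using R\<epsilon>R_eqs(1,2)[OF ij] ij by (simp_all add: y \<beta>0 R_e2(2))
  obtain k where k: "k < n" "k \<noteq> i" "k \<noteq> j" using third_index ij by blast
  have chain: "R k j (R i k v) = R i k (R k j (R i j v))" if "i < n" "j < n" "k < n" "i \<noteq> j" "i \<noteq> k" "j \<noteq> k" for i j k v
    using that by (rule R_chain)
  have A1: "A i j u = u" if "i < n" "j < n" "i \<noteq> j" "u \<in> U" for i j u
    by (rule A_trivial[OF _ that]) (simp add: \<beta>0)
  have "cf i (R k j (R i k (e i))) = cf i (R i k (R k j (R i j (e i))))"
    using ij k by (simp add: chain)
  then have "x = x * x" using ij k by (simp add: eval y)
  then have x: "x = 1" using xx by simp
  have "cf j (R k j (R i k (e j))) = cf j (R i k (R k j (R i j (e j))))"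
    using ij k by (simp add: chain)
  then have "w = w * w" using ij k by (simp add: eval y \<beta>0 A1)
  then have w: "w = 1" using ww by simp
  have "cf i (R k j (R i k (e j))) = cf i (R i k (R k j (R i j (e j))))"
    using ij k by (simp add: chain)
  then have "z + z * z = 0" using ij k by (simp add: eval y \<beta>0 A1 x w)
  \<comment> \<open>The \<open>U\<close> component of \<open>R_chain\<close> at \<open>e j\<close>.
    It excludes z = 0, and the equation z + z^2 = 0 then leaves -1.\<close>
  have bb: "b i j = - (z *s b i k)" if "i < n" "j < n" "k < n" "i \<noteq> j" "i \<noteq> k" "j \<noteq> k" for i j k
  proof -
    have "P (R k j (R i k (e j))) = P (R i k (R k j (R i j (e j))))"
      using that by (simp add: chain)
    then have "b k j = z *s b i k + b k j + b i j" using that by (simp add: eval y \<beta>0 A1 x w algebra_simps)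
    then have "z *s b i k + b i j = 0" by (simp add: algebra_simps)
    then show ?thesis by (metis eq_neg_iff_add_eq_0 add.commute)
  qed
  have "z \<noteq> 0" using bb[of i j k] ij k neq by auto
  moreover have "z * (1 + z) = 0" using \<open>z + z * z = 0\<close> by (simp add: algebra_simps)
  ultimately have "z + 1 = 0" by (simp add: add.commute)
  then have z: "z = - 1" by (simp only: eq_neg_iff_add_eq_0)
  have b_eq: "b i j = b i k" if "i < n" "j < n" "k < n" "i \<noteq> j" "i \<noteq> k" for i j k
    using bb[of i j k] that z by (cases "j = k") auto
  \<comment> \<open>With z = -1 and w = 1 each factor adds \<open>b i j - e i\<close>. The vectors
    added earlier are fixed by the remaining factors, whose first indices are different.\<close>
  have tau: "fold (\<lambda>i. R i j) xs (e j + v) = e j + v + (\<Sum>i\<leftarrow>xs. b i j - e i)"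
    if "j < n" "\<forall>i\<in>set xs. i < n \<and> i \<noteq> j" "distinct xs" "\<forall>i\<in>set xs. R i j v = v" for j xs v
    using that
  proof (induction xs arbitrary: v)
    case (Cons i xs)
    have i: "i < n" "i \<noteq> j" using Cons.prems by auto
    have 1: "R i j (e j + v) = e j + (v + (b i j - e i))"
      using Cons.prems i by (simp add: eval z w algebra_simps)
    have "R k j (v + (b i j - e i)) = v + (b i j - e i)" if k: "k \<in> set xs" for k
    proof -
      have "k < n" "k \<noteq> j" "k \<noteq> i" "R k j v = v" using k Cons.prems by auto
      then show ?thesis using Cons.prems(1) i by (simp add: eval \<beta>0 A1)
    qed
    then have "fold (\<lambda>i. R i j) xs (e j + (v + (b i j - e i))) = e j + (v + (b i j - e i)) + (\<Sum>i\<leftarrow>xs. b i j - e i)"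
      using Cons.prems by (intro Cons.IH) auto
    then show ?case unfolding fold.simps o_apply 1 by (simp add: add_ac)
  qed simp
  have sum0: "(\<Sum>i\<in>{..<n} - {j}. b i j) = 0" if j: "j < n" for j
  proof -
    let ?xs = "filter (\<lambda>i. i \<noteq> j) [0..<n]"
    have set: "set ?xs = {..<n} - {j}" by auto
    have "tau j (e j) = e j + (\<Sum>i\<leftarrow>?xs. b i j - e i)"
      using tau[OF j, of ?xs 0] by (simp add: tau_def R_lin j)
    also have "(\<Sum>i\<leftarrow>?xs. b i j - e i) = (\<Sum>i\<in>{..<n} - {j}. b i j - e i)"
      unfolding set[symmetric] by (rule sum_list_distinct_conv_sum_set) simp
    finally have t: "tau j (e j) = e j + ((\<Sum>i\<in>{..<n} - {j}. b i j) - (\<Sum>i\<in>{..<n} - {j}. e i))"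
      by (simp add: sum_subtractf)
    have lt: "lin (tau j)" unfolding tau_def by (rule fold_lin, rule linear_R) (use j in auto)
    have "Delta (tau j (e j)) = - tau j (e j)"
      using j by (simp add: Delta_tau Delta_e vp.linear_neg[OF lt])
    then have "P (tau j (e j)) = 0" by (simp add: P_def)
    moreover have "P (\<Sum>i\<in>{..<n} - {j}. b i j) = (\<Sum>i\<in>{..<n} - {j}. b i j)"
      using j R_e2(2) subspace_eig by (intro P_U subspace_sum) auto
    moreover have "P (\<Sum>i\<in>{..<n} - {j}. e i) = 0"
    proof -
      have "P (\<Sum>i\<in>I. e i) = 0" if "finite I" "I \<subseteq> {..<n}" for I
        using that by (induction I) (auto simp: P_lin P_e)
      then show ?thesis by simp
    qed
    ultimately show ?thesis using j by (simp add: t P_lin P_e)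
  qed
  define g where "g i = b i (if i = 0 then 1 else 0)" for i
  have g: "b i j = g i" if "i < n" "j < n" "i \<noteq> j" for i j
    unfolding g_def using that by (intro b_eq) auto
  have "g i = 0"
  proof (rule sum_trick[OF char, of g i])
    fix j assume j: "j < n"
    have "(\<Sum>i\<in>{..<n} - {j}. g i) = (\<Sum>i\<in>{..<n} - {j}. b i j)"
      using j g by (intro sum.cong) auto
    then show "(\<Sum>i\<in>{..<n} - {j}. g i) = 0" using sum0[OF j] by simp
  qed (rule ij)
  then show False using neq g[OF ij] by simp
qed

text \<open>Here \<open>\<beta>\<close> and \<open>b\<close> would yield six linearly independent vectors of \<open>U\<close>, which has dimension at most five.\<close>

lemma core_mixed:
  assumes ij: "i < n" "j < n" "i \<noteq> j" and u: "u \<in> U" "\<beta> i j u \<noteq> 0" and nb: "b i j \<noteq> 0"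
  shows False
proof -
  have z: "z = 0" using yb_z\<beta>(2)[OF ij u(1)] u(2) by simp
  have y: "y = 0" using yb_z\<beta>(1)[OF ij] nb by simp
  have xx: "x * x = 1" using R\<epsilon>R_eqs(1)[OF ij] by (simp add: y)
  obtain k where k: "k < n" "k \<noteq> i" "k \<noteq> j" using third_index ij by blast
  have chain: "R k j (R i k v) = R i k (R k j (R i j v))" if "i < n" "j < n" "k < n" "i \<noteq> j" "i \<noteq> k" "j \<noteq> k" for i j k v
    using that by (rule R_chain)
  have "cf i (R k j (R i k (e i))) = cf i (R i k (R k j (R i j (e i))))"
    using ij k by (simp add: chain)
  then have "x = x * x" using ij k by (simp add: eval y)
  then have x: "x = 1" using xx by simp
  have t: "transpose i j permutes {..<n}" using ij by simp
  \<comment> \<open>In \<open>R_three\<close> at \<open>e i\<close>, the coefficient of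
    \<open>e j\<close> is 0 on the left and w on the right. Hence w = 0, in contrast to the cases
    with a single nonzero entry.\<close>
  let ?b = "\<sigma> (transpose i j) (b j i)"
  have bU: "?b \<in> U" using \<sigma>_eig[OF t R_e2(2)[of j i]] ij by simp
  have "e i = L j i (\<sigma> (transpose i j) (\<epsilon> j (R j i (e i))))"
    using R_three'[of i j "e i"] ij by (simp add: R_e1 x y)
  also have "\<sigma> (transpose i j) (\<epsilon> j (R j i (e i))) = w *s e j + ?b"
    using ij t by (simp add: eval z \<sigma>_lin swap_e)
  finally have "cf j (e i) = cf j (L j i (w *s e j + ?b))" by simp
  then have w: "w = 0" using ij bU by (simp add: eval x y)
  \<comment> \<open>From here on each relation among the \<open>R\<close>, read off at a suitable
    coefficient, evaluates one functional \<beta> on one vector b: -1 on matching pairs and 0 on the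
    others that are needed.\<close>
  have diag: "\<beta> i j (b i j) = - 1" if "i < n" "j < n" "i \<noteq> j" for i j
    using R\<epsilon>R_eqs(2)[OF that] by (simp add: z w minus_equation_iff)
  have first: "\<beta> i k (b i j) = 0" if "i < n" "j < n" "k < n" "i \<noteq> j" "i \<noteq> k" "j \<noteq> k" for i j k
  proof -
    have "cf k (R i j (L i k (e j))) = cf k (L i k (R i j (e j)))" using that by (simp add: R_L')
    then show ?thesis using that by (simp add: eval z w)
  qed
  have second: "\<beta> k j (b i j) = 0" if "i < n" "j < n" "k < n" "i \<noteq> j" "i \<noteq> k" "j \<noteq> k" for i j k
  proof -
    have "cf j (R k j (R i k (e j))) = cf j (R i k (R k j (R i j (e j))))" using that by (simp add: chain)
    then show ?thesis using that by (simp add: eval z w)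
  qed
  have disj: "\<beta> k l (b i j) = 0"
    if "i < n" "j < n" "k < n" "l < n" "i \<noteq> j" "k \<noteq> l" "i \<noteq> k" "i \<noteq> l" "j \<noteq> k" "j \<noteq> l" for i j k l
  proof -
    have "cf l (R i j (R k l (e j))) = cf l (R k l (R i j (e j)))" using that by (simp add: R_comm)
    then show ?thesis using that by (simp add: eval z w)
  qed
  have head: "\<beta> k j (b i k) = 0" if "i < n" "j < n" "k < n" "i \<noteq> j" "i \<noteq> k" "j \<noteq> k" for i j k
  proof -
    have "cf j (R k j (R i k (e k))) = cf j (R i k (R k j (R i j (e k))))" using that by (simp add: chain)
    then show ?thesis using that by (simp add: eval x y z w)
  qed
  have tail: "\<beta> i k (b k j) = 0" if "i < n" "j < n" "k < n" "i \<noteq> j" "i \<noteq> k" "j \<noteq> k" for i j k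
  proof -
    have inv: "\<beta> i k (A i j u) = \<beta> i k u" if "u \<in> U" for u
    proof -
      have "cf k (R i k (L i j u)) = cf k (L i j (R i k u))"
        using \<open>i < n\<close> \<open>j < n\<close> \<open>k < n\<close> \<open>i \<noteq> j\<close> \<open>i \<noteq> k\<close> by (simp add: R_L')
      then show ?thesis
        using \<open>i < n\<close> \<open>j < n\<close> \<open>k < n\<close> \<open>i \<noteq> j\<close> \<open>i \<noteq> k\<close> \<open>j \<noteq> k\<close> that by (simp add: eval)
    qed
    have "R k j (R i j v) = R i j (R k j v)" for v using that by (intro R_comm) auto
    then have "cf k (R k j (R i k (e j))) = cf k (R i k (R i j (R k j (e j))))" using that by (simp add: chain)
    then have "\<beta> i k (A i j (b k j)) = 0" using that by (simp add: eval z w)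
    then show ?thesis using inv[OF R_e2(2)[of k j]] that by simp
  qed
  \<comment> \<open>Only increasing pairs are taken, so that opposite pairs (i, j) and (j, i) never
    meet; the earlier facts cover all remaining overlaps.\<close>
  have orth: "\<beta> i j (b k l) = 0" if H: "i < j" "k < l" "j < n" "l < n" "(i, j) \<noteq> (k, l)" for i j k l
  proof -
    have less: "i < n" "k < n" using H by auto
    have ne: "\<not> (i = l \<and> j = k)" "\<not> (i = k \<and> j = l)" using H by auto
    consider "i = k" "j \<noteq> l" | "j = l" "i \<noteq> k" | "i = l" "j \<noteq> k" | "j = k" "i \<noteq> l" | "i \<noteq> k" "i \<noteq> l" "j \<noteq> k" "j \<noteq> l"
      using ne by blast
    then show ?thesis
    proof cases
      case 1 then show ?thesis using first[of i l j] H less by auto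
    next
      case 2 then show ?thesis using second[of k j i] H less by auto
    next
      case 3 then show ?thesis using head[of k j i] H less by auto
    next
      case 4 then show ?thesis using tail[of i l j] H less by auto
    next
      case 5 then show ?thesis using disj[of k l i j] H less by auto
    qed
  qed
  \<comment> \<open>The increasing pairs from the four available indices.\<close>
  let ?S = "{(0, 1), (0, 2), (0, 3), (1, 2), (1, 3), (2, 3 :: nat)} :: (nat \<times> nat) set"
  have S: "fst s < snd s" "snd s < n" "fst s < n" "fst s \<noteq> snd s" if "s \<in> ?S" for s
    using that n0 by auto
  have "card ?S \<le> dim U"
  proof (rule card_le_dim_dual[OF finite_dimensional_vector_space_axioms, of ?S "\<lambda>s. b (fst s) (snd s)" U "\<lambda>s. \<beta> (fst s) (snd s)"])
    show "finite ?S" by simp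
    show "(\<lambda>s. b (fst s) (snd s)) ` ?S \<subseteq> U"
    proof (intro image_subsetI)
      show "b (fst s) (snd s) \<in> U" if "s \<in> ?S" for s using S[OF that] by (intro R_e2(2))
    qed
    show "Vector_Spaces.linear (*s) (*) (\<beta> (fst s) (snd s))" if "s \<in> ?S" for s
    proof -
      have "vector_space ((*) :: 'k \<Rightarrow> _)" by unfold_locales (auto simp: algebra_simps)
      then show ?thesis
        unfolding Vector_Spaces.linear_iff using S[OF that] vector_space_axioms by (simp add: \<beta>_lin)
    qed
    show "\<beta> (fst s) (snd s) (b (fst s) (snd s)) \<noteq> 0" if "s \<in> ?S" for s
      using S[OF that] by (simp add: diag)
    show "\<beta> (fst s) (snd s) (b (fst t) (snd t)) = 0" if "s \<in> ?S" "t \<in> ?S" "s \<noteq> t" for s t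
      using S[OF that(1)] S[OF that(2)] that(3) by (intro orth) (auto simp: prod_eq_iff)
  qed
  moreover have "card ?S = 6" by simp
  ultimately show False using dim_U by simp
qed

theorem core:
  assumes char: "of_nat (n - 1) \<noteq> (0::'k)" and ij: "i < n" "j < n" "i \<noteq> j"
  shows "\<beta> i j u = 0 \<or> u \<notin> U" "b i j = 0"
proof -
  show b: "b i j = 0"
  proof (rule ccontr)
    assume nb: "b i j \<noteq> 0"
    have "\<beta> k l v = 0" if kl: "k < n" "l < n" "k \<noteq> l" "v \<in> U" for k l v
    proof (rule ccontr)
      assume "\<beta> k l v \<noteq> 0"
      moreover have "b k l \<noteq> 0" using b_zero[OF kl(1-3) ij] nb by blast
      ultimately show False using core_mixed[OF kl] by blast
    qed
    then have "b i j = 0" by (rule core_b[OF char _ ij])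
    then show False using nb by simp
  qed
  have "\<beta> i j u = 0" if u: "u \<in> U"
  proof (rule core_beta[OF char _ ij u])
    show "b k l = 0" if "k < n" "l < n" "k \<noteq> l" for k l by (rule b_zero[OF ij that b])
  qed
  then show "\<beta> i j u = 0 \<or> u \<notin> U" by blast
qed

lemma core_commute:
  assumes char: "of_nat (n - 1) \<noteq> (0::'k)" and ij: "i < n" "j < n" "i \<noteq> j"
  shows "u \<in> U \<Longrightarrow> R i j u = L i j u" "k < n \<Longrightarrow> R i j (e k) = L i j (e k)"
proof -
  show "R i j u = L i j u" if "u \<in> U" using core(1)[OF char ij, of u] that ij by (simp add: R_U L_U)
  show "R i j (e k) = L i j (e k)" if "k < n"
  proof -
    consider "k = i" | "k = j" | "k \<noteq> i" "k \<noteq> j" by blast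
    then show ?thesis
      by cases (use core(2)[OF char ij] ij that in \<open>simp_all add: R_e1 L_e1 R_e2 L_e2 R_e_other L_e_other\<close>)
  qed
qed

end

section \<open>Dimension count over sign patterns\<close>

context out_rep begin

text \<open>The whole space is the sum of the eigenspaces, phrased as an induction rule. In the
  proof, d counts the indices whose sign is still undetermined.\<close>

lemma eig_induct:
  assumes eig: "\<And>I v. I \<subseteq> {..<n} \<Longrightarrow> v \<in> eig I \<Longrightarrow> Q v" and add: "\<And>v w. Q v \<Longrightarrow> Q w \<Longrightarrow> Q (v + w)"
  shows "Q v"
proof -
  have "Q v" if "d \<le> n" "I \<subseteq> {..<n - d}" "\<And>k. k < n - d \<Longrightarrow> \<epsilon> k v = sg I k *s v" for d v I
    using that
  proof (induction d arbitrary: v I)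
    case 0
    then show ?case using eig[of I v] by (simp add: eig_sg)
  next
    case (Suc d)
    let ?i = "n - Suc d"
    have i: "?i < n" "?i \<notin> I" using Suc.prems by auto
    obtain v1 v2 where v: "v = v1 + v2" "\<epsilon> ?i v1 = v1" "\<epsilon> ?i v2 = - 1 *s v2"
      "\<And>k c. k < n \<Longrightarrow> \<epsilon> k v = c *s v \<Longrightarrow> \<epsilon> k v1 = c *s v1 \<and> \<epsilon> k v2 = c *s v2"
      by (rule \<epsilon>_split[OF i(1), of v], (rule that; assumption))
    have less: "k < ?i \<or> k = ?i" if "k < n - d" for k using that by auto
    have old: "\<epsilon> k v1 = sg I k *s v1" "\<epsilon> k v2 = sg I k *s v2" if "k < ?i" for k
      using v(4)[of k, OF _ Suc.prems(3)[OF that]] that by auto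
    have "Q v1"
    proof (rule Suc.IH)
      show "\<epsilon> k v1 = sg I k *s v1" if "k < n - d" for k
        using less[OF that] old(1) v(2) i(2) by auto
    qed (use Suc.prems in auto)
    moreover have "Q v2"
    proof (rule Suc.IH)
      show "insert ?i I \<subseteq> {..<n - d}" using Suc.prems by auto
      show "\<epsilon> k v2 = sg (insert ?i I) k *s v2" if "k < n - d" for k
        using less[OF that] old(2) v(3) by auto
    qed (use Suc.prems in auto)
    ultimately show ?case using v(1) add by simp
  qed
  from this[of n "{}" v] show ?thesis by simp
qed

text \<open>The dimension of an eigenspace with k minus signs; {..<k} stands for all sets of that
  size by \<open>dim_eig\<close>.\<close>

definition D :: "nat \<Rightarrow> nat" where "D k = dim (eig {..<k})"

text \<open>Different sign patterns are separated by some \<epsilon>, as 1 and -1 differ. Bases of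
  the eigenspaces, taken together, are therefore independent.\<close>

lemma sum_dim_eig:
  assumes "finite F" "F \<subseteq> Pow {..<n}"
  shows "(\<Sum>I\<in>F. dim (eig I)) \<le> dim (UNIV :: 'v set)"
proof -
  have "\<forall>I. \<exists>B. B \<subseteq> eig I \<and> independent B \<and> card B = dim (eig I)"
    using basis_exists by metis
  then obtain B where B: "\<And>I. B I \<subseteq> eig I" "\<And>I. independent (B I)" "\<And>I. card (B I) = dim (eig I)"
    by metis
  have finB: "finite (B I)" for I using B(2) by (rule finiteI_independent)
  have "card (Sigma F B) \<le> dim (UNIV :: 'v set)"
  proof (rule card_le_dimI[OF finite_dimensional_vector_space_axioms, of _ snd])
    show "finite (Sigma F B)" using assms finB by auto
    fix a assume "(\<Sum>s\<in>Sigma F B. a s *s snd s) = 0"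
    then have sum: "(\<Sum>I\<in>F. \<Sum>x\<in>B I. a (I, x) *s x) = 0"
      using assms finB by (subst sum.Sigma) (auto simp: case_prod_unfold)
    let ?v = "\<lambda>I. \<Sum>x\<in>B I. a (I, x) *s x"
    have v: "?v I \<in> eig I" for I
      using B(1) subspace_eig by (intro subspace_sum subspace_scale) auto
    have ne: "(1::'k) \<noteq> - 1" using two by (metis add.right_inverse one_add_one)
    have zero: "\<forall>I\<in>F. ?v I = 0"
    proof (rule joint_eigen_sum_zero[OF assms(1), of "{..<n}" \<epsilon> ?v sg])
      show "\<epsilon> k (?v I) = sg I k *s ?v I" if "I \<in> F" "k \<in> {..<n}" for I k
        using v[of I] that unfolding eig_sg by blast
      show "\<exists>k\<in>{..<n}. sg I k \<noteq> sg I' k" if "I \<in> F" "I' \<in> F" "I \<noteq> I'" for I I'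
      proof -
        obtain k where k: "(k \<in> I) \<noteq> (k \<in> I')" using \<open>I \<noteq> I'\<close> by blast
        then have "k \<in> {..<n}" using that assms(2) by auto
        moreover have "sg I k \<noteq> sg I' k" using k ne ne[symmetric] by auto
        ultimately show ?thesis by blast
      qed
    qed (use sum linear_\<epsilon> in auto)
    show "\<forall>s\<in>Sigma F B. a s = 0"
    proof
      fix s assume s: "s \<in> Sigma F B"
      then obtain I x where Ix: "s = (I, x)" "I \<in> F" "x \<in> B I" by blast
      have "?v I = 0" using zero Ix(2) by blast
      then have "a (I, x) = 0"
        using independentD[OF B(2)[of I] finB order_refl, of "\<lambda>x. a (I, x)" x] Ix(3) by blast
      then show "a s = 0" using Ix(1) by simp
    qed
  qed simp
  moreover have "card (Sigma F B) = (\<Sum>I\<in>F. dim (eig I))"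
    using assms(1) finB by (simp add: B(3) card_SigmaI)
  ultimately show ?thesis by simp
qed

lemma dim_eig_perm:
  assumes "\<pi> permutes {..<n}"
  shows "dim (eig I) \<le> dim (eig (\<pi> ` I))"
proof -
  obtain B where B: "B \<subseteq> eig I" "independent B" "card B = dim (eig I)"
    using basis_exists by metis
  have fin: "finite B" using B(2) by (rule finiteI_independent)
  have "card B \<le> dim (eig (\<pi> ` I))"
  proof (rule card_le_dimI[OF finite_dimensional_vector_space_axioms fin, of "\<sigma> \<pi>"])
    show "\<sigma> \<pi> ` B \<subseteq> eig (\<pi> ` I)" using B(1) \<sigma>_eig[OF assms] by blast
    fix a assume "(\<Sum>x\<in>B. a x *s \<sigma> \<pi> x) = 0"
    then have "\<sigma> \<pi> (\<Sum>x\<in>B. a x *s x) = 0" using assms by (simp add: \<sigma>_lin)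
    then have "(\<Sum>x\<in>B. a x *s x) = 0" using \<sigma>_zero[OF assms] by blast
    then show "\<forall>x\<in>B. a x = 0" using independentD[OF B(2) fin order_refl, of a] by blast
  qed
  then show ?thesis using B(3) by simp
qed

lemma perm_onto:
  assumes "I \<subseteq> {..<n}" "J \<subseteq> {..<n}" "card I = card J"
  obtains \<pi> where "\<pi> permutes {..<n}" "\<pi> ` I = J"
proof -
  have fin: "finite I" "finite J" using assms finite_subset by blast+
  obtain f where f: "bij_betw f I J" using finite_same_card_bij[OF fin assms(3)] by blast
  have "card ({..<n} - I) = card ({..<n} - J)" using assms fin by (simp add: card_Diff_subset)
  then obtain g where g: "bij_betw g ({..<n} - I) ({..<n} - J)"
    using finite_same_card_bij[of "{..<n} - I" "{..<n} - J"] by auto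
  let ?p = "\<lambda>x. if x \<in> I then f x else if x < n then g x else x"
  have pI: "bij_betw ?p I J"
    by (rule iffD2[OF bij_betw_cong[of I ?p f J] f]) simp
  have "bij_betw ?p ({..<n} - I) ({..<n} - J)"
    by (rule iffD2[OF bij_betw_cong[of _ ?p g] g]) simp
  with pI have "bij_betw ?p (I \<union> ({..<n} - I)) (J \<union> ({..<n} - J))"
    by (rule bij_betw_combine) (rule Diff_disjoint)
  moreover have "I \<union> ({..<n} - I) = {..<n}" "J \<union> ({..<n} - J) = {..<n}" using assms by blast+
  ultimately have "bij_betw ?p {..<n} {..<n}" by (simp only:)
  then have "?p permutes {..<n}" by (rule bij_imp_permutes) (use assms in auto)
  moreover have "?p ` I = J" using pI by (rule bij_betw_imp_surj_on)
  ultimately show ?thesis by (rule that)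
qed

lemma dim_eig:
  assumes "I \<subseteq> {..<n}"
  shows "dim (eig I) = D (card I)"
proof -
  have c: "card I \<le> n" using card_mono[OF _ assms] by simp
  have sub: "{..<card I} \<subseteq> {..<n}" using c by auto
  obtain \<pi> where p: "\<pi> permutes {..<n}" "\<pi> ` I = {..<card I}" by (rule perm_onto[OF assms sub]) auto
  obtain \<rho> where r: "\<rho> permutes {..<n}" "\<rho> ` {..<card I} = I" by (rule perm_onto[OF sub assms]) auto
  show ?thesis
    using dim_eig_perm[OF p(1), of I] dim_eig_perm[OF r(1), of "{..<card I}"] by (simp add: p r D_def)
qed

text \<open>Every set size k contributes \<open>n choose k\<close> eigenspaces of equal dimension.
  Only the sizes of interest are put into \<open>K\<close>.\<close>

lemma dim_count:
  assumes "finite K"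
  shows "(\<Sum>k\<in>K. (n choose k) * D k) \<le> dim (UNIV :: 'v set)"
proof -
  let ?F = "\<lambda>k. {I. I \<subseteq> {..<n} \<and> card I = k}"
  have fin: "finite (?F k)" for k by (rule finite_subset[of _ "Pow {..<n}"]) auto
  have "(\<Sum>I\<in>(\<Union>k\<in>K. ?F k). dim (eig I)) = (\<Sum>k\<in>K. \<Sum>I\<in>?F k. dim (eig I))"
    using assms fin by (intro sum.UNION_disjoint) auto
  also have "\<dots> = (\<Sum>k\<in>K. (n choose k) * D k)"
  proof (rule sum.cong[OF refl])
    fix k
    have "(\<Sum>I\<in>?F k. dim (eig I)) = (\<Sum>I\<in>?F k. D k)" by (intro sum.cong) (auto simp: dim_eig)
    then show "(\<Sum>I\<in>?F k. dim (eig I)) = (n choose k) * D k" using n_subsets[of "{..<n}" k] by simp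
  qed
  finally have eq: "(\<Sum>I\<in>(\<Union>k\<in>K. ?F k). dim (eig I)) = (\<Sum>k\<in>K. (n choose k) * D k)" .
  show ?thesis
  proof -
    have "finite (\<Union>k\<in>K. ?F k)" using assms fin by (rule finite_UN_I)
    moreover have "(\<Union>k\<in>K. ?F k) \<subseteq> Pow {..<n}" by blast
    ultimately show ?thesis using sum_dim_eig[of "\<Union>k\<in>K. ?F k"] unfolding eq by blast
  qed
qed

lemma D_pos: "I \<subseteq> {..<n} \<Longrightarrow> v \<in> eig I \<Longrightarrow> v \<noteq> 0 \<Longrightarrow> 0 < D (card I)"
  using dim_eq_0[of "eig I"] dim_eig[of I] by auto

lemma D_zero: "I \<subseteq> {..<n} \<Longrightarrow> v \<in> eig I \<Longrightarrow> D (card I) = 0 \<Longrightarrow> v = 0"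
  using D_pos[of I v] by fastforce

lemma R_block:
  assumes ij: "i < n" "j < n" "i \<noteq> j" and v: "v \<in> eig I"
  obtains w1 w2 w3 w4 where "w1 \<in> eig (I - {i, j})" "w2 \<in> eig (insert i (I - {i, j}))"
    "w3 \<in> eig (insert j (I - {i, j}))" "w4 \<in> eig (insert i (insert j (I - {i, j})))"
    "R i j v = w1 + w2 + w3 + w4"
proof -
  have "\<epsilon> k (R i j v) = (if k \<in> I - {i, j} then - R i j v else R i j v)" if "k < n" "k \<noteq> i" "k \<noteq> j" for k
    using that ij eigD[OF v that(1)] by (simp add: \<epsilon>_R R_lin)
  from block_decomp[OF ij _ _ this] show ?thesis using that by blast
qed

lemma \<epsilon>\<epsilon>_block:
  assumes "i < n" "j < n" "i \<noteq> j" "w1 \<in> eig (I - {i, j})" "w2 \<in> eig (insert i (I - {i, j}))"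
    "w3 \<in> eig (insert j (I - {i, j}))" "w4 \<in> eig (insert i (insert j (I - {i, j})))"
  shows "\<epsilon> i (\<epsilon> j (w1 + w2 + w3 + w4)) = w1 - w2 - w3 + w4"
  using assms by (simp add: \<epsilon>_lin eigD[OF assms(4)] eigD[OF assms(5)] eigD[OF assms(6)] eigD[OF assms(7)])

text \<open>\<open>L i j v\<close> is, up to the sign by which
  \<open>\<epsilon> i (\<epsilon> j v)\<close> differs from \<open>v\<close>, the image of
  \<open>R i j v\<close> under both sign changes. Hence the difference lives on patterns that differ
  from I at exactly one of i and j.\<close>

lemma consecutive:
  assumes ij: "i < n" "j < n" "i \<noteq> j" and I: "I \<subseteq> {..<n}" and v: "v \<in> eig I" and neq: "R i j v \<noteq> L i j v"
  shows "\<exists>k. k + 1 \<le> n \<and> 0 < D k \<and> 0 < D (k + 1)"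
proof -
  let ?J = "I - {i, j}"
  obtain w1 w2 w3 w4 where w: "w1 \<in> eig ?J" "w2 \<in> eig (insert i ?J)" "w3 \<in> eig (insert j ?J)"
    "w4 \<in> eig (insert i (insert j ?J))" "R i j v = w1 + w2 + w3 + w4"
    by (rule R_block[OF ij v])
  note eps = \<epsilon>\<epsilon>_block[OF ij w(1-4)]
  have finI: "finite ?J" using I finite_subset by blast
  have sub: "?J \<subseteq> {..<n}" "insert i ?J \<subseteq> {..<n}" "insert j ?J \<subseteq> {..<n}" "insert i (insert j ?J) \<subseteq> {..<n}"
    using I ij by auto
  define k where "k = card ?J"
  have card: "card (insert i ?J) = k + 1" "card (insert j ?J) = k + 1" "card (insert i (insert j ?J)) = k + 2"
    using finI ij by (simp_all add: k_def del: card_Diff_insert)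
  have k2: "k + 2 \<le> n" using card_mono[OF _ sub(4)] card(3) by simp
  have nz: "w1 \<noteq> 0 \<Longrightarrow> 0 < D k" "w2 \<noteq> 0 \<Longrightarrow> 0 < D (k + 1)" "w3 \<noteq> 0 \<Longrightarrow> 0 < D (k + 1)" "w4 \<noteq> 0 \<Longrightarrow> 0 < D (k + 2)"
    using D_pos[OF sub(1) w(1)] D_pos[OF sub(2) w(2)] D_pos[OF sub(3) w(3)] D_pos[OF sub(4) w(4)]
    unfolding card k_def[symmetric] by blast+
  have v0: "v \<noteq> 0" using neq ij by (auto simp: R_lin L_lin)
  then have DI: "0 < D (card I)" using D_pos[OF I v] by simp
  \<comment> \<open>Here I contains both or none of i and j, and the difference is twice
    \<open>w2 + w3\<close>, the part with exactly one of them.\<close>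
  have even: ?thesis if e: "\<epsilon> i (\<epsilon> j v) = v" and c: "0 < D k \<or> 0 < D (k + 2)"
  proof -
    have "L i j v = w1 - w2 - w3 + w4" by (simp only: L_def e w(5) eps)
    then have "w2 \<noteq> 0 \<or> w3 \<noteq> 0" using neq w(5) by auto
    then have "0 < D (k + 1)" using nz(2,3) by (elim disjE) simp_all
    then show ?thesis using c k2
    proof (elim disjE)
      assume "0 < D k" "0 < D (k + 1)"
      then show ?thesis using k2 by (intro exI[of _ k]) simp
    next
      assume "0 < D (k + 2)" "0 < D (k + 1)"
      then show ?thesis using k2 by (intro exI[of _ "k + 1"]) simp
    qed
  qed
  \<comment> \<open>Here I contains one of i and j, and the difference is twice
    \<open>w1 + w4\<close>, the part with none or both.\<close>
  have odd: ?thesis if e: "\<epsilon> i (\<epsilon> j v) = - v" and c: "0 < D (k + 1)"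
  proof -
    have "L i j v = \<epsilon> i (\<epsilon> j (- (w1 + w2 + w3 + w4)))" by (simp only: L_def e R_lin(4)[OF ij] w(5))
    also have "\<dots> = - (w1 - w2 - w3 + w4)" by (simp only: \<epsilon>_lin(4)[OF ij(2)] \<epsilon>_lin(4)[OF ij(1)] eps)
    finally have "w1 \<noteq> 0 \<or> w4 \<noteq> 0" using neq w(5) by auto
    then have "0 < D k \<or> 0 < D (k + 2)" using nz(1,4) by (elim disjE) simp_all
    then show ?thesis
    proof
      assume "0 < D k"
      then show ?thesis using c k2 by (intro exI[of _ k]) simp
    next
      assume "0 < D (k + 2)"
      then show ?thesis using c k2 by (intro exI[of _ "k + 1"]) simp
    qed
  qed
  have \<epsilon>v: "\<epsilon> i v = (if i \<in> I then - v else v)" "\<epsilon> j v = (if j \<in> I then - v else v)"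
    by (rule eigD[OF v ij(1)], rule eigD[OF v ij(2)])
  consider "i \<in> I" "j \<in> I" | "i \<in> I" "j \<notin> I" | "i \<notin> I" "j \<in> I" | "i \<notin> I" "j \<notin> I" by blast
  then show ?thesis
  proof cases
    case 1
    then have eq: "I = insert i (insert j ?J)" by blast
    have "0 < D (k + 2)" using DI arg_cong[OF eq, of card] card(3) by simp
    then show ?thesis using 1 \<epsilon>v ij by (intro even) (simp_all add: \<epsilon>_lin(4))
  next
    case 4
    then have eq: "I = ?J" by blast
    have "0 < D k" using DI arg_cong[OF eq, of card] k_def by simp
    then show ?thesis using 4 \<epsilon>v ij by (intro even) simp_all
  next
    case 2
    then have eq: "I = insert i ?J" by blast
    have "0 < D (k + 1)" using DI arg_cong[OF eq, of card] card(1) by simp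
    then show ?thesis using 2 \<epsilon>v ij by (intro odd) simp_all
  next
    case 3
    then have eq: "I = insert j ?J" by blast
    have "0 < D (k + 1)" using DI arg_cong[OF eq, of card] card(2) by simp
    then show ?thesis using 3 \<epsilon>v ij by (intro odd) (simp_all add: \<epsilon>_lin(4))
  qed
qed

lemma choose_ge:
  assumes "n \<le> 5" "0 < k" "k < n"
  shows "n \<le> n choose k"
proof -
  have "n = 4 \<or> n = 5" using n4 assms by auto
  moreover have "k = 1 \<or> k = 2 \<or> k = 3 \<or> k = 4" using assms by auto
  ultimately show ?thesis using assms(3) by (elim disjE) (simp_all add: numeral_eq_Suc)
qed

text \<open>Two neighbouring inner layers would need dimension at least 10 for n = 4 and 15 for n =
  5, against the bounds 8 and 10.\<close>

lemma choose_consecutive: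
  assumes "n \<le> 5" "0 < k" "k + 1 < n"
  shows "2 * n < (n choose k) + (n choose (k + 1))"
proof -
  have "n = 4 \<or> n = 5" using n4 assms by auto
  moreover have "k = 1 \<or> k = 2 \<or> k = 3" using assms by auto
  ultimately show ?thesis using assms(3) by (elim disjE) (simp_all add: numeral_eq_Suc)
qed

text \<open>Sign patterns with \<open>k\<close> minus signs come in orbits of length \<open>n choose k\<close>, so by the dimension bound
  two neighbouring values of \<open>k\<close> can occur only at the two ends; twisting by the determinant exchanges the ends.\<close>

lemma low_case:
  assumes n5: "n \<le> 5" and dim: "dim (UNIV :: 'v set) \<le> 2 * n" and char: "of_nat (n - 1) \<noteq> (0::'k)"
    and D: "0 < D 0" "0 < D 1" and ij: "i < n" "j < n" "i \<noteq> j"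
  shows "R i j v = L i j v"
proof -
  have 01: "D 0 + n * D 1 \<le> 2 * n" using dim_count[of "{0, 1}"] dim by simp
  \<comment> \<open>The bound 2n minus the positive \<open>D 0\<close> leaves room for a single copy
    of the n singleton patterns, and at most n dimensions for \<open>U\<close>.\<close>
  have D1: "D 1 = 1"
  proof (rule ccontr)
    assume "D 1 \<noteq> 1"
    then have "2 \<le> D 1" using D by simp
    then have "n * 2 \<le> n * D 1" by (rule mult_le_mono2)
    then show False using 01 D(1) by linarith
  qed
  then have D0: "D 0 \<le> n" using 01 by simp
  \<comment> \<open>A further inner layer takes at least n dimensions, in excess by
    \<open>D 0\<close>.\<close>
  have Dk: "D k = 0" if k: "2 \<le> k" "k < n" for k
  proof (rule ccontr)
    assume "D k \<noteq> 0"
    have "D 0 + (n * D 1 + (n choose k) * D k) \<le> 2 * n" using dim_count[of "{0, 1, k}"] dim k by simp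
    moreover have "n \<le> (n choose k) * D k" using choose_ge[of k] n5 k \<open>D k \<noteq> 0\<close>
      by (cases "D k") auto
    ultimately show False using D D1 by simp
  qed
  obtain B where B: "B \<subseteq> eig {0}" "independent B" "eig {0} \<subseteq> span B" "card B = dim (eig {0})"
    by (rule basis_exists[of "eig {0}"])
  have "{..<1} = {0::nat}" by auto
  then have "card B = 1" using B(4) D1 by (simp add: D_def)
  then obtain e0 where e0: "B = {e0}" using card_1_singletonE by blast
  have "out_rep_core (*s) Basis n R \<epsilon> \<sigma> e0"
  proof unfold_locales
    show "e0 \<noteq> 0" using B(2) e0 dependent_zero by blast
    show "e0 \<in> eig {0}" using B(1) e0 by blast
    show "\<exists>c. v = c *s e0" if "v \<in> eig {0}" for v using that B(3) e0 by (auto simp: span_singleton)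
    show "v = 0" if "I \<subseteq> {..<n}" "2 \<le> card I" "card I < n" "v \<in> eig I" for I v
      using D_zero[OF that(1,4) Dk[OF that(2,3)]] .
    show "dim (eig {}) \<le> n" using D0 by (simp add: D_def)
  qed (rule n5)
  then interpret c: out_rep_core "(*s)" Basis n R \<epsilon> \<sigma> e0 .
  show ?thesis
  proof (induction v rule: eig_induct)
    case (1 I v)
    have "card I \<le> n" using card_mono[OF _ 1(1)] by simp
    then consider "card I = 0" | "card I = 1" | "2 \<le> card I" "card I < n" | "card I = n" by linarith
    then show ?case
    proof cases
      case 1
      then have "I = {}" using \<open>I \<subseteq> {..<n}\<close> finite_subset by fastforce
      then show ?thesis using c.core_commute(1)[OF char ij] \<open>v \<in> eig I\<close> by blast
    next
      case 2
      then obtain k where k: "I = {k}" using card_1_singletonE by blast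
      then have "k < n" using \<open>I \<subseteq> {..<n}\<close> by simp
      moreover obtain a where "v = a *s c.e k" using c.eig_single[OF \<open>k < n\<close>] \<open>v \<in> eig I\<close> k by blast
      ultimately show ?thesis using c.core_commute(2)[OF char ij] ij by (simp add: R_lin L_lin)
    next
      case 3
      then have "v = 0" using D_zero[OF 1(1,2) Dk] by blast
      then show ?thesis using ij by (simp add: R_lin L_lin)
    next
      case 4
      \<comment> \<open>The full pattern is not part of \<open>out_rep_core\<close>'s analysis.
        There the two components with n-1 minus signs vanish, and on the remaining two
        \<open>R\<close> and \<open>L\<close> agree.\<close>
      then have I: "I = {..<n}" using card_subset_eq[OF _ 1(1)] by simp
      let ?J = "I - {i, j}"
      obtain w1 w2 w3 w4 where w: "w1 \<in> eig ?J" "w2 \<in> eig (insert i ?J)" "w3 \<in> eig (insert j ?J)"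
        "w4 \<in> eig (insert i (insert j ?J))" "R i j v = w1 + w2 + w3 + w4"
        by (rule R_block[OF ij 1(2)])
      note eps = \<epsilon>\<epsilon>_block[OF ij w(1-4)]
      have "card ?J = n - 2" unfolding I using ij by (subst card_Diff_subset) auto
      moreover have "finite ?J" unfolding I by simp
      ultimately have card: "card (insert i ?J) = n - 1" "card (insert j ?J) = n - 1"
        using n4 by simp_all
      have "w2 = 0" using D_zero[OF _ w(2)] Dk[of "n - 1"] n4 card ij I by simp
      moreover have "w3 = 0" using D_zero[OF _ w(3)] Dk[of "n - 1"] n4 card ij I by simp
      ultimately have "R i j v = w1 + w4" "\<epsilon> i (\<epsilon> j (R i j v)) = w1 + w4" using w(5) eps by simp_all
      moreover have "L i j v = \<epsilon> i (\<epsilon> j (R i j v))" using ij eigD[OF 1(2)] I by (simp add: L_def \<epsilon>_lin)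
      ultimately show ?thesis by simp
    qed
  next
    case (2 v w)
    then show ?case using ij by (simp add: R_lin L_lin)
  qed
qed

section \<open>Twisting by the determinant\<close>

abbreviation "\<epsilon>' \<equiv> \<lambda>i v. - \<epsilon> i v"
abbreviation "\<sigma>' \<equiv> \<lambda>\<pi> v. of_int (sign \<pi>) *s \<sigma> \<pi> v"

lemma fold_twist: "set xs \<subseteq> {..<n} \<Longrightarrow> fold \<epsilon>' xs v = (if even (length xs) then fold \<epsilon> xs v else - fold \<epsilon> xs v)"
proof (induction xs rule: rev_induct)
  case (snoc x xs)
  then have "\<epsilon> x (- w) = - \<epsilon> x w" for w by (intro \<epsilon>_lin) auto
  then show ?case using snoc by simp
qed simp

lemma lin_neg: "lin f \<Longrightarrow> lin (\<lambda>v. - f v)"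
  unfolding Vector_Spaces.linear_iff by simp

lemma lin_scale: "lin f \<Longrightarrow> lin (\<lambda>v. c *s f v)"
  unfolding Vector_Spaces.linear_iff by (simp add: scale_right_distrib scale_left_commute)

lemma lin_comp_fold:
  assumes "\<And>x. x \<in> set xs \<Longrightarrow> lin (f x)"
  shows "fold f xs (- v) = - fold f xs v"
  using assms
proof (induction xs arbitrary: v)
  case (Cons x xs)
  then show ?case by (simp add: vp.linear_neg)
qed simp

text \<open>Sign changes have determinant -1, permutations their sign, and \<open>R i j\<close> has
  determinant 1. The determinant is a character of the group, so both sides of each relation acquire
  the same sign.\<close>

lemma twisted: "out_rep (*s) Basis n R \<epsilon>' \<sigma>'"
proof (intro out_rep.intro out_rep_axioms.intro)
  show "finite_dimensional_vector_space (*s) Basis" by (rule finite_dimensional_vector_space_axioms)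
  show "4 \<le> n" by (rule n4)
  show "(2::'k) \<noteq> 0" by (rule two)
  show "lin (R i j)" if "i < n" "j < n" "i \<noteq> j" for i j by (rule linear_R[OF that])
  show "lin (\<epsilon>' i)" if "i < n" for i by (rule lin_neg[OF linear_\<epsilon>[OF that]])
  show "lin (\<sigma>' \<pi>)" if "\<pi> permutes {..<n}" for \<pi> by (rule lin_scale[OF linear_\<sigma>[OF that]])
  show "\<epsilon>' i (\<epsilon>' i v) = v" if "i < n" for i v using that by (simp add: \<epsilon>_lin(4))
  show "\<epsilon>' i (\<epsilon>' j v) = \<epsilon>' j (\<epsilon>' i v)" if "i < n" "j < n" for i j v
    using that \<epsilon>_comm[OF that] by (simp add: \<epsilon>_lin(4))
  show "\<epsilon>' k (R i j v) = R i j (\<epsilon>' k v)" if "i < n" "j < n" "i \<noteq> j" "k < n" "k \<noteq> i" "k \<noteq> j" for i j k v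
    using \<epsilon>_R[OF that] R_lin(4)[OF that(1-3)] by simp
  show "R i j (\<epsilon>' j (R i j v)) = \<epsilon>' j v" if "i < n" "j < n" "i \<noteq> j" for i j v
    using R_\<epsilon>_R[OF that] R_lin(4)[OF that] by simp
  show "R i j (R k l v) = R k l (R i j v)"
    if "i < n" "j < n" "i \<noteq> j" "k < n" "l < n" "k \<noteq> l" "i \<noteq> k" "i \<noteq> l" "j \<noteq> k" for i j k l v
    by (rule R_comm[OF that])
  have LL: "\<epsilon>' i (\<epsilon>' j (R i j (\<epsilon>' i (\<epsilon>' j v)))) = \<epsilon> i (\<epsilon> j (R i j (\<epsilon> i (\<epsilon> j v))))"
    if "i < n" "j < n" for i j v
    using that by (simp add: \<epsilon>_lin(4))
  show "R i j (\<epsilon>' i (\<epsilon>' k (R i k (\<epsilon>' i (\<epsilon>' k v))))) = \<epsilon>' i (\<epsilon>' k (R i k (\<epsilon>' i (\<epsilon>' k (R i j v)))))"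
    if "i < n" "j < n" "i \<noteq> j" "k < n" "i \<noteq> k" for i j k v
    using R_L[OF that] by (simp only: LL[OF that(1,4)])
  show "R k j (R i k v) = R i k (R k j (R i j v))"
    if "i < n" "j < n" "k < n" "i \<noteq> j" "i \<noteq> k" "j \<noteq> k" for i j k v
    by (rule R_chain[OF that])
  show "\<sigma>' \<pi> (\<sigma>' \<rho> v) = \<sigma>' (\<pi> \<circ> \<rho>) v" if "\<pi> permutes {..<n}" "\<rho> permutes {..<n}" for \<pi> \<rho> v
  proof -
    have "permutation \<pi>" "permutation \<rho>" using that by (auto simp: permutation_permutes)
    then have "sign (\<pi> \<circ> \<rho>) = sign \<pi> * sign \<rho>" by (rule sign_compose)
    then show ?thesis using \<sigma>_comp[OF that] by (simp add: \<sigma>_lin(2)[OF that(1)])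
  qed
  show "\<sigma>' id v = v" for v by (simp add: \<sigma>_id)
  show "\<sigma>' \<pi> (R i j v) = R (\<pi> i) (\<pi> j) (\<sigma>' \<pi> v)"
    if "\<pi> permutes {..<n}" "i < n" "j < n" "i \<noteq> j" for \<pi> i j v
    using \<sigma>_R[OF that] that perm_less[OF that(1)] perm_eq[OF that(1)] by (simp add: R_lin(2))
  show "\<sigma>' \<pi> (\<epsilon>' i v) = \<epsilon>' (\<pi> i) (\<sigma>' \<pi> v)" if "\<pi> permutes {..<n}" "i < n" for \<pi> i v
    using \<sigma>_\<epsilon>[OF that] perm_less[OF that] by (simp add: \<sigma>_lin(4)[OF that(1)] \<epsilon>_lin(2))
  show "R i j v = \<epsilon>' j (\<epsilon>' i (R j i (\<epsilon>' j (\<epsilon>' i (\<sigma>' (transpose i j) (\<epsilon>' j (R j i v)))))))"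
    if "i < n" "j < n" "i \<noteq> j" for i j v
  proof -
    \<comment> \<open>The transposition and the one unpaired sign change in \<open>R_three\<close>
      contribute -1 each; the other sign changes come in pairs.\<close>
    have "sign (transpose i j) = - 1" using that by (simp add: sign_swap_id)
    moreover have t: "transpose i j permutes {..<n}" using that by simp
    ultimately have "\<sigma>' (transpose i j) (\<epsilon>' j w) = \<sigma> (transpose i j) (\<epsilon> j w)" for w
      by (simp add: \<sigma>_lin(4)[OF t])
    then show ?thesis using R_three[OF that] LL[OF that(2,1)] by simp
  qed
  show "fold \<epsilon>' [0..<n] (fold (\<lambda>i. R i j) (filter (\<lambda>i. i \<noteq> j) [0..<n]) v) =
      fold (\<lambda>i. R i j) (filter (\<lambda>i. i \<noteq> j) [0..<n]) (fold \<epsilon>' [0..<n] v)" if "j < n" for j v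
  proof -
    have "set [0..<n] \<subseteq> {..<n}" by auto
    note ft = fold_twist[OF this]
    have neg: "fold (\<lambda>i. R i j) (filter (\<lambda>i. i \<noteq> j) [0..<n]) (- v) = - fold (\<lambda>i. R i j) (filter (\<lambda>i. i \<noteq> j) [0..<n]) v" for v
      by (rule lin_comp_fold) (use that linear_R in auto)
    show ?thesis unfolding ft using \<Delta>_\<tau>[OF that, of v] neg by simp
  qed
qed

text \<open>Neighbouring layers can occur only at an end. The lower end is \<open>low_case\<close>;
  the upper end becomes the lower one after the twist.\<close>

theorem R_eq_L:
  assumes n5: "n \<le> 5" and dim: "dim (UNIV :: 'v set) \<le> 2 * n" and char: "of_nat (n - 1) \<noteq> (0::'k)"
    and ij: "i < n" "j < n" "i \<noteq> j"
  shows "R i j v = L i j v"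
proof (induction v rule: eig_induct)
  case (2 v w)
  then show ?case using ij by (simp add: R_lin L_lin)
next
  case (1 I v)
  show ?case
  proof (rule ccontr)
    assume "R i j v \<noteq> L i j v"
    from consecutive[OF ij 1 this] obtain k where k: "k + 1 \<le> n" "0 < D k" "0 < D (k + 1)" by blast
    consider "k = 0" | "k + 1 = n" | "0 < k" "k + 1 < n" using k(1) by linarith
    then show False
    proof cases
      case 1
      then show ?thesis using low_case[OF n5 dim char _ _ ij] k \<open>R i j v \<noteq> L i j v\<close> by simp
    next
      case 2
      interpret t: out_rep "(*s)" Basis n R \<epsilon>' \<sigma>' by (rule twisted)
      have neg_iff: "- x = y \<longleftrightarrow> x = - y" for x y :: 'v by auto
      \<comment> \<open>Negating every \<epsilon> complements the patterns, so layers n and n-1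
        become layers 0 and 1.\<close>
      have eig: "t.eig J = eig ({..<n} - J)" for J
        by (auto simp: eig_def t.eig_def neg_iff)
      have "t.D 0 = D n" by (simp add: t.D_def D_def eig)
      moreover have "t.D 1 = D k"
      proof -
        have "{..<n} - {..<1} \<subseteq> {..<n}" "card ({..<n} - {..<1}) = k"
          using 2 by (auto simp: card_Diff_subset)
        then show ?thesis using dim_eig[of "{..<n} - {..<1}"] by (simp add: t.D_def eig)
      qed
      ultimately have "R i j v = t.L i j v" using k 2 by (intro t.low_case n5 dim char ij) simp_all
      also have "t.L i j v = L i j v" using ij by (simp add: t.L_def L_def \<epsilon>_lin(4))
      finally show ?thesis using \<open>R i j v \<noteq> L i j v\<close> by simp
    next
      case 3
      have "(n choose k) * D k + (n choose (k + 1)) * D (k + 1) \<le> 2 * n"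
        using dim_count[of "{k, k + 1}"] dim by simp
      moreover have "(n choose k) * 1 \<le> (n choose k) * D k" "(n choose (k + 1)) * 1 \<le> (n choose (k + 1)) * D (k + 1)"
        using k by (intro mult_le_mono2; simp)+
      ultimately show ?thesis using choose_consecutive[OF n5 3] by linarith
    qed
  qed
qed

end

section \<open>Presentation of the integral general linear group\<close>

text \<open>Letters double as signed basis vectors, an inverse letter being the negative one.
  Working with the coordinate at a letter, rather than at an index, lets the arguments below choose
  signs freely.\<close>

definition lval :: "(nat \<Rightarrow> int) \<Rightarrow> letter \<Rightarrow> int" where
  "lval v a = (if snd a then v (fst a) else - v (fst a))"

definition transv :: "letter \<Rightarrow> letter \<Rightarrow> (nat \<Rightarrow> int) \<Rightarrow> (nat \<Rightarrow> int)" where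
  "transv a b v = v(fst b := v (fst b) + (if snd b then lval v a else - lval v a))"

text \<open>The linear map that sends the signed basis vector a to \<open>\<theta> a\<close>;
  coordinates are therefore read through the inverse of \<theta>.\<close>

definition permv :: "(letter \<Rightarrow> letter) \<Rightarrow> (nat \<Rightarrow> int) \<Rightarrow> (nat \<Rightarrow> int)" where
  "permv \<theta> v i = lval v (inv_into UNIV \<theta> (i, True))"

definition unitv :: "letter \<Rightarrow> nat \<Rightarrow> int" where
  "unitv a i = (if i = fst a then (if snd a then 1 else - 1) else 0)"

definition signed_perm :: "nat set \<Rightarrow> (letter \<Rightarrow> letter) \<Rightarrow> bool" where
  "signed_perm I \<theta> \<longleftrightarrow> bij \<theta> \<and> (\<forall>a. \<theta> (inv_letter a) = inv_letter (\<theta> a)) \<and> (\<forall>a. fst a \<notin> I \<longrightarrow> \<theta> a = a)"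

text \<open>The quarter turn in the plane of a and b: a goes to b, and b to the negative of
  a.\<close>

definition quarter :: "letter \<Rightarrow> letter \<Rightarrow> letter \<Rightarrow> letter" where
  "quarter a b c = (if c = a then b else if c = inv_letter a then inv_letter b
     else if c = b then inv_letter a else if c = inv_letter b then a else c)"

lemma lval_inv [simp]: "lval v (inv_letter a) = - lval v a"
  by (simp add: lval_def inv_letter_def)

lemma inv_letter_eq_iff [simp]: "inv_letter a = inv_letter b \<longleftrightarrow> a = b"
  by (metis inv_letter_inv)

lemma inv_letter_neq_fst: "fst a \<noteq> fst b \<Longrightarrow> a \<noteq> inv_letter b" "fst a \<noteq> fst b \<Longrightarrow> a \<noteq> b"
  by auto

lemma letter_cases: "fst a = fst b \<Longrightarrow> a = b \<or> a = inv_letter b"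
  by (cases a; cases b) (auto simp: inv_letter_def)

lemma lval_eqI: "(\<And>a. lval v a = lval w a) \<Longrightarrow> v = w"
  by (rule ext) (metis fst_conv lval_def snd_conv)

lemma lval_transv:
  assumes "fst a \<noteq> fst b"
  shows "lval (transv a b v) c =
    (if c = b then lval v b + lval v a else if c = inv_letter b then - lval v b - lval v a else lval v c)"
  using assms by (cases a; cases b; cases c) (auto simp: transv_def lval_def inv_letter_def)

lemma transv_fun: "transv a b v i = (if i = fst b then v i + (if snd b then lval v a else - lval v a) else v i)"
  by (simp add: transv_def)

lemma lval_unitv: "lval (unitv a) c = (if c = a then 1 else if c = inv_letter a then - 1 else 0)"
  by (cases a; cases c) (auto simp: unitv_def lval_def inv_letter_def)

lemma signed_permD:
  assumes "signed_perm I \<theta>"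
  shows "bij \<theta>" "\<theta> (inv_letter a) = inv_letter (\<theta> a)" "fst a \<notin> I \<Longrightarrow> \<theta> a = a"
    "\<theta> a = \<theta> b \<longleftrightarrow> a = b"
proof -
  show b: "bij \<theta>" and "\<theta> (inv_letter a) = inv_letter (\<theta> a)" "fst a \<notin> I \<Longrightarrow> \<theta> a = a"
    using assms by (simp_all add: signed_perm_def del: split_paired_All)
  show "\<theta> a = \<theta> b \<longleftrightarrow> a = b" using bij_is_inj[OF b] by (rule inj_eq)
qed

lemma fst_eq_iff: "fst a = fst b \<longleftrightarrow> a = b \<or> a = inv_letter b"
  using letter_cases[of a b] by auto

lemma signed_perm_fst_eq:
  assumes "signed_perm I \<theta>"
  shows "fst (\<theta> a) = fst (\<theta> b) \<longleftrightarrow> fst a = fst b"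
  using signed_permD(2)[OF assms, of b] signed_permD(4)[OF assms, of a "inv_letter b"]
  by (simp add: fst_eq_iff signed_permD(4)[OF assms])

lemma signed_perm_mem:
  assumes "signed_perm I \<theta>"
  shows "fst (\<theta> a) \<in> I \<longleftrightarrow> fst a \<in> I"
  using signed_permD(3)[OF assms, of a] signed_permD(3)[OF assms, of "\<theta> a"] signed_permD(4)[OF assms, of "\<theta> a" a]
  by auto

lemma signed_perm_id [simp]: "signed_perm I (\<lambda>a. a)"
  by (simp add: signed_perm_def bij_def)

lemma signed_perm_comp: "signed_perm I \<theta> \<Longrightarrow> signed_perm I \<eta> \<Longrightarrow> signed_perm I (\<theta> \<circ> \<eta>)"
  by (simp add: signed_perm_def bij_comp del: split_paired_All)

lemma signed_perm_mono: "signed_perm I \<theta> \<Longrightarrow> I \<subseteq> J \<Longrightarrow> signed_perm J \<theta>"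
  by (auto simp: signed_perm_def simp del: split_paired_All)

lemma signed_perm_inv:
  assumes "signed_perm I \<theta>"
  shows "signed_perm I (inv_into UNIV \<theta>)" "inv_into UNIV \<theta> (\<theta> a) = a" "\<theta> (inv_into UNIV \<theta> a) = a"
proof -
  note D = signed_permD[OF assms]
  have i: "inv_into UNIV \<theta> (\<theta> a) = a" "\<theta> (inv_into UNIV \<theta> a) = a" for a
    using D(1) by (auto simp: bij_def surj_f_inv_f)
  then show "inv_into UNIV \<theta> (\<theta> a) = a" "\<theta> (inv_into UNIV \<theta> a) = a" by auto
  show "signed_perm I (inv_into UNIV \<theta>)"
    unfolding signed_perm_def
  proof (intro conjI allI impI)
    show "bij (inv_into UNIV \<theta>)" by (rule bij_imp_bij_inv[OF D(1)])
    fix a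
    have "\<theta> (inv_into UNIV \<theta> (inv_letter a)) = \<theta> (inv_letter (inv_into UNIV \<theta> a))"
      by (simp add: i signed_permD(2)[OF assms])
    then show "inv_into UNIV \<theta> (inv_letter a) = inv_letter (inv_into UNIV \<theta> a)"
      by (simp only: signed_permD(4)[OF assms])
    show "inv_into UNIV \<theta> a = a" if "fst a \<notin> I"
      using i(1)[of a] signed_permD(3)[OF assms that] by simp
  qed
qed

lemma signed_perm_inv_comp:
  assumes "signed_perm I \<theta>"
  shows "inv_into UNIV \<theta> \<circ> \<theta> = (\<lambda>a. a)" "\<theta> \<circ> inv_into UNIV \<theta> = (\<lambda>a. a)"
  using signed_perm_inv[OF assms] by auto

lemma lval_permv:
  assumes "signed_perm I \<theta>"
  shows "lval (permv \<theta> v) (\<theta> c) = lval v c"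
proof -
  note i = signed_perm_inv[OF assms]
  show ?thesis
  proof (cases "snd (\<theta> c)")
    case True
    then have "(fst (\<theta> c), True) = \<theta> c" by (simp add: prod_eq_iff)
    then show ?thesis using True i by (simp add: lval_def permv_def)
  next
    case False
    then have "(fst (\<theta> c), True) = \<theta> (inv_letter c)"
      using signed_permD(2)[OF assms] by (simp add: inv_letter_def prod_eq_iff)
    then have "inv_into UNIV \<theta> (fst (\<theta> c), True) = inv_letter c" using i by simp
    then show ?thesis using False by (simp add: lval_def[of "permv \<theta> v"] permv_def)
  qed
qed

lemma lval_permv':
  assumes "signed_perm I \<theta>"
  shows "lval (permv \<theta> v) c = lval v (inv_into UNIV \<theta> c)"
  using lval_permv[OF assms, of v "inv_into UNIV \<theta> c"] signed_perm_inv[OF assms] by simp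

lemma permv_unitv:
  assumes "signed_perm I \<theta>"
  shows "permv \<theta> (unitv a) = unitv (\<theta> a)"
proof (rule lval_eqI)
  fix c
  have "inv_into UNIV \<theta> c = a \<longleftrightarrow> c = \<theta> a"
    "inv_into UNIV \<theta> c = inv_letter a \<longleftrightarrow> c = inv_letter (\<theta> a)"
    using signed_perm_inv[OF assms] signed_permD(2)[OF assms] by metis+
  then show "lval (permv \<theta> (unitv a)) c = lval (unitv (\<theta> a)) c"
    by (simp add: lval_permv'[OF assms] lval_unitv)
qed

lemma permv_transv:
  assumes "signed_perm I \<theta>" "fst a \<noteq> fst b"
  shows "permv \<theta> (transv a b v) = transv (\<theta> a) (\<theta> b) (permv \<theta> v)"
proof (rule lval_eqI)
  fix c
  obtain d where c: "c = \<theta> d" using signed_perm_inv(3)[OF assms(1)] by metis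
  have inv: "\<theta> d = inv_letter (\<theta> b) \<longleftrightarrow> d = inv_letter b"
    using signed_permD(2,4)[OF assms(1)] by metis
  have ne: "fst (\<theta> a) \<noteq> fst (\<theta> b)" using assms signed_perm_fst_eq by auto
  show "lval (permv \<theta> (transv a b v)) c = lval (transv (\<theta> a) (\<theta> b) (permv \<theta> v)) c"
    unfolding c lval_permv[OF assms(1)] lval_transv[OF ne] lval_transv[OF assms(2)] inv
      signed_permD(4)[OF assms(1)] ..
qed

lemma quarter_simps:
  assumes "fst a \<noteq> fst b"
  shows "quarter a b a = b" "quarter a b (inv_letter a) = inv_letter b"
    "quarter a b b = inv_letter a" "quarter a b (inv_letter b) = a"
    "fst c \<noteq> fst a \<Longrightarrow> fst c \<noteq> fst b \<Longrightarrow> quarter a b c = c"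
proof -
  have ne: "a \<noteq> b" "b \<noteq> a" "a \<noteq> inv_letter b" "b \<noteq> inv_letter a" "inv_letter a \<noteq> b" "inv_letter b \<noteq> a"
    using assms by auto
  then show "quarter a b a = b" "quarter a b (inv_letter a) = inv_letter b"
    "quarter a b b = inv_letter a" "quarter a b (inv_letter b) = a"
    by (simp_all add: quarter_def)
  show "quarter a b c = c" if "fst c \<noteq> fst a" "fst c \<noteq> fst b"
  proof -
    have "c \<noteq> a" "c \<noteq> b" "c \<noteq> inv_letter a" "c \<noteq> inv_letter b" using that by auto
    then show ?thesis by (simp add: quarter_def)
  qed
qed

lemma signed_perm_quarter:
  assumes "fst a \<in> I" "fst b \<in> I" "fst a \<noteq> fst b"
  shows "signed_perm I (quarter a b)"
proof -
  note q = quarter_simps[OF assms(3)]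
  have cases: "c = a \<or> c = inv_letter a \<or> c = b \<or> c = inv_letter b \<or> fst c \<noteq> fst a \<and> fst c \<noteq> fst b" for c
    using letter_cases[of c a] letter_cases[of c b] by blast
  have 1: "quarter a b (inv_letter c) = inv_letter (quarter a b c)" for c
    using cases[of c] by (elim disjE) (simp_all add: q)
  have 2: "quarter a b (quarter a b (quarter a b (quarter a b c))) = c" for c
    using cases[of c] by (elim disjE) (simp_all add: q)
  have "bij (quarter a b)"
    by (rule o_bij[of "quarter a b \<circ> quarter a b \<circ> quarter a b"]) (simp_all add: fun_eq_iff 2 del: split_paired_All)
  moreover have "fst c \<notin> I \<Longrightarrow> quarter a b c = c" for c
    using assms by (intro q(5)) auto
  ultimately show ?thesis using 1 by (simp add: signed_perm_def del: split_paired_All)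
qed

definition prim :: "nat set \<Rightarrow> (nat \<Rightarrow> int) \<Rightarrow> bool" where
  "prim I v \<longleftrightarrow> (\<forall>i. i \<notin> I \<longrightarrow> v i = 0) \<and> (\<forall>d. (\<forall>a. d dvd lval v a) \<longrightarrow> d dvd 1)"

text \<open>The old coordinates are integer combinations of the new ones, so a common divisor of the
  new ones divides the old ones.\<close>

lemma prim_transv:
  assumes "prim I v" "fst b \<in> I" "fst a \<noteq> fst b"
  shows "prim I (transv a b v)"
proof -
  have "d dvd lval v c" if d: "\<And>c. d dvd lval (transv a b v) c" for d c
  proof -
    have a: "d dvd lval v a" using d[of a] assms(3) by (simp add: lval_transv inv_letter_neq_fst)
    have "d dvd lval v b + lval v a" using d[of b] assms(3) by (simp add: lval_transv)
    then have b: "d dvd lval v b" using a dvd_add_left_iff by blast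
    show ?thesis using b d[of c] assms(3) by (auto simp: lval_transv split: if_splits)
  qed
  then show ?thesis using assms by (auto simp: prim_def transv_fun)
qed

lemma prim_unitv: "fst a \<in> I \<Longrightarrow> prim I (unitv a)"
  unfolding prim_def
proof (intro conjI allI impI)
  show "d dvd 1" if "\<forall>c. d dvd lval (unitv a) c" for d
    using that[rule_format, of a] by (simp add: lval_unitv)
qed (auto simp: unitv_def)

definition norm1 :: "nat set \<Rightarrow> (nat \<Rightarrow> int) \<Rightarrow> nat" where
  "norm1 I v = (\<Sum>i\<in>I. nat \<bar>v i\<bar>)"

text \<open>One subtraction of Euclid's algorithm. The target coordinate stays nonnegative and drops
  by a positive amount.\<close>

lemma norm1_desc:
  assumes "finite I" "fst b \<in> I" "fst a \<noteq> fst b" "0 < lval v a" "lval v a \<le> lval v b"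
  shows "norm1 I (transv a (inv_letter b) v) < norm1 I v"
  unfolding norm1_def
proof (rule sum_strict_mono_ex1[OF assms(1)])
  show "\<forall>i\<in>I. nat \<bar>transv a (inv_letter b) v i\<bar> \<le> nat \<bar>v i\<bar>"
    using assms(4,5) by (auto simp: transv_fun lval_def inv_letter_def split: if_splits)
  show "\<exists>i\<in>I. nat \<bar>transv a (inv_letter b) v i\<bar> < nat \<bar>v i\<bar>"
    using assms(4,5) by (intro bexI[OF _ assms(2)]) (auto simp: transv_fun lval_def inv_letter_def split: if_splits)
qed

text \<open>\<open>E a b\<close> is an abstract elementary matrix, indexed by signed basis vectors. In \<open>act\<close> it sends the
  basis vector \<open>a\<close> to \<open>a + b\<close>; so the coordinate at \<open>b\<close> is the one that changes.\<close>

locale steinberg =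
  fixes mul :: "'g \<Rightarrow> 'g \<Rightarrow> 'g" (infixl "\<star>" 70)
    and e :: 'g
    and act :: "'g \<Rightarrow> (nat \<Rightarrow> int) \<Rightarrow> (nat \<Rightarrow> int)"
    and N :: "nat set"
    and E :: "letter \<Rightarrow> letter \<Rightarrow> 'g"
    and P :: "(letter \<Rightarrow> letter) \<Rightarrow> 'g"
  assumes assoc: "x \<star> y \<star> z = x \<star> (y \<star> z)"
    and unit [simp]: "e \<star> x = x" "x \<star> e = x"
    and act_mul: "act (x \<star> y) v = act x (act y v)"
    and act_e [simp]: "act e v = v"
    and act_E: "fst a \<in> N \<Longrightarrow> fst b \<in> N \<Longrightarrow> fst a \<noteq> fst b \<Longrightarrow> act (E a b) v = transv a b v"
    and act_P: "signed_perm N \<theta> \<Longrightarrow> act (P \<theta>) v = permv \<theta> v"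
    and E_inv: "fst a \<in> N \<Longrightarrow> fst b \<in> N \<Longrightarrow> fst a \<noteq> fst b \<Longrightarrow> E a b \<star> E a (inv_letter b) = e"
    and E_sym: "fst a \<in> N \<Longrightarrow> fst b \<in> N \<Longrightarrow> fst a \<noteq> fst b \<Longrightarrow> E (inv_letter a) (inv_letter b) = E a b"
    and E_comm: "fst a \<in> N \<Longrightarrow> fst b \<in> N \<Longrightarrow> fst c \<in> N \<Longrightarrow> fst d \<in> N \<Longrightarrow> fst a \<noteq> fst b \<Longrightarrow>
      fst c \<noteq> fst d \<Longrightarrow> fst a \<noteq> fst d \<Longrightarrow> fst b \<noteq> fst c \<Longrightarrow> E a b \<star> E c d = E c d \<star> E a b"
    and E_chain: "fst a \<in> N \<Longrightarrow> fst b \<in> N \<Longrightarrow> fst c \<in> N \<Longrightarrow> fst a \<noteq> fst b \<Longrightarrow> fst a \<noteq> fst c \<Longrightarrow>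
      fst b \<noteq> fst c \<Longrightarrow> E b c \<star> E a b = E a b \<star> E b c \<star> E a c"
    and E_quarter: "fst a \<in> N \<Longrightarrow> fst b \<in> N \<Longrightarrow> fst a \<noteq> fst b \<Longrightarrow>
      E a b = E b a \<star> P (quarter a b) \<star> E b a"
    and P_comp: "signed_perm N \<theta> \<Longrightarrow> signed_perm N \<eta> \<Longrightarrow> P \<theta> \<star> P \<eta> = P (\<theta> \<circ> \<eta>)"
    and P_id: "P (\<lambda>a. a) = e"
    and P_E: "signed_perm N \<theta> \<Longrightarrow> fst a \<in> N \<Longrightarrow> fst b \<in> N \<Longrightarrow> fst a \<noteq> fst b \<Longrightarrow>
      P \<theta> \<star> E a b = E (\<theta> a) (\<theta> b) \<star> P \<theta>"
begin

section \<open>Subgroups generated by elementary matrices and signed permutations\<close>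

lemma E_inv': "fst a \<in> N \<Longrightarrow> fst b \<in> N \<Longrightarrow> fst a \<noteq> fst b \<Longrightarrow> E a (inv_letter b) \<star> E a b = e"
  using E_inv[of a "inv_letter b"] by simp

lemma E_cancel [simp]:
  assumes "fst a \<in> N" "fst b \<in> N" "fst a \<noteq> fst b"
  shows "E a b \<star> (E a (inv_letter b) \<star> g) = g" "E a (inv_letter b) \<star> (E a b \<star> g) = g"
  using E_inv[OF assms] E_inv'[OF assms] by (metis assoc unit(1))+

text \<open>Products without inverses suffice, because the generating sets used are closed under
  inversion; see \<open>submonoid_gens_inverse\<close>.\<close>

inductive_set submonoid_gen :: "'g set \<Rightarrow> 'g set" for A where
  one: "e \<in> submonoid_gen A"
| mult: "a \<in> A \<Longrightarrow> g \<in> submonoid_gen A \<Longrightarrow> a \<star> g \<in> submonoid_gen A"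

lemma submonoid_gen_inc: "a \<in> A \<Longrightarrow> a \<in> submonoid_gen A"
  using submonoid_gen.mult[OF _ submonoid_gen.one, of a A] by simp

lemma submonoid_gen_mult:
  "g \<in> submonoid_gen A \<Longrightarrow> h \<in> submonoid_gen A \<Longrightarrow> g \<star> h \<in> submonoid_gen A"
  by (induction rule: submonoid_gen.induct) (auto simp: assoc intro: submonoid_gen.intros)

lemma submonoid_gen_mono: "A \<subseteq> B \<Longrightarrow> g \<in> submonoid_gen A \<Longrightarrow> g \<in> submonoid_gen B"
  by (rotate_tac, induction rule: submonoid_gen.induct) (auto intro: submonoid_gen.intros)

lemma submonoid_gen_inverse:
  assumes "g \<in> submonoid_gen A" "\<And>a. a \<in> A \<Longrightarrow> \<exists>b\<in>A. a \<star> b = e \<and> b \<star> a = e"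
  shows "\<exists>h\<in>submonoid_gen A. g \<star> h = e \<and> h \<star> g = e"
  using assms(1)
proof induction
  case (mult a g)
  then obtain h where h: "h \<in> submonoid_gen A" "g \<star> h = e" "h \<star> g = e" by auto
  obtain b where b: "b \<in> A" "a \<star> b = e" "b \<star> a = e" using assms(2) mult by blast
  have "a \<star> g \<star> (h \<star> b) = a \<star> (g \<star> h) \<star> b" "h \<star> b \<star> (a \<star> g) = h \<star> (b \<star> a) \<star> g"
    by (simp_all only: assoc)
  then have "a \<star> g \<star> (h \<star> b) = e" "h \<star> b \<star> (a \<star> g) = e" by (simp_all add: h b)
  moreover have "h \<star> b \<in> submonoid_gen A" by (rule submonoid_gen_mult[OF h(1) submonoid_gen_inc[OF b(1)]])
  ultimately show ?case by blast
qed (use submonoid_gen.one unit in blast)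

text \<open>Sources in I, targets in J, signed permutations supported on K. Different choices give
  the full group on an index set, a vector stabiliser, its radical and its Levi part.\<close>

definition gens :: "nat set \<Rightarrow> nat set \<Rightarrow> nat set \<Rightarrow> 'g set" where
  "gens I J K = {E a b |a b. fst a \<in> I \<and> fst b \<in> J \<and> fst a \<noteq> fst b} \<union> P ` {\<theta>. signed_perm K \<theta>}"

lemma gens_E: "fst a \<in> I \<Longrightarrow> fst b \<in> J \<Longrightarrow> fst a \<noteq> fst b \<Longrightarrow> E a b \<in> gens I J K"
  unfolding gens_def by blast

lemma gens_P: "signed_perm K \<theta> \<Longrightarrow> P \<theta> \<in> gens I J K"
  unfolding gens_def by blast

lemma gens_cases:
  assumes "x \<in> gens I J K"
  obtains a b where "x = E a b" "fst a \<in> I" "fst b \<in> J" "fst a \<noteq> fst b"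
    | \<theta> where "x = P \<theta>" "signed_perm K \<theta>"
  using assms unfolding gens_def by blast

lemma gens_inverse:
  assumes "I \<subseteq> N" "J \<subseteq> N" "K \<subseteq> N" "x \<in> gens I J K"
  shows "\<exists>y\<in>gens I J K. x \<star> y = e \<and> y \<star> x = e"
  using assms(4)
proof (cases rule: gens_cases)
  case (1 a b)
  then have N: "fst a \<in> N" "fst b \<in> N" using assms by auto
  show ?thesis
  proof (intro bexI conjI)
    show "x \<star> E a (inv_letter b) = e" "E a (inv_letter b) \<star> x = e"
      using 1 N by (simp_all add: E_inv E_inv')
    show "E a (inv_letter b) \<in> gens I J K" using 1 by (intro gens_E) auto
  qed
next
  case (2 \<theta>)
  have N: "signed_perm N \<theta>" "signed_perm N (inv_into UNIV \<theta>)"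
    using 2 assms signed_perm_mono signed_perm_inv(1) by blast+
  show ?thesis
  proof (intro bexI conjI)
    show "x \<star> P (inv_into UNIV \<theta>) = e" "P (inv_into UNIV \<theta>) \<star> x = e"
      by (simp_all add: 2(1) P_comp N signed_perm_inv_comp[OF N(1)] P_id)
    show "P (inv_into UNIV \<theta>) \<in> gens I J K"
      using signed_perm_inv(1)[OF 2(2)] by (rule gens_P)
  qed
qed

lemma submonoid_gens_inverse:
  assumes "I \<subseteq> N" "J \<subseteq> N" "K \<subseteq> N" "g \<in> submonoid_gen (gens I J K)"
  shows "\<exists>h\<in>submonoid_gen (gens I J K). g \<star> h = e \<and> h \<star> g = e"
  by (rule submonoid_gen_inverse[OF assms(4) gens_inverse[OF assms(1-3)]])

end

locale steinberg_descent = steinberg +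
  fixes I :: "nat set" and k :: nat
  assumes I: "I \<subseteq> N" and fin: "finite I" and k: "k \<in> I"
begin

text \<open>An elementary matrix whose source is not k fixes the k-th basis vector, and so does a
  signed permutation away from k. That these generate the whole stabiliser is
  \<open>stabilizer\<close>.\<close>

abbreviation "stab \<equiv> submonoid_gen (gens (I - {k}) I (I - {k}))"

lemma inN [simp]: "i \<in> I \<Longrightarrow> i \<in> N" using I by auto

lemma signed_perm_N: "signed_perm I \<theta> \<Longrightarrow> signed_perm N \<theta>"
  by (rule signed_perm_mono[OF _ I])

text \<open>\<open>good g v\<close>: the element \<open>g\<close> is obtained from a run of Euclid's algorithm on the primitive vector
  \<open>v\<close>, where larger coordinates are reduced by smaller ones. By \<open>good_unique\<close> all runs lead to the same coset of
  the stabiliser, because any two first steps can be joined using the defining relations.\<close>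

inductive good :: "'a \<Rightarrow> (nat \<Rightarrow> int) \<Rightarrow> bool" where
  base: "signed_perm I \<theta> \<Longrightarrow> s \<in> stab \<Longrightarrow> good (P \<theta> \<star> s) (unitv (\<theta> (k, True)))"
| step: "fst a \<in> I \<Longrightarrow> fst b \<in> I \<Longrightarrow> fst a \<noteq> fst b \<Longrightarrow> 0 < lval v a \<Longrightarrow> lval v a \<le> lval v b \<Longrightarrow>
    good g (transv a (inv_letter b) v) \<Longrightarrow> good (E a b \<star> g) v"

lemma transv_inverse [simp]:
  assumes "fst a \<noteq> fst b"
  shows "transv a b (transv a (inv_letter b) v) = v" "transv a (inv_letter b) (transv a b v) = v"
  using assms by (auto intro!: lval_eqI simp: lval_transv inv_letter_neq_fst)

lemma good_prim: "good g v \<Longrightarrow> prim I v"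
proof (induction rule: good.induct)
  case (base \<theta> s)
  then show ?case using k by (simp add: prim_unitv signed_perm_mem)
next
  case (step a b v g)
  from prim_transv[OF step.IH step.hyps(2,3)] step.hyps(3) show ?case by simp
qed

lemma good_right: "good g v \<Longrightarrow> s \<in> stab \<Longrightarrow> good (g \<star> s) v"
  by (induction rule: good.induct) (auto simp: assoc intro: good.intros submonoid_gen_mult)

text \<open>Euclid's algorithm is equivariant under relabelling: a run for \<open>v\<close> is
  carried to a run for the permuted vector.\<close>

lemma good_P: "good g v \<Longrightarrow> signed_perm I \<eta> \<Longrightarrow> good (P \<eta> \<star> g) (permv \<eta> v)"
proof (induction rule: good.induct)
  case (base \<theta> s)
  then have "P \<eta> \<star> (P \<theta> \<star> s) = P (\<eta> \<circ> \<theta>) \<star> s"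
    by (simp add: P_comp signed_perm_N flip: assoc)
  moreover have "permv \<eta> (unitv (\<theta> (k, True))) = unitv ((\<eta> \<circ> \<theta>) (k, True))"
    using base by (simp add: permv_unitv)
  ultimately show ?case using base by (auto intro!: good.base simp: signed_perm_comp simp del: o_apply)
next
  case (step a b v g)
  have eq: "P \<eta> \<star> (E a b \<star> g) = E (\<eta> a) (\<eta> b) \<star> (P \<eta> \<star> g)"
    using step by (simp add: P_E signed_perm_N flip: assoc)
  have "good (P \<eta> \<star> g) (transv (\<eta> a) (inv_letter (\<eta> b)) (permv \<eta> v))"
    using step by (simp add: permv_transv[symmetric] signed_permD(2)[symmetric])
  then show ?case unfolding eq
    using step by (intro good.step) (auto simp: signed_perm_mem signed_perm_fst_eq lval_permv)
qed

lemma E_sym': "fst a \<in> I \<Longrightarrow> fst b \<in> I \<Longrightarrow> fst a \<noteq> fst b \<Longrightarrow> E a (inv_letter b) = E (inv_letter a) b"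
  using E_sym[of "inv_letter a" b] by simp

lemma stab_E: "fst a \<in> I - {k} \<Longrightarrow> fst b \<in> I \<Longrightarrow> fst a \<noteq> fst b \<Longrightarrow> E a b \<in> stab"
  by (intro submonoid_gen_inc gens_E)

lemma stab_P: "signed_perm (I - {k}) \<theta> \<Longrightarrow> P \<theta> \<in> stab"
  by (intro submonoid_gen_inc gens_P)

lemma stab_inverse: "s \<in> stab \<Longrightarrow> \<exists>t\<in>stab. s \<star> t = e \<and> t \<star> s = e"
  using I by (intro submonoid_gens_inverse) auto

lemma P_E_swap:
  assumes "signed_perm I \<theta>" "fst a \<in> I" "fst b \<in> I" "fst a \<noteq> fst b"
  shows "E a b \<star> P \<theta> = P \<theta> \<star> E (inv_into UNIV \<theta> a) (inv_into UNIV \<theta> b)"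
  using assms signed_perm_inv[OF assms(1)]
  by (subst P_E) (auto simp: signed_perm_N signed_perm_mem[OF signed_perm_inv(1)[OF assms(1)]]
      signed_perm_fst_eq[OF signed_perm_inv(1)[OF assms(1)]])

lemma E_chain_swap:
  assumes "fst a \<in> I" "fst c \<in> I" "fst d \<in> I" "fst a \<noteq> fst c" "fst a \<noteq> fst d" "fst c \<noteq> fst d"
  shows "E a c \<star> (E c d \<star> g) = E c d \<star> (E a c \<star> (E a (inv_letter d) \<star> g))"
proof -
  have "E c d \<star> (E a c \<star> (E a (inv_letter d) \<star> g)) = E c d \<star> E a c \<star> (E a (inv_letter d) \<star> g)"
    by (simp only: assoc)
  also have "E c d \<star> E a c = E a c \<star> E c d \<star> E a d" using assms by (intro E_chain) auto
  also have "E a c \<star> E c d \<star> E a d \<star> (E a (inv_letter d) \<star> g) = E a c \<star> (E c d \<star> (E a d \<star> (E a (inv_letter d) \<star> g)))"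
    by (simp only: assoc)
  also have "E a d \<star> (E a (inv_letter d) \<star> g) = g" using assms by (intro E_cancel) auto
  finally show ?thesis ..
qed

lemma E_comm':
  assumes "fst a \<in> I" "fst b \<in> I" "fst c \<in> I" "fst d \<in> I" "fst a \<noteq> fst b" "fst c \<noteq> fst d"
    "fst a \<noteq> fst d" "fst b \<noteq> fst c"
  shows "E a b \<star> (E c d \<star> g) = E c d \<star> (E a b \<star> g)"
  using assms by (simp add: E_comm[of a b c d] flip: assoc)

text \<open>If the coordinate at a is zero, \<open>E a b\<close> fixes v. It can be pushed to the
  right through a run: it commutes with a step or spawns a second factor with the same source, whose
  coordinate is still zero, until it is absorbed into \<open>stab\<close>.\<close>

lemma good_fix:
  assumes "good g v" "fst a \<in> I" "fst b \<in> I" "fst a \<noteq> fst b" "lval v a = 0"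
  shows "good (E a b \<star> g) v"
  using assms
proof (induction "norm1 I v" arbitrary: g v a b rule: less_induct)
  case less
  show ?case
    using less.prems(1)
proof (cases rule: good.cases)
  case (base \<theta> s)
  note inv = signed_perm_inv[OF base(3)]
  let ?i = "inv_into UNIV \<theta>"
  have "a \<noteq> \<theta> (k, True)" "a \<noteq> inv_letter (\<theta> (k, True))"
    using less.prems(5) base(2) by (auto simp: lval_unitv)
  then have "fst a \<noteq> fst (\<theta> (k, True))" by (simp add: fst_eq_iff)
  moreover have "fst (\<theta> (?i a)) = fst a" by (simp only: inv(3))
  ultimately have ne: "fst (?i a) \<noteq> k"
    using signed_perm_fst_eq[OF base(3), of "?i a" "(k, True)"] by auto
  have "E (?i a) (?i b) \<in> stab"
    using less.prems base ne by (intro stab_E) (auto simp: signed_perm_mem[OF inv(1)] signed_perm_fst_eq[OF inv(1)])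
  then have "good (P \<theta> \<star> (E (?i a) (?i b) \<star> s)) (unitv (\<theta> (k, True)))"
    using base(3,4) by (intro good.base submonoid_gen_mult)
  moreover have "E a b \<star> (P \<theta> \<star> s) = P \<theta> \<star> (E (?i a) (?i b) \<star> s)"
    using P_E_swap[OF base(3) less.prems(2-4)] by (simp flip: assoc)
  ultimately show ?thesis using base by simp
next
  case (step c d h)
  note n = norm1_desc[OF fin step(3,4,5,6)]
  \<comment> \<open>The coordinates at c and d are nonzero, so a differs from both. Only b = c
    obstructs commutation, and then \<open>E_chain_swap\<close> produces the extra factor from a to
    the inverse of d.\<close>
  have main: "good (E a b \<star> (E c d \<star> h)) v"
    if a: "fst a \<in> I" "fst b \<in> I" "fst a \<noteq> fst b" "lval v a = 0" "fst b \<noteq> fst c \<or> b = c" for a b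
  proof -
    have ac: "fst a \<noteq> fst c" "fst a \<noteq> fst d"
      using step(5,6) a(4) letter_cases[of a c] letter_cases[of a d] by auto
    have 0: "lval (transv c (inv_letter d) v) a = 0"
      using step(4) ac a(4) by (simp add: lval_transv inv_letter_neq_fst)
    show ?thesis
    proof (cases "b = c")
      case False
      then have "E a b \<star> (E c d \<star> h) = E c d \<star> (E a b \<star> h)"
        using step(2-4) a ac by (intro E_comm') auto
      then show ?thesis
        using good.step[OF step(2-6) less.hyps[OF n step(7) a(1-3) 0]] by simp
    next
      case True
      have "good (E a c \<star> (E a (inv_letter d) \<star> h)) (transv c (inv_letter d) v)"
        using step(3) ac 0 a step(2) by (intro less.hyps n step(7)) auto
      moreover have "E a b \<star> (E c d \<star> h) = E c d \<star> (E a c \<star> (E a (inv_letter d) \<star> h))"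
        unfolding True using step(2-4) a ac by (intro E_chain_swap) auto
      ultimately show ?thesis using good.step[OF step(2-6)] by simp
    qed
  qed
  show ?thesis
  proof (cases "b = inv_letter c")
    case True
    \<comment> \<open>\<open>E_sym\<close> trades the inverse target for an inverse source, whose
      coordinate is zero as well.\<close>
    have "E a b = E (inv_letter a) c" using True step(2) less.prems E_sym'[of a c] by simp
    then show ?thesis using main[of "inv_letter a" c] step(1,2) less.prems True by simp
  next
    case False
    then show ?thesis using main less.prems step(1) letter_cases[of b c] by auto
  qed
qed
qed

text \<open>Adding one nonnegative coordinate to another undoes a legitimate step, since the sum is
  at least the coordinate that was added. If that coordinate is zero, \<open>good_fix\<close>
  applies.\<close>

lemma good_ascend:
  assumes "good g v" "fst a \<in> I" "fst b \<in> I" "fst a \<noteq> fst b" "0 \<le> lval v a" "0 \<le> lval v b"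
  shows "good (E a b \<star> g) (transv a b v)"
proof (cases "lval v a = 0")
  case True
  then have "transv a b v = v" by (simp add: transv_def)
  then show ?thesis using good_fix[OF assms(1-4) True] by simp
next
  case False
  then show ?thesis using assms by (intro good.step) (auto simp: lval_transv inv_letter_neq_fst)
qed

lemma positive_letter:
  assumes "v i \<noteq> 0"
  obtains a where "fst a = i" "0 < lval v a"
proof (cases "0 < v i")
  case True
  then show ?thesis using that[of "(i, True)"] by (simp add: lval_def)
next
  case False
  then show ?thesis using that[of "(i, False)"] assms by (simp add: lval_def)
qed

text \<open>While two coordinates are nonzero, signs can be chosen so that both are positive and the
  smaller is subtracted from the larger. A primitive vector with a single nonzero coordinate is a
  signed unit vector.\<close>

lemma good_exists: "prim I v \<Longrightarrow> \<exists>g \<in> submonoid_gen (gens I I I). good g v"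
proof (induction "norm1 I v" arbitrary: v rule: less_induct)
  case less
  show ?case
  proof (cases "\<exists>i j. i \<noteq> j \<and> v i \<noteq> 0 \<and> v j \<noteq> 0")
    case True
    then obtain a b where ab: "fst a \<noteq> fst b" "0 < lval v a" "0 < lval v b"
      using positive_letter by metis
    obtain a b where ab: "fst a \<noteq> fst b" "0 < lval v a" "lval v a \<le> lval v b"
    proof (cases "lval v a \<le> lval v b")
      case True then show ?thesis using that ab by blast
    next
      case False then show ?thesis using that[of b a] ab by auto
    qed
    then have I: "fst a \<in> I" "fst b \<in> I"
      using less.prems by (auto simp: prim_def lval_def split: if_splits)
    obtain g where "g \<in> submonoid_gen (gens I I I)" "good g (transv a (inv_letter b) v)"
      using less.hyps[OF norm1_desc[OF fin I(2) ab] prim_transv[OF less.prems]] I ab by auto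
    then show ?thesis
      using I ab by (intro bexI[of _ "E a b \<star> g"]) (auto intro: good.step submonoid_gen.mult gens_E)
  next
    case False
    have "\<exists>i. v i \<noteq> 0"
    proof (rule ccontr)
      assume "\<nexists>i. v i \<noteq> 0"
      then have "\<forall>a. 0 dvd lval v a" by (auto simp: lval_def)
      then have "(0::int) dvd 1" using less.prems unfolding prim_def by blast
      then show False by simp
    qed
    then obtain a where a: "0 < lval v a" by (metis positive_letter)
    have 0: "lval v c = 0" if "fst c \<noteq> fst a" for c
    proof -
      have "v (fst a) \<noteq> 0" using a by (cases "snd a") (auto simp: lval_def)
      then have "v (fst c) = 0" using False that by blast
      then show ?thesis by (simp add: lval_def)
    qed
    have "lval v a dvd lval v c" for c
      using 0[of c] letter_cases[of c a] by (cases "fst c = fst a") auto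
    then have "lval v a dvd 1" using less.prems unfolding prim_def by blast
    then have 1: "lval v a = 1" using a by simp
    have v: "v = unitv a"
    proof (rule lval_eqI)
      show "lval v c = lval (unitv a) c" for c
        using 0[of c] 1 by (auto simp: lval_unitv fst_eq_iff)
    qed
    have aI: "fst a \<in> I" using less.prems a by (auto simp: prim_def lval_def split: if_splits)
    \<comment> \<open>A signed permutation carrying the k-th basis vector to a: the identity or one
      sign change if the index is k, and a quarter turn otherwise.\<close>
    obtain \<theta> where \<theta>: "signed_perm I \<theta>" "\<theta> (k, True) = a"
    proof (cases "fst a = k")
      case True
      have "bij (\<lambda>c. if fst c = k then inv_letter c else c)"
        by (rule o_bij[of "\<lambda>c. if fst c = k then inv_letter c else c"]) auto
      then have "signed_perm I (\<lambda>c. if fst c = k then inv_letter c else c)"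
        using k by (auto simp: signed_perm_def)
      then show ?thesis
        using that[of "\<lambda>a. a"] that[of "\<lambda>c. if fst c = k then inv_letter c else c"] True
        by (cases a; cases "snd a") (auto simp: inv_letter_def)
    next
      case False
      then show ?thesis
        using that[OF signed_perm_quarter[of "(k, True)" I a]] k aI by (auto simp: quarter_def)
    qed
    have "good (P \<theta> \<star> e) v" unfolding v \<theta>(2)[symmetric]
      by (intro good.base \<theta> submonoid_gen.one)
    then show ?thesis using \<theta>
      by (intro bexI[of _ "P \<theta> \<star> e"] submonoid_gen.mult submonoid_gen.one) (auto intro: gens_P)
  qed
qed

section \<open>Confluence of Euclid's algorithm\<close>

definition canon :: "(nat \<Rightarrow> int) \<Rightarrow> letter \<Rightarrow> letter \<Rightarrow> bool" where
  "canon v a b \<longleftrightarrow> fst a \<in> I \<and> fst b \<in> I \<and> fst a \<noteq> fst b \<and> 0 < lval v a \<and> lval v a \<le> lval v b"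

text \<open>The two first steps extend to runs with the same resulting element. One such pair of
  runs is enough, as runs for the smaller vectors are unique up to \<open>stab\<close>.\<close>

definition conn :: "(nat \<Rightarrow> int) \<Rightarrow> letter \<Rightarrow> letter \<Rightarrow> letter \<Rightarrow> letter \<Rightarrow> bool" where
  "conn v a b c d \<longleftrightarrow> (\<exists>g h. good g (transv a (inv_letter b) v) \<and> good h (transv c (inv_letter d) v) \<and>
     E a b \<star> g = E c d \<star> h)"

lemma canon_step: "canon v a b \<Longrightarrow> good g (transv a (inv_letter b) v) \<Longrightarrow> good (E a b \<star> g) v"
  by (auto simp: canon_def intro: good.step)

lemma canon_prim: "canon v a b \<Longrightarrow> prim I v \<Longrightarrow> prim I (transv a (inv_letter b) v)"
  by (auto simp: canon_def intro: prim_transv)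

lemma lval_desc:
  assumes "fst a \<noteq> fst b"
  shows "lval (transv a (inv_letter b) v) b = lval v b - lval v a"
    "fst c \<noteq> fst b \<Longrightarrow> lval (transv a (inv_letter b) v) c = lval v c"
  using assms by (auto simp: lval_transv)

lemma transv_commute:
  assumes "fst a \<noteq> fst b" "fst c \<noteq> fst d" "fst a \<noteq> fst d" "fst c \<noteq> fst b"
  shows "transv a b (transv c d v) = transv c d (transv a b v)"
  using assms by (auto simp: transv_def lval_def fun_eq_iff)

lemma conn_sym: "conn v a b c d \<Longrightarrow> conn v c d a b"
  unfolding conn_def by metis

text \<open>The two witnesses at the middle step may differ by an element of \<open>stab\<close>;
  multiplying the second run by it on the right repairs this.\<close>

lemma conn_trans:
  assumes "conn v a b c d" "conn v c d x y"
    and uniq: "\<And>g h. good g (transv c (inv_letter d) v) \<Longrightarrow> good h (transv c (inv_letter d) v) \<Longrightarrow> \<exists>s\<in>stab. g = h \<star> s"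
  shows "conn v a b x y"
proof -
  from assms(1) obtain g h where 1: "good g (transv a (inv_letter b) v)" "good h (transv c (inv_letter d) v)"
     "E a b \<star> g = E c d \<star> h" unfolding conn_def by auto
  from assms(2) obtain g' h' where 2: "good g' (transv c (inv_letter d) v)" "good h' (transv x (inv_letter y) v)"
     "E c d \<star> g' = E x y \<star> h'" unfolding conn_def by auto
  obtain s where s: "s \<in> stab" "h = g' \<star> s" using uniq[OF 1(2) 2(1)] by auto
  have "E a b \<star> g = E c d \<star> g' \<star> s" using 1(3) s(2) by (simp only: assoc)
  then have "E a b \<star> g = E x y \<star> (h' \<star> s)" using 2(3) by (simp only: assoc)
  then show ?thesis
    unfolding conn_def using 1(1) good_right[OF 2(2) s(1)] by blast
qed

text \<open>The ordinary diamond: with different targets, neither of which is the source of the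
  other step, both orders lead to the same vector and the elementary matrices commute. The sources
  may coincide.\<close>

lemma conn_commute:
  assumes "canon v a b" "canon v c d" "prim I v" "fst a \<noteq> fst d" "fst c \<noteq> fst b" "fst b \<noteq> fst d"
  shows "conn v a b c d"
proof -
  have ab: "fst a \<in> I" "fst b \<in> I" "fst a \<noteq> fst b" and cd: "fst c \<in> I" "fst d \<in> I" "fst c \<noteq> fst d"
    using assms(1,2) by (auto simp: canon_def)
  let ?v1 = "transv a (inv_letter b) v" and ?v2 = "transv c (inv_letter d) v"
  have w: "transv c (inv_letter d) ?v1 = transv a (inv_letter b) ?v2"
    using assms ab cd by (intro transv_commute) auto
  have c1: "canon ?v1 c d" and c2: "canon ?v2 a b"
    using assms unfolding canon_def by (auto simp: lval_desc)
  obtain t where t: "good t (transv c (inv_letter d) ?v1)"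
    using good_exists[OF canon_prim[OF c1 canon_prim[OF assms(1,3)]]] by auto
  have "good (E c d \<star> t) ?v1" by (rule canon_step[OF c1 t])
  moreover have "good (E a b \<star> t) ?v2" by (rule canon_step[OF c2]) (use t w in simp)
  moreover have "E a b \<star> (E c d \<star> t) = E c d \<star> (E a b \<star> t)"
    using assms ab cd by (intro E_comm') auto
  ultimately show ?thesis unfolding conn_def by blast
qed

text \<open>When a is subtracted from c and c from b, the steps interact, and the relation
  \<open>E_chain\<close> accounts for the extra subtraction of a from b.\<close>

lemma conn_chain:
  assumes "canon v a c" "canon v c b" "prim I v" "fst a \<noteq> fst b"
  shows "conn v a c c b"
proof -
  have in_I: "fst a \<in> I" "fst b \<in> I" "fst c \<in> I" and ne: "fst a \<noteq> fst c" "fst c \<noteq> fst b" "fst a \<noteq> fst b"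
    and pos: "0 < lval v a" "lval v a \<le> lval v c" "lval v c \<le> lval v b"
    using assms by (auto simp: canon_def)
  let ?v1 = "transv a (inv_letter c) v" and ?v2 = "transv c (inv_letter b) v"
  let ?w = "transv a (inv_letter c) ?v2"
  have c2: "canon ?v2 a c"
    using in_I ne pos by (auto simp: canon_def lval_desc)
  obtain t where t: "good t ?w"
    using good_exists[OF canon_prim[OF c2 canon_prim[OF assms(2,3)]]] by auto
  have 2: "good (E a c \<star> t) ?v2" by (rule canon_step[OF c2 t])
  have ab: "good (E a b \<star> t) (transv a b ?w)"
    using in_I ne pos by (intro good_ascend[OF t]) (auto simp: lval_desc)
  have "good (E c b \<star> (E a b \<star> t)) (transv c b (transv a b ?w))"
    using in_I ne pos by (intro good_ascend[OF ab]) (auto simp: lval_desc lval_transv inv_letter_neq_fst)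
  \<comment> \<open>Writing a, c, b for the coordinates of v, those of \<open>?w\<close> are a, c-a,
    b-c; adding a and then c-a to the last returns it to b. All these values are nonnegative, so
    \<open>good_ascend\<close> applies twice.\<close>
  moreover have "transv c b (transv a b ?w) = ?v1"
  proof (rule lval_eqI)
    fix d
    consider "d = c" | "d = inv_letter c" | "d = b" | "d = inv_letter b" | "fst d \<noteq> fst c \<and> fst d \<noteq> fst b"
      using letter_cases[of d c] letter_cases[of d b] by blast
    then show "lval (transv c b (transv a b ?w)) d = lval ?v1 d"
      using ne by cases (simp_all add: lval_transv inv_letter_neq_fst)
  qed
  ultimately have 1: "good (E c b \<star> (E a b \<star> t)) ?v1" by simp
  have "E c b \<star> E a c = E a c \<star> E c b \<star> E a b" using in_I ne by (intro E_chain) auto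
  then have "E a c \<star> (E c b \<star> (E a b \<star> t)) = E c b \<star> (E a c \<star> t)" by (metis assoc)
  then show ?thesis unfolding conn_def using 1 2 by blast
qed

text \<open>Both steps are allowed only when the two coordinates are equal. One of them then becomes
  zero, and the results differ by a quarter turn; this is what the relation \<open>E_quarter\<close>
  is for.\<close>

lemma conn_opposite:
  assumes "canon v a b" "canon v b a" "prim I v"
  shows "conn v a b b a"
proof -
  have in_I: "fst a \<in> I" "fst b \<in> I" and ne: "fst a \<noteq> fst b" and eq: "lval v b = lval v a"
    using assms by (auto simp: canon_def)
  let ?v1 = "transv a (inv_letter b) v" and ?v2 = "transv b (inv_letter a) v"
  obtain t where t: "good t ?v1"
    using good_exists[OF canon_prim[OF assms(1,3)]] by auto
  have q: "signed_perm I (quarter a b)" by (rule signed_perm_quarter[OF in_I ne])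
  \<comment> \<open>The coordinate at b has become zero, so \<open>E b a\<close> may be inserted
    without changing the vector.\<close>
  have "good (E b a \<star> t) ?v1"
    using in_I ne eq by (intro good_fix[OF t]) (auto simp: lval_desc)
  then have "good (P (quarter a b) \<star> (E b a \<star> t)) (permv (quarter a b) ?v1)"
    by (rule good_P[OF _ q])
  moreover have "permv (quarter a b) ?v1 = ?v2"
  proof (rule lval_eqI)
    fix c
    obtain d where c: "c = quarter a b d" using signed_perm_inv(3)[OF q] by metis
    have "lval ?v1 d = lval ?v2 (quarter a b d)"
    proof -
      consider "d = a" | "d = inv_letter a" | "d = b" | "d = inv_letter b" | "fst d \<noteq> fst a \<and> fst d \<noteq> fst b"
        using letter_cases[of d a] letter_cases[of d b] by blast
      then show ?thesis
        using ne eq by cases (simp_all add: quarter_simps[OF ne] lval_desc)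
    qed
    then show "lval (permv (quarter a b) ?v1) c = lval ?v2 c"
      unfolding c lval_permv[OF q] .
  qed
  ultimately have 2: "good (P (quarter a b) \<star> (E b a \<star> t)) ?v2" by simp
  have "E a b \<star> t = E b a \<star> (P (quarter a b) \<star> (E b a \<star> t))"
    using E_quarter[of a b] in_I ne by (simp add: assoc)
  then show ?thesis unfolding conn_def using t 2 by blast
qed

text \<open>Two steps either are independent, share a target, form a chain, or are opposite to each
  other. Positivity of all four coordinates makes letters with the same index equal.\<close>

lemma conn_canon:
  assumes "canon v a b" "canon v c d" "prim I v"
    and uniq: "\<And>w g h. norm1 I w < norm1 I v \<Longrightarrow> good g w \<Longrightarrow> good h w \<Longrightarrow> \<exists>s\<in>stab. g = h \<star> s"
  shows "conn v a b c d"
proof -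
  have posI: "x = y" if "fst x = fst y" "0 < lval v x" "0 < lval v y" for x y
    using that letter_cases[of x y] by auto
  have pos: "0 < lval v a" "0 < lval v b" "0 < lval v c" "0 < lval v d"
    using assms(1,2) by (auto simp: canon_def)
  have unc: "\<exists>s\<in>stab. g = h \<star> s"
    if "canon v x y" "good g (transv x (inv_letter y) v)" "good h (transv x (inv_letter y) v)" for x y g h
    using that by (intro uniq[OF norm1_desc[OF fin]]) (auto simp: canon_def)
  \<comment> \<open>For a common target, the step between the two sources is inserted: it is
    independent of the first step and forms a chain with the second.\<close>
  have same_target: "conn v x b y b"
    if xy: "canon v x b" "canon v y b" "lval v x \<le> lval v y" "fst x \<noteq> fst y" for x y
  proof -
    have cxy: "canon v x y" using xy by (auto simp: canon_def)
    have "conn v x b x y" using xy cxy assms(3) by (intro conn_commute) (auto simp: canon_def)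
    moreover have "conn v x y y b" using xy cxy assms(3) by (intro conn_chain) (auto simp: canon_def)
    ultimately show ?thesis by (rule conn_trans) (rule unc[OF cxy])
  qed
  show ?thesis
  proof (cases "fst b = fst c")
    case True
    then have bc: "c = b" using posI[of c b] pos by auto
    show ?thesis
    proof (cases "fst a = fst d")
      case True
      then have "d = a" using posI[of d a] pos by auto
      then show ?thesis using assms bc conn_opposite by auto
    next
      case False
      then show ?thesis using assms bc conn_chain by auto
    qed
  next
    case bc: False
    show ?thesis
    proof (cases "fst a = fst d")
      case True
      then have "d = a" using posI[of d a] pos by auto
      then show ?thesis using assms bc by (auto intro!: conn_sym[OF conn_chain])
    next
      case ad: False
      show ?thesis
      proof (cases "fst b = fst d")
        case True
        then have bd: "d = b" using posI[of d b] pos by auto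
        show ?thesis
        proof (cases "fst a = fst c")
          case True
          then have ac: "c = a" using posI[of c a] pos by auto
          obtain t where "good t (transv a (inv_letter b) v)"
            using good_exists[OF canon_prim[OF assms(1,3)]] by auto
          then show ?thesis unfolding ac bd conn_def by blast
        next
          case False
          then show ?thesis
            using same_target[of a c] conn_sym[OF same_target[of c a]] assms bd by fastforce
        qed
      next
        case False
        then show ?thesis using assms bc ad by (intro conn_commute) auto
      qed
    qed
  qed
qed

text \<open>Newman's argument: first steps are connected by \<open>conn_canon\<close>, and for the
  smaller vectors uniqueness is known by induction on the norm. The ambiguity is carried to the
  right as an element of \<open>stab\<close>.\<close>

lemma good_unique: "good g v \<Longrightarrow> good h v \<Longrightarrow> \<exists>s\<in>stab. g = h \<star> s"
proof (induction "norm1 I v" arbitrary: v g h rule: less_induct)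
  case less
  note IH = less.hyps
  \<comment> \<open>A signed unit vector has one nonzero coordinate and admits no step, so the two
    forms of a run never meet.\<close>
  have two: False if "0 < lval (unitv x) a" "lval (unitv x) a \<le> lval (unitv x) b" "fst a \<noteq> fst b" for x a b
    using that by (auto simp: lval_unitv split: if_splits)
  have canonI: "canon v a b" if "fst a \<in> I" "fst b \<in> I" "fst a \<noteq> fst b" "0 < lval v a" "lval v a \<le> lval v b" for a b
    using that by (simp add: canon_def)
  show ?case
    using less.prems(1)
  proof (cases rule: good.cases)
    case g: (base \<theta> s)
    show ?thesis
      using less.prems(2)
    proof (cases rule: good.cases)
      case h: (base \<eta> t)
      let ?z = "inv_into UNIV \<eta> \<circ> \<theta>"
      have "unitv (\<theta> (k, True)) = unitv (\<eta> (k, True))" using g h by simp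
      then have "lval (unitv (\<theta> (k, True))) (\<theta> (k, True)) = lval (unitv (\<eta> (k, True))) (\<theta> (k, True))" by simp
      then have eq: "\<theta> (k, True) = \<eta> (k, True)" by (simp add: lval_unitv split: if_splits)
      note inv = signed_perm_inv[OF h(3)]
      have z: "signed_perm I ?z" using g inv by (intro signed_perm_comp) auto
      have zk: "?z (k, True) = (k, True)" using eq inv by simp
      have "?z a = a" if "fst a \<notin> I - {k}" for a
      proof (cases "fst a = k")
        case True
        then have "a = (k, True) \<or> a = inv_letter (k, True)" using fst_eq_iff[of a "(k, True)"] by simp
        then show ?thesis using zk signed_permD(2)[OF z, of "(k, True)"] by auto
      next
        case False
        then show ?thesis using that signed_permD(3)[OF z] by auto
      qed
      then have "signed_perm (I - {k}) ?z" using z by (simp add: signed_perm_def del: split_paired_All)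
      then have Pz: "P ?z \<in> stab" by (rule stab_P)
      have "\<eta> \<circ> ?z = \<theta>" by (rule ext) (simp add: inv(3))
      then have "P \<theta> = P \<eta> \<star> P ?z" using P_comp[OF signed_perm_N signed_perm_N, OF h(3) z] by simp
      obtain t' where t': "t' \<in> stab" "t \<star> t' = e" using stab_inverse[OF h(4)] by auto
      have "h \<star> (t' \<star> (P ?z \<star> s)) = P \<eta> \<star> (t \<star> t') \<star> P ?z \<star> s"
        unfolding h(1) by (simp only: assoc)
      also have "\<dots> = g" using t' \<open>P \<theta> = P \<eta> \<star> P ?z\<close> g by simp
      finally have "g = h \<star> (t' \<star> (P ?z \<star> s))" ..
      moreover have "t' \<star> (P ?z \<star> s) \<in> stab" using t' Pz g by (intro submonoid_gen_mult) auto
      ultimately show ?thesis by blast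
    next
      case (step a b h')
      then show ?thesis using two[of "\<theta> (k, True)" a b] g(2) by auto
    qed
  next
    case g: (step a b g')
    show ?thesis
      using less.prems(2)
    proof (cases rule: good.cases)
      case (base \<eta> t)
      then show ?thesis using two[of "\<eta> (k, True)" a b] g by auto
    next
      case h: (step c d h')
      have "conn v a b c d"
        using canonI[OF g(2-6)] canonI[OF h(2-6)] good_prim[OF less.prems(1)] IH by (intro conn_canon) auto
      then obtain x y where xy: "good x (transv a (inv_letter b) v)" "good y (transv c (inv_letter d) v)"
        "E a b \<star> x = E c d \<star> y" unfolding conn_def by auto
      obtain s where s: "s \<in> stab" "g' = x \<star> s"
        using IH[OF norm1_desc[OF fin g(3,4,5,6)] g(7) xy(1)] by auto
      obtain t where t: "t \<in> stab" "y = h' \<star> t"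
        using IH[OF norm1_desc[OF fin h(3,4,5,6)] xy(2) h(7)] by auto
      have "g = E a b \<star> x \<star> s" using g(1) s by (simp only: assoc)
      also have "\<dots> = h \<star> (t \<star> s)" unfolding xy(3) t(2) h(1) by (simp only: assoc)
      finally show ?thesis using submonoid_gen_mult[OF t(1) s(1)] by blast
    qed
  qed
qed

lemma transv_sym: "fst a \<noteq> fst b \<Longrightarrow> transv (inv_letter a) (inv_letter b) v = transv a b v"
  by (rule lval_eqI) (simp add: lval_transv)

text \<open>By uniqueness any run for v may be taken to begin with the given step, which the inverse
  elementary matrix then removes.\<close>

lemma good_descend:
  assumes "good g v" "canon v a b"
  shows "good (E a (inv_letter b) \<star> g) (transv a (inv_letter b) v)"
proof -
  have ab: "fst a \<in> I" "fst b \<in> I" "fst a \<noteq> fst b" using assms(2) by (auto simp: canon_def)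
  obtain t where t: "good t (transv a (inv_letter b) v)"
    using good_exists[OF canon_prim[OF assms(2) good_prim[OF assms(1)]]] by auto
  obtain s where s: "s \<in> stab" "g = E a b \<star> t \<star> s"
    using good_unique[OF assms(1) canon_step[OF assms(2) t]] by auto
  have "E a (inv_letter b) \<star> g = t \<star> s" using ab s(2) by (simp add: assoc)
  then show ?thesis using good_right[OF t s(1)] by simp
qed

text \<open>A nonnegative coordinate at b gives an ascent; one that is at most minus the coordinate
  at a gives a descent for the inverse of b. Only a change of sign at b remains to be
  treated.\<close>

lemma good_E_pos:
  assumes "good g v" "fst a \<in> I" "fst b \<in> I" "fst a \<noteq> fst b" "0 < lval v a"
  shows "good (E a b \<star> g) (transv a b v)"
proof (cases "0 \<le> lval v b")
  case True
  then show ?thesis using assms by (intro good_ascend) auto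
next
  case neg: False
  show ?thesis
  proof (cases "lval v a \<le> lval v (inv_letter b)")
    case True
    then show ?thesis using good_descend[OF assms(1), of a "inv_letter b"] assms by (simp add: canon_def)
  next
    case False
    \<comment> \<open>The sum changes sign at b, so adding a to b is not one step backwards or
      forwards. \<open>E_quarter\<close> replaces it by a descent, a quarter turn and an
      ascent.\<close>
    define v1 where "v1 = transv b a v"
    have q: "signed_perm I (quarter a b)" using assms by (intro signed_perm_quarter)
    have "good (E (inv_letter b) (inv_letter a) \<star> g) (transv (inv_letter b) (inv_letter a) v)"
      using assms neg False by (intro good_descend) (auto simp: canon_def)
    then have "good (E b a \<star> g) v1"
      using assms by (simp add: v1_def E_sym transv_sym)
    then have g2: "good (P (quarter a b) \<star> (E b a \<star> g)) (permv (quarter a b) v1)"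
      by (rule good_P[OF _ q])
    have v2: "lval (permv (quarter a b) v1) b = lval v a + lval v b"
      "lval (permv (quarter a b) v1) a = - lval v b"
      using lval_permv[OF q, of v1 a] lval_permv[OF q, of v1 "inv_letter b"] quarter_simps[OF assms(4)] assms(4)
      by (simp_all add: v1_def lval_transv inv_letter_neq_fst)
    have "good (E b a \<star> (P (quarter a b) \<star> (E b a \<star> g))) (transv b a (permv (quarter a b) v1))"
      using assms neg False v2 by (intro good_ascend[OF g2]) auto
    moreover have "E b a \<star> (P (quarter a b) \<star> (E b a \<star> g)) = E a b \<star> g"
      using E_quarter[of a b] assms by (simp add: assoc)
    moreover have "transv b a (permv (quarter a b) v1) = transv a b v"
    proof (rule lval_eqI)
      fix d
      consider "d = a" | "d = inv_letter a" | "d = b" | "d = inv_letter b" | "fst d \<noteq> fst a \<and> fst d \<noteq> fst b"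
        using letter_cases[of d a] letter_cases[of d b] by blast
      then show "lval (transv b a (permv (quarter a b) v1)) d = lval (transv a b v) d"
      proof cases
        case 5
        then have "lval (permv (quarter a b) v1) d = lval v1 d"
          using lval_permv[OF q, of v1 d] quarter_simps(5)[OF assms(4), of d] by simp
        then show ?thesis using 5 assms(4) by (simp add: lval_transv inv_letter_neq_fst v1_def)
      qed (use assms(4) v2 in \<open>simp_all add: lval_transv inv_letter_neq_fst\<close>)
    qed
    ultimately show ?thesis by simp
  qed
qed

lemma good_E:
  assumes "good g v" "fst a \<in> I" "fst b \<in> I" "fst a \<noteq> fst b"
  shows "good (E a b \<star> g) (transv a b v)"
proof -
  consider "lval v a = 0" | "0 < lval v a" | "0 < lval v (inv_letter a)" by fastforce
  then show ?thesis
  proof cases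
    case 1
    then have "transv a b v = v" by (simp add: transv_def)
    then show ?thesis using good_fix[OF assms 1] by simp
  next
    case 2
    then show ?thesis using good_E_pos assms by blast
  next
    case 3
    then show ?thesis
      using good_E_pos[of g v "inv_letter a" "inv_letter b"] assms by (simp add: E_sym transv_sym)
  qed
qed

lemma good_act:
  assumes "g \<in> submonoid_gen (gens I I I)" "good h v"
  shows "good (g \<star> h) (act g v)"
  using assms(1)
proof induction
  case (mult x g)
  from mult(1) show ?case
  proof (cases rule: gens_cases)
    case (1 a b)
    then show ?thesis using good_E[OF mult.IH, of a b] by (simp add: assoc act_mul act_E)
  next
    case (2 \<theta>)
    then show ?thesis using good_P[OF mult.IH, of \<theta>] by (simp add: assoc act_mul act_P signed_perm_N)
  qed
qed (simp add: assms(2))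

text \<open>The neutral element is good for the k-th unit vector, so g is good for its image, which
  is the same vector. A run for a unit vector has no steps, and its signed permutation fixes
  k.\<close>

lemma stabilizer:
  assumes "g \<in> submonoid_gen (gens I I I)" "act g (unitv (k, True)) = unitv (k, True)"
  shows "g \<in> stab"
proof -
  have "good (P (\<lambda>a. a) \<star> e) (unitv (k, True))"
    using good.base[OF signed_perm_id submonoid_gen.one] by simp
  then have "good g (unitv (k, True))"
    using good_act[OF assms(1), of e "unitv (k, True)"] assms(2) by (simp add: P_id)
  then show ?thesis
  proof (cases rule: good.cases)
    case (base \<theta> s)
    then have "lval (unitv (k, True)) (\<theta> (k, True)) = lval (unitv (\<theta> (k, True))) (\<theta> (k, True))" by simp
    then have eq: "\<theta> (k, True) = (k, True)" by (simp add: lval_unitv split: if_splits)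
    have "\<theta> a = a" if "fst a \<notin> I - {k}" for a
    proof (cases "fst a = k")
      case True
      then have "a = (k, True) \<or> a = inv_letter (k, True)" using fst_eq_iff[of a "(k, True)"] by simp
      then show ?thesis using eq signed_permD(2)[OF base(3), of "(k, True)"] by auto
    next
      case False
      then show ?thesis using that signed_permD(3)[OF base(3)] by auto
    qed
    then have "signed_perm (I - {k}) \<theta>" using base(3) by (simp add: signed_perm_def del: split_paired_All)
    then show ?thesis unfolding base(1) by (intro submonoid_gen_mult stab_P base(4))
  next
    case (step a b h)
    then show ?thesis by (auto simp: lval_unitv split: if_splits)
  qed
qed

lemma stab_act: "s \<in> stab \<Longrightarrow> act s (unitv (k, True)) = unitv (k, True)"
proof (induction rule: submonoid_gen.induct)
  case (mult x g)
  from mult(1) show ?case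
  proof (cases rule: gens_cases)
    case (1 a b)
    then have "lval (unitv (k, True)) a = 0" by (auto simp: lval_def unitv_def)
    then have "transv a b (unitv (k, True)) = unitv (k, True)" by (simp add: transv_def)
    then show ?thesis using 1 mult.IH by (simp add: act_mul act_E)
  next
    case (2 \<theta>)
    then have "\<theta> (k, True) = (k, True)" by (auto intro: signed_permD(3))
    moreover have "signed_perm I \<theta>" using 2 signed_perm_mono by blast
    ultimately show ?thesis using 2 mult.IH by (simp add: act_mul act_P signed_perm_N permv_unitv)
  qed
qed simp

lemma good_act_unitv: "good g v \<Longrightarrow> act g (unitv (k, True)) = v"
proof (induction rule: good.induct)
  case (base \<theta> s)
  then show ?case by (simp add: act_mul stab_act act_P signed_perm_N permv_unitv)
next
  case (step a b v g)
  then show ?case by (simp add: act_mul act_E)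
qed

section \<open>Radical and Levi part of the stabiliser\<close>

abbreviation "rad \<equiv> submonoid_gen (gens (I - {k}) {k} {})"
text \<open>\<open>rad\<close> changes only the coordinate at k, by combinations of the others;
  \<open>levi\<close> is the full group on the remaining indices. Allowing no support for signed
  permutations leaves \<open>rad\<close> with the neutral element only.\<close>

abbreviation "levi \<equiv> submonoid_gen (gens (I - {k}) (I - {k}) (I - {k}))"

lemma signed_perm_empty: "signed_perm {} \<theta> \<Longrightarrow> \<theta> = (\<lambda>a. a)"
  using signed_permD(3) by blast

text \<open>A signed permutation relabels an elementary matrix into k. An elementary matrix commutes
  with it, unless its target is the source, when the chain relation adds one more factor of
  \<open>rad\<close>.\<close>

lemma levi_rad_gen:
  assumes x: "x \<in> gens (I - {k}) (I - {k}) (I - {k})" and y: "y \<in> gens (I - {k}) {k} {}"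
  shows "\<exists>y'\<in>rad. x \<star> y = y' \<star> x"
  using y
proof (cases rule: gens_cases)
  case (2 \<theta>)
  then have "y = e" using signed_perm_empty P_id by auto
  then show ?thesis using submonoid_gen.one by (intro bexI[of _ e]) auto
next
  case y: (1 c \<kappa>)
  have radI: "E c \<kappa> \<in> rad" if "fst c \<in> I - {k}" "fst \<kappa> = k" for c \<kappa>
    using that by (intro submonoid_gen_inc gens_E) auto
  from x show ?thesis
  proof (cases rule: gens_cases)
    case (2 \<theta>)
    have \<theta>: "signed_perm I \<theta>" "\<theta> \<kappa> = \<kappa>" using 2 y signed_perm_mono signed_permD(3) by auto
    have "x \<star> y = E (\<theta> c) (\<theta> \<kappa>) \<star> x" using 2 y k \<theta> by (simp add: P_E signed_perm_N)
    moreover have "E (\<theta> c) (\<theta> \<kappa>) \<in> rad"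
      using y \<theta> signed_perm_mem[OF 2(2), of c] by (intro radI) auto
    ultimately show ?thesis by blast
  next
    case (1 a b)
    show ?thesis
    proof (cases "fst b = fst c")
      case False
      then have "x \<star> y = y \<star> x" using 1 y k by (simp add: E_comm[of a b c \<kappa>])
      then show ?thesis using submonoid_gen_inc[OF assms(2)] by blast
    next
      case True
      \<comment> \<open>The common index may occur with opposite signs; \<open>E_sym\<close> moves
        the sign to the target at k.\<close>
      obtain d \<mu> where d: "d = b" "fst \<mu> = k" "y = E d \<mu>"
      proof (cases "c = b")
        case True
        then show ?thesis using that y by auto
      next
        case False
        then have "b = inv_letter c" using True letter_cases[of b c] by auto
        then have "y = E b (inv_letter \<kappa>)" using y k by (simp add: E_sym)
        then show ?thesis using that[of b "inv_letter \<kappa>"] y by simp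
      qed
      have "x \<star> (y \<star> e) = E b \<mu> \<star> (E a b \<star> (E a (inv_letter \<mu>) \<star> e))"
        unfolding 1(1) d(3,1) using 1 d(2) k by (intro E_chain_swap) auto
      also have "E a b \<star> (E a (inv_letter \<mu>) \<star> e) = E a (inv_letter \<mu>) \<star> (E a b \<star> e)"
        using 1 d(2) k by (intro E_comm') auto
      finally have "x \<star> y = E b \<mu> \<star> E a (inv_letter \<mu>) \<star> x" by (simp add: 1(1) assoc)
      moreover have "E b \<mu> \<star> E a (inv_letter \<mu>) \<in> rad"
        using 1 d by (intro submonoid_gen_mult radI) auto
      ultimately show ?thesis by blast
    qed
  qed
qed

lemma levi_rad:
  assumes x: "x \<in> gens (I - {k}) (I - {k}) (I - {k})" and q: "q \<in> rad"
  shows "\<exists>q'\<in>rad. x \<star> q = q' \<star> x"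
  using q
proof induction
  case one
  then show ?case using submonoid_gen.one by (intro bexI[of _ e]) auto
next
  case (mult y q)
  obtain q' where q': "q' \<in> rad" "x \<star> q = q' \<star> x" using mult.IH by auto
  obtain y' where y': "y' \<in> rad" "x \<star> y = y' \<star> x" using levi_rad_gen[OF x mult(1)] by auto
  have "x \<star> (y \<star> q) = y' \<star> (x \<star> q)" using y'(2) by (simp flip: assoc)
  also have "\<dots> = y' \<star> q' \<star> x" by (simp add: q'(2) assoc)
  finally show ?case using submonoid_gen_mult[OF y'(1) q'(1)] by blast
qed

lemma stab_decomp: "s \<in> stab \<Longrightarrow> \<exists>q\<in>rad. \<exists>g\<in>levi. s = q \<star> g"
proof (induction rule: submonoid_gen.induct)
  case one
  then show ?case using submonoid_gen.one by (intro bexI[of _ e]) auto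
next
  case (mult x s)
  obtain q g where qg: "q \<in> rad" "g \<in> levi" "s = q \<star> g" using mult.IH by auto
  have "x \<in> gens (I - {k}) {k} {} \<or> x \<in> gens (I - {k}) (I - {k}) (I - {k})"
    using mult(1)
  proof (cases rule: gens_cases)
    case (1 a b)
    then show ?thesis by (cases "fst b = k") (auto intro: gens_E)
  qed (auto intro: gens_P)
  then show ?case
  proof
    assume x: "x \<in> gens (I - {k}) {k} {}"
    have "x \<star> s = x \<star> q \<star> g" by (simp add: qg(3) assoc)
    then show ?thesis using submonoid_gen.mult[OF x qg(1)] qg(2) by blast
  next
    assume x: "x \<in> gens (I - {k}) (I - {k}) (I - {k})"
    obtain q' where q': "q' \<in> rad" "x \<star> q = q' \<star> x" using levi_rad[OF x qg(1)] by auto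
    have "x \<star> s = x \<star> q \<star> g" by (simp add: qg(3) assoc)
    also have "\<dots> = q' \<star> (x \<star> g)" by (simp add: q'(2) assoc)
    finally show ?thesis using submonoid_gen.mult[OF x qg(2)] q'(1) by blast
  qed
qed

lemma rad_act: "q \<in> rad \<Longrightarrow> i \<noteq> k \<Longrightarrow> act q v i = v i"
proof (induction rule: submonoid_gen.induct)
  case (mult x g)
  from mult(1) show ?case
  proof (cases rule: gens_cases)
    case (1 a b)
    then show ?thesis using mult.IH mult.prems k by (auto simp: act_mul act_E transv_fun)
  next
    case (2 \<theta>)
    then have "x = e" using signed_perm_empty P_id by auto
    then show ?thesis using mult by simp
  qed
qed simp

lemma levi_act: "g \<in> levi \<Longrightarrow> act g (v(k := c)) = (act g v)(k := c)"
proof (induction rule: submonoid_gen.induct)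
  case (mult x g)
  from mult(1) show ?case
  proof (cases rule: gens_cases)
    case (1 a b)
    then show ?thesis
      using mult.IH k by (auto simp: act_mul act_E transv_def lval_def fun_eq_iff)
  next
    case (2 \<theta>)
    have \<theta>: "signed_perm I \<theta>" using 2 signed_perm_mono by blast
    note inv = signed_perm_inv[OF 2(2)]
    have "permv \<theta> (w(k := c)) = (permv \<theta> w)(k := c)" for w
    proof
      fix i
      have "fst (inv_into UNIV \<theta> (i, True)) = k \<longleftrightarrow> i = k" "inv_into UNIV \<theta> (k, True) = (k, True)"
        using signed_permD(3)[OF inv(1), of "(k, True)"]
          signed_perm_fst_eq[OF inv(1), of "(i, True)" "(k, True)"] by auto
      then show "permv \<theta> (w(k := c)) i = ((permv \<theta> w)(k := c)) i"
        by (auto simp: permv_def lval_def)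
    qed
    then show ?thesis using 2 \<theta> mult.IH by (simp add: act_mul act_P signed_perm_N del: fun_upd_apply)
  qed
qed simp

lemma funpow_rad:
  assumes "q \<in> submonoid_gen (gens J {k} {})" "fst a \<in> J" "fst \<kappa> = k" "fst a \<noteq> k"
  shows "((\<star>) (E a \<kappa>) ^^ m) q \<in> submonoid_gen (gens J {k} {})"
  using assms by (induction m) (auto intro!: submonoid_gen.mult gens_E)

lemma act_funpow:
  assumes "fst a \<in> I" "fst \<kappa> = k" "fst a \<noteq> k"
  shows "act (((\<star>) (E a \<kappa>) ^^ m) q) v = (act q v)(k := act q v k + int m * (if snd \<kappa> then 1 else - 1) * lval (act q v) a)"
proof (induction m)
  case (Suc m)
  then show ?case
    using assms k by (auto simp: act_mul act_E transv_def lval_def algebra_simps)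
qed simp

lemma rad_act_J:
  assumes "q \<in> submonoid_gen (gens J {k} {})" "J \<subseteq> I - {k}" "\<And>j. j \<in> J \<Longrightarrow> v j = 0"
  shows "act q v = v"
  using assms(1)
proof induction
  case (mult x g)
  from mult(1) show ?case
  proof (cases rule: gens_cases)
    case (1 a b)
    then have "fst a \<in> N" "fst b \<in> N" "lval v a = 0" using assms(2,3) k by (auto simp: lval_def)
    then show ?thesis using 1 mult.IH by (simp add: act_mul act_E transv_def del: fun_upd_apply)
  next
    case (2 \<theta>)
    then have "x = e" using signed_perm_empty P_id by auto
    then show ?thesis using mult by simp
  qed
qed simp

text \<open>Generators with different sources commute, so those with source i can be collected in
  front. The sign of the exponent is carried by the letter \<kappa>, which keeps m a natural
  number.\<close>

lemma rad_split:
  assumes q: "q \<in> submonoid_gen (gens (insert i J) {k} {})" and J: "insert i J \<subseteq> I - {k}"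
  shows "\<exists>m \<kappa>. fst \<kappa> = k \<and> (\<exists>q'\<in>submonoid_gen (gens J {k} {}). q = ((\<star>) (E (i, True) \<kappa>) ^^ m) q')"
  using q
proof induction
  case one
  then show ?case
    using submonoid_gen.one by (intro exI[of _ 0] exI[of _ "(k, True)"]) auto
next
  case (mult x q)
  obtain m \<kappa> q' where IH: "fst \<kappa> = k" "q' \<in> submonoid_gen (gens J {k} {})" "q = ((\<star>) (E (i, True) \<kappa>) ^^ m) q'"
    using mult.IH by auto
  from mult(1) show ?case
  proof (cases rule: gens_cases)
    case (2 \<theta>)
    then have "x = e" using signed_perm_empty P_id by auto
    then have "x \<star> q = ((\<star>) (E (i, True) \<kappa>) ^^ m) q'" using IH(3) by simp
    then show ?thesis using IH(1,2) by blast
  next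
    case (1 a b)
    show ?thesis
    proof (cases "fst a = i")
      case True
      obtain \<mu> where mu: "x = E (i, True) \<mu>" "fst \<mu> = k"
      proof (cases "snd a")
        case True
        then have "a = (i, True)" using \<open>fst a = i\<close> by (simp add: prod_eq_iff)
        then show ?thesis using that[of b] 1 by simp
      next
        case False
        then have "inv_letter a = (i, True)" using \<open>fst a = i\<close> by (simp add: inv_letter_def)
        moreover have "E (inv_letter a) (inv_letter b) = E a b" using 1 J k by (intro E_sym) auto
        ultimately show ?thesis using that[of "inv_letter b"] 1 by simp
      qed
      consider "\<mu> = \<kappa>" | "\<mu> = inv_letter \<kappa>" "m = 0" | m' where "\<mu> = inv_letter \<kappa>" "m = Suc m'"
        using letter_cases[of \<mu> \<kappa>] mu IH(1) by (cases m) auto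
      then show ?thesis
      proof cases
        case 1
        then have "x \<star> q = ((\<star>) (E (i, True) \<kappa>) ^^ Suc m) q'" using mu IH by simp
        then show ?thesis using IH by blast
      next
        case 2
        then have "x \<star> q = ((\<star>) (E (i, True) \<mu>) ^^ 1) q'" using mu IH by simp
        then show ?thesis using IH mu by blast
      next
        case (3 m')
        then have "x \<star> q = ((\<star>) (E (i, True) \<kappa>) ^^ m') q'" using mu IH J k by auto
        then show ?thesis using IH by blast
      qed
    next
      case False
      have "x \<star> ((\<star>) (E (i, True) \<kappa>) ^^ m) r = ((\<star>) (E (i, True) \<kappa>) ^^ m) (x \<star> r)" for r
      proof (induction m)
        case (Suc m)
        have "x \<star> (E (i, True) \<kappa> \<star> r) = E (i, True) \<kappa> \<star> (x \<star> r)" for r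
          unfolding 1(1) using 1 J IH(1) k by (intro E_comm') auto
        then show ?case using Suc by simp
      qed simp
      then have "x \<star> q = ((\<star>) (E (i, True) \<kappa>) ^^ m) (x \<star> q')" using IH by simp
      moreover have "x \<star> q' \<in> submonoid_gen (gens J {k} {})"
        using 1 False IH(2) by (auto intro!: submonoid_gen.mult gens_E)
      ultimately show ?thesis using IH(1) by blast
    qed
  qed
qed

text \<open>After collecting the factors with source i, the exponent is read off as the k-th
  coordinate of the image of the i-th unit vector.\<close>

lemma rad_faithful:
  assumes "finite J" "J \<subseteq> I - {k}" "q \<in> submonoid_gen (gens J {k} {})" "\<And>v. act q v = v"
  shows "q = e"
  using assms
proof (induction J arbitrary: q)
  case empty
  from empty(2) show ?case
  proof induction
    case (mult x g)
    from mult(1) show ?case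
    proof (cases rule: gens_cases)
      case (2 \<theta>)
      then have "x = e" using signed_perm_empty P_id by auto
      then show ?thesis using mult by simp
    qed auto
  qed simp
next
  case (insert i J)
  obtain m \<kappa> q' where q: "fst \<kappa> = k" "q' \<in> submonoid_gen (gens J {k} {})" "q = ((\<star>) (E (i, True) \<kappa>) ^^ m) q'"
    using rad_split[OF insert.prems(2,1)] by auto
  have i: "i \<in> I" "i \<noteq> k" using insert.prems(1) by auto
  have "act q' (unitv (i, True)) = unitv (i, True)"
    using insert by (intro rad_act_J[OF q(2)]) (auto simp: unitv_def)
  then have "act q (unitv (i, True)) k = int m * (if snd \<kappa> then 1 else - 1)"
    unfolding q(3) using i q(1) by (subst act_funpow) (auto simp: lval_unitv, auto simp: unitv_def)
  moreover have "act q (unitv (i, True)) k = 0" using insert.prems(3) i by (simp add: unitv_def)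
  ultimately have "m = 0" by (auto split: if_splits)
  then have "q = q'" using q by simp
  then show ?case using insert q by auto
qed

text \<open>Multiplying powers of the generators realises every integral row at k; this completes
  the block form in \<open>surjective\<close>.\<close>

lemma rad_exists:
  assumes "finite J" "J \<subseteq> I - {k}"
  shows "\<exists>q\<in>submonoid_gen (gens J {k} {}). \<forall>v. act q v = v(k := v k + (\<Sum>j\<in>J. c j * v j))"
  using assms
proof (induction J)
  case empty
  then show ?case using submonoid_gen.one by (intro bexI[of _ e]) auto
next
  case (insert i J)
  have "J \<subseteq> I - {k}" using insert.prems by blast
  then obtain q where q: "q \<in> submonoid_gen (gens J {k} {})" "\<And>v. act q v = v(k := v k + (\<Sum>j\<in>J. c j * v j))"
    using insert.IH by blast
  have i: "i \<in> I" "i \<noteq> k" using insert.prems(1) by auto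
  let ?q = "((\<star>) (E (i, True) (k, 0 \<le> c i)) ^^ nat \<bar>c i\<bar>) q"
  have "gens J {k} {} \<subseteq> gens (insert i J) {k} {}" unfolding gens_def by blast
  then have "?q \<in> submonoid_gen (gens (insert i J) {k} {})"
    using i submonoid_gen_mono q(1) by (intro funpow_rad) auto
  moreover have "act ?q v = v(k := v k + (\<Sum>j\<in>insert i J. c j * v j))" for v
  proof -
    have "act ?q v = (act q v)(k := act q v k + int (nat \<bar>c i\<bar>) * (if 0 \<le> c i then 1 else - 1) * lval (act q v) (i, True))"
      using i act_funpow[of "(i, True)" "(k, 0 \<le> c i)" "nat \<bar>c i\<bar>" q v] by simp
    moreover have "lval (act q v) (i, True) = v i" using i by (simp add: q(2) lval_def)
    moreover have "int (nat \<bar>c i\<bar>) * (if 0 \<le> c i then 1 else - 1) = c i" by simp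
    ultimately show ?thesis using insert.hyps by (simp add: q(2) ac_simps)
  qed
  ultimately show ?case by (intro bexI[of _ ?q] allI)
qed

end

section \<open>Faithfulness of the action\<close>

context steinberg begin

lemma gens_mono: "I \<subseteq> I' \<Longrightarrow> J \<subseteq> J' \<Longrightarrow> K \<subseteq> K' \<Longrightarrow> gens I J K \<subseteq> gens I' J' K'"
proof
  fix x assume le: "I \<subseteq> I'" "J \<subseteq> J'" "K \<subseteq> K'" and x: "x \<in> gens I J K"
  from x show "x \<in> gens I' J' K'"
  proof (cases rule: gens_cases)
    case (1 a b)
    then show ?thesis using le by (auto intro: gens_E)
  next
    case (2 \<theta>)
    then show ?thesis using le signed_perm_mono gens_P by metis
  qed
qed

text \<open>An element acting trivially lies in the stabiliser of a basis vector, hence is a product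
  of a radical and a Levi element. Both act trivially as they affect complementary coordinates, and
  the Levi element is covered by the smaller index set.\<close>

theorem faithful:
  assumes "finite I" "I \<subseteq> N" "g \<in> submonoid_gen (gens I I I)" "\<And>v. act g v = v"
  shows "g = e"
  using assms
proof (induction I arbitrary: g)
  case empty
  from empty(2) show ?case
  proof induction
    case (mult x g)
    from mult(1) show ?case
    proof (cases rule: gens_cases)
      case (2 \<theta>)
      then have "\<theta> = (\<lambda>a. a)" using signed_permD(3) by blast
      then have "x = e" using 2 P_id by auto
      then show ?thesis using mult by simp
    qed auto
  qed simp
next
  case (insert k I)
  interpret steinberg_descent mul e act N E P "insert k I" k
    by unfold_locales (use insert in auto)
  have eqI: "insert k I - {k} = I" using insert by auto
  have "g \<in> stab" using insert by (intro stabilizer) auto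
  then obtain q h where qh: "q \<in> rad" "h \<in> levi" "g = q \<star> h" using stab_decomp by blast
  have "act h v = v" for v
  proof
    fix i
    have "act g v = act q (act h v)" using qh by (simp add: act_mul)
    then have *: "act q (act h v) = v" using insert.prems by simp
    show "act h v i = v i"
    proof (cases "i = k")
      case True
      then show ?thesis using levi_act[OF qh(2), of v "v k"] by (metis fun_upd_same fun_upd_triv)
    next
      case False
      then show ?thesis using rad_act[OF qh(1) False, of "act h v"] * by simp
    qed
  qed
  then have "h = e" using insert qh(2) eqI by auto
  moreover have "q = e"
  proof (rule rad_faithful[OF _ _ qh(1)])
    show "act q v = v" for v using insert.prems(3)[of v] qh(3) \<open>h = e\<close> by simp
  qed (use insert in auto)
  ultimately show ?case using qh by simp
qed

end

text \<open>A matrix on the coordinates in I and the identity elsewhere, so that matrices of all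
  sizes act on the same space of functions during the induction on I.\<close>

definition lin_on :: "nat set \<Rightarrow> (nat \<Rightarrow> nat \<Rightarrow> int) \<Rightarrow> (nat \<Rightarrow> int) \<Rightarrow> nat \<Rightarrow> int" where
  "lin_on I A v i = (if i \<in> I then \<Sum>j\<in>I. A i j * v j else v i)"

lemma lin_on_cong:
  assumes "\<And>j. j \<in> I \<Longrightarrow> v j = w j" "i \<notin> I \<Longrightarrow> v i = w i"
  shows "lin_on I A v i = lin_on I A w i"
  using assms by (simp add: lin_on_def)

lemma lin_on_comp:
  assumes "finite I"
  shows "lin_on I A (lin_on I B v) = lin_on I (\<lambda>i j. \<Sum>k\<in>I. A i k * B k j) v"
proof
  fix i
  show "lin_on I A (lin_on I B v) i = lin_on I (\<lambda>i j. \<Sum>k\<in>I. A i k * B k j) v i"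
  proof (cases "i \<in> I")
    case True
    have "(\<Sum>k\<in>I. A i k * (\<Sum>j\<in>I. B k j * v j)) = (\<Sum>k\<in>I. \<Sum>j\<in>I. A i k * B k j * v j)"
      by (simp add: sum_distrib_left mult.assoc)
    also have "\<dots> = (\<Sum>j\<in>I. \<Sum>k\<in>I. A i k * B k j * v j)" by (rule sum.swap)
    finally show ?thesis using True by (simp add: lin_on_def sum_distrib_right)
  qed (simp add: lin_on_def)
qed

lemma lin_on_id: "finite I \<Longrightarrow> lin_on I (\<lambda>i j. if i = j then 1 else 0) v = v"
  by (auto simp: lin_on_def fun_eq_iff if_distrib[of "\<lambda>x. x * _"] cong: if_cong)

lemma lin_on_transv:
  assumes "finite I" "fst a \<in> I" "fst b \<in> I"
  shows "\<exists>A. \<forall>v. transv a b v = lin_on I A v"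
proof (intro exI allI ext)
  fix v i
  let ?s = "(if snd b then 1 else - 1) * (if snd a then 1 else - 1) :: int"
  show "transv a b v i = lin_on I (\<lambda>i j. (if i = j then 1 else 0) + (if i = fst b \<and> j = fst a then ?s else 0)) v i"
  proof (cases "i \<in> I")
    case True
    have "(\<Sum>j\<in>I. ((if i = j then 1 else 0) + (if i = fst b \<and> j = fst a then ?s else 0)) * v j) =
        (\<Sum>j\<in>I. if i = j then v j else 0) + (\<Sum>j\<in>I. if fst a = j then (if i = fst b then ?s * v j else 0) else 0)"
      by (simp add: distrib_right sum.distrib) (auto intro!: sum.cong arg_cong2[of _ _ _ _ "(+)"])
    then show ?thesis using True assms by (simp add: lin_on_def transv_fun lval_def)
  qed (use assms in \<open>auto simp: lin_on_def transv_fun\<close>)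
qed

lemma lin_on_permv:
  assumes "finite I" "signed_perm I \<theta>"
  shows "\<exists>A. \<forall>v. permv \<theta> v = lin_on I A v"
proof (intro exI allI ext)
  fix v i
  let ?t = "\<lambda>i. inv_into UNIV \<theta> (i, True)"
  note inv = signed_perm_inv[OF assms(2)]
  show "permv \<theta> v i = lin_on I (\<lambda>i j. if fst (?t i) = j then (if snd (?t i) then 1 else - 1) else 0) v i"
  proof (cases "i \<in> I")
    case True
    have "fst (?t i) \<in> I" using True signed_perm_mem[OF inv(1), of "(i, True)"] by simp
    moreover have "(\<Sum>j\<in>I. (if fst (?t i) = j then (if snd (?t i) then 1 else - 1) else 0) * v j) =
        (\<Sum>j\<in>I. if fst (?t i) = j then (if snd (?t i) then 1 else - 1) * v j else 0)"
      by (intro sum.cong) auto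
    ultimately show ?thesis using True assms(1) by (simp add: lin_on_def permv_def lval_def)
  next
    case False
    then have "?t i = (i, True)" using signed_permD(3)[OF inv(1), of "(i, True)"] by simp
    then show ?thesis using False by (simp add: lin_on_def permv_def lval_def)
  qed
qed

section \<open>Surjectivity onto invertible integral matrices\<close>

context steinberg begin

lemma gens_act_lin:
  assumes "finite I" "I \<subseteq> N" "g \<in> submonoid_gen (gens I I I)"
  shows "\<exists>A. \<forall>v. act g v = lin_on I A v"
  using assms(3)
proof induction
  case one
  then show ?case using lin_on_id[OF assms(1)] act_e by metis
next
  case (mult x g)
  have "\<exists>A. \<forall>v. act x v = lin_on I A v"
    using mult(1)
  proof (cases rule: gens_cases)
    case (1 a b)
    then show ?thesis using lin_on_transv[OF assms(1), of a b] assms(2) by (simp add: act_E subset_iff)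
  next
    case (2 \<theta>)
    then show ?thesis using lin_on_permv[OF assms(1), of \<theta>] signed_perm_mono[OF _ assms(2)] by (simp add: act_P)
  qed
  then obtain A where A: "\<And>v. act x v = lin_on I A v" by auto
  obtain B where B: "\<And>v. act g v = lin_on I B v" using mult.IH by auto
  show ?case
    by (intro exI[of _ "\<lambda>i j. \<Sum>k\<in>I. A i k * B k j"]) (simp add: act_mul A B lin_on_comp[OF assms(1)])
qed

text \<open>The column at k of an invertible matrix is primitive, so Euclid's algorithm moves the
  k-th unit vector to it. What remains fixes that vector and is a Levi block together with a row at
  k. The inverse B is carried along to keep blocks invertible.\<close>

theorem surjective:
  assumes "finite I" "I \<subseteq> N" "\<And>v. lin_on I A (lin_on I B v) = v" "\<And>v. lin_on I B (lin_on I A v) = v"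
  shows "\<exists>g\<in>submonoid_gen (gens I I I). \<forall>v. act g v = lin_on I A v"
  using assms
proof (induction I arbitrary: A B)
  case empty
  then show ?case using submonoid_gen.one by (intro bexI[of _ e]) (auto simp: lin_on_def fun_eq_iff)
next
  case (insert k I)
  let ?K = "insert k I" and ?u = "unitv (k, True)"
  interpret steinberg_descent mul e act N E P ?K k
    by unfold_locales (use insert in auto)
  have eqI: "?K - {k} = I" using insert by auto
  \<comment> \<open>The column of A at k. A common divisor of its entries divides the k-th entry of
    B applied to it, which is 1.\<close>
  define v where "v = lin_on ?K A ?u"
  have u: "lin_on ?K B v = ?u" using insert.prems(3) by (simp add: v_def)
  have "prim ?K v"
    unfolding prim_def
  proof (intro conjI allI impI)
    show "v i = 0" if "i \<notin> ?K" for i using that by (auto simp: v_def lin_on_def unitv_def)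
    show "d dvd 1" if d: "\<forall>a. d dvd lval v a" for d
    proof -
      have "d dvd v i" for i using d[rule_format, of "(i, True)"] by (simp add: lval_def)
      then have "d dvd lin_on ?K B v k" by (auto simp: lin_on_def intro!: dvd_sum simp del: sum.insert)
      then show ?thesis by (simp add: u unitv_def)
    qed
  qed
  then obtain g where g: "g \<in> submonoid_gen (gens ?K ?K ?K)" "good g v" using good_exists by blast
  obtain h where h: "h \<in> submonoid_gen (gens ?K ?K ?K)" "g \<star> h = e" "h \<star> g = e"
    using submonoid_gens_inverse[OF insert.prems(1) insert.prems(1) insert.prems(1) g(1)] by blast
  have fin: "finite ?K" using insert by simp
  obtain G where G: "\<And>v. act g v = lin_on ?K G v" using gens_act_lin[OF fin insert.prems(1) g(1)] by blast
  obtain H where H: "\<And>v. act h v = lin_on ?K H v" using gens_act_lin[OF fin insert.prems(1) h(1)] by blast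
  \<comment> \<open>C is A with the run g undone, and D is its inverse; both fix the k-th unit
    vector.\<close>
  define C where "C = (\<lambda>i j. \<Sum>k\<in>?K. H i k * A k j)"
  define D where "D = (\<lambda>i j. \<Sum>k\<in>?K. B i k * G k j)"
  have C: "lin_on ?K C v = act h (lin_on ?K A v)" for v by (simp add: C_def H lin_on_comp[OF fin])
  have D: "lin_on ?K D v = lin_on ?K B (act g v)" for v by (simp add: D_def G lin_on_comp[OF fin])
  have gh: "act g (act h v) = v" "act h (act g v) = v" for v by (simp_all add: h flip: act_mul)
  have CD: "lin_on ?K C (lin_on ?K D v) = v" "lin_on ?K D (lin_on ?K C v) = v" for v
    by (simp_all add: C D insert.prems gh)
  have "act g ?u = v" by (rule good_act_unitv[OF g(2)])
  then have "lin_on ?K C ?u = ?u" "lin_on ?K D ?u = ?u"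
    using gh(2)[of ?u] by (simp_all add: C D u flip: v_def)
  have lin_u: "lin_on ?K M ?u i = M i k" if "i \<in> ?K" for M i
  proof -
    have "lin_on ?K M ?u i = (\<Sum>j\<in>?K. M i j * ?u j)" using that by (simp only: lin_on_def if_True)
    also have "\<dots> = (\<Sum>j\<in>?K. if k = j then M i j else 0)"
      by (intro sum.cong) (auto simp: unitv_def)
    also have "\<dots> = M i k" using sum.delta'[OF fin, of k "\<lambda>j. M i j"] by simp
    finally show ?thesis .
  qed
  have col: "M i k = 0" if "lin_on ?K M ?u = ?u" "i \<in> I" for M i
  proof -
    have "M i k = ?u i" using lin_u[of i M] that by simp
    then show ?thesis using that insert.hyps by (auto simp: unitv_def)
  qed
  have colk: "C k k = 1"
    using lin_u[of k C] \<open>lin_on ?K C ?u = ?u\<close> by (simp add: unitv_def)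
  \<comment> \<open>The column of M at k vanishes outside k, so the coordinates in I are computed by
    the smaller block.\<close>
  have restr: "lin_on I M w i = lin_on ?K M w i" if "lin_on ?K M ?u = ?u" "i \<noteq> k" for M w i
    using that col[OF that(1)] insert by (auto simp: lin_on_def)
  have inv: "lin_on I M (lin_on I M' w) = w"
    if "lin_on ?K M ?u = ?u" "lin_on ?K M' ?u = ?u" "\<And>w. lin_on ?K M (lin_on ?K M' w) = w" for M M' w
  proof
    fix i
    show "lin_on I M (lin_on I M' w) i = w i"
    proof (cases "i = k")
      case True
      then show ?thesis using insert by (simp add: lin_on_def)
    next
      case False
      have "lin_on I M (lin_on I M' w) i = lin_on I M (lin_on ?K M' w) i"
      proof (rule lin_on_cong)
        show "lin_on I M' w j = lin_on ?K M' w j" if "j \<in> I" for j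
          using restr[OF \<open>lin_on ?K M' ?u = ?u\<close>] that insert.hyps by metis
        show "lin_on I M' w i = lin_on ?K M' w i"
          using restr[OF \<open>lin_on ?K M' ?u = ?u\<close> False] .
      qed
      also have "\<dots> = w i" using restr[OF that(1) False] that(3) by simp
      finally show ?thesis .
    qed
  qed
  obtain g' where g': "g' \<in> levi" "\<And>v. act g' v = lin_on I C v"
  proof -
    have "I \<subseteq> N" using insert.prems(1) by blast
    from insert.IH[OF this] have "\<exists>g\<in>submonoid_gen (gens I I I). \<forall>v. act g v = lin_on I C v"
      using inv \<open>lin_on ?K C ?u = ?u\<close> \<open>lin_on ?K D ?u = ?u\<close> CD by blast
    then show ?thesis using that unfolding eqI by blast
  qed
  \<comment> \<open>The row of C at k. It is applied before g', as it must read the coordinates in I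
    while they are unchanged.\<close>
  obtain q where q: "q \<in> rad" "\<And>v. act q v = v(k := v k + (\<Sum>j\<in>I. C k j * v j))"
    using rad_exists[of "?K - {k}" "C k"] insert.hyps(1) unfolding eqI by auto
  have mem: "x \<in> submonoid_gen (gens ?K ?K ?K)" if "x \<in> levi \<or> x \<in> rad" for x
  proof -
    have "gens (?K - {k}) (?K - {k}) (?K - {k}) \<subseteq> gens ?K ?K ?K"
      by (intro gens_mono Diff_subset)
    moreover have "gens (?K - {k}) {k} {} \<subseteq> gens ?K ?K ?K"
      by (intro gens_mono Diff_subset empty_subsetI) simp
    ultimately show ?thesis using that submonoid_gen_mono[of _ "gens ?K ?K ?K" x] by (elim disjE) simp_all
  qed
  have "act (g' \<star> q) w = lin_on ?K C w" for w
  proof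
    fix i
    show "act (g' \<star> q) w i = lin_on ?K C w i"
    proof (cases "i = k")
      case True
      then show ?thesis using insert colk by (simp add: act_mul g' q lin_on_def)
    next
      case False
      have "act (g' \<star> q) w i = lin_on I C w i"
        unfolding act_mul g' q using False insert.hyps by (intro lin_on_cong) auto
      then show ?thesis using restr[OF \<open>lin_on ?K C ?u = ?u\<close> False] by simp
    qed
  qed
  then have "act (g \<star> (g' \<star> q)) w = lin_on ?K A w" for w
    by (simp add: act_mul[of g] C gh)
  moreover have "g \<star> (g' \<star> q) \<in> submonoid_gen (gens ?K ?K ?K)"
    using g(1) mem g' q by (intro submonoid_gen_mult) auto
  ultimately show ?case by blast
qed

end

section \<open>Nielsen automorphisms\<close>

declare split_paired_All [simp del]

definition inv_word :: "letter list \<Rightarrow> letter list" where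
  "inv_word w = rev (map inv_letter w)"

lemma inv_word_simps [simp]:
  "inv_word [] = []" "inv_word (a # w) = inv_word w @ [inv_letter a]" "inv_word (u @ v) = inv_word v @ inv_word u"
  "inv_word (inv_word w) = w"
  by (simp_all add: inv_word_def rev_map o_def)

lemma fst_inv_word: "fst ` set (inv_word w) = fst ` set w"
  by (simp add: inv_word_def image_image)

abbreviation "word n w \<equiv> fst ` set w \<subseteq> {..<n}"

lemma free_reduction_carrier: "word n w \<Longrightarrow> free_reduction w \<in> carrier (free_group n)"
  using set_free_reduction[of w] by (auto simp: mem_free_group)

lemma carrier_word: "w \<in> carrier (free_group n) \<Longrightarrow> word n w \<and> free_reduction w = w"
  by (simp add: mem_free_group free_reduction_reduced)

lemma free_reduction_cancel: "free_reduction (u @ w @ inv_word w @ v) = free_reduction (u @ v)"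
proof -
  have "foldr cons_red w (foldr cons_red (inv_word w) x) = x" if "reduced x" for x
    using foldr_inverse_word[OF that, of "inv_word w"] by (simp add: inv_word_def rev_map o_def)
  then show ?thesis by (simp add: free_reduction_append)
qed

section \<open>Endomorphisms given by substitution of letters\<close>

definition sub_word :: "(letter \<Rightarrow> letter list) \<Rightarrow> letter list \<Rightarrow> letter list" where
  "sub_word s w = concat (map s w)"

lemma sub_word_simps [simp]:
  "sub_word s [] = []" "sub_word s (a # w) = s a @ sub_word s w" "sub_word s (u @ v) = sub_word s u @ sub_word s v"
  by (simp_all add: sub_word_def)

definition sym_sub :: "(letter \<Rightarrow> letter list) \<Rightarrow> bool" where
  "sym_sub s \<longleftrightarrow> (\<forall>a. s (inv_letter a) = inv_word (s a))"

lemma sym_subD: "sym_sub s \<Longrightarrow> s (inv_letter a) = inv_word (s a)"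
  by (simp add: sym_sub_def del: split_paired_All)

text \<open>A cancelling pair of letters becomes a word followed by its inverse, which cancels after
  the substitution.\<close>

lemma sub_word_free_reduction:
  assumes "sym_sub s"
  shows "free_reduction (sub_word s (free_reduction w)) = free_reduction (sub_word s w)"
proof -
  have "foldr cons_red (sub_word s (cons_red a w)) x = foldr cons_red (s a) (foldr cons_red (sub_word s w) x)"
    if "reduced x" for a w x
  proof (cases w)
    case (Cons b v)
    show ?thesis
    proof (cases "b = inv_letter a")
      case True
      have "foldr cons_red (inv_word (s b)) (foldr cons_red (s b) y) = y" if "reduced y" for y
        using foldr_inverse_word[OF that, of "s b"] by (simp add: inv_word_def)
      moreover have "s a = inv_word (s b)" using sym_subD[OF assms, of a] True by simp
      ultimately show ?thesis using True Cons that by (simp add: reduced_foldr)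
    qed (simp add: Cons)
  qed simp
  then have "foldr cons_red (sub_word s (free_reduction w)) x = foldr cons_red (sub_word s w) x" if "reduced x" for x
    using that by (induction w) (auto simp: free_reduction_def)
  then show ?thesis by (simp add: free_reduction_def)
qed

text \<open>Restricted to the carrier, because members of the automorphism group are extensional
  functions.\<close>

definition end_of :: "nat \<Rightarrow> (letter \<Rightarrow> letter list) \<Rightarrow> letter list \<Rightarrow> letter list" where
  "end_of n s = (\<lambda>w\<in>carrier (free_group n). free_reduction (sub_word s w))"

definition word_sub :: "nat \<Rightarrow> (letter \<Rightarrow> letter list) \<Rightarrow> bool" where
  "word_sub n s \<longleftrightarrow> sym_sub s \<and> (\<forall>a. fst a < n \<longrightarrow> word n (s a))"

lemma word_sub_word:
  assumes "word_sub n s" "word n w"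
  shows "word n (sub_word s w)"
  using assms(2)
proof (induction w)
  case (Cons a w)
  then have "word n (s a)" using assms(1) by (simp add: word_sub_def)
  then show ?case using Cons by (simp add: image_Un)
qed simp

lemma end_of_free_reduction:
  assumes "word_sub n s" "word n w"
  shows "end_of n s (free_reduction w) = free_reduction (sub_word s w)"
  using assms sub_word_free_reduction[of s w]
  by (simp add: end_of_def free_reduction_carrier word_sub_def)

lemma end_of_letter: "word_sub n s \<Longrightarrow> fst c < n \<Longrightarrow> end_of n s [c] = free_reduction (s c)"
  using end_of_free_reduction[of n s "[c]"] by (simp add: free_reduction_def)

lemma end_of_hom:
  assumes "word_sub n s"
  shows "end_of n s \<in> hom (free_group n) (free_group n)"
proof (rule homI)
  fix u v assume uv: "u \<in> carrier (free_group n)" "v \<in> carrier (free_group n)"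
  then have w: "word n u" "word n v" using carrier_word by blast+
  then have uv': "word n (u @ v)" by (simp add: image_Un)
  have "end_of n s (u \<otimes>\<^bsub>free_group n\<^esub> v) = free_reduction (sub_word s u @ sub_word s v)"
    using end_of_free_reduction[OF assms uv'] by (simp add: mult_free_group)
  also have "\<dots> = free_reduction (free_reduction (sub_word s u) @ free_reduction (sub_word s v))"
    by (simp add: free_reduction_append_left free_reduction_append_right)
  finally show "end_of n s (u \<otimes>\<^bsub>free_group n\<^esub> v) = end_of n s u \<otimes>\<^bsub>free_group n\<^esub> end_of n s v"
    using uv by (simp add: end_of_def mult_free_group)
next
  fix w assume "w \<in> carrier (free_group n)"
  then show "end_of n s w \<in> carrier (free_group n)"
    using word_sub_word[OF assms, of w] carrier_word[of w n] by (simp add: end_of_def free_reduction_carrier)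
qed

lemma end_of_compose:
  assumes "word_sub n s" "word_sub n t" "w \<in> carrier (free_group n)"
  shows "end_of n s (end_of n t w) = free_reduction (sub_word s (sub_word t w))"
  using assms word_sub_word[OF assms(2), of w] carrier_word[OF assms(3)]
  by (simp add: end_of_def[of n t] end_of_free_reduction)

lemma letter_carrier: "fst c < n \<Longrightarrow> [c] \<in> carrier (free_group n)"
  by (simp add: mem_free_group)

lemma inv_letter_group:
  assumes "fst c < n"
  shows "inv\<^bsub>free_group n\<^esub> [c] = [inv_letter c]"
proof -
  interpret group "free_group n" by (rule group_free_group)
  show ?thesis
    using assms by (intro inv_equality)
      (auto simp: mem_free_group mult_free_group one_free_group free_reduction_def)
qed

text \<open>A homomorphism is determined by one letter of each inverse pair. The disjunction lets
  the caller take whichever sign is easier to evaluate.\<close>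

lemma hom_eqI:
  assumes f: "f \<in> hom (free_group n) (free_group n)" and g: "g \<in> hom (free_group n) (free_group n)"
    and eq: "\<And>c. fst c < n \<Longrightarrow> f [c] = g [c] \<or> f [inv_letter c] = g [inv_letter c]"
    and w: "w \<in> carrier (free_group n)"
  shows "f w = g w"
proof -
  interpret F: group "free_group n" by (rule group_free_group)
  interpret f: group_hom "free_group n" "free_group n" f
    using f by (simp add: group_hom_def group_hom_axioms_def group_free_group)
  interpret g: group_hom "free_group n" "free_group n" g
    using g by (simp add: group_hom_def group_hom_axioms_def group_free_group)
  have single: "f [c] = g [c]" if c: "fst c < n" for c
  proof (cases "f [c] = g [c]")
    case False
    then have "f [inv_letter c] = g [inv_letter c]" using eq[OF c] by simp
    then have "f (inv\<^bsub>free_group n\<^esub> [inv_letter c]) = g (inv\<^bsub>free_group n\<^esub> [inv_letter c])"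
      using c by (simp add: letter_carrier)
    then show ?thesis using c by (simp add: inv_letter_group)
  qed
  show ?thesis using w
  proof (induction w)
    case Nil
    have "f \<one>\<^bsub>free_group n\<^esub> = g \<one>\<^bsub>free_group n\<^esub>" by (simp only: f.hom_one g.hom_one)
    then show ?case by (simp add: one_free_group)
  next
    case (Cons a w)
    note sp = reduced_word_split[OF Cons.prems]
    have "fst a < n" using sp(1) by (simp add: mem_free_group)
    then have "f ([a] \<otimes>\<^bsub>free_group n\<^esub> w) = g ([a] \<otimes>\<^bsub>free_group n\<^esub> w)"
      using sp(1,2) single Cons.IH by simp
    then show ?case using sp(3) by simp
  qed
qed

abbreviation "AG n \<equiv> AutoGroup (free_group n)"

lemma group_AG: "group (AG n)"
  by (rule group.AutoGroup[OF group_free_group])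

lemma auto_iff:
  "f \<in> auto (free_group n) \<longleftrightarrow> f \<in> hom (free_group n) (free_group n) \<and> f \<in> extensional (carrier (free_group n)) \<and>
     bij_betw f (carrier (free_group n)) (carrier (free_group n))"
  by (auto simp: auto_def Bij_def)

lemma AG_eqI:
  assumes "f \<in> carrier (AG n)" "g \<in> carrier (AG n)"
    and "\<And>c. fst c < n \<Longrightarrow> f [c] = g [c] \<or> f [inv_letter c] = g [inv_letter c]"
  shows "f = g"
proof (rule extensionalityI)
  have fg: "f \<in> auto (free_group n)" "g \<in> auto (free_group n)" using assms by (simp_all add: AutoGroup_simps)
  then show "f \<in> extensional (carrier (free_group n))" "g \<in> extensional (carrier (free_group n))"
    by (simp_all add: auto_iff)
  show "f w = g w" if "w \<in> carrier (free_group n)" for w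
    using fg that assms(3) by (intro hom_eqI[of f n g]) (simp_all add: auto_iff)
qed

lemma AG_mult:
  assumes "f \<in> carrier (AG n)" "g \<in> carrier (AG n)" "w \<in> carrier (free_group n)"
  shows "(f \<otimes>\<^bsub>AG n\<^esub> g) w = f (g w)"
  using assms by (simp add: AutoGroup_simps compose_def)

lemma end_of_AG:
  assumes s: "word_sub n s" and t: "word_sub n t"
    and st: "\<And>c. fst c < n \<Longrightarrow> free_reduction (sub_word s (t c)) = [c] \<or> free_reduction (sub_word s (t (inv_letter c))) = [inv_letter c]"
    and ts: "\<And>c. fst c < n \<Longrightarrow> free_reduction (sub_word t (s c)) = [c] \<or> free_reduction (sub_word t (s (inv_letter c))) = [inv_letter c]"
  shows "end_of n s \<in> carrier (AG n)"
proof -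
  interpret F: group "free_group n" by (rule group_free_group)
  have id: "(\<lambda>w. w) \<in> hom (free_group n) (free_group n)" by (auto simp: hom_def)
  have inv: "end_of n s (end_of n t w) = w"
    if s: "word_sub n s" and t: "word_sub n t"
      and st: "\<And>c. fst c < n \<Longrightarrow> free_reduction (sub_word s (t c)) = [c] \<or> free_reduction (sub_word s (t (inv_letter c))) = [inv_letter c]"
      and w: "w \<in> carrier (free_group n)" for s t w
  proof -
    have "(end_of n s \<circ> end_of n t) w = (\<lambda>w. w) w"
    proof (rule hom_eqI[OF _ id _ w])
      show "end_of n s \<circ> end_of n t \<in> hom (free_group n) (free_group n)"
        using Group.hom_compose[OF end_of_hom[OF t] end_of_hom[OF s]] .
      show "(end_of n s \<circ> end_of n t) [c] = [c] \<or> (end_of n s \<circ> end_of n t) [inv_letter c] = [inv_letter c]"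
        if "fst c < n" for c
        using st[OF that] that by (simp add: end_of_compose[OF s t] letter_carrier)
    qed
    then show ?thesis by simp
  qed
  have hs: "end_of n s \<in> carrier (free_group n) \<rightarrow> carrier (free_group n)"
    and ht: "end_of n t \<in> carrier (free_group n) \<rightarrow> carrier (free_group n)"
    using end_of_hom[OF s] end_of_hom[OF t] by (auto simp: hom_def)
  have "bij_betw (end_of n s) (carrier (free_group n)) (carrier (free_group n))"
    by (rule bij_betwI[OF hs ht]) (use inv s t st ts in blast)+
  then show ?thesis
    using end_of_hom[OF s] by (simp add: AutoGroup_simps auto_iff) (simp add: end_of_def)
qed

section \<open>Nielsen automorphisms and their relations\<close>

definition nielsen_sub :: "letter \<Rightarrow> letter \<Rightarrow> letter \<Rightarrow> letter list" where
  "nielsen_sub a b c = (if c = a then [a, b] else if c = inv_letter a then [inv_letter b, inv_letter a] else [c])"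

text \<open>Since a and b are letters with sign, this covers both sides: inverting both letters
  turns right multiplication of a by b into left multiplication by b. The axiom \<open>E_sym\<close>
  therefore says that the two become equal.\<close>

definition nielsen :: "nat \<Rightarrow> letter \<Rightarrow> letter \<Rightarrow> letter list \<Rightarrow> letter list" where
  "nielsen n a b = end_of n (nielsen_sub a b)"

definition permaut :: "nat \<Rightarrow> (letter \<Rightarrow> letter) \<Rightarrow> letter list \<Rightarrow> letter list" where
  "permaut n \<theta> = end_of n (\<lambda>c. [\<theta> c])"

lemma nielsen_sub_simps [simp]:
  "nielsen_sub a b a = [a, b]" "nielsen_sub a b (inv_letter a) = [inv_letter b, inv_letter a]"
  "fst c \<noteq> fst a \<Longrightarrow> nielsen_sub a b c = [c]"
  by (auto simp: nielsen_sub_def)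

lemma nielsen_word_sub:
  assumes "fst a < n" "fst b < n"
  shows "word_sub n (nielsen_sub a b)"
proof -
  have "nielsen_sub a b (inv_letter c) = inv_word (nielsen_sub a b c)" for c
  proof -
    consider "c = a" | "c = inv_letter a" | "fst c \<noteq> fst a" using letter_cases by blast
    then show ?thesis by cases simp_all
  qed
  moreover have "word n (nielsen_sub a b c)" if "fst c < n" for c
    using assms that by (auto simp: nielsen_sub_def)
  ultimately show ?thesis by (simp add: word_sub_def sym_sub_def del: split_paired_All)
qed

lemma permaut_word_sub:
  assumes "signed_perm {..<n} \<theta>"
  shows "word_sub n (\<lambda>c. [\<theta> c])"
  unfolding word_sub_def sym_sub_def
  using signed_permD(2)[OF assms] signed_perm_mem[OF assms] by (simp del: split_paired_All)

lemma nielsen_AG: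
  assumes "fst a < n" "fst b < n" "fst a \<noteq> fst b"
  shows "nielsen n a b \<in> carrier (AG n)"
  unfolding nielsen_def
proof (rule end_of_AG[of n _ "nielsen_sub a (inv_letter b)"])
  have *: "free_reduction (sub_word (nielsen_sub a b) (nielsen_sub a (inv_letter b) c)) = [c] \<or>
    free_reduction (sub_word (nielsen_sub a b) (nielsen_sub a (inv_letter b) (inv_letter c))) = [inv_letter c]"
    if "fst a \<noteq> fst b" for a b c
  proof -
    consider "c = a" | "c = inv_letter a" | "fst c \<noteq> fst a" using letter_cases by blast
    then show ?thesis using that by cases (simp_all add: free_reduction_def)
  qed
  show "free_reduction (sub_word (nielsen_sub a b) (nielsen_sub a (inv_letter b) c)) = [c] \<or>
    free_reduction (sub_word (nielsen_sub a b) (nielsen_sub a (inv_letter b) (inv_letter c))) = [inv_letter c]" for c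
    by (rule *[OF assms(3)])
  show "free_reduction (sub_word (nielsen_sub a (inv_letter b)) (nielsen_sub a b c)) = [c] \<or>
    free_reduction (sub_word (nielsen_sub a (inv_letter b)) (nielsen_sub a b (inv_letter c))) = [inv_letter c]" for c
    using *[of a "inv_letter b" c] assms(3) by simp
qed (use assms in \<open>simp_all add: nielsen_word_sub\<close>)

lemma permaut_AG:
  assumes "signed_perm {..<n} \<theta>"
  shows "permaut n \<theta> \<in> carrier (AG n)"
  unfolding permaut_def
  by (rule end_of_AG[of n _ "\<lambda>c. [inv_into UNIV \<theta> c]"])
    (simp_all add: assms permaut_word_sub signed_perm_inv[OF assms] free_reduction_def)

lemma nielsen_fr:
  assumes "fst a < n" "fst b < n" "word n w"
  shows "nielsen n a b (free_reduction w) = free_reduction (sub_word (nielsen_sub a b) w)"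
  unfolding nielsen_def by (rule end_of_free_reduction[OF nielsen_word_sub[OF assms(1,2)] assms(3)])

lemma permaut_fr:
  assumes "signed_perm {..<n} \<theta>" "word n w"
  shows "permaut n \<theta> (free_reduction w) = free_reduction (map \<theta> w)"
proof -
  have "sub_word (\<lambda>c. [\<theta> c]) w = map \<theta> w" by (induction w) auto
  then show ?thesis
    unfolding permaut_def using end_of_free_reduction[OF permaut_word_sub[OF assms(1)] assms(2)] by simp
qed

lemma AG_eqI_on:
  assumes "f \<in> carrier (AG n)" "g \<in> carrier (AG n)"
    and "\<And>x. x \<in> set xs \<Longrightarrow> f [x] = g [x]"
    and "\<And>c. fst c < n \<Longrightarrow> fst c \<notin> fst ` set xs \<Longrightarrow> f [c] = g [c]"
  shows "f = g"
proof (rule AG_eqI[OF assms(1,2)])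
  fix c :: letter assume c: "fst c < n"
  show "f [c] = g [c] \<or> f [inv_letter c] = g [inv_letter c]"
  proof (cases "fst c \<in> fst ` set xs")
    case True
    then obtain x where x: "x \<in> set xs" "fst c = fst x" by auto
    then have "c = x \<or> inv_letter c = x" using letter_cases[of c x] by auto
    then show ?thesis using assms(3)[OF x(1)] by auto
  next
    case False
    then show ?thesis using assms(4) c by blast
  qed
qed

lemma nielsen_letter: "fst a < n \<Longrightarrow> fst b < n \<Longrightarrow> fst c < n \<Longrightarrow> nielsen n a b [c] = free_reduction (nielsen_sub a b c)"
  unfolding nielsen_def by (rule end_of_letter[OF nielsen_word_sub])

lemma permaut_letter: "signed_perm {..<n} \<theta> \<Longrightarrow> fst c < n \<Longrightarrow> permaut n \<theta> [c] = free_reduction [\<theta> c]"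
  unfolding permaut_def by (rule end_of_letter[OF permaut_word_sub])

lemma signed_perm_less: "signed_perm {..<n} \<theta> \<Longrightarrow> fst c < n \<Longrightarrow> fst (\<theta> c) < n"
  using signed_perm_mem[of "{..<n}" \<theta> c] by simp

lemma AG_closed [simp]: "f \<in> carrier (AG n) \<Longrightarrow> g \<in> carrier (AG n) \<Longrightarrow> f \<otimes>\<^bsub>AG n\<^esub> g \<in> carrier (AG n)"
  using group.is_monoid[OF group_AG] by (rule monoid.m_closed)

lemma AG_one: "w \<in> carrier (free_group n) \<Longrightarrow> \<one>\<^bsub>AG n\<^esub> w = w"
  by (simp add: AutoGroup_simps)

lemma AG_one_closed [simp]: "\<one>\<^bsub>AG n\<^esub> \<in> carrier (AG n)"
  using group.is_monoid[OF group_AG] by (rule monoid.one_closed)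

lemmas AG_eval = AG_mult AG_one nielsen_letter permaut_letter nielsen_fr permaut_fr nielsen_AG permaut_AG
  letter_carrier signed_perm_less AG_closed free_reduction_carrier

lemma nielsen_sub_inv [simp]: "nielsen_sub (inv_letter a) b a = [inv_letter b, a]"
  using nielsen_sub_simps(2)[of "inv_letter a" b] by simp

lemma nielsen_inv:
  assumes "fst a < n" "fst b < n" "fst a \<noteq> fst b"
  shows "nielsen n a b \<otimes>\<^bsub>AG n\<^esub> nielsen n a (inv_letter b) = \<one>\<^bsub>AG n\<^esub>"
proof (rule AG_eqI_on[of _ n _ "[a]"])
  show "(nielsen n a b \<otimes>\<^bsub>AG n\<^esub> nielsen n a (inv_letter b)) [c] = \<one>\<^bsub>AG n\<^esub> [c]" if "c \<in> set [a]" for c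
    using assms that by (simp add: AG_eval) (simp add: free_reduction_def)
  show "(nielsen n a b \<otimes>\<^bsub>AG n\<^esub> nielsen n a (inv_letter b)) [c] = \<one>\<^bsub>AG n\<^esub> [c]"
    if "fst c < n" "fst c \<notin> fst ` set [a]" for c
    using assms that by (simp add: AG_eval) (simp add: free_reduction_def)
qed (use assms in \<open>simp_all add: AG_eval\<close>)

text \<open>The letters a and c may be inverse to each other: then a left and a right multiplication
  of the same generator commute. Two right multiplications of the same generator do not in general,
  hence \<open>a \<noteq> c\<close>.\<close>

lemma nielsen_comm:
  assumes "fst a < n" "fst b < n" "fst c < n" "fst d < n" "fst a \<noteq> fst b" "fst c \<noteq> fst d"
    "a \<noteq> c" "fst a \<noteq> fst d" "fst b \<noteq> fst c"
  shows "nielsen n a b \<otimes>\<^bsub>AG n\<^esub> nielsen n c d = nielsen n c d \<otimes>\<^bsub>AG n\<^esub> nielsen n a b"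
proof (cases "c = inv_letter a")
  case False
  then have ac: "fst a \<noteq> fst c" "fst c \<noteq> fst a" using assms(7) letter_cases[of c a] by auto
  show ?thesis
    by (rule AG_eqI_on[of _ n _ "[a, c]"])
      (use assms ac in \<open>auto simp: AG_eval\<close>)
next
  case True
  show ?thesis
    by (rule AG_eqI_on[of _ n _ "[a]"])
      (use assms True in \<open>auto simp: AG_eval\<close>)
qed

lemma nielsen_chain:
  assumes "fst a < n" "fst b < n" "fst c < n" "fst a \<noteq> fst b" "fst a \<noteq> fst c" "fst b \<noteq> fst c"
  shows "nielsen n b c \<otimes>\<^bsub>AG n\<^esub> nielsen n a b = nielsen n a b \<otimes>\<^bsub>AG n\<^esub> nielsen n b c \<otimes>\<^bsub>AG n\<^esub> nielsen n a c"
proof (rule AG_eqI_on[of _ n _ "[a, b]"])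
  show "(nielsen n b c \<otimes>\<^bsub>AG n\<^esub> nielsen n a b) [x] = (nielsen n a b \<otimes>\<^bsub>AG n\<^esub> nielsen n b c \<otimes>\<^bsub>AG n\<^esub> nielsen n a c) [x]"
    if "x \<in> set [a, b]" for x
  proof -
    from that have "x = a \<or> x = b" by simp
    then show ?thesis using assms by (elim disjE) (simp_all add: AG_eval)
  qed
  show "(nielsen n b c \<otimes>\<^bsub>AG n\<^esub> nielsen n a b) [x] = (nielsen n a b \<otimes>\<^bsub>AG n\<^esub> nielsen n b c \<otimes>\<^bsub>AG n\<^esub> nielsen n a c) [x]"
    if "fst x < n" "fst x \<notin> fst ` set [a, b]" for x
    using assms that by (simp add: AG_eval)
qed (use assms in \<open>simp_all add: AG_eval\<close>)

text \<open>The first factor is a left multiplication here; identifying left and right gives the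
  relation \<open>E_quarter\<close>.\<close>

lemma nielsen_quarter:
  assumes "fst a < n" "fst b < n" "fst a \<noteq> fst b"
  shows "nielsen n a b = nielsen n (inv_letter b) (inv_letter a) \<otimes>\<^bsub>AG n\<^esub> permaut n (quarter a b) \<otimes>\<^bsub>AG n\<^esub> nielsen n b a"
proof -
  have q: "signed_perm {..<n} (quarter a b)" using assms by (intro signed_perm_quarter) auto
  note qs = quarter_simps[OF assms(3)]
  let ?g = "nielsen n (inv_letter b) (inv_letter a) \<otimes>\<^bsub>AG n\<^esub> permaut n (quarter a b) \<otimes>\<^bsub>AG n\<^esub> nielsen n b a"
  show ?thesis
  proof (rule AG_eqI_on[of _ n _ "[a, b]"])
    show "nielsen n a b [x] = ?g [x]" if "x \<in> set [a, b]" for x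
    proof -
      from that have "x = a \<or> x = b" by simp
      then show ?thesis using assms q
        by (elim disjE) (simp_all add: AG_eval qs, simp_all add: free_reduction_def)
    qed
    show "nielsen n a b [x] = ?g [x]" if "fst x < n" "fst x \<notin> fst ` set [a, b]" for x
      using assms q that by (simp add: AG_eval qs)
  qed (use assms q in \<open>simp_all add: AG_eval\<close>)
qed

lemma permaut_comp:
  assumes "signed_perm {..<n} \<theta>" "signed_perm {..<n} \<eta>"
  shows "permaut n \<theta> \<otimes>\<^bsub>AG n\<^esub> permaut n \<eta> = permaut n (\<theta> \<circ> \<eta>)"
  by (rule AG_eqI_on[of _ n _ "[]"])
    (use assms signed_perm_comp[OF assms] in \<open>auto simp: AG_eval\<close>)

lemma permaut_id: "permaut n (\<lambda>a. a) = \<one>\<^bsub>AG n\<^esub>"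
  by (rule AG_eqI_on[of _ n _ "[]"]) (auto simp: AG_eval free_reduction_def)

lemma permaut_nielsen:
  assumes "signed_perm {..<n} \<theta>" "fst a < n" "fst b < n" "fst a \<noteq> fst b"
  shows "permaut n \<theta> \<otimes>\<^bsub>AG n\<^esub> nielsen n a b = nielsen n (\<theta> a) (\<theta> b) \<otimes>\<^bsub>AG n\<^esub> permaut n \<theta>"
proof (rule AG_eqI_on[of _ n _ "[a]"])
  have ne: "fst (\<theta> a) \<noteq> fst (\<theta> b)" using assms signed_perm_fst_eq by blast
  then show "nielsen n (\<theta> a) (\<theta> b) \<otimes>\<^bsub>AG n\<^esub> permaut n \<theta> \<in> carrier (AG n)"
    using assms by (simp add: AG_eval)
  show "(permaut n \<theta> \<otimes>\<^bsub>AG n\<^esub> nielsen n a b) [c] = (nielsen n (\<theta> a) (\<theta> b) \<otimes>\<^bsub>AG n\<^esub> permaut n \<theta>) [c]"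
    if "c \<in> set [a]" for c
    using assms ne that by (simp add: AG_eval)
  show "(permaut n \<theta> \<otimes>\<^bsub>AG n\<^esub> nielsen n a b) [c] = (nielsen n (\<theta> a) (\<theta> b) \<otimes>\<^bsub>AG n\<^esub> permaut n \<theta>) [c]"
    if "fst c < n" "fst c \<notin> fst ` set [a]" for c
    using assms ne that signed_perm_fst_eq[OF assms(1), of c a] by (simp add: AG_eval)
qed (use assms in \<open>simp_all add: AG_eval\<close>)

section \<open>Sign changes, permutations and simultaneous right multiplication\<close>

definition flip :: "nat set \<Rightarrow> letter \<Rightarrow> letter" where
  "flip S c = (if fst c \<in> S then inv_letter c else c)"

lemma signed_perm_flip: "S \<subseteq> I \<Longrightarrow> signed_perm I (flip S)"
proof -
  assume S: "S \<subseteq> I"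
  have "bij (flip S)" by (rule o_bij[of "flip S"]) (auto simp: flip_def)
  then show ?thesis using S by (auto simp: signed_perm_def flip_def)
qed

definition lift_perm :: "(nat \<Rightarrow> nat) \<Rightarrow> letter \<Rightarrow> letter" where
  "lift_perm \<pi> c = (\<pi> (fst c), snd c)"

lemma signed_perm_lift_perm:
  assumes "\<pi> permutes I"
  shows "signed_perm I (lift_perm \<pi>)"
proof -
  have "bij (lift_perm \<pi>)"
    by (rule o_bij[of "lift_perm (inv_into UNIV \<pi>)"])
      (auto simp: lift_perm_def permutes_inverses[OF assms])
  then show ?thesis
    using assms by (auto simp: signed_perm_def lift_perm_def inv_letter_def permutes_not_in)
qed

definition tau_sub :: "nat set \<Rightarrow> nat \<Rightarrow> letter \<Rightarrow> letter list" where
  "tau_sub S j c = (if fst c \<notin> S then [c] else if snd c then [c, (j, True)] else [(j, False), c])"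

lemma tau_word_sub:
  assumes "j < n"
  shows "word_sub n (tau_sub S j)"
  using assms by (auto simp: word_sub_def sym_sub_def tau_sub_def inv_letter_def)

text \<open>Enlarging S by i composes with one Nielsen automorphism. This is how a product of right
  multiplications by the same generator becomes a single substitution.\<close>

lemma tau_AG:
  assumes "S \<subseteq> {..<n}" "j < n" "j \<notin> S"
  shows "end_of n (tau_sub S j) \<in> carrier (AG n) \<and>
    (\<forall>i<n. i \<notin> S \<longrightarrow> i \<noteq> j \<longrightarrow> end_of n (tau_sub (insert i S) j) =
      end_of n (tau_sub S j) \<otimes>\<^bsub>AG n\<^esub> nielsen n (i, True) (j, True))"
proof -
  have "finite S" using assms finite_subset by blast
  have step: "end_of n (tau_sub (insert i S) j) \<in> carrier (AG n) \<and>
      end_of n (tau_sub (insert i S) j) = end_of n (tau_sub S j) \<otimes>\<^bsub>AG n\<^esub> nielsen n (i, True) (j, True)"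
    if S: "end_of n (tau_sub S j) \<in> carrier (AG n)" and i: "i < n" "i \<notin> S" "i \<noteq> j" "j \<notin> S" for i S
  proof -
    have N: "nielsen n (i, True) (j, True) \<in> carrier (AG n)" using i assms by (intro nielsen_AG) auto
    have eq: "end_of n (tau_sub (insert i S) j) w = (end_of n (tau_sub S j) \<otimes>\<^bsub>AG n\<^esub> nielsen n (i, True) (j, True)) w"
      if w: "w \<in> carrier (free_group n)" for w
    proof (rule hom_eqI[OF end_of_hom[OF tau_word_sub[OF assms(2)]] _ _ w])
      show "end_of n (tau_sub S j) \<otimes>\<^bsub>AG n\<^esub> nielsen n (i, True) (j, True) \<in> hom (free_group n) (free_group n)"
        using AG_closed[OF S N] by (simp add: AutoGroup_simps auto_iff)
      fix c :: letter assume c: "fst c < n"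
      have ev: "(end_of n (tau_sub S j) \<otimes>\<^bsub>AG n\<^esub> nielsen n (i, True) (j, True)) [c] =
          free_reduction (sub_word (tau_sub S j) (nielsen_sub (i, True) (j, True) c))" if "fst c < n" for c
      proof -
        have "word n (nielsen_sub (i, True) (j, True) c)"
          using that i assms(2) by (auto simp: nielsen_sub_def)
        then show ?thesis
          using that i assms(2) S N
          by (simp add: AG_mult letter_carrier nielsen_letter end_of_free_reduction[OF tau_word_sub[OF assms(2)]])
      qed
      have t: "end_of n (tau_sub (insert i S) j) [c] = free_reduction (tau_sub (insert i S) j c)" if "fst c < n" for c
        using that by (rule end_of_letter[OF tau_word_sub[OF assms(2)]])
      consider "c = (i, True)" | "c = (i, False)" | "fst c \<noteq> i" by (cases c) auto
      then show "end_of n (tau_sub (insert i S) j) [c] = (end_of n (tau_sub S j) \<otimes>\<^bsub>AG n\<^esub> nielsen n (i, True) (j, True)) [c] \<or>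
          end_of n (tau_sub (insert i S) j) [inv_letter c] = (end_of n (tau_sub S j) \<otimes>\<^bsub>AG n\<^esub> nielsen n (i, True) (j, True)) [inv_letter c]"
      proof cases
        case 1
        then show ?thesis using i ev[OF c] t[OF c] by (simp add: tau_sub_def)
      next
        case 2
        then have "inv_letter c = (i, True)" by (simp add: inv_letter_def)
        then show ?thesis using i c ev[of "inv_letter c"] t[of "inv_letter c"] by (simp add: tau_sub_def)
      next
        case 3
        then show ?thesis using i ev[OF c] t[OF c] by (simp add: tau_sub_def)
      qed
    qed
    have "end_of n (tau_sub (insert i S) j) = end_of n (tau_sub S j) \<otimes>\<^bsub>AG n\<^esub> nielsen n (i, True) (j, True)"
    proof (rule extensionalityI)
      show "end_of n (tau_sub (insert i S) j) \<in> extensional (carrier (free_group n))" by (simp add: end_of_def)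
      show "end_of n (tau_sub S j) \<otimes>\<^bsub>AG n\<^esub> nielsen n (i, True) (j, True) \<in> extensional (carrier (free_group n))"
        using AG_closed[OF S N] by (simp add: AutoGroup_simps auto_iff)
    qed (rule eq)
    then show ?thesis using AG_closed[OF S N] by simp
  qed
  have "end_of n (tau_sub S j) \<in> carrier (AG n)"
    using \<open>finite S\<close> assms
  proof (induction S)
    case empty
    have "tau_sub {} j = (\<lambda>c. [c])" by (auto simp: tau_sub_def)
    then have "end_of n (tau_sub {} j) = permaut n (\<lambda>c. c)" by (simp add: permaut_def)
    then show ?case using permaut_AG[of n "\<lambda>c. c"] by simp
  next
    case (insert i S)
    then show ?case using step[of S i] by auto
  qed
  then show ?thesis using step assms by blast
qed

text \<open>In one order a_i goes to the product of the inverses of a_i and a_j, in the other to the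
  inverse of their product; conjugation by a_j turns the second into the first and fixes the inverse
  of a_j.\<close>

lemma tau_delta:
  assumes j: "j < n"
  defines "S \<equiv> {..<n} - {j}"
  shows "\<exists>g\<in>inner_auts (free_group n). permaut n (flip {..<n}) \<otimes>\<^bsub>AG n\<^esub> end_of n (tau_sub S j) =
    g \<otimes>\<^bsub>AG n\<^esub> (end_of n (tau_sub S j) \<otimes>\<^bsub>AG n\<^esub> permaut n (flip {..<n}))"
proof -
  interpret F: group "free_group n" by (rule group_free_group)
  let ?D = "permaut n (flip {..<n})" and ?T = "end_of n (tau_sub S j)" and ?a = "[(j, True)]"
  let ?g = "\<lambda>x\<in>carrier (free_group n). ?a \<otimes>\<^bsub>free_group n\<^esub> x \<otimes>\<^bsub>free_group n\<^esub> inv\<^bsub>free_group n\<^esub> ?a"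
  have a: "?a \<in> carrier (free_group n)" using j by (intro letter_carrier) simp
  have fl: "signed_perm {..<n} (flip {..<n})" by (rule signed_perm_flip) simp
  have D: "?D \<in> carrier (AG n)" by (rule permaut_AG[OF fl])
  have T: "?T \<in> carrier (AG n)" using tau_AG[of S n j] j by (auto simp: S_def)
  have g: "?g \<in> carrier (AG n)" using F.inner_in_auto[OF a] by (simp add: AutoGroup_simps)
  have gw: "?g (free_reduction w) = free_reduction ((j, True) # w @ [(j, False)])" if "word n w" for w
  proof -
    have "inv\<^bsub>free_group n\<^esub> ?a = [(j, False)]"
      using inv_letter_group[of "(j, True)" n] j by (simp add: inv_letter_def)
    then show ?thesis using free_reduction_carrier[OF that]
      free_reduction_append_left[of "?a @ w" "[(j, False)]"] free_reduction_append_right[of ?a w]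
      by (simp add: mult_free_group del: append_Cons) simp
  qed
  have "?D \<otimes>\<^bsub>AG n\<^esub> ?T = ?g \<otimes>\<^bsub>AG n\<^esub> (?T \<otimes>\<^bsub>AG n\<^esub> ?D)"
  proof (rule AG_eqI_on[of _ n _ "map (\<lambda>i. (i, True)) [0..<n]"])
    show "(?D \<otimes>\<^bsub>AG n\<^esub> ?T) [c] = (?g \<otimes>\<^bsub>AG n\<^esub> (?T \<otimes>\<^bsub>AG n\<^esub> ?D)) [c]"
      if cs: "c \<in> set (map (\<lambda>i. (i, True)) [0..<n])" for c
    proof -
      obtain i where c: "c = (i, True)" "i < n" using cs by auto
      have ws: "word n (tau_sub S j c)" using c j by (auto simp: tau_sub_def)
      have l: "(?D \<otimes>\<^bsub>AG n\<^esub> ?T) [c] = free_reduction (map (flip {..<n}) (tau_sub S j c))"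
        using c ws j by (simp add: AG_mult[OF D T] letter_carrier end_of_letter[OF tau_word_sub[OF j]] permaut_fr[OF fl])
      have "?T (free_reduction [(i, False)]) = free_reduction (tau_sub S j (i, False))"
        using end_of_free_reduction[OF tau_word_sub[OF j], of "[(i, False)]" S] c by simp
      moreover have "?D [c] = free_reduction [(i, False)]"
        using c by (simp add: permaut_letter[OF fl]) (simp add: flip_def inv_letter_def)
      ultimately have "(?T \<otimes>\<^bsub>AG n\<^esub> ?D) [c] = free_reduction (tau_sub S j (i, False))"
        using c by (simp add: AG_mult[OF T D] letter_carrier)
      moreover have "word n (tau_sub S j (i, False))" using c j by (auto simp: tau_sub_def)
      ultimately have r: "(?g \<otimes>\<^bsub>AG n\<^esub> (?T \<otimes>\<^bsub>AG n\<^esub> ?D)) [c] = free_reduction ((j, True) # tau_sub S j (i, False) @ [(j, False)])"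
        using c by (simp add: AG_mult[OF g AG_closed[OF T D]] letter_carrier gw del: restrict_apply)
      show ?thesis
        unfolding l r using c j by (auto simp: tau_sub_def S_def flip_def inv_letter_def free_reduction_def)
    qed
    show "(?D \<otimes>\<^bsub>AG n\<^esub> ?T) [c] = (?g \<otimes>\<^bsub>AG n\<^esub> (?T \<otimes>\<^bsub>AG n\<^esub> ?D)) [c]"
      if "fst c < n" "fst c \<notin> fst ` set (map (\<lambda>i. (i, True)) [0..<n])" for c
      using that by (auto simp: image_image)
  qed (use D T g in simp_all)
  moreover have "?g \<in> inner_auts (free_group n)" using a by (auto simp: inner_auts_def)
  ultimately show ?thesis by blast
qed

section \<open>Nielsen's theorem\<close>

lemma reduced_append:
  "reduced (u @ v) \<longleftrightarrow> reduced u \<and> reduced v \<and> (u \<noteq> [] \<longrightarrow> v \<noteq> [] \<longrightarrow> hd v \<noteq> inv_letter (last u))"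
  by (auto simp: reduced_def successively_append_iff)

lemma reduced_appendD: "reduced (u @ v) \<Longrightarrow> reduced u" "reduced (u @ v) \<Longrightarrow> reduced v"
  by (auto simp: reduced_append)

lemma reduced_inv_word: "reduced (inv_word w) \<longleftrightarrow> reduced w"
proof -
  have "reduced w \<Longrightarrow> reduced (inv_word w)" for w
  proof (induction w)
    case (Cons a w)
    then have "reduced (inv_word w)" using reduced_ConsD by blast
    moreover have "w \<noteq> [] \<Longrightarrow> last (inv_word w) = inv_letter (hd w)" by (cases w) auto
    moreover have "w \<noteq> [] \<Longrightarrow> hd w \<noteq> inv_letter a" using Cons.prems by (cases w) auto
    ultimately show ?case by (cases "w = []") (auto simp: reduced_append)
  qed simp
  from this[of w] this[of "inv_word w"] show ?thesis by auto
qed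

lemma length_inv_word [simp]: "length (inv_word w) = length w"
  by (simp add: inv_word_def)

lemma inv_carrier:
  assumes "w \<in> carrier (free_group n)"
  shows "inv\<^bsub>free_group n\<^esub> w = inv_word w"
proof -
  interpret group "free_group n" by (rule group_free_group)
  have "inv_word w \<in> carrier (free_group n)"
    using assms by (simp add: mem_free_group reduced_inv_word fst_inv_word)
  moreover have "inv_word w \<otimes>\<^bsub>free_group n\<^esub> w = \<one>\<^bsub>free_group n\<^esub>"
    using free_reduction_cancel[of "[]" "inv_word w" "[]"]
    by (simp add: mult_free_group one_free_group) (simp add: free_reduction_def)
  ultimately show ?thesis using assms by (intro inv_equality)
qed

text \<open>The length of the word p in \<open>cancel_decomp\<close>, that is, of the part lost from
  each factor.\<close>

definition canc :: "letter list \<Rightarrow> letter list \<Rightarrow> nat" where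
  "canc u v = (length u + length v - length (free_reduction (u @ v))) div 2"

lemma cancel_unique:
  assumes "u = u' @ inv_word p" "v = p @ v'" "reduced (u' @ v')"
  shows "free_reduction (u @ v) = u' @ v'" "canc u v = length p"
proof -
  show "free_reduction (u @ v) = u' @ v'"
    using free_reduction_cancel[of u' "inv_word p" v'] assms by (simp add: free_reduction_reduced)
  then show "canc u v = length p" using assms by (simp add: canc_def)
qed

lemma cancel_decomp:
  assumes "reduced u" "reduced v"
  obtains u' p v' where "u = u' @ inv_word p" "v = p @ v'" "reduced (u' @ v')" "length p = canc u v"
    "free_reduction (u @ v) = u' @ v'"
proof -
  have "\<exists>u' p v'. u = u' @ inv_word p \<and> v = p @ v' \<and> reduced (u' @ v')"
    using assms
  proof (induction u arbitrary: v rule: rev_induct)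
    case Nil
    then show ?case by (intro exI[of _ "[]"] exI[of _ v]) simp
  next
    case (snoc x u)
    show ?case
    proof (cases "v \<noteq> [] \<and> hd v = inv_letter x")
      case True
      then obtain v0 where v: "v = inv_letter x # v0" by (cases v) auto
      have "reduced u" "reduced v0" using snoc.prems v reduced_ConsD by (auto simp: reduced_append)
      then obtain u' p v' where "u = u' @ inv_word p" "v0 = p @ v'" "reduced (u' @ v')"
        using snoc.IH by blast
      then show ?thesis using v
        by (intro exI[of _ u'] exI[of _ "inv_letter x # p"] exI[of _ v']) simp
    next
      case False
      then have "reduced ((u @ [x]) @ v)" using snoc.prems by (subst reduced_append) auto
      then show ?thesis by (intro exI[of _ "u @ [x]"] exI[of _ "[]"] exI[of _ v]) simp
    qed
  qed
  then obtain u' p v' where "u = u' @ inv_word p" "v = p @ v'" "reduced (u' @ v')" by blast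
  then show ?thesis using that cancel_unique by metis
qed

lemma canc_inv:
  assumes "reduced u" "reduced v"
  shows "canc (inv_word v) (inv_word u) = canc u v"
proof -
  obtain u' p v' where d: "u = u' @ inv_word p" "v = p @ v'" "reduced (u' @ v')" "length p = canc u v"
    "free_reduction (u @ v) = u' @ v'"
    by (rule cancel_decomp[OF assms])
  have "reduced (inv_word (u' @ v'))" using d(3) by (simp only: reduced_inv_word)
  then show ?thesis
    using cancel_unique(2)[of "inv_word v" "inv_word v'" p "inv_word u" "inv_word u'"] d by simp
qed

text \<open>If at least half of w cancelled against itself, letters in mirrored positions would be
  mutually inverse. For even length the two middle letters would cancel; for odd length the middle
  letter would be its own inverse.\<close>

lemma canc_self:
  assumes "reduced w" "w \<noteq> []"
  shows "2 * canc w w < length w"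
proof (rule ccontr)
  assume nc: "\<not> 2 * canc w w < length w"
  obtain u' p v' where d: "w = u' @ inv_word p" "w = p @ v'" "length p = canc w w"
    by (rule cancel_decomp[OF assms(1,1)])
  let ?L = "length w" and ?k = "length p"
  have len: "?L = length u' + ?k" using arg_cong[OF d(1), of length] by simp
  have k: "?L \<le> 2 * ?k" "?k \<le> ?L" using nc d(3) len by simp_all
  have opp: "w ! (?L - 1 - i) = inv_letter (w ! i)" if i: "i < ?k" for i
  proof -
    have "?L - 1 - i = length u' + (?k - 1 - i)" using i len by simp
    moreover have "w ! (length u' + (?k - 1 - i)) = inv_word p ! (?k - 1 - i)"
      by (subst d(1)) (rule nth_append_length_plus)
    moreover have "inv_word p ! (?k - 1 - i) = inv_letter (p ! i)" using i by (simp add: inv_word_def rev_nth)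
    moreover have "w ! i = p ! i" using i by (subst d(2)) (simp add: nth_append)
    ultimately show ?thesis by simp
  qed
  have L: "0 < ?L" using assms by simp
  show False
  proof (cases "even ?L")
    case True
    then obtain l where l: "?L = 2 * l" by (rule evenE)
    then obtain m where m: "?L = 2 * Suc m" using L by (cases l) auto
    then have "m < ?k" "?L - 1 - m = Suc m" using k by auto
    then have "w ! Suc m = inv_letter (w ! m)" using opp[of m] by simp
    moreover have "w ! Suc m \<noteq> inv_letter (w ! m)"
      using assms(1) m unfolding reduced_def by (simp add: successively_conv_nth)
    ultimately show False by simp
  next
    case False
    then obtain m where m: "?L = 2 * m + 1" by (rule oddE)
    then have "m < ?k" "?L - 1 - m = m" using k by auto
    then have "w ! m = inv_letter (w ! m)" using opp[of m] by simp
    then show False by simp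
  qed
qed

section \<open>Products of Nielsen reduced words\<close>

lemma reduced_glue:
  assumes "reduced (q @ s)" "reduced (s @ v)" "s \<noteq> []"
  shows "reduced (q @ s @ v)"
  using assms by (auto simp: reduced_append)

text \<open>Nielsen's conditions: a neighbour cancels at most half of a word, and between its two
  neighbours some letter of every word survives.\<close>

locale nielsen_reduced =
  fixes n :: nat and w :: "letter \<Rightarrow> letter list"
  assumes red: "fst a < n \<Longrightarrow> reduced (w a)"
    and nonempty: "fst a < n \<Longrightarrow> w a \<noteq> []"
    and half: "fst a < n \<Longrightarrow> fst b < n \<Longrightarrow> b \<noteq> inv_letter a \<Longrightarrow> 2 * canc (w a) (w b) \<le> length (w a)"
    and rest: "fst a < n \<Longrightarrow> fst b < n \<Longrightarrow> fst c < n \<Longrightarrow> b \<noteq> inv_letter a \<Longrightarrow> c \<noteq> inv_letter b \<Longrightarrow>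
      canc (w a) (w b) + canc (w b) (w c) < length (w b)"
begin

lemma growth_step:
  assumes "reduced (q @ s)" "w a = r @ s" "fst a < n" "fst b < n" "canc (w a) (w b) < length s"
  shows "\<exists>q' r' s'. free_reduction ((q @ s) @ w b) = q' @ s' \<and> reduced (q' @ s') \<and> w b = r' @ s' \<and>
    length r' = canc (w a) (w b) \<and> length q < length q'"
proof -
  obtain u p v where d: "w a = u @ inv_word p" "w b = p @ v" "reduced (u @ v)" "length p = canc (w a) (w b)"
    by (rule cancel_decomp[OF red[OF assms(3)] red[OF assms(4)]])
  have "r @ s = u @ inv_word p" using assms(2) d(1) by simp
  then consider t where "r @ t = u" "s = t @ inv_word p" | t where "t @ s = inv_word p"
    unfolding append_eq_append_conv2 by blast
  then obtain t where t: "u = r @ t" "s = t @ inv_word p"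
  proof cases
    case (1 t)
    show ?thesis by (rule that[OF 1(1)[symmetric] 1(2)])
  next
    case (2 t)
    from arg_cong[OF this, of length] have False using assms(5) d(4) by simp
    then show ?thesis ..
  qed
  have "t \<noteq> []" using assms(5) d(4) t by auto
  have "reduced (q @ t)" using assms(1) t reduced_appendD(1)[of "q @ t" "inv_word p"] by simp
  moreover have "reduced (t @ v)" using d(3) t reduced_appendD(2)[of r "t @ v"] by simp
  ultimately have rd: "reduced ((q @ t) @ v)" using \<open>t \<noteq> []\<close> by (simp add: reduced_glue)
  have "free_reduction ((q @ s) @ w b) = (q @ t) @ v"
    by (rule cancel_unique(1)[OF _ d(2) rd]) (simp add: t)
  then show ?thesis
    using rd d \<open>t \<noteq> []\<close> by (intro exI[of _ "q @ t"] exI[of _ p] exI[of _ v]) simp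
qed

text \<open>The invariant splits the reduced product into q and s, where s is the surviving tail of
  the last factor. The lost part r is just what the preceding factor cancelled, so by
  \<open>rest\<close> the next factor cannot use up s, and q grows with each factor.\<close>

lemma growth:
  assumes "reduced (xs @ [a])" "word n (xs @ [a])"
  shows "\<exists>q r s. free_reduction (sub_word w (xs @ [a])) = q @ s \<and> reduced (q @ s) \<and> w a = r @ s \<and>
    length r = (if xs = [] then 0 else canc (w (last xs)) (w a)) \<and> length xs \<le> length q"
  using assms
proof (induction xs arbitrary: a rule: rev_induct)
  case Nil
  then show ?case using red by (intro exI[of _ "[]"] exI[of _ "w a"]) (simp add: free_reduction_reduced)
next
  case (snoc b xs)
  have b: "reduced (xs @ [b])" "word n (xs @ [b])" "fst a < n" "fst b < n" "a \<noteq> inv_letter b"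
    using snoc.prems by (auto simp: reduced_append)
  obtain q r s where IH: "free_reduction (sub_word w (xs @ [b])) = q @ s" "reduced (q @ s)" "w b = r @ s"
    "length r = (if xs = [] then 0 else canc (w (last xs)) (w b))" "length xs \<le> length q"
    using snoc.IH[OF b(1,2)] by blast
  have "canc (w b) (w a) < length s"
  proof (cases "xs = []")
    case True
    then have "length s = length (w b)" using IH by simp
    moreover have "2 * canc (w b) (w a) \<le> length (w b)" using half b by blast
    moreover have "0 < length (w b)" using nonempty b by simp
    ultimately show ?thesis by linarith
  next
    case False
    then have "last xs \<in> set xs" by simp
    then have "fst (last xs) < n" using b(2) by auto
    moreover have "b \<noteq> inv_letter (last xs)"
      using b(1) False by (simp add: reduced_append)
    ultimately have "canc (w (last xs)) (w b) + canc (w b) (w a) < length (w b)"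
      using rest[of "last xs" b a] b by blast
    then show ?thesis using IH(3,4) False by simp
  qed
  from growth_step[OF IH(2,3) b(4,3) this] obtain q' r' s' where
    "free_reduction ((q @ s) @ w a) = q' @ s'" "reduced (q' @ s')" "w a = r' @ s'"
    "length r' = canc (w b) (w a)" "length q < length q'" by - (elim exE conjE, (rule that; assumption))
  moreover have "free_reduction (sub_word w ((xs @ [b]) @ [a])) = free_reduction ((q @ s) @ w a)"
    using free_reduction_append_left[of "sub_word w (xs @ [b])" "w a"] IH(1) by simp
  ultimately show ?case using IH(5)
    by (intro exI[of _ q'] exI[of _ r'] exI[of _ s'] conjI) simp_all
qed

text \<open>Besides the letters of q, at least one letter of the last factor survives, which makes
  up for the last position.\<close>

lemma length_le:
  assumes "reduced xs" "word n xs"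
  shows "length xs \<le> length (free_reduction (sub_word w xs))"
proof (cases xs rule: rev_exhaust)
  case (snoc ys a)
  have "reduced (ys @ [a])" "word n (ys @ [a])" using assms snoc by simp_all
  from growth[OF this] obtain q r s where g: "free_reduction (sub_word w (ys @ [a])) = q @ s" "w a = r @ s"
    "length r = (if ys = [] then 0 else canc (w (last ys)) (w a))" "length ys \<le> length q"
    by - (elim exE conjE, (rule that; assumption))
  have a: "fst a < n" using assms snoc by simp
  have "s \<noteq> []"
  proof
    assume "s = []"
    then have "length (w a) = (if ys = [] then 0 else canc (w (last ys)) (w a))" using g by simp
    then have "ys \<noteq> []" "length (w a) = canc (w (last ys)) (w a)" using nonempty[OF a] by (auto split: if_splits)
    moreover have "last ys \<in> set ys" using \<open>ys \<noteq> []\<close> by simp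
    then have "fst (last ys) < n" using assms(2) snoc by auto
    moreover have "a \<noteq> inv_letter (last ys)"
      using assms(1) snoc \<open>ys \<noteq> []\<close> by (simp add: reduced_append)
    ultimately show False using rest[of "last ys" a a] a by simp
  qed
  then show ?thesis using g(1,4) snoc by (cases s) auto
qed simp

end

section \<open>Lexicographic weight of words\<close>

definition lval_digit :: "letter \<Rightarrow> nat" where
  "lval_digit a = 2 * fst a + (if snd a then 1 else 0)"

text \<open>The word read as a numeral in base 2n. For words of equal length this is the
  lexicographic order, in a form that can be added up over the generators.\<close>

fun word_value :: "nat \<Rightarrow> letter list \<Rightarrow> nat" where
  "word_value n [] = 0"
| "word_value n (a # w) = lval_digit a * (2 * n) ^ length w + word_value n w"

lemma word_value_append: "word_value n (u @ v) = word_value n u * (2 * n) ^ length v + word_value n v"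
  by (induction u) (auto simp: power_add algebra_simps)

lemma digit_less: "fst a < n \<Longrightarrow> lval_digit a < 2 * n"
  by (auto simp: lval_digit_def)

lemma digit_inj: "lval_digit a = lval_digit b \<Longrightarrow> a = b"
  by (cases a; cases b) (auto simp: lval_digit_def split: if_splits; presburger)

lemma word_value_less: "word n w \<Longrightarrow> word_value n w < (2 * n) ^ length w"
proof (induction w)
  case (Cons a w)
  then have "lval_digit a + 1 \<le> 2 * n" "word_value n w < (2 * n) ^ length w" using digit_less[of a n] by auto
  then have "lval_digit a * (2 * n) ^ length w + word_value n w < (lval_digit a + 1) * (2 * n) ^ length w"
    by simp
  also have "\<dots> \<le> (2 * n) * (2 * n) ^ length w"
    by (rule mult_le_mono1) (use \<open>lval_digit a + 1 \<le> 2 * n\<close> in simp)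
  finally show ?case by simp
qed simp

lemma word_value_inj:
  assumes "word n u" "word n v" "length u = length v" "word_value n u = word_value n v"
  shows "u = v"
  using assms(3,1,2,4)
proof (induction u v rule: list_induct2)
  case (Cons a u b v)
  let ?B = "(2 * n) ^ length u"
  have l: "word_value n u < ?B" "word_value n v < ?B"
    using Cons word_value_less[of u n] word_value_less[of v n] by simp_all
  have "lval_digit a * ?B + word_value n u = lval_digit b * ?B + word_value n v" using Cons by simp
  moreover have "x = y \<and> k = l" if "x * B + k = y * B + l" "k < B" "l < B" for x y k l B :: nat
    using arg_cong[OF that(1), of "\<lambda>t. t div B"] arg_cong[OF that(1), of "\<lambda>t. t mod B"] that(2,3) by simp
  ultimately have "lval_digit a = lval_digit b" "word_value n u = word_value n v" using l by blast+
  then show ?case using Cons digit_inj by simp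
qed simp

definition front_half :: "letter list \<Rightarrow> letter list" where
  "front_half w = take ((length w + 1) div 2) w"

text \<open>Both ends are counted, so that a generator and its inverse have the same weight.\<close>

definition weight :: "nat \<Rightarrow> letter list \<Rightarrow> nat" where
  "weight n w = word_value n (front_half w) + word_value n (front_half (inv_word w))"

lemma weight_inv_word [simp]: "weight n (inv_word w) = weight n w"
  by (simp add: weight_def)

text \<open>The exchanged tail is at most half of the word, so the front half is unaffected, while
  the front half of the inverse begins with q in place of p.\<close>

lemma weight_less:
  assumes "length p \<le> length u" "length q = length p" "word_value n q < word_value n p" "0 < n"
  shows "weight n (u @ inv_word q) < weight n (u @ inv_word p)"
proof -
  \<comment> \<open>The remainder of the front half of the inverse, common to both words.\<close>
  let ?t = "take ((length u + length p + 1) div 2 - length p) (inv_word u)"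
  have le: "(length u + length p + 1) div 2 \<le> length u" using assms(1,3) by (cases "length p = length u") auto
  have h: "front_half (u @ inv_word r) = take ((length u + length p + 1) div 2) u"
      "front_half (inv_word (u @ inv_word r)) = r @ ?t" if "length r = length p" for r
    using that le assms(1) by (simp_all add: front_half_def add.commute)
  have "0 < (2 * n) ^ length ?t" using assms(4) by simp
  then have "word_value n q * (2 * n) ^ length ?t < word_value n p * (2 * n) ^ length ?t"
    using assms(3) by (rule mult_less_mono1[rotated])
  then show ?thesis
    unfolding weight_def h[OF assms(2)] h[OF refl] word_value_append by simp
qed

text \<open>Nielsen's argument: a basis none of whose elements can be shortened by a Nielsen move, and which
  among bases of the same lengths has lexicographically small initial halves, has bounded cancellation.\<close>

lemma nielsen_reducedI:
  assumes red: "\<And>a. fst a < n \<Longrightarrow> reduced (w a)" and ne: "\<And>a. fst a < n \<Longrightarrow> w a \<noteq> []"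
    and wd: "\<And>a. fst a < n \<Longrightarrow> word n (w a)" and iw: "\<And>a. fst a < n \<Longrightarrow> w (inv_letter a) = inv_word (w a)"
    and len: "\<And>a b. fst a < n \<Longrightarrow> fst b < n \<Longrightarrow> fst a \<noteq> fst b \<Longrightarrow> length (w a) \<le> length (free_reduction (w a @ w b))"
    and wt: "\<And>a b. fst a < n \<Longrightarrow> fst b < n \<Longrightarrow> fst a \<noteq> fst b \<Longrightarrow>
      length (free_reduction (w a @ w b)) = length (w a) \<Longrightarrow> weight n (w a) \<le> weight n (free_reduction (w a @ w b))"
  shows "nielsen_reduced n w"
proof -
  \<comment> \<open>Writing the product as \<open>u @ v\<close> with p cancelled, not being shorter
    than \<open>u @ inv_word p\<close> means that p is no longer than v.\<close>
  have half1: "2 * canc (w a) (w b) \<le> length (w b)" if ab: "fst a < n" "fst b < n" "fst a \<noteq> fst b" for a b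
  proof -
    obtain u p v where "w a = u @ inv_word p" "w b = p @ v" "length p = canc (w a) (w b)"
      "free_reduction (w a @ w b) = u @ v"
      by (rule cancel_decomp[OF red[OF ab(1)] red[OF ab(2)]])
    then show ?thesis using len[OF ab] by simp
  qed
  have half2: "2 * canc (w a) (w b) \<le> length (w a)" if ab: "fst a < n" "fst b < n" "fst a \<noteq> fst b" for a b
    using half1[of "inv_letter b" "inv_letter a"] canc_inv[OF red[OF ab(1)] red[OF ab(2)]] ab by (simp add: iw)
  have eq: "a = b" if "b \<noteq> inv_letter a" "fst a = fst b" for a b :: letter
    using that letter_cases[of b a] by auto
  have half: "2 * canc (w a) (w b) \<le> length (w a)" "2 * canc (w a) (w b) \<le> length (w b)"
    if "fst a < n" "fst b < n" "b \<noteq> inv_letter a" for a b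
  proof -
    have "2 * canc (w a) (w b) \<le> length (w a) \<and> 2 * canc (w a) (w b) \<le> length (w b)"
    proof (cases "fst a = fst b")
      case True
      with eq that(3) have "a = b" by blast
      then show ?thesis using canc_self[OF red[OF that(2)] ne[OF that(2)]] by simp
    next
      case False
      with half1 half2 that show ?thesis by blast
    qed
    then show "2 * canc (w a) (w b) \<le> length (w a)" "2 * canc (w a) (w b) \<le> length (w b)" by simp_all
  qed
  show ?thesis
  proof
    fix a b c :: letter assume l: "fst a < n" "fst b < n" "fst c < n" "b \<noteq> inv_letter a" "c \<noteq> inv_letter b"
    show "canc (w a) (w b) + canc (w b) (w c) < length (w b)"
    proof (rule ccontr)
      assume "\<not> canc (w a) (w b) + canc (w b) (w c) < length (w b)"
      \<comment> \<open>The halves are then exhausted exactly: \<open>w b\<close> is p followed by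
        the inverse of q, with p and q of equal length. Whichever of the two is larger can be
        exchanged for the smaller in a neighbour.\<close>
      then have k: "2 * canc (w a) (w b) = length (w b)" "2 * canc (w b) (w c) = length (w b)"
        using half(2)[OF l(1,2,4)] half(1)[OF l(2,3,5)] by linarith+
      have strict: "2 * canc (w b) (w b) < length (w b)" using canc_self red ne l(2) by blast
      have ab: "fst a \<noteq> fst b" using eq[OF l(4)] k(1) strict by auto
      have bc: "fst b \<noteq> fst c" using eq[OF l(5)] k(2) strict by auto
      obtain u p v where d: "w a = u @ inv_word p" "w b = p @ v" "length p = canc (w a) (w b)"
        "free_reduction (w a @ w b) = u @ v"
        by (rule cancel_decomp[OF red[OF l(1)] red[OF l(2)]])
      obtain u' q v' where e: "w b = u' @ inv_word q" "w c = q @ v'" "length q = canc (w b) (w c)"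
        "free_reduction (w b @ w c) = u' @ v'" "reduced (u' @ v')"
        by (rule cancel_decomp[OF red[OF l(2)] red[OF l(3)]])
      have "length p = length u'" using arg_cong[OF e(1), of length] d(3) e(3) k by simp
      then have s: "p = u'" "v = inv_word q" using d(2) e(1) by (simp_all add: append_eq_append_conv)
      have len_eq: "length q = length p" using d(3) e(3) k by simp
      have ww: "word n p" "word n q"
        using wd[OF l(2)] wd[OF l(3)] d(2) e(2) by (simp_all add: image_Un)
      have "p \<noteq> q"
      proof
        assume "p = q"
        then have "w b = p @ inv_word p" using d(2) s by simp
        then have "free_reduction (w b) = []" using free_reduction_cancel[of "[]" p "[]"]
          by (simp add: free_reduction_def)
        then show False using red[OF l(2)] ne[OF l(2)] by (simp add: free_reduction_reduced)
      qed
      then have vals: "word_value n p \<noteq> word_value n q" using word_value_inj[OF ww] len_eq by auto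
      have n: "0 < n" using l by simp
      show False
      proof (cases "word_value n q < word_value n p")
        case True
        \<comment> \<open>Multiplying \<open>w a\<close> by \<open>w b\<close> replaces its tail,
          the inverse of p, by the inverse of q: same length, smaller weight.\<close>
        have "length p \<le> length u" using half(1)[OF l(1,2,4)] d by simp
        from weight_less[OF this len_eq True n]
        have wl: "weight n (u @ inv_word q) < weight n (w a)" unfolding d(1) .
        have fr: "free_reduction (w a @ w b) = u @ inv_word q" using d(4) s(2) by simp
        have "length (u @ inv_word q) = length (w a)" by (simp add: d(1) len_eq)
        then have "weight n (w a) \<le> weight n (u @ inv_word q)"
          using wt[OF l(1,2) ab] unfolding fr by blast
        then show False using wl by simp
      next
        case False
        then have lt: "word_value n p < word_value n q" using vals by simp
        \<comment> \<open>The mirror image: the inverse of \<open>w c\<close> is multiplied by the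
          inverse of \<open>w b\<close>, and q is exchanged for p.\<close>
        have "length q \<le> length v'" using half(2)[OF l(2,3,5)] e by simp
        then have "length q \<le> length (inv_word v')" by simp
        from weight_less[OF this len_eq[symmetric] lt n]
        have wl: "weight n (inv_word v' @ inv_word p) < weight n (inv_word v' @ inv_word q)" .
        have wc: "w (inv_letter c) = inv_word v' @ inv_word q" unfolding iw[OF l(3)] e(2) by simp
        have wb: "w (inv_letter b) = q @ inv_word p" unfolding iw[OF l(2)] e(1) s(1) by simp
        have "reduced (inv_word (u' @ v'))" using e(5) by (simp only: reduced_inv_word)
        then have "reduced (inv_word v' @ inv_word p)" unfolding s(1) by simp
        then have fr: "free_reduction (w (inv_letter c) @ w (inv_letter b)) = inv_word v' @ inv_word p"
          using free_reduction_cancel[of "inv_word v'" "inv_word q" "inv_word p"]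
          unfolding wc wb by (simp add: free_reduction_reduced)
        have c: "fst (inv_letter c) < n" "fst (inv_letter b) < n" "fst (inv_letter c) \<noteq> fst (inv_letter b)"
          using l bc by simp_all
        have "length (inv_word v' @ inv_word p) = length (w (inv_letter c))" unfolding wc by (simp add: len_eq)
        then have "weight n (w (inv_letter c)) \<le> weight n (inv_word v' @ inv_word p)"
          using wt[OF c] unfolding fr by blast
        then show False using wl unfolding wc by simp
      qed
    qed
  qed (use red ne half in blast)+
qed

text \<open>The modified letter a may be an inverse letter, while the sums run over positive ones;
  invariance under inversion bridges this. Written additively to avoid subtraction of natural
  numbers.\<close>

lemma sum_letters_change:
  fixes g h :: "letter \<Rightarrow> nat"
  assumes "\<And>c. fst c < n \<Longrightarrow> g (inv_letter c) = g c" "\<And>c. fst c < n \<Longrightarrow> h (inv_letter c) = h c" "fst a < n"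
    and "\<And>c. fst c < n \<Longrightarrow> fst c \<noteq> fst a \<Longrightarrow> g c = h c"
  shows "(\<Sum>i<n. g (i, True)) + h a = (\<Sum>i<n. h (i, True)) + g a"
proof -
  have a: "g (fst a, True) = g a" "h (fst a, True) = h a"
    using assms(1)[of a] assms(2)[of a] assms(3) by (cases a; cases "snd a"; simp add: inv_letter_def)+
  have "(\<Sum>i<n. f (i, True)) = f (fst a, True) + (\<Sum>i\<in>{..<n}-{fst a}. f (i, True))" for f :: "letter \<Rightarrow> nat"
    using assms(3) by (simp add: sum.remove)
  moreover have "(\<Sum>i\<in>{..<n}-{fst a}. g (i, True)) = (\<Sum>i\<in>{..<n}-{fst a}. h (i, True))"
    using assms(4) by (intro sum.cong) auto
  ultimately show ?thesis using a by simp
qed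

section \<open>Descent by Nielsen moves\<close>

lemma AG_hom: "f \<in> carrier (AG n) \<Longrightarrow> f \<in> hom (free_group n) (free_group n)"
  by (simp add: AutoGroup_simps auto_iff)

lemma AG_inv_letter:
  assumes "f \<in> carrier (AG n)" "fst c < n"
  shows "f [inv_letter c] = inv_word (f [c])"
proof -
  interpret f: group_hom "free_group n" "free_group n" f
    using AG_hom[OF assms(1)] by (simp add: group_hom_def group_hom_axioms_def group_free_group)
  have "f (inv\<^bsub>free_group n\<^esub> [c]) = inv\<^bsub>free_group n\<^esub> f [c]" using assms(2) by (intro f.hom_inv letter_carrier)
  then show ?thesis using assms(2) by (simp add: inv_letter_group inv_carrier letter_carrier)
qed

lemma AG_inj: "f \<in> carrier (AG n) \<Longrightarrow> u \<in> carrier (free_group n) \<Longrightarrow> v \<in> carrier (free_group n) \<Longrightarrow> f u = f v \<longleftrightarrow> u = v"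
  by (auto simp: AutoGroup_simps auto_iff bij_betw_def inj_on_def)

lemma AG_Nil: "f \<in> carrier (AG n) \<Longrightarrow> f [] = []"
proof -
  assume "f \<in> carrier (AG n)"
  then interpret f: group_hom "free_group n" "free_group n" f
    using AG_hom by (simp add: group_hom_def group_hom_axioms_def group_free_group)
  show ?thesis using f.hom_one by (simp add: one_free_group)
qed

lemma AG_sub_word:
  assumes f: "f \<in> carrier (AG n)" and "word n xs"
  shows "f (free_reduction xs) = free_reduction (sub_word (\<lambda>c. f [c]) xs)"
  using assms(2)
proof (induction xs)
  case Nil
  then show ?case using AG_Nil[OF f] by (simp add: free_reduction_def)
next
  case (Cons a xs)
  interpret f: group_hom "free_group n" "free_group n" f
    using AG_hom[OF f] by (simp add: group_hom_def group_hom_axioms_def group_free_group)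
  have a: "fst a < n" and xs: "word n xs" using Cons.prems by auto
  have "free_reduction (a # xs) = [a] \<otimes>\<^bsub>free_group n\<^esub> free_reduction xs"
    using free_reduction_append_right[of "[a]" xs] by (simp add: mult_free_group)
  then have "f (free_reduction (a # xs)) = f [a] \<otimes>\<^bsub>free_group n\<^esub> f (free_reduction xs)"
    using a xs by (simp add: letter_carrier free_reduction_carrier)
  also have "\<dots> = free_reduction (f [a] @ sub_word (\<lambda>c. f [c]) xs)"
    using Cons.IH[OF xs] by (simp add: mult_free_group free_reduction_append_right)
  finally show ?case by simp
qed

lemma AG_letter_carrier: "f \<in> carrier (AG n) \<Longrightarrow> fst c < n \<Longrightarrow> f [c] \<in> carrier (free_group n)"
  using AG_hom[of f n] letter_carrier[of c n] by (auto simp: hom_def)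

text \<open>Composing with a Nielsen automorphism on the right replaces one generator image by its
  product with another, so the change of both sums is the change of one term.\<close>

lemma AG_descent:
  assumes f: "f \<in> carrier (AG n)"
    and stuck: "\<And>a b. fst a < n \<Longrightarrow> fst b < n \<Longrightarrow> fst a \<noteq> fst b \<Longrightarrow>
      (f \<otimes>\<^bsub>AG n\<^esub> nielsen n a b, f) \<notin> measures [\<lambda>f. \<Sum>i<n. length (f [(i, True)]), \<lambda>f. \<Sum>i<n. weight n (f [(i, True)])]"
  shows "nielsen_reduced n (\<lambda>c. f [c])"
proof (rule nielsen_reducedI)
  note car = AG_letter_carrier[OF f]
  show "reduced (f [a])" "word n (f [a])" if "fst a < n" for a
    using car[OF that] by (simp_all add: mem_free_group)
  show "f [a] \<noteq> []" if "fst a < n" for a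
  proof
    assume "f [a] = []"
    then have "f [a] = f []" using AG_Nil[OF f] by simp
    then have "[a] = []" using AG_inj[OF f letter_carrier[OF that], of "[]"] by (simp add: mem_free_group)
    then show False by simp
  qed
  show "f [inv_letter a] = inv_word (f [a])" if "fst a < n" for a by (rule AG_inv_letter[OF f that])
  show "length (f [a]) \<le> length (free_reduction (f [a] @ f [b]))"
    "length (free_reduction (f [a] @ f [b])) = length (f [a]) \<Longrightarrow> weight n (f [a]) \<le> weight n (free_reduction (f [a] @ f [b]))"
    if ab: "fst a < n" "fst b < n" "fst a \<noteq> fst b" for a b
  proof -
    let ?g = "f \<otimes>\<^bsub>AG n\<^esub> nielsen n a b"
    have N: "nielsen n a b \<in> carrier (AG n)" by (rule nielsen_AG[OF ab])
    have g: "?g \<in> carrier (AG n)" by (rule AG_closed[OF f N])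
    have ev: "?g [c] = free_reduction (sub_word (\<lambda>c. f [c]) (nielsen_sub a b c))" if "fst c < n" for c
    proof -
      have "word n (nielsen_sub a b c)" using that ab by (auto simp: nielsen_sub_def)
      then show ?thesis
        using that ab by (simp add: AG_mult[OF f N] letter_carrier nielsen_letter AG_sub_word[OF f])
    qed
    have ga: "?g [a] = free_reduction (f [a] @ f [b])" using ev[OF ab(1)] by simp
    have gc: "?g [c] = f [c]" if "fst c < n" "fst c \<noteq> fst a" for c
      using ev[OF that(1)] that(2) carrier_word[OF car[OF that(1)]] by simp
    have change: "(\<Sum>i<n. h (?g [(i, True)])) + h (f [a]) = (\<Sum>i<n. h (f [(i, True)])) + h (?g [a])"
      if "\<And>w. h (inv_word w) = h w" for h :: "letter list \<Rightarrow> nat"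
      by (rule sum_letters_change[where g = "\<lambda>c. h (?g [c])" and h = "\<lambda>c. h (f [c])"])
        (simp_all add: that gc ab(1) AG_inv_letter[OF f] AG_inv_letter[OF g])
    have ch: "(\<Sum>i<n. length (?g [(i, True)])) + length (f [a]) = (\<Sum>i<n. length (f [(i, True)])) + length (?g [a])"
      "(\<Sum>i<n. weight n (?g [(i, True)])) + weight n (f [a]) = (\<Sum>i<n. weight n (f [(i, True)])) + weight n (?g [a])"
      by (rule change; simp)+
    note st = stuck[OF ab]
    show "length (f [a]) \<le> length (free_reduction (f [a] @ f [b]))"
      using st ch(1) unfolding ga[symmetric] by (simp add: not_less)
    show "weight n (f [a]) \<le> weight n (free_reduction (f [a] @ f [b]))"
      if "length (free_reduction (f [a] @ f [b])) = length (f [a])"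
      using st ch that unfolding ga[symmetric] by (simp add: not_less)
  qed
qed

text \<open>Each letter is the image of some word by surjectivity, and \<open>length_le\<close>
  bounds the length of that word by one. Hence f permutes the letters.\<close>

lemma nielsen_reduced_permaut:
  assumes f: "f \<in> carrier (AG n)" and nr: "nielsen_reduced n (\<lambda>c. f [c])"
  obtains \<theta> where "signed_perm {..<n} \<theta>" "f = permaut n \<theta>"
proof -
  have ex: "\<exists>d. fst d < n \<and> f [d] = [c]" if c: "fst c < n" for c
  proof -
    have "[c] \<in> f ` carrier (free_group n)"
      using f letter_carrier[OF c] by (simp add: AutoGroup_simps auto_iff bij_betw_def)
    then obtain xs where xs: "xs \<in> carrier (free_group n)" "f xs = [c]" by auto
    have xs': "word n xs" "free_reduction xs = xs" "reduced xs"
      using carrier_word[OF xs(1)] xs(1) by (simp_all add: mem_free_group)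
    have "free_reduction (sub_word (\<lambda>c. f [c]) xs) = [c]" using AG_sub_word[OF f xs'(1)] xs xs' by simp
    then have "length xs \<le> 1" using nielsen_reduced.length_le[OF nr xs'(3,1)] by simp
    moreover have "xs \<noteq> []" using AG_Nil[OF f] xs(2) by auto
    ultimately obtain d where "xs = [d]" by (cases xs) auto
    then show ?thesis using xs xs'(1) by (intro exI[of _ d]) simp
  qed
  \<comment> \<open>The preimage of a letter under f; the signed permutation describing f is the
    inverse of \<eta>. Outside the range \<eta> is the identity, as \<open>signed_perm\<close>
    demands.\<close>
  define \<eta> where "\<eta> c = (if fst c < n then SOME d. fst d < n \<and> f [d] = [c] else c)" for c
  have \<eta>: "fst (\<eta> c) < n" "f [\<eta> c] = [c]" if "fst c < n" for c
    using someI_ex[OF ex[OF that]] that by (simp_all add: \<eta>_def)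
  have out: "\<eta> c = c" if "\<not> fst c < n" for c using that by (simp add: \<eta>_def)
  have mem: "fst (\<eta> c) < n \<longleftrightarrow> fst c < n" for c by (cases "fst c < n") (simp_all add: \<eta>(1) out)
  have inj: "inj \<eta>"
  proof (rule injI)
    fix c d assume e: "\<eta> c = \<eta> d"
    have "fst (\<eta> c) < n \<longleftrightarrow> fst (\<eta> d) < n" unfolding e ..
    then have m: "fst c < n \<longleftrightarrow> fst d < n" unfolding mem .
    show "c = d"
    proof (cases "fst c < n")
      case True
      have "[c] = f [\<eta> c]" using \<eta>(2)[OF True] by (rule sym)
      also have "\<dots> = [d]" unfolding e by (rule \<eta>(2)[OF iffD1[OF m True]])
      finally show ?thesis by simp
    next
      case False
      have "c = \<eta> c" by (rule out[OF False, symmetric])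
      also have "\<dots> = d" unfolding e by (rule out) (use m False in blast)
      finally show ?thesis .
    qed
  qed
  let ?C = "{c::letter. fst c < n}"
  have "?C = {..<n} \<times> UNIV" by auto
  then have fin: "finite ?C" by (simp only: finite_cartesian_product finite_lessThan finite)
  have "\<eta> ` ?C \<subseteq> ?C" by (rule image_subsetI) (simp add: \<eta>(1))
  then have "\<eta> ` ?C = ?C" by (rule endo_inj_surj[OF fin _ inj_on_subset[OF inj subset_UNIV]])
  have "\<exists>c. d = \<eta> c" for d
  proof (cases "fst d < n")
    case True
    then have "d \<in> \<eta> ` ?C" using \<open>\<eta> ` ?C = ?C\<close> by simp
    then show ?thesis by (rule imageE) (rule exI)
  next
    case False
    show ?thesis by (rule exI[of _ d]) (rule out[OF False, symmetric])
  qed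
  then have "surj \<eta>" unfolding surj_def by (rule allI)
  then have "bij \<eta>" using inj by (simp add: bij_def)
  have sp: "signed_perm {..<n} \<eta>"
    unfolding signed_perm_def
  proof (intro conjI allI impI)
    show "bij \<eta>" by fact
    fix c
    show "\<eta> (inv_letter c) = inv_letter (\<eta> c)"
    proof (cases "fst c < n")
      case True
      have "f [\<eta> (inv_letter c)] = f [inv_letter (\<eta> c)]"
        using \<eta>[of c] \<eta>[of "inv_letter c"] True AG_inv_letter[OF f, of "\<eta> c"] by simp
      then show ?thesis
        using AG_inj[OF f letter_carrier letter_carrier, of "\<eta> (inv_letter c)" "inv_letter (\<eta> c)"]
          \<eta>(1)[of c] \<eta>(1)[of "inv_letter c"] True by simp
    qed (simp add: out)
    show "\<eta> c = c" if "fst c \<notin> {..<n}" using that out by simp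
  qed
  let ?\<theta> = "inv_into UNIV \<eta>"
  note sq = signed_perm_inv[OF sp]
  have "f = permaut n ?\<theta>"
  proof (rule AG_eqI_on[OF f permaut_AG[OF sq(1)], of "[]"])
    fix c :: letter assume c: "fst c < n"
    then have "f [c] = [?\<theta> c]" using \<eta>(2)[of "?\<theta> c"] sq(3)[of c] mem[of "?\<theta> c"] by simp
    then show "f [c] = permaut n ?\<theta> [c]"
      using c by (simp add: permaut_letter[OF sq(1)] free_reduction_reduced)
  qed simp
  then show ?thesis using that sq(1) by blast
qed

text \<open>Generation by Nielsen automorphisms and signed permutations, as an induction rule. A
  descending move is made and then undone by its inverse, which is again such an
  automorphism.\<close>

theorem AG_induct [consumes 1, case_names one nielsen permaut]:
  assumes "f \<in> carrier (AG n)" and one: "P \<one>\<^bsub>AG n\<^esub>"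
    and N: "\<And>f a b. f \<in> carrier (AG n) \<Longrightarrow> P f \<Longrightarrow> fst a < n \<Longrightarrow> fst b < n \<Longrightarrow> fst a \<noteq> fst b \<Longrightarrow> P (f \<otimes>\<^bsub>AG n\<^esub> nielsen n a b)"
    and Q: "\<And>f \<theta>. f \<in> carrier (AG n) \<Longrightarrow> P f \<Longrightarrow> signed_perm {..<n} \<theta> \<Longrightarrow> P (f \<otimes>\<^bsub>AG n\<^esub> permaut n \<theta>)"
  shows "P f"
  using assms(1)
proof (induction f rule: wf_induct_rule[OF wf_measures[of "[\<lambda>f. \<Sum>i<n. length (f [(i, True)]), \<lambda>f. \<Sum>i<n. weight n (f [(i, True)])]"]])
  case (1 f)
  interpret G: group "AG n" by (rule group_AG)
  show ?case
  proof (cases "nielsen_reduced n (\<lambda>c. f [c])")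
    case True
    then obtain \<theta> where "signed_perm {..<n} \<theta>" "f = permaut n \<theta>"
      using nielsen_reduced_permaut[OF 1(2)] by blast
    then show ?thesis using Q[OF AG_one_closed one] permaut_AG by simp
  next
    case False
    then obtain a b where ab: "fst a < n" "fst b < n" "fst a \<noteq> fst b" and
      less: "(f \<otimes>\<^bsub>AG n\<^esub> nielsen n a b, f) \<in> measures [\<lambda>f. \<Sum>i<n. length (f [(i, True)]), \<lambda>f. \<Sum>i<n. weight n (f [(i, True)])]"
      using AG_descent[OF 1(2)] by blast
    let ?g = "f \<otimes>\<^bsub>AG n\<^esub> nielsen n a b"
    have NN: "nielsen n a b \<in> carrier (AG n)" "nielsen n a (inv_letter b) \<in> carrier (AG n)"
      using ab by (simp_all add: nielsen_AG)
    then have g: "?g \<in> carrier (AG n)" using 1(2) by simp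
    have "P (?g \<otimes>\<^bsub>AG n\<^esub> nielsen n a (inv_letter b))"
      by (rule N[OF g 1(1)[OF less g] ab(1)]) (use ab in simp_all)
    moreover have "?g \<otimes>\<^bsub>AG n\<^esub> nielsen n a (inv_letter b) = f"
      using 1(2) NN by (simp add: G.m_assoc nielsen_inv[OF ab])
    ultimately show ?thesis by simp
  qed
qed

section \<open>Factorisation through the abelianisation\<close>

lemma exp_sum_single: "exp_sum i [c] = unitv c i"
  by (cases c) (simp add: unitv_def)

lemma lin_on_unitv:
  assumes "finite I" "i \<in> I" "j \<in> I"
  shows "lin_on I A (unitv (j, True)) i = A i j"
  using assms by (simp add: lin_on_def unitv_def if_distrib[of "\<lambda>x. _ * x"] cong: if_cong)

lemma lin_on_eqI:
  assumes "finite I" "\<exists>A. \<forall>v. g v = lin_on I A v"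
    and "\<And>i j. i \<in> I \<Longrightarrow> j \<in> I \<Longrightarrow> B i j = g (unitv (j, True)) i"
  shows "lin_on I B v = g v"
proof -
  obtain A where A: "\<And>v. g v = lin_on I A v" using assms(2) by blast
  have "B i j = A i j" if "i \<in> I" "j \<in> I" for i j
    using assms(3)[OF that] lin_on_unitv[OF assms(1) that] by (simp add: A)
  then have "lin_on I B v = lin_on I A v" by (simp add: lin_on_def fun_eq_iff)
  then show ?thesis by (simp add: A)
qed

text \<open>The induced matrix, acting on functions as the locale \<open>steinberg\<close> expects;
  it is the identity on coordinates from n on.\<close>

definition ab_act :: "nat \<Rightarrow> (letter list \<Rightarrow> letter list) \<Rightarrow> (nat \<Rightarrow> int) \<Rightarrow> nat \<Rightarrow> int" where
  "ab_act n f = lin_on {..<n} (\<lambda>i j. exp_sum i (f (gen j)))"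

lemma ab_act_aut_matrix: "ab_act n f = lin_on {..<n} (\<lambda>i j. aut_matrix n f $$ (i, j))"
  by (simp add: ab_act_def lin_on_def fun_eq_iff)

lemma ab_act_mult:
  assumes "f \<in> carrier (AG n)" "g \<in> carrier (AG n)"
  shows "ab_act n (f \<otimes>\<^bsub>AG n\<^esub> g) v = ab_act n f (ab_act n g v)"
proof -
  have "aut_matrix n (f \<otimes>\<^bsub>AG n\<^esub> g) = aut_matrix n f * aut_matrix n g"
    using assms by (simp add: AutoGroup_simps aut_matrix_compose)
  then have "aut_matrix n (f \<otimes>\<^bsub>AG n\<^esub> g) $$ (i, j) = (\<Sum>k<n. aut_matrix n f $$ (i, k) * aut_matrix n g $$ (k, j))"
    if "i < n" "j < n" for i j
    using that by (simp add: scalar_prod_def atLeast0LessThan aut_matrix_def)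
  then show ?thesis
    unfolding ab_act_aut_matrix lin_on_comp[OF finite_lessThan] by (simp add: lin_on_def fun_eq_iff)
qed

lemma ab_act_eq_iff:
  assumes "A \<in> carrier_mat n n"
  shows "(\<forall>v. ab_act n f v = lin_on {..<n} (\<lambda>i j. A $$ (i, j)) v) \<longleftrightarrow> aut_matrix n f = A"
proof
  assume h: "\<forall>v. ab_act n f v = lin_on {..<n} (\<lambda>i j. A $$ (i, j)) v"
  have "aut_matrix n f $$ (i, j) = A $$ (i, j)" if "i < n" "j < n" for i j
  proof -
    have ij: "i \<in> {..<n}" "j \<in> {..<n}" using that by auto
    show ?thesis
      using lin_on_unitv[OF finite_lessThan ij, of "\<lambda>i j. aut_matrix n f $$ (i, j)"]
        lin_on_unitv[OF finite_lessThan ij, of "\<lambda>i j. A $$ (i, j)"] h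
      unfolding ab_act_aut_matrix by metis
  qed
  then show "aut_matrix n f = A" using assms by (intro eq_matI) (auto simp: aut_matrix_def)
qed (simp add: ab_act_aut_matrix)

lemma ab_act_one: "ab_act n \<one>\<^bsub>AG n\<^esub> v = v"
proof -
  have "aut_matrix n \<one>\<^bsub>AG n\<^esub> = 1\<^sub>m n" by (simp add: AutoGroup_simps aut_matrix_one)
  then have "ab_act n \<one>\<^bsub>AG n\<^esub> v = lin_on {..<n} (\<lambda>i j. if i = j then 1 else 0) v"
    unfolding ab_act_aut_matrix by (simp add: lin_on_def fun_eq_iff)
  then show ?thesis by (simp only: lin_on_id[OF finite_lessThan])
qed

lemma ab_act_nielsen:
  assumes "fst a < n" "fst b < n" "fst a \<noteq> fst b"
  shows "ab_act n (nielsen n a b) v = transv a b v"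
  unfolding ab_act_def
proof (rule lin_on_eqI[OF finite_lessThan lin_on_transv])
  fix i j assume ij: "i \<in> {..<n}" "j \<in> {..<n}"
  have "exp_sum i (nielsen n a b (gen j)) = exp_sum i (nielsen_sub a b (j, True))"
    using assms ij by (simp add: gen_def nielsen_letter)
  also have "\<dots> = transv a b (unitv (j, True)) i"
    using assms(3) by (cases a; cases b)
      (auto simp: nielsen_sub_def transv_def unitv_def lval_def inv_letter_def)
  finally show "exp_sum i (nielsen n a b (gen j)) = transv a b (unitv (j, True)) i" .
qed (use assms in simp_all)

lemma ab_act_permaut:
  assumes "signed_perm {..<n} \<theta>"
  shows "ab_act n (permaut n \<theta>) v = permv \<theta> v"
  unfolding ab_act_def
proof (rule lin_on_eqI[OF finite_lessThan lin_on_permv[OF finite_lessThan assms]])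
  fix i j assume ij: "i \<in> {..<n}" "j \<in> {..<n}"
  have "exp_sum i (permaut n \<theta> (gen j)) = exp_sum i [\<theta> (j, True)]"
    using ij by (simp only: gen_def) (simp add: permaut_letter[OF assms] del: exp_sum_simps)
  then show "exp_sum i (permaut n \<theta> (gen j)) = permv \<theta> (unitv (j, True)) i"
    by (simp only: exp_sum_single permv_unitv[OF assms])
qed

text \<open>The map \<psi> chooses preimages under p; triviality of h on the kernel makes the choice
  irrelevant.\<close>

lemma (in group_hom) factor:
  assumes "group_hom G K p" "p ` carrier G = carrier K" and "\<And>x. x \<in> carrier G \<Longrightarrow> p x = \<one>\<^bsub>K\<^esub> \<Longrightarrow> h x = \<one>\<^bsub>H\<^esub>"
  shows "\<exists>\<psi>\<in>hom K H. \<forall>x\<in>carrier G. h x = \<psi> (p x)"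
proof -
  interpret p: group_hom G K p by (rule assms(1))
  have eq: "h x = h y" if "x \<in> carrier G" "y \<in> carrier G" "p x = p y" for x y
  proof -
    have "p (x \<otimes> inv y) = \<one>\<^bsub>K\<^esub>" using that by simp
    then have "h (x \<otimes> inv y) = \<one>\<^bsub>H\<^esub>" using that assms(3) by simp
    then have "h (x \<otimes> inv y \<otimes> y) = h y" using that(1,2) by (simp del: hom_inv)
    then show ?thesis using that(1,2) by (simp add: m_assoc)
  qed
  define s where "s k = (SOME x. x \<in> carrier G \<and> p x = k)" for k
  have s: "s k \<in> carrier G" "p (s k) = k" if "k \<in> carrier K" for k
  proof -
    have "k \<in> p ` carrier G" using that by (simp only: assms(2))
    then have "\<exists>x. x \<in> carrier G \<and> p x = k" by (elim imageE) (intro exI conjI, simp_all)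
    from someI_ex[OF this] have "s k \<in> carrier G \<and> p (s k) = k" unfolding s_def .
    then show "s k \<in> carrier G" "p (s k) = k" by blast+
  qed
  have fac: "h x = h (s (p x))" if "x \<in> carrier G" for x
    using that s(1)[of "p x"] s(2)[of "p x", symmetric] by (intro eq) simp_all
  have "(\<lambda>k. h (s k)) \<in> hom K H"
  proof (rule homI)
    fix k l assume kl: "k \<in> carrier K" "l \<in> carrier K"
    note sk = s[OF kl(1)] s[OF kl(2)] s[OF p.H.m_closed[OF kl]]
    have "p (s k \<otimes> s l) = k \<otimes>\<^bsub>K\<^esub> l" using sk(1,3) by (simp add: sk(2,4))
    then have "h (s (k \<otimes>\<^bsub>K\<^esub> l)) = h (s k \<otimes> s l)" using sk by (intro eq) simp_all
    then show "h (s (k \<otimes>\<^bsub>K\<^esub> l)) = h (s k) \<otimes>\<^bsub>H\<^esub> h (s l)" using sk(1,3) by simp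
  next
    fix k assume "k \<in> carrier K"
    from s(1)[OF this] show "h (s k) \<in> carrier H" by (rule hom_closed)
  qed
  then show ?thesis by (rule bexI[rotated]) (use fac in blast)
qed

section \<open>Representations of Aut(F_n) trivial on inner automorphisms\<close>

lemma lift_perm_simps [simp]: "lift_perm \<pi> (i, s) = (\<pi> i, s)"
  by (simp add: lift_perm_def)

lemma flip_simps: "flip S (i, s) = (i, if i \<in> S then \<not> s else s)"
  by (simp add: flip_def inv_letter_def)

locale aut_rep = finite_dimensional_vector_space scale Basis
  for scale :: "'k::field \<Rightarrow> 'v::ab_group_add \<Rightarrow> 'v" and Basis +
  fixes n :: nat and \<Phi> :: "(letter list \<Rightarrow> letter list) \<Rightarrow> 'v \<Rightarrow> 'v"
  assumes \<Phi>_hom: "\<Phi> \<in> hom (AG n) (GL scale)"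
    and \<Phi>_inner: "k \<in> inner_auts (free_group n) \<Longrightarrow> \<Phi> k = id"
begin

lemma \<Phi>_mult: "f \<in> carrier (AG n) \<Longrightarrow> g \<in> carrier (AG n) \<Longrightarrow> \<Phi> (f \<otimes>\<^bsub>AG n\<^esub> g) v = \<Phi> f (\<Phi> g v)"
  using hom_mult[OF \<Phi>_hom, of f g] by (simp add: GL_def)

lemma \<Phi>_one: "\<Phi> \<one>\<^bsub>AG n\<^esub> v = v"
proof -
  interpret group_hom "AG n" "GL scale" \<Phi>
    using \<Phi>_hom group_AG group_GL[OF vector_space_axioms] by (simp add: group_hom_def group_hom_axioms_def)
  show ?thesis using hom_one by (simp add: GL_def)
qed

lemma \<Phi>_linear: "f \<in> carrier (AG n) \<Longrightarrow> Vector_Spaces.linear scale scale (\<Phi> f)"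
  using \<Phi>_hom by (auto simp: hom_def GL_def)

definition T :: "letter \<Rightarrow> letter \<Rightarrow> 'v \<Rightarrow> 'v" where "T a b = \<Phi> (nielsen n a b)"

definition Q :: "(letter \<Rightarrow> letter) \<Rightarrow> 'v \<Rightarrow> 'v" where "Q \<theta> = \<Phi> (permaut n \<theta>)"

lemma T_inv:
  assumes "fst a < n" "fst b < n" "fst a \<noteq> fst b"
  shows "T a b (T a (inv_letter b) v) = v"
  using nielsen_inv[OF assms] assms unfolding T_def by (simp add: \<Phi>_mult[symmetric] nielsen_AG \<Phi>_one)

lemma T_comm:
  assumes "fst a < n" "fst b < n" "fst c < n" "fst d < n" "fst a \<noteq> fst b" "fst c \<noteq> fst d"
    "a \<noteq> c" "fst a \<noteq> fst d" "fst b \<noteq> fst c"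
  shows "T a b (T c d v) = T c d (T a b v)"
  using nielsen_comm[OF assms] assms unfolding T_def by (simp add: \<Phi>_mult[symmetric] nielsen_AG)

lemma T_chain:
  assumes "fst a < n" "fst b < n" "fst c < n" "fst a \<noteq> fst b" "fst a \<noteq> fst c" "fst b \<noteq> fst c"
  shows "T b c (T a b v) = T a b (T b c (T a c v))"
  using nielsen_chain[OF assms] assms unfolding T_def
  by (simp add: \<Phi>_mult[symmetric] nielsen_AG) (simp add: \<Phi>_mult nielsen_AG)

lemma T_quarter:
  assumes "fst a < n" "fst b < n" "fst a \<noteq> fst b"
  shows "T a b v = T (inv_letter b) (inv_letter a) (Q (quarter a b) (T b a v))"
proof -
  have "signed_perm {..<n} (quarter a b)" using assms by (intro signed_perm_quarter) auto
  then show ?thesis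
    using assms unfolding T_def Q_def by (subst nielsen_quarter[OF assms]) (simp add: \<Phi>_mult nielsen_AG permaut_AG)
qed

lemma Q_comp:
  assumes "signed_perm {..<n} \<theta>" "signed_perm {..<n} \<eta>"
  shows "Q \<theta> (Q \<eta> v) = Q (\<theta> \<circ> \<eta>) v"
  using permaut_comp[OF assms] assms unfolding Q_def by (simp add: \<Phi>_mult[symmetric] permaut_AG)

lemma Q_id: "Q (\<lambda>a. a) v = v"
  by (simp add: Q_def permaut_id \<Phi>_one)

lemma Q_T:
  assumes "signed_perm {..<n} \<theta>" "fst a < n" "fst b < n" "fst a \<noteq> fst b"
  shows "Q \<theta> (T a b v) = T (\<theta> a) (\<theta> b) (Q \<theta> v)"
proof -
  have "fst (\<theta> a) \<noteq> fst (\<theta> b)" using assms signed_perm_fst_eq by blast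
  then show ?thesis
    using permaut_nielsen[OF assms] assms unfolding Q_def T_def
    by (simp add: \<Phi>_mult[symmetric] permaut_AG nielsen_AG signed_perm_less)
qed

lemma Q_flip_flip: "S \<subseteq> {..<n} \<Longrightarrow> Q (flip S) (Q (flip S) v) = v"
proof -
  assume "S \<subseteq> {..<n}"
  then have "Q (flip S) (Q (flip S) v) = Q (flip S \<circ> flip S) v" by (simp add: Q_comp signed_perm_flip)
  moreover have "flip S \<circ> flip S = (\<lambda>a. a)" by (auto simp: fun_eq_iff flip_def)
  ultimately show ?thesis by (simp add: Q_id)
qed

lemma fold_flip: "m \<le> n \<Longrightarrow> fold (\<lambda>i. Q (flip {i})) [0..<m] v = Q (flip {..<m}) v"
proof (induction m)
  case 0
  have "flip {} = (\<lambda>a. a)" by (auto simp: flip_def)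
  then show ?case by (simp add: Q_id)
next
  case (Suc m)
  have "flip {m} \<circ> flip {..<m} = flip {..<Suc m}" by (auto simp: flip_def fun_eq_iff)
  then show ?case using Suc by (simp add: Q_comp signed_perm_flip)
qed

lemma fold_T:
  assumes "distinct xs" "set xs \<subseteq> {..<n} - {j}" "j < n"
  shows "fold (\<lambda>i. T (i, True) (j, True)) xs v = \<Phi> (end_of n (tau_sub (set xs) j)) v"
  using assms
proof (induction xs arbitrary: v)
  case Nil
  have "tau_sub {} j = (\<lambda>c. [c])" by (auto simp: tau_sub_def)
  then have "end_of n (tau_sub {} j) = permaut n (\<lambda>a. a)" by (simp add: permaut_def)
  then show ?case by (simp add: permaut_id \<Phi>_one)
next
  case (Cons i xs)
  have i: "i < n" "i \<noteq> j" "i \<notin> set xs" "set xs \<subseteq> {..<n}" "j \<notin> set xs" using Cons.prems by auto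
  have "end_of n (tau_sub (set xs) j) \<in> carrier (AG n)"
    "end_of n (tau_sub (insert i (set xs)) j) = end_of n (tau_sub (set xs) j) \<otimes>\<^bsub>AG n\<^esub> nielsen n (i, True) (j, True)"
    using tau_AG[OF i(4) assms(3) i(5)] i by blast+
  then show ?case using Cons i by (simp add: \<Phi>_mult nielsen_AG T_def)
qed

lemma out_rep:
  assumes "4 \<le> n" "(2::'k) \<noteq> 0"
  shows "out_rep scale Basis n (\<lambda>i j. T (i, True) (j, True)) (\<lambda>i. Q (flip {i})) (\<lambda>\<pi>. Q (lift_perm \<pi>))"
proof -
  note fl = signed_perm_flip[of "{i}" "{..<n}" for i, simplified]
  note lp = signed_perm_lift_perm
  have less: "\<pi> i < n \<longleftrightarrow> i < n" if "\<pi> permutes {..<n}" for \<pi> i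
    using permutes_in_image[OF that, of i] by simp
  \<comment> \<open>Conjugation by the sign changes at i and j inverts both letters, hence turns
    right into left multiplication: this is \<open>L i j\<close> of the locale.\<close>
  have twist: "Q (flip {i}) (Q (flip {j}) (T (i, True) (j, True) (Q (flip {i}) (Q (flip {j}) v)))) = T (i, False) (j, False) v"
    if "i < n" "j < n" "i \<noteq> j" for i j v
  proof -
    have com: "flip {i} \<circ> flip {j} = flip {i, j}" using that by (auto simp: flip_def fun_eq_iff)
    have "Q (flip {i}) (Q (flip {j}) w) = Q (flip {i, j}) w" for w
      unfolding com[symmetric] using that by (intro Q_comp fl)
    then show ?thesis
      using that by (simp add: signed_perm_flip Q_T flip_simps Q_flip_flip)
  qed
  show ?thesis
  proof (intro out_rep.intro out_rep_axioms.intro)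
    show "finite_dimensional_vector_space scale Basis" by unfold_locales
    show "4 \<le> n" "(2::'k) \<noteq> 0" by fact+
    show "Vector_Spaces.linear scale scale (T (i, True) (j, True))" if "i < n" "j < n" "i \<noteq> j" for i j
      unfolding T_def using that by (intro \<Phi>_linear nielsen_AG) auto
    show "Vector_Spaces.linear scale scale (Q (flip {i}))" if "i < n" for i
      unfolding Q_def using that by (intro \<Phi>_linear permaut_AG fl)
    show "Vector_Spaces.linear scale scale (Q (lift_perm \<pi>))" if "\<pi> permutes {..<n}" for \<pi>
      unfolding Q_def using that by (intro \<Phi>_linear permaut_AG lp)
    show "Q (flip {i}) (Q (flip {i}) v) = v" if "i < n" for i v
      using that by (intro Q_flip_flip) auto
    show "Q (flip {i}) (Q (flip {j}) v) = Q (flip {j}) (Q (flip {i}) v)" if "i < n" "j < n" for i j v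
    proof -
      have "flip {i} \<circ> flip {j} = flip {j} \<circ> flip {i}" by (auto simp: flip_def fun_eq_iff)
      then show ?thesis using that by (simp add: Q_comp fl)
    qed
    show "Q (flip {k}) (T (i, True) (j, True) v) = T (i, True) (j, True) (Q (flip {k}) v)"
      if "i < n" "j < n" "i \<noteq> j" "k < n" "k \<noteq> i" "k \<noteq> j" for i j k v
      using that by (simp add: Q_T fl flip_simps)
    show "T (i, True) (j, True) (Q (flip {j}) (T (i, True) (j, True) v)) = Q (flip {j}) v"
      if "i < n" "j < n" "i \<noteq> j" for i j v
      using that T_inv[of "(i, True)" "(j, True)"] by (simp add: Q_T fl flip_simps inv_letter_def)
    show "T (i, True) (j, True) (T (k, True) (l, True) v) = T (k, True) (l, True) (T (i, True) (j, True) v)"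
      if "i < n" "j < n" "i \<noteq> j" "k < n" "l < n" "k \<noteq> l" "i \<noteq> k" "i \<noteq> l" "j \<noteq> k" for i j k l v
      using that by (intro T_comm) auto
    show "T (i, True) (j, True) (Q (flip {i}) (Q (flip {k}) (T (i, True) (k, True) (Q (flip {i}) (Q (flip {k}) v))))) =
        Q (flip {i}) (Q (flip {k}) (T (i, True) (k, True) (Q (flip {i}) (Q (flip {k}) (T (i, True) (j, True) v)))))"
      if "i < n" "j < n" "i \<noteq> j" "k < n" "i \<noteq> k" for i j k v
      unfolding twist[OF that(1,4,5)] using that by (intro T_comm) auto
    show "T (k, True) (j, True) (T (i, True) (k, True) v) =
        T (i, True) (k, True) (T (k, True) (j, True) (T (i, True) (j, True) v))"
      if "i < n" "j < n" "k < n" "i \<noteq> j" "i \<noteq> k" "j \<noteq> k" for i j k v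
      using that by (intro T_chain) auto
    show "Q (lift_perm \<pi>) (Q (lift_perm \<rho>) v) = Q (lift_perm (\<pi> \<circ> \<rho>)) v"
      if "\<pi> permutes {..<n}" "\<rho> permutes {..<n}" for \<pi> \<rho> v
    proof -
      have "lift_perm \<pi> \<circ> lift_perm \<rho> = lift_perm (\<pi> \<circ> \<rho>)" by (auto simp: lift_perm_def)
      then show ?thesis using that by (simp add: Q_comp lp)
    qed
    have "lift_perm id = (\<lambda>a. a)" by (auto simp: lift_perm_def)
    then show "Q (lift_perm id) v = v" for v by (simp add: Q_id)
    show "Q (lift_perm \<pi>) (T (i, True) (j, True) v) = T (\<pi> i, True) (\<pi> j, True) (Q (lift_perm \<pi>) v)"
      if "\<pi> permutes {..<n}" "i < n" "j < n" "i \<noteq> j" for \<pi> i j v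
      using that by (simp add: Q_T lp)
    show "Q (lift_perm \<pi>) (Q (flip {i}) v) = Q (flip {\<pi> i}) (Q (lift_perm \<pi>) v)"
      if "\<pi> permutes {..<n}" "i < n" for \<pi> i v
    proof -
      have "\<pi> k = \<pi> i \<longleftrightarrow> k = i" for k using permutes_inj[OF that(1)] by (auto simp: inj_eq)
      then have "lift_perm \<pi> \<circ> flip {i} = flip {\<pi> i} \<circ> lift_perm \<pi>"
        by (auto simp: lift_perm_def flip_def inv_letter_def fun_eq_iff)
      then show ?thesis using that by (simp add: Q_comp lp fl less)
    qed
    show "T (i, True) (j, True) v = Q (flip {j}) (Q (flip {i}) (T (j, True) (i, True)
        (Q (flip {j}) (Q (flip {i}) (Q (lift_perm (transpose i j)) (Q (flip {j}) (T (j, True) (i, True) v)))))))"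
      if "i < n" "j < n" "i \<noteq> j" for i j v
    proof -
      have p: "transpose i j permutes {..<n}" using that by (intro permutes_swap_id) auto
      \<comment> \<open>A quarter turn is a sign change at j followed by the transposition.\<close>
      have "quarter (i, True) (j, True) = lift_perm (transpose i j) \<circ> flip {j}"
        using that by (auto simp: quarter_def flip_def inv_letter_def lift_perm_def fun_eq_iff transpose_def split: if_splits)
      then show ?thesis
        using T_quarter[of "(i, True)" "(j, True)" v] twist[of j i] that
        by (simp add: Q_comp lp p fl) (simp add: inv_letter_def)
    qed
    show "fold (\<lambda>i. Q (flip {i})) [0..<n] (fold (\<lambda>i. T (i, True) (j, True)) (filter (\<lambda>i. i \<noteq> j) [0..<n]) v) =
        fold (\<lambda>i. T (i, True) (j, True)) (filter (\<lambda>i. i \<noteq> j) [0..<n]) (fold (\<lambda>i. Q (flip {i})) [0..<n] v)"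
      if j: "j < n" for j v
    proof -
      let ?S = "{..<n} - {j}"
      have set: "set (filter (\<lambda>i. i \<noteq> j) [0..<n]) = ?S" by auto
      have tau: "fold (\<lambda>i. T (i, True) (j, True)) (filter (\<lambda>i. i \<noteq> j) [0..<n]) v = \<Phi> (end_of n (tau_sub ?S j)) v" for v
        using fold_T[of "filter (\<lambda>i. i \<noteq> j) [0..<n]" j v] j unfolding set by simp
      have t: "end_of n (tau_sub ?S j) \<in> carrier (AG n)" using tau_AG[of ?S n j] j by blast
      have d: "permaut n (flip {..<n}) \<in> carrier (AG n)" by (intro permaut_AG signed_perm_flip) simp
      obtain g where g: "g \<in> inner_auts (free_group n)" "permaut n (flip {..<n}) \<otimes>\<^bsub>AG n\<^esub> end_of n (tau_sub ?S j) =
        g \<otimes>\<^bsub>AG n\<^esub> (end_of n (tau_sub ?S j) \<otimes>\<^bsub>AG n\<^esub> permaut n (flip {..<n}))"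
        using tau_delta[OF j] by blast
      have gc: "g \<in> carrier (AG n)"
        using g(1) group.inner_in_auto[OF group_free_group] by (auto simp: inner_auts_def AutoGroup_simps)
      have "\<Phi> (permaut n (flip {..<n})) (\<Phi> (end_of n (tau_sub ?S j)) v) =
        \<Phi> g (\<Phi> (end_of n (tau_sub ?S j)) (\<Phi> (permaut n (flip {..<n})) v))"
        using arg_cong[OF g(2), of "\<lambda>f. \<Phi> f v"] t d gc by (simp add: \<Phi>_mult)
      then show ?thesis unfolding tau fold_flip[OF le_refl] unfolding Q_def \<Phi>_inner[OF g(1)] by simp
    qed
  qed
qed

text \<open>For positive letters this is \<open>R_eq_L\<close>; conjugation by sign changes
  transports it to all choices of signs.\<close>

theorem T_sym:
  assumes "4 \<le> n" "n \<le> 5" "(2::'k) \<noteq> 0" "of_nat (n - 1) \<noteq> (0::'k)" "dim (UNIV :: 'v set) \<le> 2 * n"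
    and ab: "fst a < n" "fst b < n" "fst a \<noteq> fst b"
  shows "T (inv_letter a) (inv_letter b) v = T a b v"
proof -
  interpret o: out_rep scale Basis n "\<lambda>i j. T (i, True) (j, True)" "\<lambda>i. Q (flip {i})" "\<lambda>\<pi>. Q (lift_perm \<pi>)"
    by (rule out_rep[OF assms(1,3)])
  define i where "i = fst a"
  define j where "j = fst b"
  have ij: "i < n" "j < n" "i \<noteq> j" using ab by (simp_all add: i_def j_def)
  have com: "Q (flip {i}) (Q (flip {j}) w) = Q (flip {i, j}) w" for w
  proof -
    have "flip {i} \<circ> flip {j} = flip {i, j}" using ij by (auto simp: flip_def fun_eq_iff)
    then show ?thesis using ij by (subst Q_comp) (simp_all add: signed_perm_flip)
  qed
  have pos: "T (i, True) (j, True) v = T (i, False) (j, False) v" for v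
    using o.R_eq_L[OF assms(2,5,4) ij] unfolding o.L_def com
    using ij by (simp add: Q_T signed_perm_flip flip_simps Q_flip_flip)
  define S where "S = (if snd a then {} else {i}) \<union> (if snd b then {} else {j})"
  have S: "S \<subseteq> {..<n}" using ij by (auto simp: S_def)
  have letters: "flip S (i, True) = a" "flip S (j, True) = b" "flip S (i, False) = inv_letter a" "flip S (j, False) = inv_letter b"
    using ij by (cases a; cases b; auto simp: S_def flip_simps i_def j_def inv_letter_def)+
  have "T a b (Q (flip S) w) = T (inv_letter a) (inv_letter b) (Q (flip S) w)" for w
    using Q_T[OF signed_perm_flip[OF S], of "(i, True)" "(j, True)" w]
      Q_T[OF signed_perm_flip[OF S], of "(i, False)" "(j, False)" w] ij pos[of w]
    unfolding letters by simp
  from this[of "Q (flip S) v"] show ?thesis by (simp add: Q_flip_flip[OF S])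
qed

text \<open>The second component lets the presentation of the integral general linear group act on the pairs, so that the
  first component is determined by it.\<close>

definition \<Psi> :: "(letter list \<Rightarrow> letter list) \<Rightarrow> ('v \<Rightarrow> 'v) \<times> ((nat \<Rightarrow> int) \<Rightarrow> nat \<Rightarrow> int)" where
  "\<Psi> f = (\<Phi> f, ab_act n f)"

abbreviation pair_mult (infixl "\<star>" 70) where
  "p \<star> q \<equiv> (fst p \<circ> fst q, snd p \<circ> snd q)"

lemma \<Psi>_mult: "f \<in> carrier (AG n) \<Longrightarrow> g \<in> carrier (AG n) \<Longrightarrow> \<Psi> f \<star> \<Psi> g = \<Psi> (f \<otimes>\<^bsub>AG n\<^esub> g)"
  by (simp add: \<Psi>_def fun_eq_iff \<Phi>_mult ab_act_mult)

lemma \<Psi>_one: "\<Psi> \<one>\<^bsub>AG n\<^esub> = (id, id)"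
  by (simp add: \<Psi>_def fun_eq_iff \<Phi>_one ab_act_one)

lemma \<Psi>_mult_eq:
  assumes "f \<in> carrier (AG n)" "g \<in> carrier (AG n)" "h \<in> carrier (AG n)" "k \<in> carrier (AG n)"
    "f \<otimes>\<^bsub>AG n\<^esub> g = h \<otimes>\<^bsub>AG n\<^esub> k"
  shows "\<Psi> f \<star> \<Psi> g = \<Psi> h \<star> \<Psi> k"
  unfolding \<Psi>_mult[OF assms(1,2)] \<Psi>_mult[OF assms(3,4)] assms(5) ..

definition symmetric :: bool where
  "symmetric \<longleftrightarrow> (\<forall>a b. fst a < n \<longrightarrow> fst b < n \<longrightarrow> fst a \<noteq> fst b \<longrightarrow> T (inv_letter a) (inv_letter b) = T a b)"

text \<open>Two axioms fail for Nielsen automorphisms themselves: multiplications of one generator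
  on the same side need not commute, and the relation with the quarter turn mixes sides.
  \<open>symmetric\<close> allows a factor to change sides and restores both.\<close>

lemma steinberg:
  assumes symmetric
  shows "steinberg (\<lambda>p q. p \<star> q) (id, id) snd {..<n} (\<lambda>a b. \<Psi> (nielsen n a b)) (\<lambda>\<theta>. \<Psi> (permaut n \<theta>))"
proof -
  have sym: "\<Psi> (nielsen n (inv_letter a) (inv_letter b)) = \<Psi> (nielsen n a b)"
    if ab: "fst a < n" "fst b < n" "fst a \<noteq> fst b" for a b
  proof -
    have "transv (inv_letter a) (inv_letter b) v = transv a b v" for v
      by (simp add: transv_def) (simp add: inv_letter_def)
    moreover have "\<Phi> (nielsen n (inv_letter a) (inv_letter b)) = \<Phi> (nielsen n a b)"
      using assms ab unfolding symmetric_def T_def by blast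
    ultimately show ?thesis using ab by (simp add: \<Psi>_def fun_eq_iff ab_act_nielsen)
  qed
  have comm: "\<Psi> (nielsen n a b) \<star> \<Psi> (nielsen n c d) = \<Psi> (nielsen n c d) \<star> \<Psi> (nielsen n a b)"
    if l: "fst a < n" "fst b < n" "fst c < n" "fst d < n" "fst a \<noteq> fst b" "fst c \<noteq> fst d"
      "fst a \<noteq> fst d" "fst b \<noteq> fst c" "a \<noteq> c" for a b c d
    by (intro \<Psi>_mult_eq nielsen_AG nielsen_comm) (use l in simp_all)
  show ?thesis
  proof (rule steinberg.intro)
    show "snd (\<Psi> (nielsen n a b)) v = transv a b v"
      if "fst a \<in> {..<n}" "fst b \<in> {..<n}" "fst a \<noteq> fst b" for a b v
      using that by (simp add: \<Psi>_def ab_act_nielsen)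
    show "snd (\<Psi> (permaut n \<theta>)) v = permv \<theta> v" if "signed_perm {..<n} \<theta>" for \<theta> v
      using that by (simp add: \<Psi>_def ab_act_permaut)
    show "\<Psi> (nielsen n a b) \<star> \<Psi> (nielsen n a (inv_letter b)) = (id, id)"
      if "fst a \<in> {..<n}" "fst b \<in> {..<n}" "fst a \<noteq> fst b" for a b
    proof -
      have l: "fst a < n" "fst b < n" "fst a \<noteq> fst b" using that by simp_all
      then have "\<Psi> (nielsen n a b) \<star> \<Psi> (nielsen n a (inv_letter b)) = \<Psi> (nielsen n a b \<otimes>\<^bsub>AG n\<^esub> nielsen n a (inv_letter b))"
        by (intro \<Psi>_mult nielsen_AG) simp_all
      then show ?thesis unfolding nielsen_inv[OF l] \<Psi>_one .
    qed
    show "\<Psi> (nielsen n (inv_letter a) (inv_letter b)) = \<Psi> (nielsen n a b)"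
      if "fst a \<in> {..<n}" "fst b \<in> {..<n}" "fst a \<noteq> fst b" for a b
      using that by (intro sym) auto
    show "\<Psi> (nielsen n a b) \<star> \<Psi> (nielsen n c d) = \<Psi> (nielsen n c d) \<star> \<Psi> (nielsen n a b)"
      if l: "fst a \<in> {..<n}" "fst b \<in> {..<n}" "fst c \<in> {..<n}" "fst d \<in> {..<n}" "fst a \<noteq> fst b" "fst c \<noteq> fst d"
        "fst a \<noteq> fst d" "fst b \<noteq> fst c" for a b c d
    \<comment> \<open>For a = c the first factor is replaced by the left multiplication, which
      commutes with the second.\<close>
    proof (cases "a = c")
      case True
      have "\<Psi> (nielsen n (inv_letter a) (inv_letter b)) \<star> \<Psi> (nielsen n c d) =
          \<Psi> (nielsen n c d) \<star> \<Psi> (nielsen n (inv_letter a) (inv_letter b))"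
        by (rule comm) (use l True in simp_all)
      moreover have "\<Psi> (nielsen n (inv_letter a) (inv_letter b)) = \<Psi> (nielsen n a b)"
        by (rule sym) (use l in simp_all)
      ultimately show ?thesis by (simp only:)
    next
      case False
      then show ?thesis using l by (intro comm) simp_all
    qed
    show "\<Psi> (nielsen n b c) \<star> \<Psi> (nielsen n a b) = \<Psi> (nielsen n a b) \<star> \<Psi> (nielsen n b c) \<star> \<Psi> (nielsen n a c)"
      if l: "fst a \<in> {..<n}" "fst b \<in> {..<n}" "fst c \<in> {..<n}" "fst a \<noteq> fst b" "fst a \<noteq> fst c" "fst b \<noteq> fst c" for a b c
    proof -
      have c: "nielsen n a b \<in> carrier (AG n)" "nielsen n b c \<in> carrier (AG n)" "nielsen n a c \<in> carrier (AG n)"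
        using l by (auto intro!: nielsen_AG)
      have "nielsen n b c \<otimes>\<^bsub>AG n\<^esub> nielsen n a b =
          nielsen n a b \<otimes>\<^bsub>AG n\<^esub> nielsen n b c \<otimes>\<^bsub>AG n\<^esub> nielsen n a c"
        by (rule nielsen_chain) (use l in simp_all)
      then show ?thesis unfolding \<Psi>_mult[OF c(1,2)] by (intro \<Psi>_mult_eq AG_closed c)
    qed
    show "\<Psi> (nielsen n a b) = \<Psi> (nielsen n b a) \<star> \<Psi> (permaut n (quarter a b)) \<star> \<Psi> (nielsen n b a)"
      if l: "fst a \<in> {..<n}" "fst b \<in> {..<n}" "fst a \<noteq> fst b" for a b
    proof -
      have q: "permaut n (quarter a b) \<in> carrier (AG n)" by (intro permaut_AG signed_perm_quarter l)
      have b: "nielsen n b a \<in> carrier (AG n)" "nielsen n (inv_letter b) (inv_letter a) \<in> carrier (AG n)"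
        using l by (auto intro!: nielsen_AG)
      have "nielsen n a b = nielsen n (inv_letter b) (inv_letter a) \<otimes>\<^bsub>AG n\<^esub> permaut n (quarter a b) \<otimes>\<^bsub>AG n\<^esub> nielsen n b a"
        by (rule nielsen_quarter) (use l in simp_all)
      then have "\<Psi> (nielsen n a b) = \<Psi> (nielsen n (inv_letter b) (inv_letter a)) \<star> \<Psi> (permaut n (quarter a b)) \<star> \<Psi> (nielsen n b a)"
        unfolding \<Psi>_mult[OF b(2) q] \<Psi>_mult[OF AG_closed[OF b(2) q] b(1)] by (rule arg_cong)
      moreover have "\<Psi> (nielsen n (inv_letter b) (inv_letter a)) = \<Psi> (nielsen n b a)"
        by (rule sym) (use l in simp_all)
      ultimately show ?thesis by (simp only:)
    qed
    show "\<Psi> (permaut n \<theta>) \<star> \<Psi> (permaut n \<eta>) = \<Psi> (permaut n (\<theta> \<circ> \<eta>))"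
      if "signed_perm {..<n} \<theta>" "signed_perm {..<n} \<eta>" for \<theta> \<eta>
      unfolding permaut_comp[OF that, symmetric] by (intro \<Psi>_mult permaut_AG that)
    show "\<Psi> (permaut n (\<lambda>a. a)) = (id, id)" by (simp only: permaut_id \<Psi>_one)
    show "\<Psi> (permaut n \<theta>) \<star> \<Psi> (nielsen n a b) = \<Psi> (nielsen n (\<theta> a) (\<theta> b)) \<star> \<Psi> (permaut n \<theta>)"
      if "signed_perm {..<n} \<theta>" "fst a \<in> {..<n}" "fst b \<in> {..<n}" "fst a \<noteq> fst b" for \<theta> a b
    proof -
      have "fst (\<theta> a) < n" "fst (\<theta> b) < n" "fst (\<theta> a) \<noteq> fst (\<theta> b)"
        using that signed_perm_less signed_perm_fst_eq by auto
      then show ?thesis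
        using that by (intro \<Psi>_mult_eq permaut_nielsen permaut_AG nielsen_AG) simp_all
    qed
  qed (simp_all add: comp_assoc)
qed

section \<open>Kernel and image of the projection\<close>

context
  assumes sym: symmetric
begin

interpretation st: steinberg "\<lambda>p q. p \<star> q" "(id, id)" snd "{..<n}" "\<lambda>a b. \<Psi> (nielsen n a b)" "\<lambda>\<theta>. \<Psi> (permaut n \<theta>)"
  by (rule steinberg[OF sym])

lemma \<Psi>_gens:
  assumes "f \<in> carrier (AG n)"
  shows "\<Psi> f \<in> st.submonoid_gen (st.gens {..<n} {..<n} {..<n})"
  using assms
proof (induction rule: AG_induct)
  case one
  show ?case unfolding \<Psi>_one by (rule st.submonoid_gen.one)
next
  case (nielsen f a b)
  have "\<Psi> (f \<otimes>\<^bsub>AG n\<^esub> nielsen n a b) = \<Psi> f \<star> \<Psi> (nielsen n a b)"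
    by (rule \<Psi>_mult[symmetric]) (use nielsen in \<open>auto intro: nielsen_AG\<close>)
  moreover have "\<Psi> (nielsen n a b) \<in> st.gens {..<n} {..<n} {..<n}"
    by (rule st.gens_E) (use nielsen in simp_all)
  ultimately show ?case using st.submonoid_gen_mult[OF nielsen.IH st.submonoid_gen_inc] by (simp only:)
next
  case (permaut f \<theta>)
  have "\<Psi> (f \<otimes>\<^bsub>AG n\<^esub> permaut n \<theta>) = \<Psi> f \<star> \<Psi> (permaut n \<theta>)"
    by (rule \<Psi>_mult[symmetric]) (use permaut in \<open>auto intro: permaut_AG\<close>)
  moreover have "\<Psi> (permaut n \<theta>) \<in> st.gens {..<n} {..<n} {..<n}"
    by (rule st.gens_P) (use permaut in simp_all)
  ultimately show ?case using st.submonoid_gen_mult[OF permaut.IH st.submonoid_gen_inc] by (simp only:)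
qed

lemma gens_\<Psi>:
  assumes "g \<in> st.submonoid_gen (st.gens {..<n} {..<n} {..<n})"
  shows "\<exists>f\<in>carrier (AG n). g = \<Psi> f"
  using assms
proof (induction rule: st.submonoid_gen.induct)
  case one
  show ?case using \<Psi>_one AG_one_closed by metis
next
  case (mult x g)
  then obtain f where f: "f \<in> carrier (AG n)" "g = \<Psi> f" by blast
  have "\<exists>h\<in>carrier (AG n). x = \<Psi> h"
    using mult(1) nielsen_AG[of _ n] permaut_AG[of n] unfolding st.gens_def
    by (elim UnE imageE) (blast, blast)
  then obtain h where h: "h \<in> carrier (AG n)" "x = \<Psi> h" by blast
  show ?case unfolding f(2) h(2) \<Psi>_mult[OF h(1) f(1)] by (rule bexI[OF refl AG_closed[OF h(1) f(1)]])
qed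

text \<open>With trivial matrix the pair acts trivially on integer vectors, and faithfulness makes
  the whole pair trivial, including its first component.\<close>

lemma \<Phi>_kernel:
  assumes "f \<in> carrier (AG n)" "aut_matrix n f = 1\<^sub>m n"
  shows "\<Phi> f = id"
proof -
  have "ab_act n f v = v" for v
    using ab_act_one[of n v] assms(2) unfolding ab_act_aut_matrix
    by (simp add: AutoGroup_simps aut_matrix_one)
  then have "\<Psi> f = (id, id)"
    using st.faithful[OF finite_lessThan order_refl \<Psi>_gens[OF assms(1)]] by (simp add: \<Psi>_def)
  then show ?thesis by (simp add: \<Psi>_def)
qed

text \<open>Elements of the generated group are values of \<Psi>, so \<open>surjective\<close>
  yields an automorphism inducing A.\<close>

lemma aut_matrix_surj:
  assumes "A \<in> carrier (GL_int n)"
  shows "\<exists>f\<in>carrier (AG n). aut_matrix n f = A"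
proof -
  obtain B where A: "A \<in> carrier_mat n n" and B: "B \<in> carrier_mat n n" "A * B = 1\<^sub>m n" "B * A = 1\<^sub>m n"
    using assms by (auto simp: GL_int_def units_of_def Units_def ring_mat_def)
  have inv: "lin_on {..<n} (\<lambda>i j. C $$ (i, j)) (lin_on {..<n} (\<lambda>i j. D $$ (i, j)) v) = v"
    if CD: "C \<in> carrier_mat n n" "D \<in> carrier_mat n n" "C * D = 1\<^sub>m n" for C D v
  proof -
    have "(\<Sum>k<n. C $$ (i, k) * D $$ (k, j)) = (if i = j then 1 else 0)" if "i < n" "j < n" for i j
      using arg_cong[OF CD(3), of "\<lambda>M. M $$ (i, j)"] CD(1,2) that
      by (simp add: scalar_prod_def atLeast0LessThan)
    then have "lin_on {..<n} (\<lambda>i j. C $$ (i, j)) (lin_on {..<n} (\<lambda>i j. D $$ (i, j)) v) =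
        lin_on {..<n} (\<lambda>i j. if i = j then 1 else 0) v"
      unfolding lin_on_comp[OF finite_lessThan] by (simp add: lin_on_def fun_eq_iff)
    then show ?thesis by (simp only: lin_on_id[OF finite_lessThan])
  qed
  obtain g where g: "g \<in> st.submonoid_gen (st.gens {..<n} {..<n} {..<n})"
    "\<forall>v. snd g v = lin_on {..<n} (\<lambda>i j. A $$ (i, j)) v"
    using st.surjective[OF finite_lessThan order_refl inv[OF A B(1,2)] inv[OF B(1) A B(3)]] by blast
  obtain f where f: "f \<in> carrier (AG n)" "g = \<Psi> f" using gens_\<Psi>[OF g(1)] by blast
  have "aut_matrix n f = A" using g(2) ab_act_eq_iff[OF A] by (simp add: f(2) \<Psi>_def)
  then show ?thesis using f(1) by blast
qed

end

end

theorem theorem3p14: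
  fixes scale :: "'k::field \<Rightarrow> 'v::ab_group_add \<Rightarrow> 'v"
    and Basis :: "'v set"
    and n m :: nat
    and \<phi> :: "(letter list \<Rightarrow> letter list) set \<Rightarrow> ('v \<Rightarrow> 'v)"
  assumes char: "CHAR('k) = 0 \<or> CHAR('k) > 5"
    and V: "finite_dimensional_vector_space scale Basis"
    and m: "vector_space.dim scale (UNIV :: 'v set) = m"
    and n: "n \<in> {4, 5}"
    and bound: "m < 2 * n + 1"
    and rep: "\<phi> \<in> hom (OutGroup (free_group n)) (GL scale)"
  shows "\<exists>\<psi> \<in> hom (GL_int n) (GL scale).
           \<forall>x \<in> carrier (OutGroup (free_group n)). \<phi> x = \<psi> (nat_proj n x)"
proof -
  interpret V: finite_dimensional_vector_space scale Basis by (rule V)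
  interpret F: group "free_group n" by (rule group_free_group)
  interpret N: normal "inner_auts (free_group n)" "AG n" by (rule F.inner_auts_normal)
  interpret \<phi>: group_hom "OutGroup (free_group n)" "GL scale" \<phi>
    using rep F.group_OutGroup group_GL[OF V.vector_space_axioms] by (simp add: group_hom_def group_hom_axioms_def)
  let ?q = "\<lambda>f. inner_auts (free_group n) #>\<^bsub>AG n\<^esub> f"
  have q: "?q \<in> hom (AG n) (OutGroup (free_group n))"
    unfolding OutGroup_def by (rule N.r_coset_hom_Mod)
  have q_proj: "nat_proj n (?q f) = aut_matrix n f" if "f \<in> carrier (AG n)" for f
    using that N.subgroup_axioms by (intro nat_proj_coset hom_in_carrier[OF q] N.rcos_self)
  have cosets: "\<exists>f\<in>carrier (AG n). x = ?q f" if "x \<in> carrier (OutGroup (free_group n))" for x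
    using that by (auto simp: OutGroup_def FactGroup_def RCOSETS_def)
  interpret aut_rep scale Basis n "\<lambda>f. \<phi> (?q f)"
  proof (intro aut_rep.intro aut_rep_axioms.intro V)
    show "(\<lambda>f. \<phi> (?q f)) \<in> hom (AG n) (GL scale)"
      using hom_compose[OF q rep] by (simp add: comp_def)
    fix k assume "k \<in> inner_auts (free_group n)"
    then have "?q k = \<one>\<^bsub>OutGroup (free_group n)\<^esub>"
      using N.rcos_const by (simp add: OutGroup_def FactGroup_def)
    then show "\<phi> (?q k) = id" using \<phi>.hom_one by (simp add: GL_def)
  qed
  \<comment> \<open>The characteristic does not divide positive numbers up to 5; this is applied to
    2 and to n-1.\<close>
  have ne: "of_nat k \<noteq> (0::'k)" if "0 < k" "k \<le> 5" for k
    using char dvd_imp_le[OF _ that(1), of "CHAR('k)"] that by (auto simp: of_nat_eq_0_iff_char_dvd)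
  have two: "(2::'k) \<noteq> 0" using ne[of 2] by simp
  have n1: "of_nat (n - 1) \<noteq> (0::'k)" by (rule ne) (use n in auto)
  have n45: "4 \<le> n" "n \<le> 5" and dim: "V.dim UNIV \<le> 2 * n" using n m bound by auto
  have sym: symmetric
    unfolding symmetric_def
  proof (intro allI impI ext)
    show "T (inv_letter a) (inv_letter b) v = T a b v"
      if "fst a < n" "fst b < n" "fst a \<noteq> fst b" for a b v
      by (rule T_sym[OF n45 two n1 dim that])
  qed
  show ?thesis
  proof (rule \<phi>.factor)
    show "group_hom (OutGroup (free_group n)) (GL_int n) (nat_proj n)"
      using F.group_OutGroup group_GL_int nat_proj_hom by (simp add: group_hom_def group_hom_axioms_def)
    show "nat_proj n ` carrier (OutGroup (free_group n)) = carrier (GL_int n)"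
    proof
      show "nat_proj n ` carrier (OutGroup (free_group n)) \<subseteq> carrier (GL_int n)"
        using hom_in_carrier[OF nat_proj_hom] by blast
      show "carrier (GL_int n) \<subseteq> nat_proj n ` carrier (OutGroup (free_group n))"
      proof
        fix A assume "A \<in> carrier (GL_int n)"
        then obtain f where f: "f \<in> carrier (AG n)" "aut_matrix n f = A" using aut_matrix_surj[OF sym] by blast
        then have "A = nat_proj n (?q f)" by (simp add: q_proj)
        then show "A \<in> nat_proj n ` carrier (OutGroup (free_group n))" using hom_in_carrier[OF q f(1)] by (rule image_eqI)
      qed
    qed
    fix x assume x: "x \<in> carrier (OutGroup (free_group n))" "nat_proj n x = \<one>\<^bsub>GL_int n\<^esub>"
    obtain f where f: "f \<in> carrier (AG n)" "x = ?q f" using cosets[OF x(1)] by blast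
    have "aut_matrix n f = 1\<^sub>m n" using x(2) q_proj[OF f(1)] f(2) by (simp add: GL_int_def units_of_def ring_mat_def)
    then show "\<phi> x = \<one>\<^bsub>GL scale\<^esub>" using \<Phi>_kernel[OF sym f(1)] f(2) by (simp add: GL_def)
  qed
qed

end
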